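(* Let $\mathbb{K}$ be a field, $n\ge 1$, and let $\mathscr{C}_n$ be the quantum torus associated with the parameters $P,Q,\Gamma$ as defined in the context. Suppose that $p_i=1$ and $q_i$ is not a root of unity for $1\le i\le n$. Then $\dim(\mathscr{C}_n)=n$.
   Context: Let $P=(p_1,\ldots,p_n)$, $Q=(q_1,\ldots,q_n)$ be $n$-tuples of elements of $\mathbb{K}^*$ with $p_i\neq q_i$ for all $i$, and let $\Gamma=(\gamma_{ij})$ be a multiplicatively antisymmetric $n\times n$ matrix over $\mathbb{K}$ ($\gamma_{ii}=1$, $\gamma_{ij}\gamma_{ji}=1$). $\mathscr{C}_n$ is the quantum torus of rank $2n$ over $\mathbb{K}$ with generators $z_1^{\pm1},\ldots,z_n^{\pm1},y_1^{\pm1},\ldots,y_n^{\pm1}$ and defining relations $z_iz_j=z_jz_i$ for all $i,j$; $z_jy_i=p_iy_iz_j$ for $j<i$; $z_jy_i=q_iy_iz_j$ for $j\ge i$; $y_iy_j=\gamma_{ij}y_jy_i$ for all $i,j$ (together with the relations making each generator invertible). (It arises from Horton's algebra $K_{n,\Gamma}^{P,Q}(\mathbb{K})$ with generators $x_i,y_i$ by inverting the normal elements $z_i=\sum_{l\le i}(q_l-p_l)y_lx_l$ and then $y_1,\ldots,y_n$.) For a quantum torus $\mathcal{A}$ the Krull dimension and the global dimension coincide (McConnell--Pettit), and $\dim(\mathcal{A})$ denotes this common value. *)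

theory Defs
  imports
    "HOL-Algebra.QuotRing"
    "HOL-Algebra.Module"
    "HOL-Library.Poly_Mapping"
    "HOL-Library.Extended_Real"
begin

section \<open>Krull dimension (Gabriel--Rentschler)\<close>

text \<open>
  \<open>dev_less d L\<close> says that the deviation of the poset \<open>L\<close> is less than \<open>d\<close>. The only value
  below 0 is \<open>-\<infinity>\<close>, the deviation of a poset without strict inequalities; and the deviation is
  less than \<open>Suc d\<close>, i.e. at most \<open>d\<close>, iff in every descending chain all but finitely many of the
  factors \<open>[a (Suc i), a i]\<close> have deviation less than \<open>d\<close>.
\<close>

primrec dev_less :: "nat \<Rightarrow> 'a::order set \<Rightarrow> bool" where
  "dev_less 0 L \<longleftrightarrow> (\<forall>x\<in>L. \<forall>y\<in>L. \<not> x < y)"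
| "dev_less (Suc d) L \<longleftrightarrow>
     (\<forall>a :: nat \<Rightarrow> 'a. range a \<subseteq> L \<and> decseq a \<longrightarrow>
        (\<forall>\<^sub>F i in sequentially. dev_less d (L \<inter> {a (Suc i)..a i})))"

text \<open>The value \<open>\<infinity>\<close> stands for an infinite ordinal or an undefined deviation.\<close>

definition deviation :: "'a::order set \<Rightarrow> ereal" where
  "deviation L =
     (if dev_less 0 L then - \<infinity> else (INF d\<in>{d. dev_less (Suc d) L}. ereal (real d)))"

text \<open>
  Krull and global dimension are taken on the left. For the quantum tori below with all \<open>p i = 1\<close> the
  side is immaterial: the opposite ring has the same form, with inverted \<open>q i\<close> and transposed \<open>\<gamma>\<close>.
\<close>

definition left_ideals :: "('a, 'r) ring_scheme \<Rightarrow> 'a set set" where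
  "left_ideals R =
     {I. additive_subgroup I R \<and> (\<forall>r\<in>carrier R. \<forall>x\<in>I. r \<otimes>\<^bsub>R\<^esub> x \<in> I)}"

definition krull_dim :: "('a, 'r) ring_scheme \<Rightarrow> ereal" where
  "krull_dim R = deviation (left_ideals R)"

section \<open>Global dimension\<close>

text \<open>The library's locale \<open>module\<close> demands a commutative ring of scalars.\<close>

locale left_module = R?: ring R + M?: abelian_group M
    for R :: "('a, 'r) ring_scheme" (structure)
    and M :: "('a, 'm, 's) module_scheme" (structure) +
  assumes smult_closed [simp, intro]:
      "\<lbrakk>a \<in> carrier R; x \<in> carrier M\<rbrakk> \<Longrightarrow> a \<odot>\<^bsub>M\<^esub> x \<in> carrier M"
    and smult_l_distr:
      "\<lbrakk>a \<in> carrier R; b \<in> carrier R; x \<in> carrier M\<rbrakk> \<Longrightarrow>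
       (a \<oplus>\<^bsub>R\<^esub> b) \<odot>\<^bsub>M\<^esub> x = a \<odot>\<^bsub>M\<^esub> x \<oplus>\<^bsub>M\<^esub> b \<odot>\<^bsub>M\<^esub> x"
    and smult_r_distr:
      "\<lbrakk>a \<in> carrier R; x \<in> carrier M; y \<in> carrier M\<rbrakk> \<Longrightarrow>
       a \<odot>\<^bsub>M\<^esub> (x \<oplus>\<^bsub>M\<^esub> y) = a \<odot>\<^bsub>M\<^esub> x \<oplus>\<^bsub>M\<^esub> a \<odot>\<^bsub>M\<^esub> y"
    and smult_assoc1:
      "\<lbrakk>a \<in> carrier R; b \<in> carrier R; x \<in> carrier M\<rbrakk> \<Longrightarrow>
       (a \<otimes>\<^bsub>R\<^esub> b) \<odot>\<^bsub>M\<^esub> x = a \<odot>\<^bsub>M\<^esub> (b \<odot>\<^bsub>M\<^esub> x)"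
    and smult_one [simp]: "x \<in> carrier M \<Longrightarrow> \<one>\<^bsub>R\<^esub> \<odot>\<^bsub>M\<^esub> x = x"

definition left_module_hom ::
    "('a, 'r) ring_scheme \<Rightarrow> ('a, 'm) module \<Rightarrow> ('a, 'n) module \<Rightarrow> ('m \<Rightarrow> 'n) set" where
  "left_module_hom R M N =
     {f \<in> hom (add_monoid M) (add_monoid N).
        \<forall>r\<in>carrier R. \<forall>x\<in>carrier M. f (r \<odot>\<^bsub>M\<^esub> x) = r \<odot>\<^bsub>N\<^esub> f x}"

text \<open>
  The lifting property is tested against the modules carried by the same type \<open>'m\<close> as \<open>P\<close>. This is
  projectivity as soon as \<open>'m\<close> is infinite and at least as large as \<open>R\<close>, since then the free
  module on the elements of \<open>P\<close> has an isomorphic copy carried by \<open>'m\<close>.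
\<close>

definition projective :: "('a, 'r) ring_scheme \<Rightarrow> ('a, 'm) module \<Rightarrow> bool" where
  "projective R P \<longleftrightarrow> left_module R P \<and>
     (\<forall>(M :: ('a, 'm) module) (N :: ('a, 'm) module) g f.
        left_module R M \<and> left_module R N \<and>
        g \<in> left_module_hom R M N \<and> g ` carrier M = carrier N \<and>
        f \<in> left_module_hom R P N \<longrightarrow>
          (\<exists>h\<in>left_module_hom R P M. \<forall>x\<in>carrier P. g (h x) = f x))"

text \<open>
  An exact sequence \<open>0 \<rightarrow> P d \<rightarrow> \<dots> \<rightarrow> P 0 \<rightarrow> M \<rightarrow> 0\<close> with all \<open>P i\<close> projective; \<open>\<delta> 0\<close> is the
  augmentation and \<open>\<delta> (Suc i)\<close> maps \<open>P (Suc i)\<close> to \<open>P i\<close>.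
\<close>

definition has_projective_resolution ::
    "('a, 'r) ring_scheme \<Rightarrow> ('a, 'm) module \<Rightarrow> nat \<Rightarrow> bool" where
  "has_projective_resolution R M d \<longleftrightarrow>
     (\<exists>(P :: nat \<Rightarrow> ('a, 'm) module) (\<delta> :: nat \<Rightarrow> 'm \<Rightarrow> 'm).
        (\<forall>i\<le>d. projective R (P i)) \<and>
        \<delta> 0 \<in> left_module_hom R (P 0) M \<and> \<delta> 0 ` carrier (P 0) = carrier M \<and>
        (\<forall>i<d. \<delta> (Suc i) \<in> left_module_hom R (P (Suc i)) (P i) \<and>
           \<delta> (Suc i) ` carrier (P (Suc i)) =
             a_kernel (P i) (case i of 0 \<Rightarrow> M | Suc j \<Rightarrow> P j) (\<delta> i)) \<and>
        inj_on (\<delta> d) (carrier (P d)))"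

definition proj_dim :: "('a, 'r) ring_scheme \<Rightarrow> ('a, 'm) module \<Rightarrow> ereal" where
  "proj_dim R M = (INF d\<in>{d. has_projective_resolution R M d}. ereal (real d))"

text \<open>
  A definition in HOL cannot quantify over the types that may carry a module. We therefore let the
  modules be carried by the type \<open>'u + nat + 'a set\<close>, with \<open>'u\<close> a parameter. This type is infinite
  and contains all quotients of \<open>R\<close> by left ideals, so it carries enough modules (free covers,
  cyclic modules) for projectivity, projective dimension and global dimension to have their usual
  meaning. A statement for all \<open>'u\<close> covers every module, whatever type carries it.
\<close>

definition global_dim :: "'u itself \<Rightarrow> ('a, 'r) ring_scheme \<Rightarrow> ereal" where
  "global_dim U R =
     (SUP M\<in>{M :: ('a, 'u + nat + 'a set) module. left_module R M}. proj_dim R M)"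

section \<open>Free algebras\<close>

text \<open>
  Words form the free monoid under concatenation, so that the convolution product of
  \<^theory>\<open>HOL-Library.Poly_Mapping\<close> on \<open>'x list \<Rightarrow>\<^sub>0 'k\<close> is the product of noncommutative polynomials.
\<close>

instantiation list :: (type) monoid_add
begin

definition zero_list :: "'a list" where "zero_list = []"

definition plus_list :: "'a list \<Rightarrow> 'a list \<Rightarrow> 'a list" where "plus_list = (@)"

instance
  by standard (simp_all add: zero_list_def plus_list_def)

end

definition free_algebra :: "'x set \<Rightarrow> ('x list \<Rightarrow>\<^sub>0 'k::field) ring" where
  "free_algebra X =
     \<lparr>carrier = {f. \<forall>w\<in>Poly_Mapping.keys f. set w \<subseteq> X},
      mult = (*), one = 1, zero = 0, add = (+)\<rparr>"

definition gen :: "'x \<Rightarrow> 'x list \<Rightarrow>\<^sub>0 'k::field" where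
  "gen x = Poly_Mapping.single [x] 1"

definition scalar :: "'k \<Rightarrow> 'x list \<Rightarrow>\<^sub>0 'k::field" where
  "scalar c = Poly_Mapping.single [] c"

section \<open>The quantum torus \<open>C\<^sub>n\<close>\<close>

datatype generator = Z nat | Z_inv nat | Y nat | Y_inv nat

definition torus_generators :: "nat \<Rightarrow> generator set" where
  "torus_generators n = Z ` {1..n} \<union> Z_inv ` {1..n} \<union> Y ` {1..n} \<union> Y_inv ` {1..n}"

text \<open>A relation \<open>l = r\<close> is represented by the element \<open>l - r\<close> of the free algebra.\<close>

definition torus_relations ::
    "nat \<Rightarrow> (nat \<Rightarrow> 'k) \<Rightarrow> (nat \<Rightarrow> 'k) \<Rightarrow> (nat \<Rightarrow> nat \<Rightarrow> 'k::field) \<Rightarrow>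
     (generator list \<Rightarrow>\<^sub>0 'k) set" where
  "torus_relations n p q \<gamma> =
     {gen (Z i) * gen (Z_inv i) - 1 | i. i \<in> {1..n}} \<union>
     {gen (Z_inv i) * gen (Z i) - 1 | i. i \<in> {1..n}} \<union>
     {gen (Y i) * gen (Y_inv i) - 1 | i. i \<in> {1..n}} \<union>
     {gen (Y_inv i) * gen (Y i) - 1 | i. i \<in> {1..n}} \<union>
     {gen (Z i) * gen (Z j) - gen (Z j) * gen (Z i) | i j. i \<in> {1..n} \<and> j \<in> {1..n}} \<union>
     {gen (Z j) * gen (Y i) - scalar (p i) * gen (Y i) * gen (Z j) | i j.
        i \<in> {1..n} \<and> j \<in> {1..n} \<and> j < i} \<union>
     {gen (Z j) * gen (Y i) - scalar (q i) * gen (Y i) * gen (Z j) | i j.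
        i \<in> {1..n} \<and> j \<in> {1..n} \<and> i \<le> j} \<union>
     {gen (Y i) * gen (Y j) - scalar (\<gamma> i j) * gen (Y j) * gen (Y i) | i j.
        i \<in> {1..n} \<and> j \<in> {1..n}}"

definition quantum_torus ::
    "nat \<Rightarrow> (nat \<Rightarrow> 'k) \<Rightarrow> (nat \<Rightarrow> 'k) \<Rightarrow> (nat \<Rightarrow> nat \<Rightarrow> 'k::field) \<Rightarrow>
     (generator list \<Rightarrow>\<^sub>0 'k) set ring" where
  "quantum_torus n p q \<gamma> =
     (let F = free_algebra (torus_generators n) in F Quot (Idl\<^bsub>F\<^esub> (torus_relations n p q \<gamma>)))"

lemma ring_free_algebra: "ring (free_algebra X :: ('x list \<Rightarrow>\<^sub>0 'k::field) ring)"
proof -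
  let ?F = "free_algebra X :: ('x list \<Rightarrow>\<^sub>0 'k) ring"
  let ?C = "{f :: 'x list \<Rightarrow>\<^sub>0 'k. \<forall>w\<in>Poly_Mapping.keys f. set w \<subseteq> X}"
  have add: "f + g \<in> ?C" if "f \<in> ?C" "g \<in> ?C" for f g
    using that Poly_Mapping.keys_add[of f g] by blast
  have mult: "f * g \<in> ?C" if "f \<in> ?C" "g \<in> ?C" for f g
  proof (intro CollectI ballI)
    fix w assume "w \<in> Poly_Mapping.keys (f * g)"
    then obtain u v where "u \<in> Poly_Mapping.keys f" "v \<in> Poly_Mapping.keys g" "w = u @ v"
      using keys_mult[of f g] unfolding plus_list_def by blast
    with that show "set w \<subseteq> X" by simp
  qed
  have one: "1 \<in> ?C"
    by (simp flip: Poly_Mapping.single_one add: zero_list_def)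
  have "abelian_group ?F"
  proof (rule abelian_groupI)
    fix f assume "f \<in> carrier ?F"
    then show "\<exists>g\<in>carrier ?F. g \<oplus>\<^bsub>?F\<^esub> f = \<zero>\<^bsub>?F\<^esub>"
      by (intro bexI[of _ "- f"]) (simp_all add: free_algebra_def)
  next
    fix f g assume "f \<in> carrier ?F" "g \<in> carrier ?F"
    then show "f \<oplus>\<^bsub>?F\<^esub> g \<in> carrier ?F"
      using add[of f g] by (simp add: free_algebra_def)
  qed (simp_all add: free_algebra_def add.assoc add.commute)
  moreover have "Group.monoid ?F"
    by (rule Group.monoidI)
      (use mult one in \<open>simp_all only: free_algebra_def partial_object.simps monoid.simps
        mult.assoc mult_1_left mult_1_right\<close>)
  ultimately show ?thesis
    by (rule ringI) (simp_all add: free_algebra_def distrib_left distrib_right)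
qed

lemma torus_relations_closed:
  "torus_relations n p q \<gamma> \<subseteq> carrier (free_algebra (torus_generators n))"
proof -
  let ?F = "free_algebra (torus_generators n) :: (generator list \<Rightarrow>\<^sub>0 'a) ring"
  interpret ring ?F by (rule ring_free_algebra)
  have mult: "f * g \<in> carrier ?F" if "f \<in> carrier ?F" "g \<in> carrier ?F" for f g
    using m_closed[OF that] by (simp add: free_algebra_def)
  have one: "1 \<in> carrier ?F"
    using one_closed by (simp add: free_algebra_def)
  have diff: "f - g \<in> carrier ?F" if "f \<in> carrier ?F" "g \<in> carrier ?F" for f g
    using that Poly_Mapping.keys_diff[of f g] unfolding free_algebra_def partial_object.simps
    by blast
  have gen: "gen x \<in> carrier ?F" if "x \<in> torus_generators n" for x
    using that by (simp add: free_algebra_def gen_def)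
  have scalar: "scalar c \<in> carrier ?F" for c
    by (simp add: free_algebra_def scalar_def)
  show ?thesis
    unfolding torus_relations_def
    by (intro Un_least subsetI; elim CollectE exE conjE; hypsubst;
        intro mult one diff scalar gen; simp add: torus_generators_def)
qed

lemma ring_quantum_torus: "ring (quantum_torus n p q \<gamma>)"
  unfolding quantum_torus_def Let_def
  by (intro ideal.quotient_is_ring ring.genideal_ideal ring_free_algebra torus_relations_closed)

end

theory Submission
  imports Defs "HOL-Library.Function_Algebras"
begin

text \<open>In the generators \<open>w\<^sub>i = z\<^sub>i / z\<^sub>i\<^sub>-\<^sub>1\<close> and \<open>y\<^sub>i\<close> each \<open>w\<^sub>i\<close> commutes with everything but
  \<open>y\<^sub>i\<close>, and \<open>w\<^sub>i y\<^sub>i = q\<^sub>i y\<^sub>i w\<^sub>i\<close> with \<open>q\<^sub>i\<close> not a root of unity. As for Weyl algebras, Bernstein's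
  inequality holds: a nonzero finitely generated module grows at least like \<open>N ^ n\<close>, while the ring grows
  like \<open>N ^ 2n\<close>; counting leading exponents bounds the Krull dimension by \<open>n\<close>. The same inequality shows that
  the obstructions to splitting a free resolution of a left ideal, being torsion along every choice of \<open>n\<close>
  coordinate directions, vanish in high degrees, and Auslander's lemma passes from left ideals to all modules.
  For the lower bounds, the \<open>w\<^sub>i\<close> generate a commutative Laurent polynomial ring over which the quantum torus is
  free: evaluation at the points \<open>w\<^sub>i = t ^ b\<^sub>i\<close> yields a lexicographic chain of left ideals indexed by \<open>b\<close>,
  and the module induced from the point \<open>w = (1, \<dots>, 1)\<close> has projective dimension at least \<open>n\<close> because
  \<open>w\<^sub>1 - 1, \<dots>, w\<^sub>n - 1\<close> is a regular sequence on every projective module.\<close>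

section \<open>Twisted function modules\<close>

text \<open>All modules are spaces of functions \<open>'x \<times> expo \<Rightarrow> 'k\<close> on
  which monomials act by translation: finite support gives free modules, wider support gives
  injective modules and eigenvectors. The presented ring enters only at the end, through an
  isomorphism. Ext groups appear as statements that homomorphisms extend
  (\<open>extends_to\<close>). Adjoining one variable costs one degree, so starting from the field
  alone extension holds only from degree 2n on. To reach n, start from a subtorus on n coordinates
  \<open>S\<close>: the module \<open>tors S\<close> is injective over it, so only the n other
  variables cost a degree. Passing from values in \<open>tors S\<close> to values in the ring is
  possible up to a nonzero factor from the subtorus, acting on the right; this produces the torsion
  to which Bernstein's inequality for right multiplication applies. The inequality itself rests on
  separating the exponents of a box by their commutation characters. That each \<open>q i\<close>
  has infinite order makes the characters take distinct values; the arbitrary factors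
  \<open>\<gamma>\<close> among the y's are dealt with by comparing y-exponents before
  w-exponents.\<close>

declare plus_fun_apply [simp del] and zero_fun_apply [simp del]

type_synonym expo = "nat \<Rightarrow> int"

definition sc :: "'k::field \<Rightarrow> ('b \<Rightarrow> 'k) \<Rightarrow> 'b \<Rightarrow> 'k" where
  "sc r f = (\<lambda>x. r * f x)"

lemma sc_apply: "sc r f x = r * f x"
  by (simp add: sc_def)

interpretation fs: vector_space sc
  by standard (auto simp: sc_def plus_fun_def algebra_simps)

interpretation fsp: vector_space_pair sc sc
  by standard

lemma sum_fun_apply: "(\<Sum>i\<in>I. f i) x = (\<Sum>i\<in>I. f i x)"
  by (induction I rule: infinite_finite_induct) (auto simp: plus_fun_apply zero_fun_apply)

lemmas fun_simps = plus_fun_apply zero_fun_apply sc_apply sum_fun_apply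

definition supp :: "('b \<Rightarrow> 'k::zero) \<Rightarrow> 'b set" where
  "supp f = {p. f p \<noteq> 0}"

lemma supp_iff: "p \<in> supp f \<longleftrightarrow> f p \<noteq> 0"
  by (simp add: supp_def fun_simps)

lemma supp_zero [simp]: "supp (0 :: 'b \<Rightarrow> 'k::comm_monoid_add) = {}"
  by (simp add: supp_def fun_simps)

lemma supp_add: "supp (f + g) \<subseteq> supp f \<union> supp (g :: 'b \<Rightarrow> 'k::ab_group_add)"
  by (auto simp: supp_def fun_simps)

lemma supp_diff: "supp (f - g) \<subseteq> supp f \<union> supp (g :: 'b \<Rightarrow> 'k::ab_group_add)"
  by (auto simp: supp_def fun_simps)

lemma supp_sc: "supp (sc r f) \<subseteq> supp f"
  by (auto simp: supp_def fun_simps)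

lemma supp_eq_empty: "supp f = {} \<longleftrightarrow> f = (0 :: 'b \<Rightarrow> 'k::ab_group_add)"
  by (auto simp: supp_def fun_eq_iff fun_simps)

definition bas :: "'b \<Rightarrow> 'b \<Rightarrow> 'k::field" where
  "bas p = (\<lambda>q. if q = p then 1 else 0)"

lemma supp_bas [simp]: "supp (bas p :: 'b \<Rightarrow> 'k::field) = {p}"
  by (auto simp: supp_def bas_def)

lemma bas_apply: "bas p q = (if q = p then 1 else 0)"
  by (simp add: bas_def)

lemma bas_expansion:
  assumes "finite A" "supp f \<subseteq> A"
  shows "f = (\<Sum>p\<in>A. sc (f p) (bas p :: 'b \<Rightarrow> 'k::field))"
proof
  fix q
  have "(\<Sum>p\<in>A. sc (f p) (bas p)) q = (\<Sum>p\<in>A. if q = p then f q else 0)"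
    by (auto simp: bas_def fun_simps intro!: sum.cong)
  also have "\<dots> = (if q \<in> A then f q else 0)" using assms(1) by (simp add: sum.delta)
  finally show "f q = (\<Sum>p\<in>A. sc (f p) (bas p)) q" using assms(2) by (auto simp: supp_def fun_simps)
qed

lemma sc_add_right: "sc r (f + g) = sc r f + sc r g"
  by (rule fs.scale_right_distrib)

lemma sc_sum: "sc r (\<Sum>i\<in>I. f i) = (\<Sum>i\<in>I. sc r (f i))"
  by (rule fs.scale_sum_right)

text \<open>Linear extension from the basis vectors \<open>bas p\<close>. It is meaningful for
  finite support only, a sum over an infinite set being 0; the values \<open>h p\<close> may have
  infinite support.\<close>

definition lext :: "('b \<Rightarrow> 'c \<Rightarrow> 'k::field) \<Rightarrow> ('b \<Rightarrow> 'k) \<Rightarrow> 'c \<Rightarrow> 'k" where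
  "lext h f = (\<Sum>p\<in>supp f. sc (f p) (h p))"

lemma lext_superset:
  assumes "finite A" "supp f \<subseteq> A"
  shows "lext h f = (\<Sum>p\<in>A. sc (f p) (h p))"
  unfolding lext_def
  by (rule sum.mono_neutral_left) (use assms in \<open>auto simp: supp_def fun_eq_iff fun_simps\<close>)

lemma lext_bas [simp]: "lext h (bas p) = h p"
  by (simp add: lext_def bas_apply)

lemma lext_zero [simp]: "lext h 0 = 0"
  by (simp add: lext_def)

lemma lext_add:
  assumes "finite (supp f)" "finite (supp g)"
  shows "lext h (f + g) = lext h f + lext h g"
proof -
  let ?A = "supp f \<union> supp g"
  have "finite ?A" using assms by simp
  then show ?thesis
    using lext_superset[of ?A "f + g" h] lext_superset[of ?A f h] lext_superset[of ?A g h]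
      supp_add[of f g] by (simp add: fun_simps sum.distrib fs.scale_left_distrib)
qed

lemma lext_sc:
  assumes "finite (supp f)"
  shows "lext h (sc r f) = sc r (lext h f)"
  using lext_superset[of "supp f" "sc r f" h] lext_superset[of "supp f" f h] supp_sc[of r f] assms
  by (simp add: sc_sum sc_apply)

lemma lext_sum:
  assumes "\<And>i. i \<in> I \<Longrightarrow> finite (supp (f i))"
  shows "lext h (\<Sum>i\<in>I. f i) = (\<Sum>i\<in>I. lext h (f i)) \<and> finite (supp (\<Sum>i\<in>I. f i))"
  using assms
proof (induction I rule: infinite_finite_induct)
  case (insert i I)
  moreover have "finite (supp (f i + (\<Sum>i\<in>I. f i)))"
    by (rule finite_subset[OF supp_add]) (use insert in auto)
  ultimately show ?case by (simp add: lext_add)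
qed auto

text \<open>A bicharacter on exponent vectors: \<open>bich m c a b\<close> is the scalar by which the normally
  ordered monomials \<open>X\<^sup>a\<close> and \<open>X\<^sup>b\<close> multiply to \<open>X\<^sup>a\<^sup>+\<^sup>b\<close>.\<close>

definition bich :: "nat \<Rightarrow> (nat \<Rightarrow> nat \<Rightarrow> 'k::field) \<Rightarrow> expo \<Rightarrow> expo \<Rightarrow> 'k" where
  "bich m c a b = (\<Prod>i<m. \<Prod>j<m. c i j powi (a i * b j))"

lemma bich_add_left:
  "(\<And>i j. c i j \<noteq> 0) \<Longrightarrow> bich m c (a + a') b = bich m c a b * bich m c a' b"
  by (simp add: bich_def fun_simps distrib_right power_int_add prod.distrib)

lemma bich_add_right:
  "(\<And>i j. c i j \<noteq> 0) \<Longrightarrow> bich m c a (b + b') = bich m c a b * bich m c a b'"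
  by (simp add: bich_def fun_simps distrib_left power_int_add prod.distrib)

lemma bich_zero [simp]: "bich m c 0 b = 1" "bich m c a 0 = 1"
  by (simp_all add: bich_def fun_simps)

lemma bich_nonzero: "(\<And>i j. c i j \<noteq> 0) \<Longrightarrow> bich m c a b \<noteq> 0"
  by (simp add: bich_def)

lemma bich_minus:
  assumes "\<And>i j. c i j \<noteq> 0"
  shows "bich m c (- a) b = inverse (bich m c a b)" "bich m c a (- b) = inverse (bich m c a b)"
proof -
  have "bich m c (- a + a) b = bich m c (-a) b * bich m c a b" by (rule bich_add_left[OF assms])
  then have "1 = bich m c (-a) b * bich m c a b" by (metis bich_zero(1) add.left_inverse)
  then show "bich m c (- a) b = inverse (bich m c a b)"
    by (metis inverse_unique mult.commute)
  have "bich m c a (- b + b) = bich m c a (-b) * bich m c a b" by (rule bich_add_right[OF assms])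
  then have "1 = bich m c a (-b) * bich m c a b" by (metis bich_zero(2) add.left_inverse)
  then show "bich m c a (- b) = inverse (bich m c a b)"
    by (metis inverse_unique mult.commute)
qed

lemma bich_transpose: "bich m (\<lambda>i j. c j i) a b = bich m c b a"
  unfolding bich_def by (subst prod.swap) (simp add: mult.commute)

definition unit_vec :: "nat \<Rightarrow> expo" where
  "unit_vec i = (\<lambda>j. if j = i then 1 else 0)"

definition lat :: "nat set \<Rightarrow> expo set" where
  "lat T = {a. \<forall>i. i \<notin> T \<longrightarrow> a i = 0}"

lemma lat_add [simp]: "a \<in> lat T \<Longrightarrow> b \<in> lat T \<Longrightarrow> a + b \<in> lat T"
  and lat_minus [simp]: "a \<in> lat T \<Longrightarrow> - a \<in> lat T"
  and lat_zero [simp]: "0 \<in> lat T"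
  by (auto simp: lat_def fun_simps)

lemma lat_diff [simp]: "a \<in> lat T \<Longrightarrow> b \<in> lat T \<Longrightarrow> a - b \<in> lat T"
  by (auto simp: lat_def fun_simps)

lemma lat_mono: "T \<subseteq> T' \<Longrightarrow> a \<in> lat T \<Longrightarrow> a \<in> lat T'"
  by (auto simp: lat_def fun_simps)

lemma lat_empty [simp]: "lat {} = {0}"
  by (auto simp: lat_def fun_eq_iff fun_simps)

lemma unit_vec_lat [simp]: "i \<in> T \<Longrightarrow> unit_vec i \<in> lat T"
  by (auto simp: lat_def unit_vec_def)

text \<open>The free module on \<open>X\<close> over the subtorus with coordinates \<open>T\<close>:
  \<open>bas (x, a)\<close> stands for the monomial X^a times the basis vector x.\<close>

definition Fr :: "nat set \<Rightarrow> 'x set \<Rightarrow> ('x \<times> expo \<Rightarrow> 'k::field) set" where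
  "Fr T X = {f. finite (supp f) \<and> supp f \<subseteq> X \<times> lat T}"

lemma Fr_finite: "f \<in> Fr T X \<Longrightarrow> finite (supp f)"
  by (simp add: Fr_def)

lemma Fr_zero [simp]: "0 \<in> Fr T X"
  by (simp add: Fr_def)

lemma Fr_add [simp]: "f \<in> Fr T X \<Longrightarrow> g \<in> Fr T X \<Longrightarrow> f + g \<in> Fr T X"
  unfolding Fr_def using supp_add[of f g] by (auto intro: finite_subset)

lemma Fr_sc [simp]: "f \<in> Fr T X \<Longrightarrow> sc r f \<in> Fr T X"
  unfolding Fr_def using supp_sc[of r f] by (auto intro: finite_subset)

lemma Fr_bas [simp]: "x \<in> X \<Longrightarrow> a \<in> lat T \<Longrightarrow> bas (x, a) \<in> Fr T X"
  by (simp add: Fr_def)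

lemma Fr_mono: "X \<subseteq> V \<Longrightarrow> f \<in> Fr T X \<Longrightarrow> f \<in> Fr T V"
  by (auto simp: Fr_def)

text \<open>The \<open>c i j\<close> define the cocycle of the normally ordered monomials; X^a and
  X^b commute up to the factor \<open>bc a b / bc b a\<close>. The condition \<open>c_diag\<close>
  lets powers of a single variable multiply without a scalar.\<close>

locale qt =
  fixes m :: nat and c :: "nat \<Rightarrow> nat \<Rightarrow> 'k::field"
  assumes c_nonzero: "\<And>i j. c i j \<noteq> 0" and c_diag: "\<And>i. c i i = 1"
begin

abbreviation bc :: "expo \<Rightarrow> expo \<Rightarrow> 'k" where "bc \<equiv> bich m c"

lemma bc_add_left: "bc (a + a') b = bc a b * bc a' b"
  and bc_add_right: "bc a (b + b') = bc a b * bc a b'"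
  and bc_minus: "bc (- a) b = inverse (bc a b)" "bc a (- b) = inverse (bc a b)"
  and bc_nonzero [simp]: "bc a b \<noteq> 0"
  by (simp_all add: bich_add_left bich_add_right bich_minus bich_nonzero c_nonzero)

lemma bc_diff_left: "bc (a - a') b = bc a b / bc a' b"
  using bc_add_left[of a "- a'" b] by (simp add: bc_minus divide_inverse)

lemma bc_diff_right: "bc a (b - b') = bc a b / bc a b'"
  using bc_add_right[of a b "- b'"] by (simp add: bc_minus divide_inverse)

lemmas bc_simps = bc_add_left bc_add_right bc_diff_left bc_diff_right bc_minus

text \<open>Left multiplication by X^a, as \<open>rop\<close> is right multiplication. Both are
  translations followed by a pointwise scalar, hence make sense for functions of infinite support as
  well.\<close>

definition mop :: "expo \<Rightarrow> ('x \<times> expo \<Rightarrow> 'k) \<Rightarrow> 'x \<times> expo \<Rightarrow> 'k" where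
  "mop a f = (\<lambda>(x, b). bc a (b - a) * f (x, b - a))"

definition rop :: "expo \<Rightarrow> ('x \<times> expo \<Rightarrow> 'k) \<Rightarrow> 'x \<times> expo \<Rightarrow> 'k" where
  "rop a f = (\<lambda>(x, b). bc (b - a) a * f (x, b - a))"

lemma mop_apply: "mop a f (x, b) = bc a (b - a) * f (x, b - a)"
  by (simp add: mop_def)

lemma rop_apply: "rop a f (x, b) = bc (b - a) a * f (x, b - a)"
  by (simp add: rop_def)

lemma mop_add: "mop a (f + g) = mop a f + mop a g"
  and mop_sc: "mop a (sc r f) = sc r (mop a f)"
  and mop_zero [simp]: "mop a 0 = 0"
  and mop_0 [simp]: "mop 0 f = f"
  by (auto simp: mop_def fun_eq_iff fun_simps algebra_simps)

lemma rop_add: "rop a (f + g) = rop a f + rop a g"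
  and rop_sc: "rop a (sc r f) = sc r (rop a f)"
  and rop_zero [simp]: "rop a 0 = 0"
  and rop_0 [simp]: "rop 0 f = f"
  by (auto simp: rop_def fun_eq_iff fun_simps algebra_simps)

lemma mop_sum: "mop a (\<Sum>i\<in>I. f i) = (\<Sum>i\<in>I. mop a (f i))"
  by (induction I rule: infinite_finite_induct) (auto simp: mop_add)

lemma mop_diff: "mop a (f - g) = mop a f - mop a g"
  by (auto simp: mop_def fun_eq_iff fun_simps algebra_simps)

lemma rop_diff: "rop a (f - g) = rop a f - rop a g"
  by (auto simp: rop_def fun_eq_iff fun_simps algebra_simps)

lemma mop_mop: "mop a (mop b f) = sc (bc a b) (mop (a + b) f)"
proof (rule ext, clarify)
  fix x e
  have e: "e - a - b = e - (a + b)" by (simp add: algebra_simps)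
  show "mop a (mop b f) (x, e) = sc (bc a b) (mop (a + b) f) (x, e)"
    by (simp add: mop_apply e fun_simps bc_simps field_simps)
qed

text \<open>The arguments of \<open>bc\<close> are exchanged: right multiplication is a
  representation of the opposite torus, whose cocycle is the transpose of \<open>c\<close>.\<close>

lemma rop_rop: "rop a (rop b f) = sc (bc b a) (rop (a + b) f)"
proof (rule ext, clarify)
  fix x e
  have e: "e - a - b = e - (a + b)" by (simp add: algebra_simps)
  show "rop a (rop b f) (x, e) = sc (bc b a) (rop (a + b) f) (x, e)"
    by (simp add: rop_apply e fun_simps bc_simps field_simps)
qed

text \<open>Associativity of the twisted product, which reduces to \<open>bc\<close> being
  multiplicative in both arguments.\<close>

lemma mop_rop: "mop a (rop b f) = rop b (mop a f)"
proof (rule ext, clarify)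
  fix x e
  have e: "e - a - b = e - b - a" by (simp add: algebra_simps)
  show "mop a (rop b f) (x, e) = rop b (mop a f) (x, e)"
    by (simp add: mop_apply rop_apply e fun_simps bc_simps field_simps)
qed

lemma mop_commute: "mop a (mop b f) = sc (bc a b / bc b a) (mop b (mop a f))"
  by (simp add: mop_mop add.commute)

lemma mop_inverse: "mop (- a) (mop a f) = sc (bc (-a) a) f" "mop a (mop (- a) f) = sc (bc (-a) a) f"
  by (simp_all add: mop_mop bc_minus)

lemma mop_bas: "mop a (bas (x, b)) = sc (bc a b) (bas (x, a + b))"
proof (rule ext, clarify)
  fix y e
  have "e - a = b \<longleftrightarrow> e = a + b" by (auto simp: algebra_simps)
  then show "mop a (bas (x, b)) (y, e) = sc (bc a b) (bas (x, a + b)) (y, e)"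
    by (auto simp: mop_apply bas_apply fun_simps)
qed

lemma bas_eq_mop: "bas (x, a) = mop a (bas (x, 0))"
  by (simp add: mop_bas)

lemma supp_mop: "supp (mop a f) = (\<lambda>(x, b). (x, a + b)) ` supp f"
proof -
  have "p \<in> supp (mop a f) \<longleftrightarrow> p \<in> (\<lambda>(x, b). (x, a + b)) ` supp f" for p
    by (cases p) (force simp: supp_iff mop_apply image_iff)
  then show ?thesis by blast
qed

lemma supp_rop: "supp (rop a f) = (\<lambda>(x, b). (x, a + b)) ` supp f"
proof -
  have "p \<in> supp (rop a f) \<longleftrightarrow> p \<in> (\<lambda>(x, b). (x, a + b)) ` supp f" for p
    by (cases p) (force simp: supp_iff rop_apply image_iff)
  then show ?thesis by blast
qed

lemma finite_supp_mop [simp]: "finite (supp f) \<Longrightarrow> finite (supp (mop a f))"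
  by (simp add: supp_mop)

lemma Fr_mop [simp]: "f \<in> Fr T X \<Longrightarrow> a \<in> lat T \<Longrightarrow> mop a f \<in> Fr T X"
  by (auto simp: Fr_def supp_mop)

lemma Fr_rop [simp]: "f \<in> Fr T X \<Longrightarrow> a \<in> lat T \<Longrightarrow> rop a f \<in> Fr T X"
  by (auto simp: Fr_def supp_rop)

text \<open>Scalars and monomials span the subtorus on \<open>T\<close>, so closure under them is
  closure under its action. The parameter \<open>T\<close> allows restriction of scalars to smaller
  subtori.\<close>

definition submod :: "nat set \<Rightarrow> ('x \<times> expo \<Rightarrow> 'k) set \<Rightarrow> bool" where
  "submod T L \<longleftrightarrow> 0 \<in> L \<and> (\<forall>u\<in>L. \<forall>v\<in>L. u + v \<in> L) \<and> (\<forall>r. \<forall>u\<in>L. sc r u \<in> L) \<and>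
     (\<forall>a\<in>lat T. \<forall>u\<in>L. mop a u \<in> L)"

text \<open>Conditions are imposed on \<open>N\<close> only: a homomorphism defined on a submodule
  is a total function with arbitrary values elsewhere.\<close>

definition lin :: "nat set \<Rightarrow> ('x \<times> expo \<Rightarrow> 'k) set \<Rightarrow> (('x \<times> expo \<Rightarrow> 'k) \<Rightarrow> ('y \<times> expo \<Rightarrow> 'k)) \<Rightarrow> bool"
  where
  "lin T N h \<longleftrightarrow> (\<forall>u\<in>N. \<forall>v\<in>N. h (u + v) = h u + h v) \<and> (\<forall>r. \<forall>u\<in>N. h (sc r u) = sc r (h u)) \<and>
     (\<forall>a\<in>lat T. \<forall>u\<in>N. h (mop a u) = mop a (h u))"

lemma submodD:
  assumes "submod T L"
  shows submod_zero: "0 \<in> L" and submod_add: "u \<in> L \<Longrightarrow> v \<in> L \<Longrightarrow> u + v \<in> L"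
    and submod_sc: "u \<in> L \<Longrightarrow> sc r u \<in> L" and submod_mop: "a \<in> lat T \<Longrightarrow> u \<in> L \<Longrightarrow> mop a u \<in> L"
    and submod_diff: "u \<in> L \<Longrightarrow> v \<in> L \<Longrightarrow> u - v \<in> L"
    and submod_uminus: "u \<in> L \<Longrightarrow> - u \<in> L"
proof -
  have L: "0 \<in> L" "\<And>u v. u \<in> L \<Longrightarrow> v \<in> L \<Longrightarrow> u + v \<in> L" "\<And>r u. u \<in> L \<Longrightarrow> sc r u \<in> L"
    "\<And>a u. a \<in> lat T \<Longrightarrow> u \<in> L \<Longrightarrow> mop a u \<in> L"
    using assms unfolding submod_def by blast+
  show "0 \<in> L" "u \<in> L \<Longrightarrow> v \<in> L \<Longrightarrow> u + v \<in> L" "u \<in> L \<Longrightarrow> sc r u \<in> L"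
    "a \<in> lat T \<Longrightarrow> u \<in> L \<Longrightarrow> mop a u \<in> L" by (fact L)+
  have neg: "- v \<in> L" if "v \<in> L" for v
    using L(3)[OF that, of "-1"] by (simp add: sc_def fun_Compl_def)
  show "u \<in> L \<Longrightarrow> v \<in> L \<Longrightarrow> u - v \<in> L" using L(2)[of u "- v"] neg by simp
  show "u \<in> L \<Longrightarrow> - u \<in> L" by (rule neg)
qed

lemma submod_sum: "submod T L \<Longrightarrow> (\<And>i. i \<in> I \<Longrightarrow> f i \<in> L) \<Longrightarrow> (\<Sum>i\<in>I. f i) \<in> L"
  by (induction I rule: infinite_finite_induct) (auto intro: submod_zero submod_add)

lemma submod_mono: "submod T L \<Longrightarrow> S \<subseteq> T \<Longrightarrow> submod S L"
  unfolding submod_def using lat_mono by blast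

lemma submod_subspace: "submod T L \<Longrightarrow> fs.subspace L"
  by (auto simp: submod_def fs.subspace_def)

lemma submod_Fr: "S \<subseteq> T \<Longrightarrow> submod S (Fr T X)"
  by (simp add: submod_def) (blast intro: lat_mono Fr_mop)

lemma linD:
  assumes "lin T N h"
  shows lin_add: "u \<in> N \<Longrightarrow> v \<in> N \<Longrightarrow> h (u + v) = h u + h v"
    and lin_sc: "u \<in> N \<Longrightarrow> h (sc r u) = sc r (h u)"
    and lin_mop: "a \<in> lat T \<Longrightarrow> u \<in> N \<Longrightarrow> h (mop a u) = mop a (h u)"
  using assms by (auto simp: lin_def)

lemma lin_zero:
  assumes "lin T N h" "submod S N"
  shows "h 0 = 0"
  using lin_sc[OF assms(1) submod_zero[OF assms(2)], of 0] by simp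

lemma lin_diff:
  assumes "lin T N h" "submod S N" "u \<in> N" "v \<in> N"
  shows "h (u - v) = h u - h v"
  using lin_add[OF assms(1) submod_diff[OF assms(2-4)] assms(4)] by simp

lemma lin_sum:
  assumes "lin T N h" "submod S N" "\<And>i. i \<in> I \<Longrightarrow> f i \<in> N"
  shows "h (\<Sum>i\<in>I. f i) = (\<Sum>i\<in>I. h (f i))"
  using assms(3)
proof (induction I rule: infinite_finite_induct)
  case (insert i I)
  then show ?case using lin_add[OF assms(1), of "f i" "sum f I"] submod_sum[OF assms(2), of I f] by simp
qed (auto simp: lin_zero[OF assms(1,2)])

lemma lin_mono: "lin T N h \<Longrightarrow> S \<subseteq> T \<Longrightarrow> N' \<subseteq> N \<Longrightarrow> lin S N' h"
  unfolding lin_def using lat_mono by blast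

lemma lin_comp:
  assumes "lin T N h" "lin T V g" "h ` N \<subseteq> V"
  shows "lin T N (\<lambda>z. g (h z))"
  using assms unfolding lin_def by (auto simp: image_subset_iff)

lemma lin_image_submod:
  assumes "lin T N h" "submod T N"
  shows "submod T (h ` N)"
  unfolding submod_def
proof (intro conjI ballI allI)
  show "0 \<in> h ` N" using lin_zero[OF assms] submod_zero[OF assms(2)] by force
  fix u assume "u \<in> h ` N"
  then obtain u' where u: "u' \<in> N" "u = h u'" by blast
  show "sc r u \<in> h ` N" for r
    using lin_sc[OF assms(1) u(1), of r] submod_sc[OF assms(2) u(1), of r] u(2) by force
  show "mop a u \<in> h ` N" if "a \<in> lat T" for a
    using lin_mop[OF assms(1) that u(1)] submod_mop[OF assms(2) that u(1)] u(2) by force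
  fix v assume "v \<in> h ` N"
  then obtain v' where v: "v' \<in> N" "v = h v'" by blast
  show "u + v \<in> h ` N"
    using lin_add[OF assms(1) u(1) v(1)] submod_add[OF assms(2) u(1) v(1)] u(2) v(2) by force
qed

lemma lin_kernel_submod:
  assumes "lin T N h" "submod T N"
  shows "submod T {z\<in>N. h z = 0}"
  using linD[OF assms(1)] submodD[OF assms(2)] lin_zero[OF assms]
  unfolding submod_def by simp

text \<open>Universal property of the free module: the homomorphism sending the basis vector x to
  \<open>g x\<close>. The index of the target is free, so targets such as \<open>tors S\<close> are
  allowed.\<close>

definition fext :: "('x \<Rightarrow> 'y \<times> expo \<Rightarrow> 'k) \<Rightarrow> ('x \<times> expo \<Rightarrow> 'k) \<Rightarrow> 'y \<times> expo \<Rightarrow> 'k" where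
  "fext g = lext (\<lambda>(x, a). mop a (g x))"

lemma fext_bas: "fext g (bas (x, a)) = mop a (g x)"
  by (simp add: fext_def)

lemma fext_zero [simp]: "fext g 0 = 0"
  by (simp add: fext_def)

lemma fext_add: "finite (supp f) \<Longrightarrow> finite (supp f') \<Longrightarrow> fext g (f + f') = fext g f + fext g f'"
  by (simp add: fext_def lext_add)

lemma fext_sc: "finite (supp f) \<Longrightarrow> fext g (sc r f) = sc r (fext g f)"
  by (simp add: fext_def lext_sc)

lemma fext_mop:
  assumes "finite (supp f)"
  shows "fext g (mop a f) = mop a (fext g f)"
proof -
  have f: "f = (\<Sum>p\<in>supp f. sc (f p) (bas p))" by (rule bas_expansion) (use assms in auto)
  have fin: "finite (supp (sc r (bas p :: 'x \<times> expo \<Rightarrow> 'k)))" for r p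
    by (rule finite_subset[OF supp_sc]) simp
  have 1: "fext g (mop a (sc r (bas p))) = mop a (fext g (sc r (bas p)))" for r p
    by (cases p) (simp add: mop_sc fext_sc mop_bas fext_bas mop_mop)
  have "fext g (mop a f) = fext g (\<Sum>p\<in>supp f. mop a (sc (f p) (bas p)))"
    by (subst f) (simp add: mop_sum)
  also have "\<dots> = (\<Sum>p\<in>supp f. fext g (mop a (sc (f p) (bas p))))"
    unfolding fext_def by (rule lext_sum[THEN conjunct1]) (simp add: fin)
  also have "\<dots> = mop a (\<Sum>p\<in>supp f. fext g (sc (f p) (bas p)))"
    by (simp add: 1 mop_sum)
  also have "\<dots> = mop a (fext g (\<Sum>p\<in>supp f. sc (f p) (bas p)))"
    unfolding fext_def by (rule arg_cong[where f = "mop a"], rule lext_sum[THEN conjunct1, symmetric]) (simp add: fin)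
  finally show ?thesis by (simp flip: f)
qed

lemma lin_fext: "lin T (Fr T' X) (fext g)"
  by (simp add: lin_def fext_add fext_sc fext_mop Fr_finite)

lemma fext_in:
  assumes "submod T L" "f \<in> Fr T X" "\<And>x. x \<in> X \<Longrightarrow> g x \<in> L"
  shows "fext g f \<in> L"
  unfolding fext_def lext_def
  using assms(2,3) by (intro submod_sum[OF assms(1)] submod_sc[OF assms(1)])
    (auto simp: Fr_def intro!: submod_mop[OF assms(1)])

lemma lin_eq_fext:
  fixes f :: "'x \<times> expo \<Rightarrow> 'k"
  assumes "lin T (Fr T X) h" "f \<in> Fr T X"
  shows "h f = fext (\<lambda>x. h (bas (x, 0))) f"
proof -
  have sub: "submod T (Fr T X :: ('x \<times> expo \<Rightarrow> 'k) set)" by (simp add: submod_Fr)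
  have f: "f = (\<Sum>p\<in>supp f. sc (f p) (bas p))" by (rule bas_expansion) (use assms Fr_finite in auto)
  have in_Fr: "bas p \<in> Fr T X" if "p \<in> supp f" for p
    using that assms(2) by (cases p) (auto simp: Fr_def)
  have b: "h (bas p) = (\<lambda>(x, a). mop a (h (bas (x, 0)))) p" if p: "p \<in> supp f" for p
  proof -
    obtain x a where xa: "p = (x, a)" by fastforce
    have *: "bas (x, 0) \<in> Fr T X" "a \<in> lat T" using p assms(2) by (auto simp: Fr_def xa)
    have "bas p = mop a (bas (x, 0))" unfolding xa by (rule bas_eq_mop)
    then show ?thesis using lin_mop[OF assms(1) *(2,1)] by (simp add: xa)
  qed
  have "h f = h (\<Sum>p\<in>supp f. sc (f p) (bas p))" by (simp flip: f)
  also have "\<dots> = (\<Sum>p\<in>supp f. h (sc (f p) (bas p)))"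
    by (rule lin_sum[OF assms(1) sub]) (simp add: in_Fr)
  also have "\<dots> = (\<Sum>p\<in>supp f. sc (f p) ((\<lambda>(x, a). mop a (h (bas (x, 0)))) p))"
    by (rule sum.cong) (auto simp: lin_sc[OF assms(1) in_Fr] b)
  finally show ?thesis by (simp add: fext_def lext_def case_prod_unfold)
qed

end

section \<open>Exponent vectors\<close>

definition gp :: "nat set \<Rightarrow> expo set" where
  "gp T = {a\<in>lat T. \<forall>i. 0 \<le> a i}"

definition deg :: "nat \<Rightarrow> expo \<Rightarrow> int" where
  "deg m a = (\<Sum>i<m. a i)"

definition lexlt :: "expo \<Rightarrow> expo \<Rightarrow> bool" where
  "lexlt a b \<longleftrightarrow> (\<exists>k. a k < b k \<and> (\<forall>j<k. a j = b j))"

text \<open>A monomial order for free modules of finite rank. Degree comes first, so that a positive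
  exponent has finitely many predecessors and reductions never raise the degree; ties are broken by
  position, then lexicographically, which is compatible with translation.\<close>

definition ltr :: "nat \<Rightarrow> nat \<times> expo \<Rightarrow> nat \<times> expo \<Rightarrow> bool" where
  "ltr m p q \<longleftrightarrow> deg m (snd p) < deg m (snd q) \<or> deg m (snd p) = deg m (snd q) \<and>
     (fst p < fst q \<or> fst p = fst q \<and> lexlt (snd p) (snd q))"

lemma gp_add [simp]: "a \<in> gp T \<Longrightarrow> b \<in> gp T \<Longrightarrow> a + b \<in> gp T"
  by (auto simp: gp_def plus_fun_apply)

lemma gp_zero [simp]: "0 \<in> gp T"
  by (auto simp: gp_def zero_fun_apply)

lemma gp_lat: "a \<in> gp T \<Longrightarrow> a \<in> lat T"
  by (simp add: gp_def)

lemma gp_mono: "T \<subseteq> T' \<Longrightarrow> a \<in> gp T \<Longrightarrow> a \<in> gp T'"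
  by (auto simp: gp_def intro: lat_mono)

lemma gp_diff: "a \<in> gp T \<Longrightarrow> b \<in> lat T \<Longrightarrow> b \<le> a \<Longrightarrow> a - b \<in> gp T"
  by (auto simp: gp_def le_fun_def)

lemma deg_add: "deg m (a + b) = deg m a + deg m b"
  by (simp add: deg_def plus_fun_apply sum.distrib)

lemma deg_diff: "deg m (a - b) = deg m a - deg m b"
  by (simp add: deg_def sum_subtractf)

lemma deg_nonneg: "a \<in> gp T \<Longrightarrow> 0 \<le> deg m a"
  by (auto simp: deg_def gp_def intro: sum_nonneg)

lemma ltr_deg: "ltr m p q \<Longrightarrow> deg m (snd p) \<le> deg m (snd q)"
  by (auto simp: ltr_def)

lemma ltr_irrefl [simp]: "\<not> ltr m p p"
  by (auto simp: ltr_def lexlt_def)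

lemma lexlt_trans:
  assumes "lexlt a b" "lexlt b e"
  shows "lexlt a e"
proof -
  obtain k l where "a k < b k" "\<forall>j<k. a j = b j" "b l < e l" "\<forall>j<l. b j = e j"
    using assms by (auto simp: lexlt_def)
  then have "a (min k l) < e (min k l) \<and> (\<forall>j<min k l. a j = e j)"
    by (cases k l rule: linorder_cases) auto
  then show ?thesis unfolding lexlt_def by blast
qed

lemma lexlt_total:
  assumes "a \<noteq> b"
  shows "lexlt a b \<or> lexlt b a"
proof -
  define k where "k = (LEAST i. a i \<noteq> b i)"
  have "\<exists>i. a i \<noteq> b i" using assms by auto
  then have k: "a k \<noteq> b k" unfolding k_def by (rule LeastI_ex)
  have eq: "a j = b j" if "j < k" for j using not_less_Least[OF that[unfolded k_def]] by simp
  from k consider "a k < b k" | "b k < a k" by linarith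
  then show ?thesis by cases (use eq in \<open>auto simp: lexlt_def\<close>)
qed

lemma ltr_trans: "ltr m p q \<Longrightarrow> ltr m q r \<Longrightarrow> ltr m p r"
  unfolding ltr_def by (elim disjE conjE) (simp_all, blast intro: lexlt_trans)

lemma ltr_total:
  assumes "p \<noteq> q"
  shows "ltr m p q \<or> ltr m q p"
proof (cases "deg m (snd p) = deg m (snd q) \<and> fst p = fst q")
  case True
  then have "snd p \<noteq> snd q" using assms by (auto simp: prod_eq_iff)
  then show ?thesis using True lexlt_total by (auto simp: ltr_def)
qed (auto simp: ltr_def)

lemma ltr_shift: "ltr m (x, a) (y, b) \<Longrightarrow> ltr m (x, e + a) (y, e + b)"
  by (auto simp: ltr_def lexlt_def deg_add plus_fun_apply)

lemma finite_gp_deg: "finite {a \<in> gp {..<m}. deg m a \<le> N}"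
proof (rule finite_subset)
  show "{a \<in> gp {..<m}. deg m a \<le> N} \<subseteq>
    {a. \<forall>i. (i \<in> {..<m} \<longrightarrow> a i \<in> {0..N}) \<and> (i \<notin> {..<m} \<longrightarrow> a i = 0)}"
  proof (clarify, intro conjI impI)
    fix a i assume a: "a \<in> gp {..<m}" "deg m a \<le> N"
    show "a i = 0" if "i \<notin> {..<m}" using a(1) that by (auto simp: gp_def lat_def)
    assume "i \<in> {..<m}"
    then have "a i \<le> deg m a"
      unfolding deg_def using a(1) by (intro member_le_sum) (auto simp: gp_def)
    then show "a i \<in> {0..N}" using a by (auto simp: gp_def)
  qed
qed (use finite_set_of_finite_funs[of "{..<m}" "{0..N}" 0] in blast)

text \<open>Induction on the number of predecessors, which is finite because \<open>ltr\<close>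
  refines the degree and only finitely many positive exponents have bounded degree.\<close>

lemma ltr_induct [consumes 1, case_names less]:
  assumes "p \<in> {..<r} \<times> gp {..<m}"
    and step: "\<And>q. q \<in> {..<r} \<times> gp {..<m} \<Longrightarrow>
      (\<And>p. p \<in> {..<r} \<times> gp {..<m} \<Longrightarrow> ltr m p q \<Longrightarrow> P p) \<Longrightarrow> P q"
  shows "P p"
proof -
  define D where "D = {..<r} \<times> gp {..<m}"
  have fin: "finite {p\<in>D. ltr m p q}" for q
  proof (rule finite_subset)
    show "{p\<in>D. ltr m p q} \<subseteq> {..<r} \<times> {a \<in> gp {..<m}. deg m a \<le> deg m (snd q)}"
      by (auto simp: D_def dest: ltr_deg)
  qed (simp add: finite_gp_deg)
  have "p \<in> D \<Longrightarrow> P p"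
  proof (induction "card {q\<in>D. ltr m q p}" arbitrary: p rule: less_induct)
    case less
    show ?case
    proof (rule step)
      show "p \<in> {..<r} \<times> gp {..<m}" using less.prems by (simp add: D_def)
      fix q assume q: "q \<in> {..<r} \<times> gp {..<m}" "ltr m q p"
      have "{s\<in>D. ltr m s q} \<subset> {s\<in>D. ltr m s p}"
      proof (rule psubsetI)
        show "{s\<in>D. ltr m s q} \<subseteq> {s\<in>D. ltr m s p}" using q(2) ltr_trans by blast
        have "q \<in> {s\<in>D. ltr m s p}" "q \<notin> {s\<in>D. ltr m s q}" using q by (simp_all add: D_def)
        then show "{s\<in>D. ltr m s q} \<noteq> {s\<in>D. ltr m s p}" by (metis (no_types, lifting))
      qed
      then have "card {s\<in>D. ltr m s q} < card {s\<in>D. ltr m s p}"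
        by (rule psubset_card_mono[OF fin])
      then show "P q" by (rule less.hyps) (use q in \<open>simp add: D_def\<close>)
    qed
  qed
  then show ?thesis using assms(1) by (simp add: D_def)
qed

lemma ltr_max:
  assumes "finite A" "A \<noteq> {}"
  shows "\<exists>p\<in>A. \<forall>q\<in>A. q \<noteq> p \<longrightarrow> ltr m q p"
  using assms
proof (induction A rule: finite_ne_induct)
  case (insert x F)
  then obtain p where p: "p \<in> F" "\<forall>q\<in>F. q \<noteq> p \<longrightarrow> ltr m q p" by blast
  then have "x \<noteq> p" using insert by blast
  then consider "ltr m x p" | "ltr m p x" using ltr_total by blast
  then show ?case
  proof cases
    case 1
    then show ?thesis using p by (intro bexI[of _ p]) auto
  next
    case 2
    then show ?thesis using p ltr_trans[of m _ p x] by (intro bexI[of _ x]) auto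
  qed
qed simp

lemma card_bounded_funs:
  fixes B :: "nat \<Rightarrow> int set"
  assumes "\<And>i. i < m \<Longrightarrow> finite (B i)"
  shows "finite {a \<in> lat {..<m}. \<forall>i<m. a i \<in> B i}"
    "card {a \<in> lat {..<m}. \<forall>i<m. a i \<in> B i} = (\<Prod>i<m. card (B i))"
proof -
  let ?A = "{a \<in> lat {..<m}. \<forall>i<m. a i \<in> B i}"
  have bij: "bij_betw (\<lambda>a. restrict a {..<m}) ?A (PiE {..<m} B)"
  proof (rule bij_betwI[of _ _ _ "\<lambda>f i. if i < m then f i else 0"])
    show "(\<lambda>a. restrict a {..<m}) \<in> ?A \<rightarrow> PiE {..<m} B" by auto
    show "(\<lambda>f i. if i < m then f i else 0) \<in> PiE {..<m} B \<rightarrow> ?A"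
    proof
      fix f assume "f \<in> PiE {..<m} B"
      then have "f i \<in> B i" if "i < m" for i using that by (simp add: PiE_mem)
      then show "(\<lambda>i. if i < m then f i else 0) \<in> ?A" by (simp add: lat_def)
    qed
    fix a assume "a \<in> ?A"
    then have "\<And>i. \<not> i < m \<Longrightarrow> a i = 0" by (simp add: lat_def)
    then show "(\<lambda>i. if i < m then restrict a {..<m} i else 0) = a" by (simp add: fun_eq_iff)
  next
    fix f assume "f \<in> PiE {..<m} B"
    then have "f \<in> extensional {..<m}" unfolding PiE_def by (rule IntD2)
    then have "f i = undefined" if "\<not> i < m" for i
      using that unfolding extensional_def by blast
    then show "restrict (\<lambda>i. if i < m then f i else 0) {..<m} = f" by (simp add: fun_eq_iff)
  qed
  have "finite (PiE {..<m} B)" by (rule finite_PiE) (use assms in auto)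
  then show "finite ?A" using bij_betw_finite[OF bij] by blast
  have "card (PiE {..<m} B) = (\<Prod>i<m. card (B i))" by (simp add: card_PiE)
  then show "card ?A = (\<Prod>i<m. card (B i))" using bij_betw_same_card[OF bij] by simp
qed

text \<open>An exponent with k + 1 large coordinates lies above the element of \<open>F\<close>
  supported on those coordinates. Hence a standard exponent has at most k coordinates that are not
  bounded by a constant.\<close>

lemma std_count:
  assumes F: "\<And>S. S \<subseteq> {..<m} \<Longrightarrow> card S = Suc k \<Longrightarrow> \<exists>f\<in>F. f \<in> gp S"
  shows "\<exists>C. \<forall>N. card {a \<in> gp {..<m}. deg m a \<le> int N \<and> (\<forall>f\<in>F. \<not> f \<le> a)} \<le> C * (N + 1) ^ k"
proof -
  obtain g where g: "\<And>S. S \<subseteq> {..<m} \<Longrightarrow> card S = Suc k \<Longrightarrow> g S \<in> F \<and> g S \<in> gp S"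
    using F by metis
  define M where "M = insert 0 ((\<lambda>(S, i). g S i) ` (Pow {..<m} \<times> {..<m}))"
  have finM: "finite M" by (simp add: M_def)
  \<comment> \<open>\<open>e\<close> exceeds every coordinate of the chosen elements
    \<open>g S\<close>, so a coordinate is large when it is at least \<open>e\<close>.\<close>
  define e where "e = Suc (nat (Max M))"
  have e: "g S i < int e" if "S \<subseteq> {..<m}" "i < m" for S i
  proof -
    have "g S i \<in> M" using that by (force simp: M_def)
    then have "g S i \<le> Max M" using finM by simp
    then show ?thesis by (simp add: e_def)
  qed
  define A where "A N T = {a \<in> lat {..<m}. \<forall>i<m. a i \<in> (if i \<in> T then {0..int N} else {0..<int e})}"
    for N T
  have cardA: "finite (A N T) \<and> card (A N T) \<le> (N + 1) ^ k * e ^ m"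
    if T: "T \<subseteq> {..<m}" "card T \<le> k" for N T
  proof -
    have "card (A N T) = (\<Prod>i<m. card (if i \<in> T then {0..int N} else {0..<int e}))"
      unfolding A_def by (rule card_bounded_funs) auto
    also have "\<dots> = (\<Prod>i<m. (if i \<in> T then N + 1 else 1) * (if i \<in> T then 1 else e))"
      by (rule prod.cong) (auto simp: nat_add_distrib)
    also have "\<dots> = (\<Prod>i<m. (if i \<in> T then N + 1 else 1)) * (\<Prod>i<m. (if i \<in> T then 1 else e))"
      by (rule prod.distrib)
    also have "\<dots> \<le> (N + 1) ^ k * e ^ m"
    proof (rule mult_le_mono)
      have "(\<Prod>i<m. (if i \<in> T then N + 1 else 1)) = (\<Prod>i\<in>{..<m} \<inter> T. N + 1)"
        by (rule prod.inter_restrict[symmetric]) simp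
      also have "\<dots> = (N + 1) ^ card T" using T(1) by (simp add: Int_absorb1)
      also have "\<dots> \<le> (N + 1) ^ k" using T(2) by (intro power_increasing) auto
      finally show "(\<Prod>i<m. (if i \<in> T then N + 1 else 1)) \<le> (N + 1) ^ k" .
      have "(\<Prod>i<m. (if i \<in> T then 1 else e)) \<le> (\<Prod>i<m. e)"
        by (rule prod_mono) (auto simp: e_def)
      then show "(\<Prod>i<m. (if i \<in> T then 1 else e)) \<le> e ^ m" by simp
    qed
    finally have "card (A N T) \<le> (N + 1) ^ k * e ^ m" .
    moreover have "finite (A N T)" unfolding A_def by (rule card_bounded_funs(1)) simp
    ultimately show ?thesis by simp
  qed
  let ?P = "{T\<in>Pow {..<m}. card T \<le> k}"
  have "card {a \<in> gp {..<m}. deg m a \<le> int N \<and> (\<forall>f\<in>F. \<not> f \<le> a)} \<le> (2 ^ m * e ^ m) * (N + 1) ^ k" for N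
  proof -
    have "{a \<in> gp {..<m}. deg m a \<le> int N \<and> (\<forall>f\<in>F. \<not> f \<le> a)} \<subseteq> (\<Union>T\<in>?P. A N T)"
    proof clarify
      fix a assume a: "a \<in> gp {..<m}" "deg m a \<le> int N" "\<forall>f\<in>F. \<not> f \<le> a"
      \<comment> \<open>The large coordinates of \<open>a\<close>; if there were more than k of
        them, some \<open>g S\<close> would lie below \<open>a\<close>.\<close>
      define T where "T = {i\<in>{..<m}. int e \<le> a i}"
      have "card T \<le> k"
      proof (rule ccontr)
        assume "\<not> card T \<le> k"
        then obtain S where S: "S \<subseteq> T" "card S = Suc k"
          by (metis not_less_eq_eq obtain_subset_with_card_n)
        have "S \<subseteq> {..<m}" using S T_def by auto
        then have gS: "g S \<in> F" "g S \<in> gp S" using g S by auto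
        have "g S i \<le> a i" for i
        proof (cases "i \<in> S")
          case True
          then show ?thesis using e[OF \<open>S \<subseteq> {..<m}\<close>, of i] S(1) by (force simp: T_def)
        next
          case False
          then show ?thesis using gS(2) a(1) by (auto simp: gp_def lat_def)
        qed
        then show False using a(3) gS(1) by (auto simp: le_fun_def)
      qed
      moreover have "a i \<le> int N" if "i < m" for i
      proof -
        have "a i \<le> deg m a"
          unfolding deg_def using a(1) that by (intro member_le_sum) (auto simp: gp_def)
        then show ?thesis using a(2) by simp
      qed
      ultimately show "a \<in> (\<Union>T\<in>?P. A N T)"
        using a(1) by (intro UN_I[of T]) (auto simp: A_def T_def gp_def)
    qed
    then have "card {a \<in> gp {..<m}. deg m a \<le> int N \<and> (\<forall>f\<in>F. \<not> f \<le> a)} \<le> card (\<Union>T\<in>?P. A N T)"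
      by (intro card_mono) (use cardA in auto)
    also have "\<dots> \<le> (\<Sum>T\<in>?P. card (A N T))" by (rule card_UN_le) auto
    also have "\<dots> \<le> (\<Sum>T\<in>?P. (N + 1) ^ k * e ^ m)" by (rule sum_mono) (use cardA in auto)
    also have "\<dots> = card ?P * ((N + 1) ^ k * e ^ m)" by simp
    also have "\<dots> \<le> 2 ^ m * ((N + 1) ^ k * e ^ m)"
    proof (rule mult_le_mono1)
      have "card ?P \<le> card (Pow {..<m})" by (rule card_mono) auto
      then show "card ?P \<le> 2 ^ m" by (simp add: card_Pow)
    qed
    finally show ?thesis by (simp add: ac_simps)
  qed
  then show ?thesis by blast
qed

section \<open>Linear algebra of functions\<close>

text \<open>The vectors form an indexed family, so a repeated vector already yields the dependency
  \<open>v i - v j = 0\<close>; otherwise the dimension bound applies to the image.\<close>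

lemma exists_dependency:
  fixes v :: "'i \<Rightarrow> 'b \<Rightarrow> 'k::field"
  assumes "finite I" "finite W" "\<And>i. i \<in> I \<Longrightarrow> v i \<in> fs.span W" "card W < card I"
  shows "\<exists>s. (\<exists>i\<in>I. s i \<noteq> 0) \<and> (\<Sum>i\<in>I. sc (s i) (v i)) = 0"
proof (cases "inj_on v I")
  case True
  have "fs.dependent (v ` I)"
  proof (rule ccontr)
    assume "\<not> fs.dependent (v ` I)"
    then have "card (v ` I) \<le> card W"
      using fs.independent_span_bound[of W "v ` I"] assms(2,3) by blast
    then show False using True assms(4) by (simp add: card_image)
  qed
  then obtain u where u: "\<exists>w\<in>v ` I. u w \<noteq> 0" "(\<Sum>w\<in>v ` I. sc (u w) w) = 0"
    using fs.dependent_finite[of "v ` I"] assms(1) by auto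
  show ?thesis
    using u by (intro exI[of _ "\<lambda>i. u (v i)"]) (auto simp: sum.reindex[OF True])
next
  case False
  then obtain i j where ij: "i \<in> I" "j \<in> I" "i \<noteq> j" "v i = v j" by (auto simp: inj_on_def)
  have "(\<Sum>l\<in>I. sc (bas i l - bas j l) (v l)) = (\<Sum>l\<in>I. (if l = i then v i else 0) - (if l = j then v j else 0))"
    by (rule sum.cong) (auto simp: bas_apply fun_eq_iff fun_simps)
  also have "\<dots> = 0" using ij assms(1) by (simp add: sum_subtractf)
  finally show ?thesis
    using ij by (intro exI[of _ "\<lambda>l. bas i l - bas j l"]) (auto simp: bas_apply intro!: bexI[of _ i])
qed

lemma span_image_finite:
  assumes "finite A" "x \<in> fs.span (f ` A)"
  shows "\<exists>k. x = (\<Sum>a\<in>A. sc (k a) (f a))"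
  using assms(2)
proof (induction rule: fs.span_induct_alt)
  case base
  show ?case by (intro exI[of _ "\<lambda>_. 0"]) simp
next
  case (step r x y)
  then obtain k a where k: "y = (\<Sum>a\<in>A. sc (k a) (f a))" "a \<in> A" "x = f a" by blast
  have "sc r (f a) = (\<Sum>b\<in>A. if b = a then sc r (f a) else 0)" using k assms(1) by simp
  also have "\<dots> = (\<Sum>b\<in>A. sc (r * bas a b) (f b))"
    by (rule sum.cong) (auto simp: bas_apply)
  finally have "sc r x + y = (\<Sum>b\<in>A. sc (r * bas a b + k b) (f b))"
    using k by (simp add: fs.scale_left_distrib sum.distrib)
  then show ?case by (intro exI[of _ "\<lambda>b. r * bas a b + k b"])
qed

lemma span_Un_subspace:
  assumes "fs.subspace V" "x \<in> fs.span (A \<union> V)"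
  shows "\<exists>y\<in>fs.span A. x - y \<in> V"
proof -
  obtain y z where "x = y + z" "y \<in> fs.span A" "z \<in> fs.span V"
    using assms(2) by (auto simp: fs.span_Un)
  moreover have "z \<in> V" using \<open>z \<in> fs.span V\<close> unfolding fs.span_eq_iff[THEN iffD2, OF assms(1)] .
  ultimately show ?thesis by (intro bexI[of _ y]) auto
qed

section \<open>Bernstein's inequality for quantum tori\<close>

text \<open>A module over a quantum torus of rank \<open>m\<close>, given by the operators of its monomials, together
  with a submodule \<open>V0\<close>. Left and right multiplication are both instances.\<close>

locale torus_rep =
  fixes m :: nat and d :: "nat \<Rightarrow> nat \<Rightarrow> 'k::field" and opr :: "expo \<Rightarrow> ('b \<Rightarrow> 'k) \<Rightarrow> 'b \<Rightarrow> 'k"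
    and V0 :: "('b \<Rightarrow> 'k) set"
  assumes d_nonzero: "\<And>i j. d i j \<noteq> 0"
    and opr_add: "\<And>a u v. opr a (u + v) = opr a u + opr a v"
    and opr_sc: "\<And>a r u. opr a (sc r u) = sc r (opr a u)"
    and opr_0: "\<And>u. opr 0 u = u"
    and opr_opr: "\<And>a b u. opr a (opr b u) = sc (bich m d a b) (opr (a + b) u)"
    and V0_subspace: "fs.subspace V0"
    and V0_opr: "\<And>a u. a \<in> lat {..<m} \<Longrightarrow> u \<in> V0 \<Longrightarrow> opr a u \<in> V0"
begin

lemma bd_nonzero [simp]: "bich m d a b \<noteq> 0"
  by (rule bich_nonzero) (rule d_nonzero)

lemma opr_zero: "opr a 0 = 0"
  using opr_sc[of a 0 0] by simp

lemma opr_sum: "opr a (\<Sum>i\<in>I. f i) = (\<Sum>i\<in>I. opr a (f i))"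
  by (induction I rule: infinite_finite_induct) (auto simp: opr_add opr_zero)

lemma V0_sc_iff:
  assumes "r \<noteq> 0"
  shows "sc r u \<in> V0 \<longleftrightarrow> u \<in> V0"
proof
  assume "sc r u \<in> V0"
  then have "sc (inverse r) (sc r u) \<in> V0" by (rule fs.subspace_scale[OF V0_subspace])
  then show "u \<in> V0" using assms by simp
qed (rule fs.subspace_scale[OF V0_subspace])

lemma V0_opr_iff:
  assumes a: "a \<in> lat {..<m}"
  shows "opr a u \<in> V0 \<longleftrightarrow> u \<in> V0"
proof
  assume "opr a u \<in> V0"
  then have "opr (- a) (opr a u) \<in> V0" by (rule V0_opr[OF lat_minus[OF a]])
  moreover have "opr (- a) (opr a u) = sc (bich m d (- a) a) u" by (simp add: opr_opr opr_0)
  ultimately show "u \<in> V0" using V0_sc_iff[OF bd_nonzero] by simp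
qed (rule V0_opr[OF a])

lemma opr_span:
  assumes "a \<in> lat {..<m}" "u \<in> fs.span (A \<union> V0)"
  shows "opr a u \<in> fs.span (opr a ` A \<union> V0)"
  using assms(2)
proof (induction rule: fs.span_induct_alt)
  case base
  show ?case by (simp add: opr_zero fs.span_zero)
next
  case (step r x y)
  then have "opr a x \<in> fs.span (opr a ` A \<union> V0)"
    using assms(1) V0_opr by (intro fs.span_base) auto
  then show ?case unfolding opr_add opr_sc by (intro fs.span_add fs.span_scale step.IH)
qed

lemma opr_shift: "opr b v = sc (inverse (bich m d (b - a) a)) (opr (b - a) (opr a v))"
  by (simp add: opr_opr)

text \<open>A relation along \<open>S\<close> satisfied by v modulo \<open>V0\<close> is multiplied
  by a monomial until all its exponents are positive; dividing by the leading coefficient then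
  expresses the largest term through smaller ones.\<close>

lemma leading_relation:
  assumes s: "finite (supp s)" "supp s \<subseteq> lat S" "s \<noteq> 0" "S \<subseteq> {..<m}"
    and rel: "(\<Sum>a\<in>supp s. sc (s a) (opr a v)) \<in> V0"
  shows "\<exists>a\<in>gp S. opr a v \<in> fs.span ((\<lambda>b. opr b v) ` {b\<in>gp S. ltr m (0, b) (0, a)} \<union> V0)"
proof -
  \<comment> \<open>A bound for all negative exponents in the relation; shifting by M in the
    directions of \<open>S\<close> makes them nonnegative.\<close>
  define M where "M = Max (insert 0 ((\<lambda>(a, i). - a i) ` (supp s \<times> {..<m})))"
  define e :: expo where "e = (\<lambda>i. if i \<in> S then M else 0)"
  have e_lat: "e \<in> lat S" by (auto simp: e_def lat_def)
  have fin: "finite (insert 0 ((\<lambda>(a, i). - a i) ` (supp s \<times> {..<m})))" using s by simp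
  have Mge: "- a i \<le> M" if "a \<in> supp s" "i < m" for a i
    unfolding M_def using that by (intro Max_ge[OF fin]) force
  have pos: "e + a \<in> gp S" if "a \<in> supp s" for a
    unfolding gp_def
  proof (intro CollectI conjI allI)
    have a: "a \<in> lat S" using s that by auto
    then show "e + a \<in> lat S" using e_lat by simp
    show "0 \<le> (e + a) i" for i
      using Mge[OF that, of i] a s(4) by (auto simp: e_def plus_fun_apply lat_def)
  qed
  have "supp s \<noteq> {}" using s(3) by (simp add: supp_eq_empty)
  then obtain p where p: "p \<in> Pair 0 ` supp s" "\<forall>q\<in>Pair 0 ` supp s. q \<noteq> p \<longrightarrow> ltr m q p"
    using ltr_max[of "Pair 0 ` supp s" m] s(1) by auto
  then obtain a0 where a0: "a0 \<in> supp s" "p = (0, a0)" by auto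
  have lt: "ltr m (0, a) (0, a0)" if "a \<in> supp s" "a \<noteq> a0" for a
    using p(2) that a0 by auto
  let ?G = "fs.span ((\<lambda>b. opr b v) ` {b\<in>gp S. ltr m (0, b) (0, e + a0)} \<union> V0)"
  define R where "R = (\<Sum>a\<in>supp s - {a0}. sc (s a) (opr a v))"
  have "opr e (\<Sum>a\<in>supp s. sc (s a) (opr a v)) \<in> V0"
    using e_lat s(4) rel lat_mono by (intro V0_opr) auto
  moreover have "(\<Sum>a\<in>supp s. sc (s a) (opr a v)) = sc (s a0) (opr a0 v) + R"
    unfolding R_def by (rule sum.remove[OF s(1) a0(1)])
  ultimately have 1: "sc (s a0) (opr e (opr a0 v)) + opr e R \<in> ?G"
    by (simp add: opr_add opr_sc fs.span_base)
  have "opr e (opr a v) \<in> ?G" if "a \<in> supp s - {a0}" for a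
    unfolding opr_opr using that pos[of a] lt[of a] ltr_shift[of m 0 a 0 a0 e]
    by (intro fs.span_scale fs.span_base) auto
  then have 2: "opr e R \<in> ?G"
    unfolding R_def opr_sum opr_sc by (intro fs.span_sum fs.span_scale)
  have "sc (s a0) (opr e (opr a0 v)) \<in> ?G"
    using fs.span_diff[OF 1 2] by simp
  then have "sc (inverse (s a0 * bich m d e a0)) (sc (s a0) (opr e (opr a0 v))) \<in> ?G"
    by (rule fs.span_scale)
  moreover have "s a0 \<noteq> 0" using a0 by (simp add: supp_iff)
  then have "inverse (s a0 * bich m d e a0) * (s a0 * bich m d e a0) = 1" by (intro left_inverse) simp
  ultimately have "opr (e + a0) v \<in> ?G" by (simp only: opr_opr fs.scale_scale mult.assoc fs.scale_one)
  then show ?thesis using pos[OF a0(1)] by blast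
qed

text \<open>Groebner reduction: an exponent above some f in \<open>F\<close> is rewritten by
  translating the relation with leading exponent f. The degree bound survives because the order
  refines the degree.\<close>

lemma standard_span:
  assumes F: "\<And>f. f \<in> F \<Longrightarrow> f \<in> gp {..<m} \<and>
      opr f v \<in> fs.span ((\<lambda>b. opr b v) ` {b\<in>gp {..<m}. ltr m (0, b) (0, f)} \<union> V0)"
    and a: "a \<in> gp {..<m}" "deg m a \<le> N"
  shows "opr a v \<in> fs.span ((\<lambda>b. opr b v) ` {b \<in> gp {..<m}. deg m b \<le> N \<and> (\<forall>f\<in>F. \<not> f \<le> b)} \<union> V0)"
    (is "_ \<in> ?G")
proof -
  have "(0::nat, a) \<in> {..<1::nat} \<times> gp {..<m}" using a by simp
  then have "deg m (snd (0::nat, a)) \<le> N \<longrightarrow> opr (snd (0::nat, a)) v \<in> ?G"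
  proof (induction "(0::nat, a)" arbitrary: a rule: ltr_induct)
    case less
    show ?case
    proof (cases "\<forall>f\<in>F. \<not> f \<le> a")
      case True
      then show ?thesis using less by (auto intro!: fs.span_base)
    next
      case False
      then obtain f where f: "f \<in> F" "f \<le> a" by blast
      have fgp: "f \<in> gp {..<m}" using F f by blast
      have af: "a - f \<in> gp {..<m}" using gp_diff[of a _ f] fgp less f by (auto simp: gp_lat)
      let ?B = "{b\<in>gp {..<m}. ltr m (0, b) (0, f)}"
      show ?thesis
      proof
        assume N: "deg m (snd (0::nat, a)) \<le> N"
        have "opr (a - f) (opr f v) \<in> fs.span (opr (a - f) ` (\<lambda>b. opr b v) ` ?B \<union> V0)"
          by (rule opr_span) (use af F f in \<open>auto simp: gp_lat\<close>)
        moreover have "opr (a - f) ` (\<lambda>b. opr b v) ` ?B \<union> V0 \<subseteq> ?G"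
        proof
          fix x assume "x \<in> opr (a - f) ` (\<lambda>b. opr b v) ` ?B \<union> V0"
          then consider "x \<in> V0" | b where "b \<in> ?B" "x = opr (a - f) (opr b v)" by auto
          then show "x \<in> ?G"
          proof cases
            case 1
            then show ?thesis by (auto intro: fs.span_base)
          next
            case 2
            have lt: "ltr m (0, (a - f) + b) (0, a)"
              using 2(1) ltr_shift[of m 0 b 0 f "a - f"] by simp
            then have "deg m (a - f + b) \<le> N" using N ltr_deg[OF lt] by simp
            then have "opr ((a - f) + b) v \<in> ?G"
              using less(2)[of "(a - f) + b"] lt af 2(1) by auto
            then show ?thesis unfolding 2(2) opr_opr by (rule fs.span_scale)
          qed
        qed
        ultimately have "opr (a - f) (opr f v) \<in> ?G"
          using fs.span_minimal[OF _ fs.subspace_span] by blast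
        then have "sc (inverse (bich m d (a - f) f)) (opr (a - f) (opr f v)) \<in> ?G" by (rule fs.span_scale)
        then show "opr (snd (0::nat, a)) v \<in> ?G" using opr_shift[of a v f] by simp
      qed
    qed
  qed
  then show ?thesis using a by simp
qed

text \<open>The commutation character of the variable j: X^a X_j = \<open>chi j a\<close> X_j
  X^a.\<close>

definition chi :: "nat \<Rightarrow> expo \<Rightarrow> 'k" where
  "chi j a = bich m d a (unit_vec j) / bich m d (unit_vec j) a"

lemma opr_commute: "opr a (opr b u) = sc (bich m d a b / bich m d b a) (opr b (opr a u))"
  by (simp add: opr_opr add.commute)

lemma chi_eq: assumes "j < m" shows "chi j a = (\<Prod>i<m. (d i j / d j i) powi a i)"
proof -
  have "bich m d a (unit_vec j) = (\<Prod>i<m. \<Prod>l<m. if l = j then d i j powi a i else 1)"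
    unfolding bich_def by (intro prod.cong) (auto simp: unit_vec_def)
  moreover have "bich m d (unit_vec j) a = (\<Prod>l<m. \<Prod>i<m. if l = j then d j i powi a i else 1)"
    unfolding bich_def by (intro prod.cong) (auto simp: unit_vec_def)
  then have "bich m d (unit_vec j) a = (\<Prod>i<m. \<Prod>l<m. if l = j then d j i powi a i else 1)"
    by (subst prod.swap) simp
  ultimately show ?thesis using assms
    by (simp add: chi_def power_int_divide_distrib prod_dividef)
qed

text \<open>If a sum of monomial operators kills all of \<open>X\<^sup>b v\<close> for \<open>b\<close> in a box, then commuting with
  monomials multiplies its coefficients by the values of polynomials in the characters \<open>chi j\<close>;
  this isolates single monomials.\<close>

lemma killing_products:
  fixes N :: int and R :: "nat \<Rightarrow> 'k set"
  assumes kill: "\<And>b. b \<in> gp {..<m} \<Longrightarrow> (\<And>i. i < m \<Longrightarrow> b i \<le> N) \<Longrightarrow>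
      (\<Sum>a\<in>I. sc (s a) (opr a (opr b v))) \<in> V0"
    and R: "\<And>j. j < m \<Longrightarrow> finite (R j) \<and> int (card (R j)) \<le> N"
    and "0 \<le> N"
  shows "(\<Sum>a\<in>I. sc (s a * (\<Prod>j<m. \<Prod>r\<in>R j. chi j a - r)) (opr a v)) \<in> V0"
proof -
  define W where "W g \<longleftrightarrow> (\<Sum>a\<in>I. sc (s a * g a) (opr a v)) \<in> V0" for g
  define ch where "ch b a = bich m d a b / bich m d b a" for a b
  have W_diff: "W (\<lambda>a. g a - r * h a)" if "W g" "W h" for g h r
  proof -
    have "(\<Sum>a\<in>I. sc (s a * (g a - r * h a)) (opr a v)) =
        (\<Sum>a\<in>I. sc (s a * g a) (opr a v)) - sc r (\<Sum>a\<in>I. sc (s a * h a) (opr a v))"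
      by (simp add: sc_sum algebra_simps fs.scale_left_diff_distrib sum_subtractf)
    then show ?thesis using that unfolding W_def
      by (simp add: fs.subspace_diff fs.subspace_scale V0_subspace)
  qed
  have ch_add: "ch (b + b') a = ch b a * ch b' a" for a b b'
    by (simp add: ch_def bich_add_left[OF d_nonzero] bich_add_right[OF d_nonzero])
  \<comment> \<open>The variables are treated one after the other. The exponent b is kept zero in
    the directions already treated, whose room in the box has been spent on the factors for
    \<open>R j\<close>.\<close>
  have "W (\<lambda>a. ch b a * (\<Prod>j<J. \<Prod>r\<in>R j. chi j a - r))"
    if "J \<le> m" "b \<in> gp {..<m}" "\<And>i. i < m \<Longrightarrow> b i \<le> N" "\<And>i. i < J \<Longrightarrow> b i = 0" for J b
    using that
  proof (induction J arbitrary: b)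
    case 0
    have "opr b (\<Sum>a\<in>I. sc (s a * ch b a) (opr a v)) = (\<Sum>a\<in>I. sc (s a) (opr a (opr b v)))"
      unfolding opr_sum opr_sc
      by (rule sum.cong) (simp_all add: ch_def opr_commute[of _ b])
    also have "\<dots> \<in> V0" by (rule kill) (use 0 in auto)
    finally show ?case using V0_opr_iff[of b] 0 by (simp add: W_def gp_lat)
  next
    case (Suc J)
    define Pr where "Pr a = (\<Prod>j<J. \<Prod>r\<in>R j. chi j a - r)" for a
    have IH: "W (\<lambda>a. ch b a * Pr a)"
      if "b \<in> gp {..<m}" "\<And>i. i < m \<Longrightarrow> b i \<le> N" "\<And>i. i < J \<Longrightarrow> b i = 0" for b
      unfolding Pr_def using Suc.IH[of b] that Suc.prems by simp
    \<comment> \<open>Replacing b by \<open>b + unit_vec J\<close> multiplies the coefficients by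
      \<open>chi J a\<close>; subtracting r times the old sum gives the factor
      \<open>chi J a - r\<close>. Each factor uses up one power of the variable J.\<close>
    have "W (\<lambda>a. ch b a * (Pr a * (\<Prod>r\<in>R'. chi J a - r)))"
      if "finite R'" "b \<in> gp {..<m}" "\<And>i. i < m \<Longrightarrow> b i \<le> N" "\<And>i. i < J \<Longrightarrow> b i = 0"
        "b J + int (card R') \<le> N" for R' b
      using that
    proof (induction R' arbitrary: b rule: finite_induct)
      case empty
      then show ?case using IH[of b] by simp
    next
      case (insert r R')
      define b' where "b' = b + unit_vec J"
      have "unit_vec J \<in> gp {..<m}" using Suc.prems(1) by (auto simp: gp_def unit_vec_def lat_def)
      then have b': "b' \<in> gp {..<m}" "b' J = b J + 1" "\<And>i. i \<noteq> J \<Longrightarrow> b' i = b i"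
        using insert.prems by (auto simp: b'_def plus_fun_apply unit_vec_def)
      have card: "b J + int (card R') + 1 \<le> N" using insert by simp
      have "W (\<lambda>a. ch b' a * (Pr a * (\<Prod>r\<in>R'. chi J a - r)))"
      proof (rule insert.IH)
        show "b' i \<le> N" if "i < m" for i
          using b' insert.prems(2)[OF that] card by (cases "i = J") auto
        show "b' i = 0" if "i < J" for i using b'(3)[of i] insert.prems(3)[OF that] that by auto
      qed (use b' card in auto)
      moreover have "W (\<lambda>a. ch b a * (Pr a * (\<Prod>r\<in>R'. chi J a - r)))"
        by (rule insert.IH) (use insert.prems card in auto)
      ultimately have "W (\<lambda>a. ch b' a * (Pr a * (\<Prod>r\<in>R'. chi J a - r)) -
          r * (ch b a * (Pr a * (\<Prod>r\<in>R'. chi J a - r))))" by (rule W_diff)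
      moreover have "ch b' a = ch b a * chi J a" for a
        unfolding b'_def ch_add by (simp add: chi_def ch_def)
      ultimately show ?case using insert.hyps
        by (simp add: algebra_simps)
    qed
    from this[of "R J" b] show ?case
      using Suc.prems R[of J] by (simp add: Pr_def)
  qed
  from this[of m 0] show ?thesis
    using assms(3) by (simp add: W_def ch_def zero_fun_apply)
qed

end

text \<open>The variable \<open>j < n\<close> commutes with every variable except its partner
  \<open>n + j\<close>, and with that one up to a factor of infinite order. The variables from n on
  may commute among themselves up to arbitrary factors, as the y's do.\<close>

locale symplectic_rep = torus_rep "2 * n" d opr V0
  for n :: nat and d :: "nat \<Rightarrow> nat \<Rightarrow> 'k::field" and opr :: "expo \<Rightarrow> ('b \<Rightarrow> 'k) \<Rightarrow> 'b \<Rightarrow> 'k"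
    and V0 :: "('b \<Rightarrow> 'k) set" +
  assumes d_sym: "\<And>i j. j < n \<Longrightarrow> i < 2 * n \<Longrightarrow> i \<noteq> n + j \<Longrightarrow> d i j = d j i"
    and d_generic: "\<And>j e. j < n \<Longrightarrow> 0 < e \<Longrightarrow> (d (n + j) j / d j (n + j)) ^ e \<noteq> 1"
begin

lemma generic_power_int:
  assumes "j < n" "k \<noteq> l"
  shows "(d (n + j) j / d j (n + j)) powi k \<noteq> (d (n + j) j / d j (n + j)) powi l"
proof -
  define x where "x = d (n + j) j / d j (n + j)"
  have x0: "x \<noteq> 0" by (simp add: x_def d_nonzero)
  have gen: "x powi k \<noteq> x powi l" if "l < k" for k l
  proof
    assume "x powi k = x powi l"
    then have "x powi (k - l) = 1" using x0 by (simp add: power_int_diff)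
    moreover have "x powi (k - l) = x ^ nat (k - l)" using that by (simp add: power_int_nonneg_exp)
    ultimately show False using d_generic[OF assms(1), of "nat (k - l)"] that by (simp add: x_def)
  qed
  show ?thesis using gen[of k l] gen[of l k] assms(2) unfolding x_def by (metis linorder_neqE)
qed

definition dual :: "nat \<Rightarrow> nat" where
  "dual j = (if j < n then n + j else j - n)"

text \<open>For \<open>j < n\<close> the character sees only the coordinate \<open>n + j\<close>.
  For \<open>n \<le> j\<close> it also sees the other coordinates from n on, and depends on the
  partner alone once these are fixed. This triangular shape decides the order in which coordinates
  are compared.\<close>

lemma chi_dual:
  assumes j: "j < 2 * n" and eq: "n \<le> j \<Longrightarrow> (\<And>i. n \<le> i \<Longrightarrow> i < 2 * n \<Longrightarrow> a i = b i)"
  shows "chi j a = chi j b * (d (dual j) j / d j (dual j)) powi (a (dual j) - b (dual j))"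
proof -
  define k where "k i = d i j / d j i" for i
  have k0: "k i \<noteq> 0" for i by (simp add: k_def d_nonzero)
  have same: "k i powi a i = k i powi b i" if "i < 2 * n" "i \<noteq> dual j" for i
  proof (cases "j < n")
    case True
    then have "k i = 1" using d_sym[of j i] that d_nonzero by (simp add: k_def dual_def)
    then show ?thesis by simp
  next
    case False
    show ?thesis
    proof (cases "i < n")
      case True
      then have "k i = 1" using d_sym[of i j] that False j d_nonzero by (simp add: k_def dual_def)
      then show ?thesis by simp
    next
      case False
      then show ?thesis using eq[of i] \<open>\<not> j < n\<close> that by simp
    qed
  qed
  have dj: "dual j < 2 * n" using j by (auto simp: dual_def)
  have *: "(\<Prod>i<2*n. k i powi a i) = k (dual j) powi a (dual j) * (\<Prod>i\<in>{..<2*n} - {dual j}. k i powi a i)" for a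
    by (rule prod.remove) (use dj in auto)
  have "(\<Prod>i\<in>{..<2*n} - {dual j}. k i powi a i) = (\<Prod>i\<in>{..<2*n} - {dual j}. k i powi b i)"
    by (rule prod.cong) (auto simp: same)
  then show ?thesis
    using k0 by (simp add: chi_eq[OF j] * power_int_diff flip: k_def)
qed

text \<open>Interpolation: products of \<open>chi j a - r\<close> are chosen to vanish at every
  exponent of the box except \<open>a0\<close>, so that a single monomial times v remains; monomials
  being invertible, v itself lies in \<open>V0\<close>.\<close>

lemma kill_box:
  fixes N :: nat
  assumes kill: "\<And>b. b \<in> gp {..<2*n} \<Longrightarrow> (\<And>i. i < 2*n \<Longrightarrow> b i \<le> int N) \<Longrightarrow>
      (\<Sum>a\<in>I. sc (s a) (opr a (opr b v))) \<in> V0"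
    and I: "finite I" "\<And>a. a \<in> I \<Longrightarrow> a \<in> gp {..<2*n} \<and> (\<forall>i<2*n. a i \<le> int N)"
    and nz: "a0 \<in> I" "s a0 \<noteq> 0"
  shows "v \<in> V0"
proof -
  \<comment> \<open>The values that \<open>chi j\<close> takes when the partner coordinate differs
    from that of \<open>a0\<close>. Removing this one value from \<open>{0..int N}\<close> leaves N
    values, as many as the box of side N allows.\<close>
  define R where "R j = (\<lambda>l. chi j a0 * (d (dual j) j / d j (dual j)) powi (l - a0 (dual j))) `
      ({0..int N} - {a0 (dual j)})" for j
  have dual: "dual j < 2 * n" "dual (dual j) = j" if "j < 2 * n" for j
    using that by (auto simp: dual_def)
  have gen: "(d (dual j) j / d j (dual j)) powi k = 1 \<longleftrightarrow> k = 0" if "j < 2 * n" for j k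
  proof (cases "j < n")
    case True
    then show ?thesis using generic_power_int[OF True, of k 0] by (auto simp: dual_def)
  next
    case False
    define i where "i = j - n"
    have i: "i < n" "j = n + i" using False that by (auto simp: i_def)
    have "(d i (n + i) / d (n + i) i) powi k = inverse ((d (n + i) i / d i (n + i)) powi k)"
      by (simp flip: power_int_inverse)
    then show ?thesis using generic_power_int[OF i(1), of k 0] i by (auto simp: dual_def)
  qed
  have chi0: "chi j a \<noteq> 0" for j a by (simp add: chi_def)
  have cardR: "finite (R j) \<and> int (card (R j)) \<le> int N" if "j < 2 * n" for j
  proof
    show "finite (R j)" by (simp add: R_def)
    have "a0 (dual j) \<in> {0..int N}" using I(2)[OF nz(1)] dual[OF that] by (auto simp: gp_def)
    then have "card ({0..int N} - {a0 (dual j)}) = N" by (simp add: card_Diff_singleton)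
    then show "int (card (R j)) \<le> int N"
      unfolding R_def by (metis card_image_le finite_Diff finite_atLeastAtMost_int of_nat_le_iff)
  qed
  define g where "g a = (\<Prod>j<2*n. \<Prod>r\<in>R j. chi j a - r)" for a
  have "(\<Sum>a\<in>I. sc (s a * g a) (opr a v)) \<in> V0"
    unfolding g_def by (rule killing_products[OF kill]) (use cardR in auto)
  moreover have "g a = 0" if "a \<in> I" "a \<noteq> a0" for a
  proof -
    have hit: "g a = 0" if j: "j < 2 * n" "a (dual j) \<noteq> a0 (dual j)"
      and eq: "n \<le> j \<Longrightarrow> (\<And>i. n \<le> i \<Longrightarrow> i < 2 * n \<Longrightarrow> a i = a0 i)" for j
    proof -
      have "chi j a \<in> R j"
        unfolding R_def using chi_dual[OF j(1) eq] j I(2)[OF \<open>a \<in> I\<close>] dual[OF j(1)]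
        by (intro image_eqI[of _ _ "a (dual j)"]) (auto simp: gp_def)
      then have "(\<Prod>r\<in>R j. chi j a - r) = 0" using cardR[OF j(1)] by (intro prod_zero) auto
      then show ?thesis unfolding g_def using j(1) by (intro prod_zero) auto
    qed
    have "\<exists>i<2*n. a i \<noteq> a0 i"
    proof (rule ccontr)
      assume *: "\<not> (\<exists>i<2*n. a i \<noteq> a0 i)"
      have "a i = a0 i" for i
        using * I(2)[OF \<open>a \<in> I\<close>] I(2)[OF nz(1)] by (cases "i < 2*n") (auto simp: gp_def lat_def)
      then show False using \<open>a \<noteq> a0\<close> by blast
    qed
    \<comment> \<open>A differing coordinate from n on is detected by its partner below n
      unconditionally; if all of these agree, a differing coordinate \<open>i < n\<close> is
      detected by \<open>n + i\<close>.\<close>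
    show ?thesis
    proof (cases "\<exists>i. n \<le> i \<and> i < 2 * n \<and> a i \<noteq> a0 i")
      case True
      then obtain i where i: "n \<le> i" "i < 2 * n" "a i \<noteq> a0 i" by blast
      show ?thesis by (rule hit[of "i - n"]) (use i in \<open>auto simp: dual_def\<close>)
    next
      case False
      then obtain i where i: "i < n" "a i \<noteq> a0 i"
        using \<open>\<exists>i<2*n. a i \<noteq> a0 i\<close> by (meson not_less)
      show ?thesis by (rule hit[of "n + i"]) (use i False in \<open>auto simp: dual_def\<close>)
    qed
  qed
  then have "(\<Sum>a\<in>I. sc (s a * g a) (opr a v)) = (\<Sum>a\<in>I. if a = a0 then sc (s a0 * g a0) (opr a0 v) else 0)"
    by (intro sum.cong) auto
  ultimately have "sc (s a0 * g a0) (opr a0 v) \<in> V0" using I(1) nz(1) by simp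
  moreover have "g a0 \<noteq> 0"
    unfolding g_def using cardR chi0 gen by (force simp: R_def)
  ultimately have "opr a0 v \<in> V0" using nz(2) V0_sc_iff by simp
  then show ?thesis using V0_opr_iff I(2)[OF nz(1)] by (auto simp: gp_lat)
qed

text \<open>Bernstein's inequality in filtered form. The monomials of a box number about N^(2n),
  while linear maps between two layers of the filtration modulo \<open>V0\<close> form a space of
  dimension about N^(2n - 2). Hence some nonzero combination of monomials kills a whole layer, and
  \<open>kill_box\<close> applies.\<close>

theorem growth_in_V0:
  assumes n: "n \<ge> 1"
    and fin: "\<And>N. finite (X N)" and C: "\<And>N. card (X N) \<le> C * (N + 1) ^ (n - 1)"
    and v: "v \<in> fs.span (X 0 \<union> V0)"
    and X: "\<And>N K x a. x \<in> X N \<Longrightarrow> a \<in> gp {..<2*n} \<Longrightarrow> deg (2*n) a \<le> int K \<Longrightarrow>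
      opr a x \<in> fs.span (X (N + K) \<union> V0)"
  shows "v \<in> V0"
proof -
  define m where "m = 2 * n"
  \<comment> \<open>Large enough that the number (N + 1)^(2n) of monomials beats the product of the
    sizes of the two layers, a constant times (N + 1)^(2n - 2).\<close>
  define N where "N = C * (2 * m) ^ n + 1"
  define Bx where "Bx = {a \<in> lat {..<m}. \<forall>i<m. a i \<in> {0..int N}}"
  have "finite Bx" unfolding Bx_def by (rule card_bounded_funs(1)) simp
  moreover have "card Bx = (\<Prod>i<m. card {0..int N})" unfolding Bx_def by (rule card_bounded_funs(2)) simp
  ultimately have Bx: "finite Bx" "card Bx = (N + 1) ^ m" by (auto simp: nat_add_distrib)
  have Bx_gp: "a \<in> gp {..<m}" if "a \<in> Bx" for a
    unfolding gp_def
  proof (intro CollectI conjI allI)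
    show "a \<in> lat {..<m}" using that by (simp add: Bx_def)
    show "0 \<le> a i" for i using that by (cases "i < m") (simp_all add: Bx_def lat_def)
  qed
  have Bx_deg: "deg m a \<le> int (m * N)" if "a \<in> Bx" for a
  proof -
    have "deg m a \<le> (\<Sum>i<m. int N)"
      unfolding deg_def by (rule sum_mono) (use that in \<open>auto simp: Bx_def\<close>)
    then show ?thesis by simp
  qed
  define X1 where "X1 = X (m * N)"
  define X2 where "X2 = X (2 * m * N)"
  have "\<exists>k. opr a x - (\<Sum>u\<in>X2. sc (k u) u) \<in> V0" if "a \<in> Bx" "x \<in> X1" for a x
  proof -
    have "opr a x \<in> fs.span (X (m * N + m * N) \<union> V0)"
      using Bx_gp[OF that(1)] Bx_deg[OF that(1)] that(2) by (intro X) (simp_all add: X1_def m_def)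
    moreover have "m * N + m * N = 2 * m * N" by simp
    ultimately have "opr a x \<in> fs.span (X2 \<union> V0)" unfolding X2_def by metis
    then obtain y where y: "y \<in> fs.span X2" "opr a x - y \<in> V0"
      using span_Un_subspace[OF V0_subspace] by blast
    then show ?thesis using span_image_finite[of X2 y "\<lambda>b. b"] fin by (auto simp: X2_def)
  qed
  then obtain k where k: "\<And>a x. a \<in> Bx \<Longrightarrow> x \<in> X1 \<Longrightarrow>
      opr a x - (\<Sum>u\<in>X2. sc (k a x u) u) \<in> V0" by metis
  \<comment> \<open>The matrix of X^a from the layer \<open>X1\<close> to the layer
    \<open>X2\<close> modulo \<open>V0\<close>, stored as a function on index pairs.\<close>
  define w where "w a = (\<Sum>p\<in>X1 \<times> X2. sc (k a (fst p) (snd p)) (bas p))" for a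
  have fin12: "finite (X1 \<times> X2)" by (simp add: X1_def X2_def fin)
  have w_apply: "w a (t, u) = k a t u" if "t \<in> X1" "u \<in> X2" for a t u
  proof -
    have "w a (t, u) = (\<Sum>p\<in>X1 \<times> X2. if p = (t, u) then k a t u else 0)"
      unfolding w_def sum_fun_apply by (rule sum.cong) (auto simp: sc_apply bas_apply)
    then show ?thesis using that fin12 by simp
  qed
  have card_lt: "card (bas ` (X1 \<times> X2) :: (_ \<Rightarrow> 'k) set) < card Bx"
  proof -
    have le: "(l + 1) ^ (n - 1) \<le> (2 * m) ^ (n - 1) * (N + 1) ^ (n - 1)" if "l \<le> 2 * m * N" for l
    proof -
      have "l + 1 \<le> 2 * m * (N + 1)" using that n by (auto simp: m_def)
      then show ?thesis by (metis power_mono power_mult_distrib zero_le)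
    qed
    have "card (bas ` (X1 \<times> X2) :: (_ \<Rightarrow> 'k) set) \<le> card X1 * card X2"
      using card_image_le[OF fin12] by (metis card_cartesian_product)
    also have "\<dots> \<le> (C * ((2 * m) ^ (n - 1) * (N + 1) ^ (n - 1))) * (C * ((2 * m) ^ (n - 1) * (N + 1) ^ (n - 1)))"
    proof (rule mult_le_mono)
      show "card X1 \<le> C * ((2 * m) ^ (n - 1) * (N + 1) ^ (n - 1))"
        unfolding X1_def by (rule order_trans[OF C mult_le_mono2[OF le]]) simp
      show "card X2 \<le> C * ((2 * m) ^ (n - 1) * (N + 1) ^ (n - 1))"
        unfolding X2_def by (rule order_trans[OF C mult_le_mono2[OF le]]) simp
    qed
    also have "\<dots> = (C * (2 * m) ^ (n - 1)) ^ 2 * (N + 1) ^ (2 * (n - 1))"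
      by (simp add: power_mult_distrib power2_eq_square power_mult power_add mult_2 ac_simps)
    also have "\<dots> < (N + 1) ^ 2 * (N + 1) ^ (2 * (n - 1))"
    proof -
      have "(2 * m) ^ (n - 1) \<le> (2 * m) ^ n" using n by (intro power_increasing) (auto simp: m_def)
      then have "C * (2 * m) ^ (n - 1) \<le> C * (2 * m) ^ n" by (rule mult_le_mono2)
      then have "C * (2 * m) ^ (n - 1) < N + 1" unfolding N_def by linarith
      then have "(C * (2 * m) ^ (n - 1)) ^ 2 < (N + 1) ^ 2" by (intro power_strict_mono) auto
      then show ?thesis by (intro mult_strict_right_mono) auto
    qed
    also have "\<dots> = (N + 1) ^ (2 + 2 * (n - 1))" by (simp only: power_add)
    also have "2 + 2 * (n - 1) = m" using n by (simp add: m_def)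
    finally show ?thesis using Bx(2) by simp
  qed
  have "\<exists>s. (\<exists>a\<in>Bx. s a \<noteq> 0) \<and> (\<Sum>a\<in>Bx. sc (s a) (w a)) = 0"
  proof (rule exists_dependency[OF Bx(1) _ _ card_lt])
    show "finite (bas ` (X1 \<times> X2) :: (_ \<Rightarrow> 'k) set)" using fin12 by simp
    show "w a \<in> fs.span (bas ` (X1 \<times> X2))" for a
      unfolding w_def by (intro fs.span_sum fs.span_scale fs.span_base) auto
  qed
  then obtain s a0 where s: "a0 \<in> Bx" "s a0 \<noteq> 0" "(\<Sum>a\<in>Bx. sc (s a) (w a)) = 0" by blast
  \<comment> \<open>The combination of monomials whose matrix vanishes; it maps \<open>X1\<close>,
    and therefore every \<open>opr b v\<close> with b in the box, into \<open>V0\<close>.\<close>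
  define K where "K u = (\<Sum>a\<in>Bx. sc (s a) (opr a u))" for u
  have K_add: "K (u + u') = K u + K u'" and K_sc: "K (sc r u) = sc r (K u)" and K_zero: "K 0 = 0" for u u' r
    by (simp_all add: K_def opr_add opr_sc opr_zero fs.scale_right_distrib sum.distrib sc_sum mult.commute)
  have K_X1: "K t \<in> V0" if t: "t \<in> X1" for t
  proof -
    have "(\<Sum>a\<in>Bx. sc (s a) (\<Sum>u\<in>X2. sc (k a t u) u)) =
        (\<Sum>a\<in>Bx. \<Sum>u\<in>X2. sc (s a * k a t u) u)" by (simp add: sc_sum)
    also have "\<dots> = (\<Sum>u\<in>X2. sc (\<Sum>a\<in>Bx. s a * k a t u) u)"
      by (subst sum.swap) (simp add: fs.scale_sum_left)
    also have "\<dots> = 0"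
    proof (rule sum.neutral, rule ballI)
      fix u assume u: "u \<in> X2"
      have "(\<Sum>a\<in>Bx. s a * k a t u) = (\<Sum>a\<in>Bx. sc (s a) (w a)) (t, u)"
        by (simp add: fun_simps w_apply[OF t u])
      then show "sc (\<Sum>a\<in>Bx. s a * k a t u) u = 0" using s(3) by (simp add: zero_fun_apply)
    qed
    finally have "K t = (\<Sum>a\<in>Bx. sc (s a) (opr a t - (\<Sum>u\<in>X2. sc (k a t u) u)))"
      by (simp add: K_def fs.scale_right_diff_distrib sum_subtractf)
    also have "\<dots> \<in> V0"
      by (intro fs.subspace_sum[OF V0_subspace] fs.subspace_scale[OF V0_subspace] k t)
    finally show ?thesis .
  qed
  have K_V0: "K u \<in> V0" if "u \<in> V0" for u
    unfolding K_def using that Bx_gp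
    by (intro fs.subspace_sum[OF V0_subspace] fs.subspace_scale[OF V0_subspace] V0_opr)
      (auto simp: gp_lat m_def)
  have K_span: "K u \<in> V0" if "u \<in> fs.span (X1 \<union> V0)" for u
    using that
  proof (induction rule: fs.span_induct_alt)
    case base
    show ?case using fs.subspace_0[OF V0_subspace] by (simp add: K_zero)
  next
    case (step r x y)
    then show ?case using K_X1 K_V0
      by (auto simp: K_add K_sc intro!: fs.subspace_add[OF V0_subspace] fs.subspace_scale[OF V0_subspace])
  qed
  have K_box: "K (opr b v) \<in> V0" if b: "b \<in> Bx" for b
  proof (rule K_span)
    have "opr b v \<in> fs.span (opr b ` X 0 \<union> V0)"
      by (rule opr_span[OF _ v]) (use Bx_gp[OF b] in \<open>simp add: m_def gp_lat\<close>)
    moreover have "opr b ` X 0 \<union> V0 \<subseteq> fs.span (X1 \<union> V0)"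
      using X[of _ 0 b "m * N"] Bx_gp[OF b] Bx_deg[OF b]
      by (auto simp: X1_def m_def intro: fs.span_base)
    ultimately show "opr b v \<in> fs.span (X1 \<union> V0)"
      using fs.span_minimal[OF _ fs.subspace_span] by blast
  qed
  show ?thesis
  proof (rule kill_box[where N = N and s = s, OF _ _ _ s(1,2)])
    fix b assume "b \<in> gp {..<2*n}" "\<And>i. i < 2*n \<Longrightarrow> b i \<le> int N"
    then have "b \<in> Bx" by (auto simp: Bx_def gp_def m_def)
    then show "(\<Sum>a\<in>Bx. sc (s a) (opr a (opr b v))) \<in> V0" using K_box unfolding K_def by blast
  next
    show "a \<in> gp {..<2*n} \<and> (\<forall>i<2*n. a i \<le> int N)" if "a \<in> Bx" for a
      using Bx_gp[OF that] that by (simp add: m_def Bx_def)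
  qed (rule Bx(1))
qed

text \<open>Torsion along every n coordinates puts a leading exponent into every n-dimensional
  coordinate cone. By \<open>std_count\<close> the standard monomials then grow at most like N^(n -
  1), and they span the module generated by v modulo \<open>V0\<close>.\<close>

theorem torsion_in_V0:
  assumes n: "n \<ge> 1"
    and tors: "\<And>S. S \<subseteq> {..<2*n} \<Longrightarrow> card S = n \<Longrightarrow>
      \<exists>s. finite (supp s) \<and> supp s \<subseteq> lat S \<and> s \<noteq> 0 \<and> (\<Sum>a\<in>supp s. sc (s a) (opr a v)) \<in> V0"
  shows "v \<in> V0"
proof -
  define m where "m = 2 * n"
  define F where "F = {f\<in>gp {..<m}.
      opr f v \<in> fs.span ((\<lambda>b. opr b v) ` {b\<in>gp {..<m}. ltr m (0, b) (0, f)} \<union> V0)}"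
  define St where "St N = {b \<in> gp {..<m}. deg m b \<le> int N \<and> (\<forall>f\<in>F. \<not> f \<le> b)}" for N
  have finSt: "finite (St N)" for N
    by (rule finite_subset[OF _ finite_gp_deg[of m "int N"]]) (auto simp: St_def)
  have "\<exists>f\<in>F. f \<in> gp S" if S: "S \<subseteq> {..<m}" "card S = Suc (n - 1)" for S
  proof -
    obtain s where s: "finite (supp s)" "supp s \<subseteq> lat S" "s \<noteq> 0" "(\<Sum>a\<in>supp s. sc (s a) (opr a v)) \<in> V0"
      using tors[of S] S n by (auto simp: m_def)
    obtain f where f: "f \<in> gp S"
      "opr f v \<in> fs.span ((\<lambda>b. opr b v) ` {b\<in>gp S. ltr m (0, b) (0, f)} \<union> V0)"
      using leading_relation[OF s(1-3) _ s(4)] S by (auto simp: m_def)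
    have "fs.span ((\<lambda>b. opr b v) ` {b\<in>gp S. ltr m (0, b) (0, f)} \<union> V0) \<subseteq>
      fs.span ((\<lambda>b. opr b v) ` {b\<in>gp {..<m}. ltr m (0, b) (0, f)} \<union> V0)"
      using gp_mono[OF S(1)] by (intro fs.span_mono) auto
    then have "f \<in> F" unfolding F_def using f gp_mono[OF S(1) f(1)] by auto
    then show ?thesis using f by blast
  qed
  from std_count[of m "n - 1" F, OF this] obtain C where C: "\<And>N. card (St N) \<le> C * (N + 1) ^ (n - 1)"
    unfolding St_def by auto
  have St_span: "opr a v \<in> fs.span ((\<lambda>b. opr b v) ` St N \<union> V0)"
    if "a \<in> gp {..<m}" "deg m a \<le> int N" for a N
    unfolding St_def using standard_span[of F v a "int N"] that by (simp add: F_def m_def)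
  show ?thesis
  proof (rule growth_in_V0[OF n])
    show "finite ((\<lambda>b. opr b v) ` St N)" for N by (simp add: finSt)
    show "card ((\<lambda>b. opr b v) ` St N) \<le> C * (N + 1) ^ (n - 1)" for N
      using card_image_le[OF finSt] C order_trans by blast
    show "v \<in> fs.span ((\<lambda>b. opr b v) ` St 0 \<union> V0)"
      using St_span[of 0 0] by (simp add: opr_0 deg_def zero_fun_apply)
    fix N K x a assume "x \<in> (\<lambda>b. opr b v) ` St N" "a \<in> gp {..<2*n}" "deg (2*n) a \<le> int K"
    moreover from this obtain b where b: "b \<in> St N" "x = opr b v" by blast
    ultimately have "opr (a + b) v \<in> fs.span ((\<lambda>b. opr b v) ` St (N + K) \<union> V0)"
      by (intro St_span) (auto simp: St_def m_def deg_add)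
    then show "opr a x \<in> fs.span ((\<lambda>b. opr b v) ` St (N + K) \<union> V0)"
      unfolding b(2) opr_opr by (rule fs.span_scale)
  qed
qed

end

section \<open>Leading exponents\<close>

text \<open>Dickson's lemma by induction on the free coordinates \<open>T\<close>. An element not
  above a fixed u has a coordinate smaller than that of u, so it lies in one of finitely many slices
  with one free coordinate less.\<close>

lemma dickson:
  assumes "finite T" "\<And>a i. a \<in> U \<Longrightarrow> 0 \<le> a i" "\<And>a b i. a \<in> U \<Longrightarrow> b \<in> U \<Longrightarrow> i \<notin> T \<Longrightarrow> a i = b i"
  shows "\<exists>B\<subseteq>U. finite B \<and> (\<forall>u\<in>U. \<exists>b\<in>B. b \<le> (u :: nat \<Rightarrow> int))"
  using assms
proof (induction T arbitrary: U rule: finite_psubset_induct)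
  case (psubset T)
  show ?case
  proof (cases "U = {}")
    case False
    then obtain u where u: "u \<in> U" by blast
    \<comment> \<open>The index set of these slices: a coordinate together with its value below that
      of u.\<close>
    define I where "I = (SIGMA i:T. {0..<u i})"
    define U' where "U' p = {a\<in>U. a (fst p) = snd p}" for p
    have "\<exists>B\<subseteq>U' p. finite B \<and> (\<forall>u\<in>U' p. \<exists>b\<in>B. b \<le> u)" if "p \<in> I" for p
    proof (rule psubset.IH)
      have "fst p \<in> T" using that by (cases p) (simp add: I_def)
      then show "T - {fst p} \<subset> T" by blast
      show "0 \<le> a i" if "a \<in> U' p" for a i using that psubset.prems(1)[of a i] by (simp add: U'_def)
      show "a i = b i" if "a \<in> U' p" "b \<in> U' p" "i \<notin> T - {fst p}" for a b i
        using that psubset.prems(2)[of a b i] by (cases "i = fst p") (simp_all add: U'_def)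
    qed
    then obtain B where B: "\<And>p. p \<in> I \<Longrightarrow> B p \<subseteq> U' p \<and> finite (B p) \<and> (\<forall>u\<in>U' p. \<exists>b\<in>B p. b \<le> u)"
      by metis
    have "finite I" using psubset.hyps by (simp add: I_def)
    show ?thesis
    proof (intro exI[of _ "insert u (\<Union>p\<in>I. B p)"] conjI ballI)
      show "insert u (\<Union>p\<in>I. B p) \<subseteq> U" using u B by (fastforce simp: U'_def)
      show "finite (insert u (\<Union>p\<in>I. B p))" using \<open>finite I\<close> B by blast
      fix a assume a: "a \<in> U"
      show "\<exists>b\<in>insert u (\<Union>p\<in>I. B p). b \<le> a"
      proof (cases "u \<le> a")
        case False
        then obtain i where i: "a i < u i" by (auto simp: le_fun_def not_le)
        then have "i \<in> T" using psubset.prems(2)[OF a u, of i] by auto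
        then have p: "(i, a i) \<in> I" using i psubset.prems(1)[OF a] by (simp add: I_def)
        have "a \<in> U' (i, a i)" using a by (simp add: U'_def)
        then show ?thesis using B[OF p] p by blast
      qed blast
    qed
  qed blast
qed

context qt
begin

definition lead :: "(nat \<times> expo \<Rightarrow> 'k) \<Rightarrow> nat \<times> expo" where
  "lead f = (SOME p. p \<in> supp f \<and> (\<forall>q\<in>supp f. q \<noteq> p \<longrightarrow> ltr m q p))"

lemma lead:
  assumes "finite (supp f)" "f \<noteq> 0"
  shows "lead f \<in> supp f" "q \<in> supp f \<Longrightarrow> q \<noteq> lead f \<Longrightarrow> ltr m q (lead f)"
proof -
  have "supp f \<noteq> {}" using assms(2) by (simp add: supp_eq_empty)
  from ltr_max[OF assms(1) this, of m]
  have "\<exists>p. p \<in> supp f \<and> (\<forall>q\<in>supp f. q \<noteq> p \<longrightarrow> ltr m q p)" by blast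
  then have "lead f \<in> supp f \<and> (\<forall>q\<in>supp f. q \<noteq> lead f \<longrightarrow> ltr m q (lead f))"
    unfolding lead_def by (rule someI_ex)
  then show "lead f \<in> supp f" "q \<in> supp f \<Longrightarrow> q \<noteq> lead f \<Longrightarrow> ltr m q (lead f)" by blast+
qed

lemma lead_eqI:
  assumes "finite (supp f)" "p \<in> supp f" "\<And>q. q \<in> supp f \<Longrightarrow> q \<noteq> p \<Longrightarrow> ltr m q p"
  shows "lead f = p"
proof (rule ccontr)
  assume ne: "lead f \<noteq> p"
  have "f \<noteq> 0" using assms(2) by (auto simp: supp_iff zero_fun_apply)
  then have "ltr m p (lead f)" "ltr m (lead f) p"
    using lead[OF assms(1)] assms ne by blast+
  then show False using ltr_trans ltr_irrefl by blast
qed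

lemma lead_mop:
  assumes "finite (supp f)" "f \<noteq> 0"
  shows "lead (mop a f) = (fst (lead f), a + snd (lead f))"
proof (rule lead_eqI)
  show "finite (supp (mop a f))" using assms by simp
  show "(fst (lead f), a + snd (lead f)) \<in> supp (mop a f)"
    unfolding supp_mop using lead(1)[OF assms] by (rule image_eqI[rotated]) (simp add: case_prod_unfold)
  fix q assume "q \<in> supp (mop a f)" "q \<noteq> (fst (lead f), a + snd (lead f))"
  then obtain p where p: "p \<in> supp f" "q = (fst p, a + snd p)"
    unfolding supp_mop by (metis (no_types, lifting) case_prod_unfold imageE)
  then have "p \<noteq> lead f" using \<open>q \<noteq> _\<close> by auto
  then have "ltr m p (lead f)" using lead(2)[OF assms p(1)] by blast
  then show "ltr m q (fst (lead f), a + snd (lead f))"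
    unfolding p(2) using ltr_shift[of m "fst p" "snd p" "fst (lead f)" "snd (lead f)" a] by simp
qed

definition pos :: "nat set \<Rightarrow> nat \<Rightarrow> (nat \<times> expo \<Rightarrow> 'k) set" where
  "pos T r = {f. finite (supp f) \<and> supp f \<subseteq> {..<r} \<times> gp T}"

lemma pos_mop:
  assumes "f \<in> pos T r" "a \<in> gp T"
  shows "mop a f \<in> pos T r"
  using assms by (auto simp: pos_def supp_mop)

lemma pos_diff_sc: "f \<in> pos T r \<Longrightarrow> g \<in> pos T r \<Longrightarrow> f - sc k g \<in> pos T r"
  using supp_diff[of f "sc k g"] supp_sc[of k g] finite_subset[of "supp (f - sc k g)" "supp f \<union> supp g"]
  by (fastforce simp: pos_def)

lemma shift_pos:
  assumes "f \<in> Fr T {..<r}" "finite T"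
  shows "\<exists>a\<in>gp T. mop a f \<in> pos T r"
proof -
  define M where "M = Max (insert 0 ((\<lambda>(p, i). - snd p i) ` (supp f \<times> T)))"
  have fin: "finite (insert 0 ((\<lambda>(p, i). - snd p i) ` (supp f \<times> T)))"
    using assms by (simp add: Fr_def)
  have M: "- b i \<le> M" if "(x, b) \<in> supp f" "i \<in> T" for x b i
    unfolding M_def using that by (intro Max_ge[OF fin]) force
  have M0: "0 \<le> M" unfolding M_def by (rule Max_ge[OF fin]) simp
  define a :: expo where "a = (\<lambda>i. if i \<in> T then M else 0)"
  have a: "a \<in> gp T" using M0 by (auto simp: a_def gp_def lat_def)
  have "a + b \<in> gp T" if xb: "(x, b) \<in> supp f" for x b
    unfolding gp_def
  proof (intro CollectI conjI allI)
    have b: "b \<in> lat T" using xb assms(1) by (auto simp: Fr_def)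
    then show "a + b \<in> lat T" using a by (simp add: gp_lat)
    show "0 \<le> (a + b) i" for i
      using M[OF xb, of i] b by (cases "i \<in> T") (simp_all add: a_def plus_fun_apply lat_def)
  qed
  then have "mop a f \<in> pos T r"
    using assms(1) by (auto simp: Fr_def pos_def supp_mop)
  then show ?thesis using a by blast
qed

text \<open>Only elements with positive exponents are considered, as \<open>ltr\<close> is
  well-founded only there. By \<open>shift_pos\<close> every element becomes positive after
  multiplication by a monomial, which is a unit.\<close>

definition ini :: "nat set \<Rightarrow> nat \<Rightarrow> (nat \<times> expo \<Rightarrow> 'k) set \<Rightarrow> (nat \<times> expo) set" where
  "ini T r L = lead ` {f\<in>L. f \<in> pos T r \<and> f \<noteq> 0}"

lemma ini_sub: "p \<in> ini T r L \<Longrightarrow> p \<in> {..<r} \<times> gp T"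
  unfolding ini_def using lead(1) by (fastforce simp: pos_def)

lemma ini_mono: "L \<subseteq> L' \<Longrightarrow> ini T r L \<subseteq> ini T r L'"
  unfolding ini_def by blast

lemma mop_nonzero: "f \<noteq> 0 \<Longrightarrow> mop a f \<noteq> 0"
  using supp_mop[of a f] by (metis image_is_empty supp_eq_empty)

lemma ini_shift:
  assumes "submod T L" "(x, a) \<in> ini T r L" "b \<in> gp T"
  shows "(x, b + a) \<in> ini T r L"
proof -
  obtain f where f: "f \<in> L" "f \<in> pos T r" "f \<noteq> 0" "lead f = (x, a)"
    using assms(2) unfolding ini_def by force
  have fin: "finite (supp f)" using f(2) by (simp add: pos_def)
  have "lead (mop b f) = (x, b + a)" using lead_mop[OF fin f(3)] f(4) by simp
  moreover have "mop b f \<in> L" using assms f by (auto intro: submod_mop gp_lat)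
  ultimately show ?thesis
    unfolding ini_def using pos_mop[OF f(2) assms(3)] mop_nonzero[OF f(3)]
    by (intro image_eqI[of _ _ "mop b f"]) auto
qed

lemma lead_cancel:
  assumes "f \<in> pos T r" "f \<noteq> 0" "g \<in> pos T r" "g \<noteq> 0" "lead g = lead f"
    and "h = f - sc (f (lead f) / g (lead f)) g" "h \<noteq> 0"
  shows "h \<in> pos T r" "ltr m (lead h) (lead f)"
proof -
  have fin: "finite (supp f)" "finite (supp g)" using assms by (auto simp: pos_def)
  show h: "h \<in> pos T r" unfolding assms(6) by (rule pos_diff_sc) fact+
  then have finh: "finite (supp h)" by (simp add: pos_def)
  have "g (lead f) \<noteq> 0" using lead(1)[OF fin(2) assms(4)] assms(5) by (simp add: supp_iff)
  then have "h (lead f) = 0" by (simp add: assms(6) sc_apply)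
  then have ne: "lead h \<noteq> lead f" using lead(1)[OF finh assms(7)] by (auto simp: supp_iff)
  have "lead h \<in> supp f \<union> supp g"
    using lead(1)[OF finh assms(7)] supp_diff[of f "sc (f (lead f) / g (lead f)) g"]
      supp_sc[of "f (lead f) / g (lead f)" g] assms(6) by blast
  then show "ltr m (lead h) (lead f)"
    using lead(2)[OF fin(1) assms(2), of "lead h"] lead(2)[OF fin(2) assms(4), of "lead h"] ne assms(5)
    by auto
qed

text \<open>Division with remainder: the leading term of f is cancelled by an element of
  \<open>J\<close> if its exponent occurs there, and by the chosen \<open>h p\<close> otherwise. So
  the leading exponents lost from \<open>L\<close> to \<open>J\<close> measure the growth of
  \<open>L / J\<close>.\<close>

lemma division_span:
  assumes T: "T \<subseteq> {..<m}" and L: "submod T L" and J: "fs.subspace J"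
    and h: "\<And>p. p \<in> ini T r L - ini T r J \<Longrightarrow> h p \<in> L \<and> h p \<in> pos T r \<and> h p \<noteq> 0 \<and> lead (h p) = p"
    and JL: "J \<subseteq> L"
    and f: "f \<in> L" "f \<in> pos T r" "f \<noteq> 0" "deg m (snd (lead f)) \<le> N"
  shows "f \<in> fs.span (h ` {p \<in> ini T r L - ini T r J. deg m (snd p) \<le> N} \<union> J)" (is "_ \<in> ?S")
proof -
  define p where "p = lead f"
  have "p \<in> {..<r} \<times> gp {..<m}"
    unfolding p_def using ini_sub[of "lead f" T r L] f gp_mono[OF T] unfolding ini_def by auto
  then have "\<forall>f'. f' \<in> L \<and> f' \<in> pos T r \<and> f' \<noteq> 0 \<and> deg m (snd (lead f')) \<le> N \<and> lead f' = p \<longrightarrow> f' \<in> ?S"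
  proof (induction p rule: ltr_induct)
    case (less q)
    show ?case
    proof (intro allI impI)
      fix f assume f: "f \<in> L \<and> f \<in> pos T r \<and> f \<noteq> 0 \<and> deg m (snd (lead f)) \<le> N \<and> lead f = q"
      have "\<exists>g. g \<in> L \<and> g \<in> ?S \<and> g \<in> pos T r \<and> g \<noteq> 0 \<and> lead g = q"
      proof (cases "q \<in> ini T r J")
        case True
        then obtain g where "g \<in> J" "g \<in> pos T r" "g \<noteq> 0" "lead g = q" unfolding ini_def by auto
        then show ?thesis using JL fs.span_base by blast
      next
        case False
        moreover have "q \<in> ini T r L" using f unfolding ini_def by blast
        ultimately have "h q \<in> ?S" using f by (intro fs.span_base) auto
        then show ?thesis using h[of q] False \<open>q \<in> ini T r L\<close> by blast
      qed
      then obtain g where g: "g \<in> L" "g \<in> ?S" "g \<in> pos T r" "g \<noteq> 0" "lead g = q" by blast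
      define h' where "h' = f - sc (f (lead f) / g (lead f)) g"
      have "h' \<in> ?S"
      proof (cases "h' = 0")
        case False
        have 1: "h' \<in> pos T r" "ltr m (lead h') (lead f)"
          using lead_cancel[of f T r g h'] f g False h'_def by auto
        have 2: "h' \<in> L" unfolding h'_def using f g L by (auto intro: submod_diff submod_sc)
        have 3: "lead h' \<in> {..<r} \<times> gp {..<m}"
          using ini_sub[of "lead h'" T r L] 1 2 False gp_mono[OF T] unfolding ini_def by auto
        have 4: "deg m (snd (lead h')) \<le> N" using ltr_deg[OF 1(2)] f by linarith
        show ?thesis using less.IH[OF 3] 1 2 4 False f by blast
      qed (simp add: fs.span_zero)
      then have "h' + sc (f (lead f) / g (lead f)) g \<in> ?S" by (rule fs.span_add[OF _ fs.span_scale[OF g(2)]])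
      then show "f \<in> ?S" by (simp add: h'_def)
    qed
  qed
  then show ?thesis using f p_def by blast
qed

lemma ini_eqD:
  assumes T: "T \<subseteq> {..<m}" and L: "submod T L" "L \<subseteq> Fr T {..<r}" and L': "submod T L'" "L' \<subseteq> L"
    and ini: "ini T r L \<subseteq> ini T r L'"
  shows "L = L'"
proof
  show "L \<subseteq> L'"
  proof
    fix f assume f: "f \<in> L"
    obtain a where a: "a \<in> gp T" "mop a f \<in> pos T r"
      using shift_pos[of f T r] f L(2) T finite_subset[of T] by auto
    have "mop a f \<in> L'"
    proof (cases "mop a f = 0")
      case False
      \<comment> \<open>No exponent of \<open>L\<close> is missing from \<open>L'\<close>, so the
        division uses elements of \<open>L'\<close> alone.\<close>
      have "mop a f \<in> fs.span ({} \<union> L')"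
        using division_span[OF T L(1) submod_subspace[OF L'(1)], of r "\<lambda>_. 0" "mop a f" "deg m (snd (lead (mop a f)))"]
          submod_mop[OF L(1) gp_lat[OF a(1)] f] ini a(2) False L'(2) by (auto simp: Diff_eq_empty_iff[THEN iffD2])
      then show ?thesis using fs.span_eq_iff[THEN iffD2, OF submod_subspace[OF L'(1)]] by auto
    qed (use submod_zero[OF L'(1)] in simp)
    then have "mop (- a) (mop a f) \<in> L'" by (rule submod_mop[OF L'(1) lat_minus[OF gp_lat[OF a(1)]]])
    then have "sc (inverse (bc (- a) a)) (mop (- a) (mop a f)) \<in> L'" by (rule submod_sc[OF L'(1)])
    then show "f \<in> L'" by (simp add: mop_inverse)
  qed
qed fact

text \<open>Hilbert's basis theorem through leading exponents: Dickson's lemma gives finitely many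
  minimal ones in each position, and elements realizing them generate a submodule with the same
  leading exponents.\<close>

lemma noetherian:
  fixes L :: "(nat \<times> expo \<Rightarrow> 'k) set"
  assumes T: "T \<subseteq> {..<m}" and L: "submod T L" "L \<subseteq> Fr T {..<r}"
  shows "\<exists>s g. (\<forall>y<s. g y \<in> L) \<and> fext g ` Fr T {..<s::nat} = L"
proof -
  have "\<exists>B\<subseteq>{a. (x, a) \<in> ini T r L}. finite B \<and> (\<forall>u\<in>{a. (x, a) \<in> ini T r L}. \<exists>b\<in>B. b \<le> u)" for x
  proof (rule dickson[of T])
    show "finite T" using T finite_subset by blast
    show "0 \<le> a i" if "a \<in> {a. (x, a) \<in> ini T r L}" for a i
      using ini_sub[of "(x, a)" T r L] that by (auto simp: gp_def)
    show "a i = b i" if "a \<in> {a. (x, a) \<in> ini T r L}" "b \<in> {a. (x, a) \<in> ini T r L}" "i \<notin> T" for a b i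
      using ini_sub[of "(x, a)" T r L] ini_sub[of "(x, b)" T r L] that by (auto simp: gp_def lat_def)
  qed
  then obtain B where B: "\<And>x. B x \<subseteq> {a. (x, a) \<in> ini T r L}" "\<And>x. finite (B x)"
    "\<And>x a. (x, a) \<in> ini T r L \<Longrightarrow> \<exists>b\<in>B x. b \<le> a" by (metis mem_Collect_eq)
  define B' where "B' = Sigma {..<r} B"
  have "finite B'" using B(2) by (simp add: B'_def)
  then obtain e where e: "bij_betw e {0..<card B'} B'" using ex_bij_betw_nat_finite by blast
  have "\<exists>f. f \<in> L \<and> f \<in> pos T r \<and> f \<noteq> 0 \<and> lead f = p" if "p \<in> B'" for p
    using that B(1) unfolding B'_def ini_def by fastforce
  then obtain f where f: "\<And>p. p \<in> B' \<Longrightarrow> f p \<in> L \<and> f p \<in> pos T r \<and> f p \<noteq> 0 \<and> lead (f p) = p" by metis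
  define s where "s = card B'"
  define g where "g y = f (e y)" for y
  have gL: "g y \<in> L" if "y < s" for y
    using f[of "e y"] bij_betwE[OF e] that by (simp add: g_def s_def)
  have sub: "submod T (Fr T {..<s} :: (nat \<times> expo \<Rightarrow> 'k) set)" by (simp add: submod_Fr)
  let ?L' = "fext g ` Fr T {..<s}"
  have L': "submod T ?L'" by (rule lin_image_submod[OF lin_fext sub])
  have L'L: "?L' \<subseteq> L" using fext_in[OF L(1)] gL by blast
  have "ini T r L \<subseteq> ini T r ?L'"
  proof
    fix p assume p: "p \<in> ini T r L"
    obtain x a where xa: "p = (x, a)" by (cases p)
    obtain b where b: "b \<in> B x" "b \<le> a" using B(3) p xa by blast
    have x: "x < r" "a \<in> gp T" using ini_sub[OF p] xa by auto
    have bB: "(x, b) \<in> B'" using b x by (simp add: B'_def)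
    have bg: "b \<in> gp T" using B(1) b ini_sub[of "(x, b)" T r L] by auto
    obtain y where y: "y < s" "e y = (x, b)"
      using e bB unfolding bij_betw_def s_def by (metis atLeastLessThan_iff imageE)
    have gy: "g y = f (x, b)" by (simp add: g_def y)
    have "g y \<in> ?L'"
      by (rule image_eqI[of _ _ "bas (y, 0)"]) (use y in \<open>simp_all add: fext_bas\<close>)
    then have "(x, b) \<in> ini T r ?L'"
      using f[OF bB] unfolding ini_def gy[symmetric] by (intro image_eqI[of _ _ "g y"]) auto
    then have "(x, (a - b) + b) \<in> ini T r ?L'"
      using b(2) x(2) bg by (intro ini_shift[OF L'] gp_diff) (auto simp: gp_lat)
    then show "p \<in> ini T r ?L'" by (simp add: xa)
  qed
  then have "L = ?L'" by (rule ini_eqD[OF T L L' L'L])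
  then show ?thesis using gL by blast
qed

end

section \<open>Deviation\<close>

lemma dev_less_subset: "dev_less d L \<Longrightarrow> L' \<subseteq> L \<Longrightarrow> dev_less d L'"
proof (induction d arbitrary: L L')
  case (Suc d)
  show ?case unfolding dev_less.simps
  proof (intro allI impI)
    fix a :: "nat \<Rightarrow> 'a" assume "range a \<subseteq> L' \<and> decseq a"
    then have "\<forall>\<^sub>F i in sequentially. dev_less d (L \<inter> {a (Suc i)..a i})"
      using Suc.prems by auto
    then show "\<forall>\<^sub>F i in sequentially. dev_less d (L' \<inter> {a (Suc i)..a i})"
    proof eventually_elim
      case (elim i)
      show ?case by (rule Suc.IH[OF elim]) (use Suc.prems(2) in blast)
    qed
  qed
qed auto

lemma dev_less_Suc: "dev_less d L \<Longrightarrow> dev_less (Suc d) L"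
proof (induction d arbitrary: L)
  case 0
  then show ?case by (auto intro!: always_eventually)
next
  case (Suc d)
  show ?case unfolding dev_less.simps(2)[of "Suc d"]
  proof (intro allI impI)
    fix a :: "nat \<Rightarrow> 'a" assume "range a \<subseteq> L \<and> decseq a"
    then have "\<forall>\<^sub>F i in sequentially. dev_less d (L \<inter> {a (Suc i)..a i})"
      using Suc.prems by auto
    then show "\<forall>\<^sub>F i in sequentially. dev_less (Suc d) (L \<inter> {a (Suc i)..a i})"
      by eventually_elim (rule Suc.IH)
  qed
qed

lemma dev_less_mono: "dev_less d L \<Longrightarrow> d \<le> e \<Longrightarrow> dev_less e L"
  by (induction e) (auto simp: le_Suc_eq simp del: dev_less.simps(2) intro: dev_less_Suc)

text \<open>A strictly increasing map carries chains to chains and intervals into intervals; it may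
  identify incomparable elements.\<close>

lemma dev_less_embed:
  assumes "dev_less d L" "f ` M \<subseteq> L"
    and "\<And>x y. x \<in> M \<Longrightarrow> y \<in> M \<Longrightarrow> x < y \<Longrightarrow> f x < f y"
  shows "dev_less d M"
  using assms
proof (induction d arbitrary: L M)
  case 0
  then show ?case by auto blast
next
  case (Suc d)
  have mono: "f x \<le> f y" if "x \<in> M" "y \<in> M" "x \<le> y" for x y
    using Suc.prems(3)[OF that(1,2)] that(3) by (auto simp: le_less)
  show ?case unfolding dev_less.simps
  proof (intro allI impI)
    fix a :: "nat \<Rightarrow> _" assume a: "range a \<subseteq> M \<and> decseq a"
    then have aM: "a i \<in> M" for i by auto
    have "decseq (\<lambda>i. f (a i))"
      using a aM mono by (auto simp: decseq_def)
    moreover have "range (\<lambda>i. f (a i)) \<subseteq> L" using aM Suc.prems(2) by auto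
    ultimately have "\<forall>\<^sub>F i in sequentially. dev_less d (L \<inter> {f (a (Suc i))..f (a i)})"
      using Suc.prems(1)[unfolded dev_less.simps, rule_format, of "\<lambda>i. f (a i)"] by blast
    then show "\<forall>\<^sub>F i in sequentially. dev_less d (M \<inter> {a (Suc i)..a i})"
    proof eventually_elim
      case (elim i)
      show ?case
        by (rule Suc.IH[OF elim]) (use aM mono Suc.prems in auto)
    qed
  qed
qed

lemma deviation_eq:
  assumes "dev_less (Suc n) L" "\<not> dev_less n L"
  shows "deviation L = ereal (real n)"
proof -
  have eq: "{d. dev_less (Suc d) L} = {n..}"
  proof (rule Set.set_eqI, rule iffI)
    fix d assume d: "d \<in> {d. dev_less (Suc d) L}"
    show "d \<in> {n..}"
    proof (rule ccontr)
      assume "d \<notin> {n..}"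
      then show False using dev_less_mono[of "Suc d" L n] d assms(2) by auto
    qed
  next
    fix d assume "d \<in> {n..}"
    then show "d \<in> {d. dev_less (Suc d) L}" using dev_less_mono[OF assms(1), of "Suc d"] by auto
  qed
  have "\<not> dev_less 0 L" using dev_less_mono[of 0 L n] assms(2) by auto
  then have "deviation L = (INF d\<in>{n..}. ereal (real d))" by (simp add: deviation_def eq del: dev_less.simps)
  also have "\<dots> = ereal (real n)" by (rule antisym) (auto intro: INF_lower INF_greatest)
  finally show ?thesis .
qed

section \<open>Growth of differences of leading exponents\<close>

text \<open>No translate of a k-dimensional coordinate cone, called a flat below, is contained in
  \<open>D\<close>. For a difference of two sets closed under adding positive exponents this
  measures polynomial growth.\<close>

definition thin :: "nat \<Rightarrow> nat \<Rightarrow> expo set \<Rightarrow> bool" where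
  "thin m k D \<longleftrightarrow> (\<forall>S b. S \<subseteq> {..<m} \<and> card S = k \<longrightarrow> \<not> (\<forall>a\<in>gp S. b + a \<in> D))"

lemma thin_subset: "thin m k D \<Longrightarrow> D' \<subseteq> D \<Longrightarrow> thin m k D'"
  unfolding thin_def by blast

text \<open>By Dickson's lemma \<open>U\<close> is a finite union of cones \<open>b + gp\<close>.
  Inside each cone the absence of flats of dimension k + 1 says that \<open>U'\<close> meets every
  coordinate cone of that dimension, which is the hypothesis of \<open>std_count\<close>.\<close>

lemma thin_count:
  assumes U: "U \<subseteq> gp {..<m}"
    and U': "\<And>u a. u \<in> U' \<Longrightarrow> a \<in> gp {..<m} \<Longrightarrow> u + a \<in> U'"
    and U_up: "\<And>u a. u \<in> U \<Longrightarrow> a \<in> gp {..<m} \<Longrightarrow> u + a \<in> U"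
    and thin: "thin m (Suc k) (U - U')"
  shows "\<exists>C. \<forall>N. card {a\<in>U - U'. deg m a \<le> int N} \<le> C * (N + 1) ^ k"
proof -
  obtain B where B: "B \<subseteq> U" "finite B" "\<And>u. u \<in> U \<Longrightarrow> \<exists>b\<in>B. b \<le> u"
  proof -
    have "\<exists>B\<subseteq>U. finite B \<and> (\<forall>u\<in>U. \<exists>b\<in>B. b \<le> u)"
    proof (rule dickson[of "{..<m}"])
      show "0 \<le> a i" if "a \<in> U" for a i using that U by (auto simp: gp_def)
      show "a i = b i" if "a \<in> U" "b \<in> U" "i \<notin> {..<m}" for a b i
        using subsetD[OF U that(1)] subsetD[OF U that(2)] that(3) by (simp add: gp_def lat_def)
    qed simp
    then show ?thesis using that by blast
  qed
  define F where "F b = {f\<in>gp {..<m}. b + f \<in> U'}" for b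
  define A where "A b N = {a \<in> gp {..<m}. deg m a \<le> int N \<and> (\<forall>f\<in>F b. \<not> f \<le> a)}" for b N
  have "\<exists>C. \<forall>N. card (A b N) \<le> C * (N + 1) ^ k" if b: "b \<in> B" for b
    unfolding A_def
  proof (rule std_count)
    fix S assume S: "S \<subseteq> {..<m}" "card S = Suc k"
    then obtain a where a: "a \<in> gp S" "b + a \<notin> U - U'" using thin unfolding thin_def by blast
    have "a \<in> gp {..<m}" by (rule gp_mono[OF S(1) a(1)])
    then have "b + a \<in> U" using U_up b B(1) by blast
    then show "\<exists>f\<in>F b. f \<in> gp S" using a \<open>a \<in> gp {..<m}\<close> by (auto simp: F_def)
  qed
  then obtain C where C: "\<And>b N. b \<in> B \<Longrightarrow> card (A b N) \<le> C b * (N + 1) ^ k" by metis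
  have finA: "finite (A b N)" for b N
    by (rule finite_subset[OF _ finite_gp_deg[of m "int N"]]) (auto simp: A_def)
  have "card {a\<in>U - U'. deg m a \<le> int N} \<le> (\<Sum>b\<in>B. C b) * (N + 1) ^ k" for N
  proof -
    have "{a\<in>U - U'. deg m a \<le> int N} \<subseteq> (\<Union>b\<in>B. (\<lambda>a. b + a) ` A b N)"
    proof
      fix u assume u: "u \<in> {a\<in>U - U'. deg m a \<le> int N}"
      then obtain b where b: "b \<in> B" "b \<le> u" using B(3) by blast
      have bg: "b \<in> gp {..<m}" using b B U by blast
      have ub: "u - b \<in> gp {..<m}" using gp_diff[of u _ b] u U b bg by (auto simp: gp_lat)
      have "deg m (u - b) \<le> int N" using u deg_nonneg[OF bg, of m] by (simp add: deg_diff)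
      moreover have "\<not> f \<le> u - b" if f: "f \<in> F b" for f
      proof
        assume le: "f \<le> u - b"
        have "u - b - f \<in> gp {..<m}" using gp_diff[OF ub _ le] f by (simp add: F_def gp_lat)
        then have "(b + f) + (u - b - f) \<in> U'" using f by (intro U'[of "b + f"]) (simp_all add: F_def)
        then show False using u by simp
      qed
      ultimately have "u - b \<in> A b N" using ub by (simp add: A_def)
      then show "u \<in> (\<Union>b\<in>B. (\<lambda>a. b + a) ` A b N)" using b(1) by force
    qed
    then have "card {a\<in>U - U'. deg m a \<le> int N} \<le> card (\<Union>b\<in>B. (\<lambda>a. b + a) ` A b N)"
      by (rule card_mono[rotated]) (use B(2) finA in blast)
    also have "\<dots> \<le> (\<Sum>b\<in>B. card ((\<lambda>a. b + a) ` A b N))" by (rule card_UN_le[OF B(2)])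
    also have "\<dots> \<le> (\<Sum>b\<in>B. C b * (N + 1) ^ k)"
      by (rule sum_mono) (use C card_image_le[OF finA] order_trans in blast)
    finally show ?thesis by (simp add: sum_distrib_right)
  qed
  then show ?thesis by blast
qed

lemma card_box_deg:
  assumes "S \<subseteq> {..<m}"
  shows "finite {a\<in>gp S. \<forall>i. a i \<le> int N}" "card {a\<in>gp S. \<forall>i. a i \<le> int N} = (N + 1) ^ card S"
    "a \<in> gp S \<Longrightarrow> \<forall>i. a i \<le> int N \<Longrightarrow> deg m a \<le> int (card S * N)"
proof -
  let ?B = "\<lambda>i. if i \<in> S then {0..int N} else {0}"
  have eq: "{a\<in>gp S. \<forall>i. a i \<le> int N} = {a \<in> lat {..<m}. \<forall>i<m. a i \<in> ?B i}"
  proof (rule Set.set_eqI, rule iffI)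
    fix a assume "a \<in> {a\<in>gp S. \<forall>i. a i \<le> int N}"
    then show "a \<in> {a \<in> lat {..<m}. \<forall>i<m. a i \<in> ?B i}"
      using lat_mono[OF assms] by (auto simp: gp_def lat_def)
  next
    fix a assume a: "a \<in> {a \<in> lat {..<m}. \<forall>i<m. a i \<in> ?B i}"
    have *: "(i \<notin> S \<longrightarrow> a i = 0) \<and> 0 \<le> a i \<and> a i \<le> int N" for i
    proof (cases "i < m")
      case True
      then have "a i \<in> ?B i" using a by blast
      then show ?thesis by (auto split: if_splits)
    next
      case False
      then have "a i = 0" using a by (auto simp: lat_def)
      then show ?thesis by simp
    qed
    then show "a \<in> {a\<in>gp S. \<forall>i. a i \<le> int N}" by (simp add: gp_def lat_def)
  qed
  show "finite {a\<in>gp S. \<forall>i. a i \<le> int N}" unfolding eq by (rule card_bounded_funs(1)) simp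
  have "card {a \<in> lat {..<m}. \<forall>i<m. a i \<in> ?B i} = (\<Prod>i<m. card (?B i))"
    by (rule card_bounded_funs(2)) simp
  also have "\<dots> = (\<Prod>i<m. if i \<in> S then N + 1 else 1)" by (rule prod.cong) (auto simp: nat_add_distrib)
  also have "\<dots> = (\<Prod>i\<in>{..<m} \<inter> S. N + 1)" by (rule prod.inter_restrict[symmetric]) simp
  also have "\<dots> = (N + 1) ^ card S" using assms by (simp add: Int_absorb1)
  finally show "card {a\<in>gp S. \<forall>i. a i \<le> int N} = (N + 1) ^ card S" unfolding eq .
  assume a: "a \<in> gp S" "\<forall>i. a i \<le> int N"
  have "deg m a = (\<Sum>i\<in>S. a i)"
    unfolding deg_def by (rule sum.mono_neutral_right) (use assms a in \<open>auto simp: gp_def lat_def\<close>)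
  also have "\<dots> \<le> (\<Sum>i\<in>S. int N)" by (rule sum_mono) (use a in simp)
  finally show "deg m a \<le> int (card S * N)" by simp
qed

text \<open>Only finitely many disjoint \<open>k\<close>-dimensional flats fit into a set of growth at most \<open>N ^ k\<close>.\<close>

lemma flats_bounded:
  assumes count: "\<And>N. card {a\<in>D. deg m a \<le> int N} \<le> C * (N + 1) ^ k" and D: "D \<subseteq> gp {..<m}"
    and I: "finite I" "\<And>i. i \<in> I \<Longrightarrow> E i \<subseteq> D" "\<And>i j. i \<in> I \<Longrightarrow> j \<in> I \<Longrightarrow> i \<noteq> j \<Longrightarrow> E i \<inter> E j = {}"
    and flat: "\<And>i. i \<in> I \<Longrightarrow> \<not> thin m k (E i)"
  shows "card I \<le> C * (k + 1) ^ k"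
proof -
  have "\<forall>i\<in>I. \<exists>S b. S \<subseteq> {..<m} \<and> card S = k \<and> (\<forall>a\<in>gp S. b + a \<in> E i)"
    using flat unfolding thin_def by blast
  then obtain S b where S: "\<And>i. i \<in> I \<Longrightarrow> S i \<subseteq> {..<m} \<and> card (S i) = k \<and> (\<forall>a\<in>gp (S i). b i + a \<in> E i)"
    by metis
  \<comment> \<open>\<open>N\<close> dominates the degrees of all base points, so each flat
    contributes (N + 1)^k points of degree at most (k + 1) N.\<close>
  define N where "N = (\<Sum>i\<in>I. nat (deg m (b i)))"
  have N: "deg m (b i) \<le> int N" if "i \<in> I" for i
  proof -
    have "nat (deg m (b i)) \<le> N" unfolding N_def using I(1) that by (intro member_le_sum) auto
    then show ?thesis by linarith
  qed
  define P where "P i = (\<lambda>a. b i + a) ` {a\<in>gp (S i). \<forall>j. a j \<le> int N}" for i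
  have P: "finite (P i)" "card (P i) = (N + 1) ^ k" "P i \<subseteq> E i" "\<And>a. a \<in> P i \<Longrightarrow> deg m a \<le> int (k * N + N)"
    if i: "i \<in> I" for i
  proof -
    note box = card_box_deg(1,2)[OF conjunct1[OF S[OF i]], of N]
      card_box_deg(3)[OF conjunct1[OF S[OF i]], where N = N]
    show "finite (P i)" unfolding P_def using box(1) by simp
    show "card (P i) = (N + 1) ^ k" unfolding P_def using box(2) S[OF i] by (subst card_image) auto
    show "P i \<subseteq> E i" unfolding P_def using S[OF i] by blast
    show "deg m a \<le> int (k * N + N)" if "a \<in> P i" for a
      using that box(3) N[OF i] S[OF i] by (force simp: P_def deg_add)
  qed
  have fin: "finite {a\<in>D. deg m a \<le> int (k * N + N)}"
    by (rule finite_subset[OF _ finite_gp_deg[of m "int (k * N + N)"]]) (use D in auto)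
  have "card I * (N + 1) ^ k = (\<Sum>i\<in>I. card (P i))" by (simp add: P(2))
  also have "\<dots> = card (\<Union>i\<in>I. P i)"
  proof (rule card_UN_disjoint[symmetric])
    show "\<forall>i\<in>I. \<forall>j\<in>I. i \<noteq> j \<longrightarrow> P i \<inter> P j = {}"
      using P(3) I(3) by (meson disjoint_iff subsetD)
  qed (use P(1) I(1) in simp_all)
  also have "\<dots> \<le> card {a\<in>D. deg m a \<le> int (k * N + N)}"
  proof (rule card_mono[OF fin], rule UN_least)
    fix i assume i: "i \<in> I"
    show "P i \<subseteq> {a\<in>D. deg m a \<le> int (k * N + N)}" using P(3,4)[OF i] I(2)[OF i] by blast
  qed
  also have "\<dots> \<le> C * ((k * N + N) + 1) ^ k" by (rule count)
  also have "\<dots> \<le> C * ((k + 1) * (N + 1)) ^ k"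
    by (intro mult_le_mono2 power_mono) auto
  also have "\<dots> = (C * (k + 1) ^ k) * (N + 1) ^ k" by (simp only: power_mult_distrib ac_simps)
  finally show ?thesis by simp
qed

section \<open>Upper bound for the Krull dimension\<close>

context qt
begin

definition lideals :: "(nat \<times> expo \<Rightarrow> 'k) set set" where
  "lideals = {L. submod {..<m} L \<and> L \<subseteq> Fr {..<m} {..<1}}"

text \<open>The leading exponents lost from \<open>I\<close> to \<open>J\<close>; their growth is
  that of the module \<open>I / J\<close>.\<close>

definition gap :: "(nat \<times> expo \<Rightarrow> 'k) set \<Rightarrow> (nat \<times> expo \<Rightarrow> 'k) set \<Rightarrow> expo set" where
  "gap J I = {a. (0, a) \<in> ini {..<m} 1 I - ini {..<m} 1 J}"

lemma gap_mono: "J \<subseteq> J' \<Longrightarrow> I' \<subseteq> I \<Longrightarrow> gap J' I' \<subseteq> gap J I"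
  unfolding gap_def using ini_mono by blast

lemma gap_count:
  assumes "I \<in> lideals" "J \<in> lideals" "thin m (Suc k) (gap J I)"
  shows "\<exists>C. \<forall>N. card {a\<in>gap J I. deg m a \<le> int N} \<le> C * (N + 1) ^ k"
proof -
  have eq: "gap J I = {a. (0, a) \<in> ini {..<m} 1 I} - {a. (0, a) \<in> ini {..<m} 1 J}"
    by (auto simp: gap_def)
  have up: "u + a \<in> {a. (0, a) \<in> ini {..<m} 1 L}"
    if "L \<in> lideals" "u \<in> {a. (0, a) \<in> ini {..<m} 1 L}" "a \<in> gp {..<m}" for L u a
    using ini_shift[of "{..<m}" L 0 u 1 a] that by (simp add: lideals_def add.commute)
  show ?thesis unfolding eq
  proof (rule thin_count)
    show "{a. (0, a) \<in> ini {..<m} 1 I} \<subseteq> gp {..<m}" using ini_sub by blast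
  qed (use up assms eq in auto)
qed

text \<open>The gaps of consecutive chain members are disjoint subsets of \<open>gap J I\<close>,
  which grows at most like N^k. Only boundedly many of them can contain a k-dimensional
  flat.\<close>

lemma gap_chain:
  assumes I: "I \<in> lideals" and J: "J \<in> lideals" and th: "thin m (Suc k) (gap J I)"
    and a: "range a \<subseteq> lideals \<inter> {J..I}" "decseq a"
  shows "\<forall>\<^sub>F i in sequentially. thin m k (gap (a (Suc i)) (a i))"
proof (rule ccontr)
  assume "\<not> ?thesis"
  then have "infinite {i. \<not> thin m k (gap (a (Suc i)) (a i))}" (is "infinite ?X")
    by (simp add: not_eventually frequently_cofinite flip: cofinite_eq_sequentially)
  obtain C where C: "\<And>N. card {a\<in>gap J I. deg m a \<le> int N} \<le> C * (N + 1) ^ k"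
    using gap_count[OF I J th] by blast
  obtain X where X: "X \<subseteq> ?X" "finite X" "card X = Suc (C * (k + 1) ^ k)"
    using infinite_arbitrarily_large[OF \<open>infinite ?X\<close>] by blast
  have mono: "a j \<subseteq> a i" if "i \<le> j" for i j using a(2) that by (auto simp: decseq_def)
  have aJI: "J \<subseteq> a i" "a i \<subseteq> I" for i using a(1) by (auto simp: image_subset_iff)
  have "card X \<le> C * (k + 1) ^ k"
  proof (rule flats_bounded[OF C])
    show "gap J I \<subseteq> gp {..<m}" unfolding gap_def using ini_sub by blast
    show "gap (a (Suc i)) (a i) \<subseteq> gap J I" for i by (rule gap_mono) (use aJI in auto)
    have disj: "gap (a (Suc i)) (a i) \<inter> gap (a (Suc j)) (a j) = {}" if "i < j" for i j
      using ini_mono[OF mono[of "Suc i" j], of "{..<m}" 1] that by (auto simp: gap_def)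
    show "gap (a (Suc i)) (a i) \<inter> gap (a (Suc j)) (a j) = {}" if "i \<noteq> j" for i j
      using disj[of i j] disj[of j i] that by (metis Int_commute linorder_neqE_nat)
    show "\<not> thin m k (gap (a (Suc i)) (a i))" if "i \<in> X" for i using X(1) that by blast
  qed fact
  then show False using X(3) by simp
qed

end

locale sqt = qt "2 * n" c for n :: nat and c :: "nat \<Rightarrow> nat \<Rightarrow> 'k::field" +
  assumes n_pos: "n \<ge> 1"
    and c_sym: "\<And>i j. j < n \<Longrightarrow> i < 2 * n \<Longrightarrow> i \<noteq> n + j \<Longrightarrow> c i j = c j i"
    and c_generic: "\<And>j e. j < n \<Longrightarrow> 0 < e \<Longrightarrow> (c (n + j) j / c j (n + j)) ^ e \<noteq> 1"
begin

lemma symplectic_mop: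
  assumes "submod {..<2*n} V0"
  shows "symplectic_rep n c mop (V0 :: ('x \<times> expo \<Rightarrow> 'k) set)"
proof unfold_locales
  show "c i j = c j i" if "j < n" "i < 2 * n" "i \<noteq> n + j" for i j by (rule c_sym[OF that])
  show "fs.subspace V0" by (rule submod_subspace[OF assms])
  show "mop a u \<in> V0" if "a \<in> lat {..<2*n}" "u \<in> V0" for a u by (rule submod_mop[OF assms that])
qed (simp_all add: c_nonzero mop_add mop_sc mop_mop c_generic)

text \<open>Transposing \<open>c\<close> turns the commutation factors into their inverses, which
  are again of infinite order.\<close>

lemma symplectic_rop:
  assumes "fs.subspace V0" "\<And>a u. a \<in> lat {..<2*n} \<Longrightarrow> u \<in> V0 \<Longrightarrow> rop a u \<in> V0"
  shows "symplectic_rep n (\<lambda>i j. c j i) rop (V0 :: ('x \<times> expo \<Rightarrow> 'k) set)"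
proof unfold_locales
  show "(c j (n + j) / c (n + j) j) ^ e \<noteq> 1" if je: "j < n" "0 < e" for j e
  proof -
    have "(c j (n + j) / c (n + j) j) ^ e = inverse ((c (n + j) j / c j (n + j)) ^ e)"
      by (simp flip: power_inverse)
    then show ?thesis using c_generic[OF je] by simp
  qed
  show "c j i = c i j" if "j < n" "i < 2 * n" "i \<noteq> n + j" for i j by (rule c_sym[OF that, symmetric])
  show "fs.subspace V0" by (rule assms(1))
  show "rop a u \<in> V0" if "a \<in> lat {..<2*n}" "u \<in> V0" for a u by (rule assms(2)[OF that])
qed (simp_all add: c_nonzero rop_add rop_sc rop_rop bich_transpose[of _ c])

text \<open>Without n-dimensional flats in the gap, \<open>I / J\<close> grows at most like N^(n -
  1), and Bernstein's inequality forces it to be zero.\<close>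

lemma thin_gap_eq:
  assumes I: "I \<in> lideals" and J: "J \<in> lideals" and JI: "J \<subseteq> I" and th: "thin (2*n) n (gap J I)"
  shows "I \<subseteq> J"
proof
  fix v0 assume v0: "v0 \<in> I"
  let ?M = "{..<2*n}"
  have sI: "submod ?M I" "I \<subseteq> Fr ?M {..<1}" and sJ: "submod ?M J" using I J by (auto simp: lideals_def)
  obtain a where a: "a \<in> gp ?M" "mop a v0 \<in> pos ?M 1"
    using shift_pos[of v0 ?M 1] v0 sI(2) by auto
  define v where "v = mop a v0"
  have vI: "v \<in> I" "v \<in> pos ?M 1" unfolding v_def using a v0 sI(1) by (auto intro: submod_mop gp_lat)
  interpret symplectic_rep n c mop J by (rule symplectic_mop[OF sJ])
  obtain C where C: "\<And>N. card {a\<in>gap J I. deg (2*n) a \<le> int N} \<le> C * (N + 1) ^ (n - 1)"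
    using gap_count[OF I J, of "n - 1"] th n_pos by auto
  define h where "h p = (SOME f. f \<in> I \<and> f \<in> pos ?M 1 \<and> f \<noteq> 0 \<and> lead f = p)" for p
  have h: "h p \<in> I \<and> h p \<in> pos ?M 1 \<and> h p \<noteq> 0 \<and> lead (h p) = p" if "p \<in> ini ?M 1 I - ini ?M 1 J" for p
  proof -
    have "\<exists>f. f \<in> I \<and> f \<in> pos ?M 1 \<and> f \<noteq> 0 \<and> lead f = p" using that unfolding ini_def by auto
    then show ?thesis unfolding h_def by (rule someI_ex)
  qed
  \<comment> \<open>The filtration starts at degree e instead of 0, so that v lies in its first
    layer.\<close>
  define e where "e = nat (deg (2*n) (snd (lead v)))"
  define X where "X N = h ` {p \<in> ini ?M 1 I - ini ?M 1 J. deg (2*n) (snd p) \<le> int (N + e)}" for N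
  have index: "{p \<in> ini ?M 1 I - ini ?M 1 J. deg (2*n) (snd p) \<le> int N} = Pair 0 ` {a\<in>gap J I. deg (2*n) a \<le> int N}" for N
    using ini_sub[of _ ?M 1 I] by (force simp: gap_def)
  have fin: "finite {a\<in>gap J I. deg (2*n) a \<le> int N}" for N
    by (rule finite_subset[OF _ finite_gp_deg[of "2*n" "int N"]]) (use ini_sub in \<open>auto simp: gap_def\<close>)
  have span: "f \<in> fs.span (X N \<union> J)"
    if "f \<in> I" "f \<in> pos ?M 1" "f \<noteq> 0 \<Longrightarrow> deg (2*n) (snd (lead f)) \<le> int (N + e)" for f N
  proof (cases "f = 0")
    case False
    then show ?thesis unfolding X_def
      using division_span[OF _ sI(1) submod_subspace[OF sJ] h JI] that by blast
  qed (simp add: fs.span_zero)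
  have "v \<in> J"
  proof (rule growth_in_V0[OF n_pos])
    show "finite (X N)" for N unfolding X_def index by (intro finite_imageI fin)
    show "card (X N) \<le> (C * (e + 1) ^ (n - 1)) * (N + 1) ^ (n - 1)" for N
    proof -
      have "card (X N) \<le> card (Pair (0::nat) ` {a\<in>gap J I. deg (2*n) a \<le> int (N + e)})"
        unfolding X_def index by (rule card_image_le[OF finite_imageI[OF fin]])
      also have "\<dots> \<le> card {a\<in>gap J I. deg (2*n) a \<le> int (N + e)}" by (rule card_image_le[OF fin])
      also have "\<dots> \<le> C * (N + e + 1) ^ (n - 1)" by (rule C)
      also have "\<dots> \<le> C * ((e + 1) * (N + 1)) ^ (n - 1)" by (intro mult_le_mono2 power_mono) auto
      finally show ?thesis by (simp only: power_mult_distrib ac_simps)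
    qed
    show "v \<in> fs.span (X 0 \<union> J)" by (rule span) (use vI in \<open>auto simp: e_def\<close>)
    fix N K x a assume x: "x \<in> X N" and a: "a \<in> gp ?M" "deg (2*n) a \<le> int K"
    obtain p where p: "p \<in> ini ?M 1 I - ini ?M 1 J" "deg (2*n) (snd p) \<le> int (N + e)" "x = h p"
      using x unfolding X_def by blast
    have hp: "finite (supp (h p))" using h[OF p(1)] by (simp add: pos_def)
    show "mop a x \<in> fs.span (X (N + K) \<union> J)"
    proof (rule span)
      show "mop a x \<in> I" "mop a x \<in> pos ?M 1"
        using h[OF p(1)] a p(3) sI(1) pos_mop by (auto intro: submod_mop gp_lat)
      show "deg (2*n) (snd (lead (mop a x))) \<le> int (N + K + e)"
        using lead_mop[OF hp] h[OF p(1)] p a by (simp add: deg_add)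
    qed
  qed
  then have "mop (- a) v \<in> J" by (rule submod_mop[OF sJ lat_minus[OF gp_lat[OF a(1)]]])
  then have "sc (inverse (bc (- a) a)) (mop (- a) (mop a v0)) \<in> J" unfolding v_def by (rule submod_sc[OF sJ])
  then show "v0 \<in> J" by (simp add: mop_inverse)
qed

text \<open>Each passage to the factors of a chain lowers the possible dimension of flats by one,
  except at finitely many places; below dimension n the factors are zero.\<close>

lemma dev_less_interval:
  assumes "I \<in> lideals" "J \<in> lideals" "thin (2*n) (n + k) (gap J I)"
  shows "dev_less k (lideals \<inter> {J..I})"
  using assms
proof (induction k arbitrary: I J)
  case 0
  have "\<not> x < y" if x: "x \<in> lideals" "J \<subseteq> x" and y: "y \<in> lideals" "y \<subseteq> I" for x y
  proof
    assume "x < y"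
    moreover have "thin (2*n) n (gap x y)" using 0(3) gap_mono[OF x(2) y(2)] thin_subset by simp
    ultimately show False using thin_gap_eq[OF y(1) x(1)] by auto
  qed
  then show ?case by auto
next
  case (Suc k)
  show ?case unfolding dev_less.simps
  proof (intro allI impI)
    fix a :: "nat \<Rightarrow> _" assume a: "range a \<subseteq> lideals \<inter> {J..I} \<and> decseq a"
    have "\<forall>\<^sub>F i in sequentially. thin (2*n) (n + k) (gap (a (Suc i)) (a i))"
      by (rule gap_chain[of I J]) (use Suc.prems a in auto)
    then show "\<forall>\<^sub>F i in sequentially. dev_less k (lideals \<inter> {J..I} \<inter> {a (Suc i)..a i})"
    proof eventually_elim
      case (elim i)
      then have "dev_less k (lideals \<inter> {a (Suc i)..a i})" using a by (intro Suc.IH) auto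
      then show ?case by (rule dev_less_subset) blast
    qed
  qed
qed

theorem dev_less_lideals: "dev_less (Suc n) lideals"
proof -
  \<comment> \<open>Flats of dimension 2n + 1 cannot exist in 2n coordinates.\<close>
  have "thin (2*n) (n + Suc n) (gap {0} (Fr {..<2*n} {..<1}))"
    unfolding thin_def
  proof (intro allI impI notI)
    fix S assume S: "S \<subseteq> {..<2*n} \<and> card S = n + Suc n"
    then have "card S \<le> card {..<2*n}" by (intro card_mono) auto
    then show False using S by simp
  qed
  moreover have "Fr {..<2*n} {..<1} \<in> lideals" "{0} \<in> lideals"
    by (auto simp: lideals_def submod_Fr) (auto simp: submod_def)
  ultimately have "dev_less (Suc n) (lideals \<inter> {{0}..Fr {..<2*n} {..<1}})" by (intro dev_less_interval)
  then show ?thesis by (rule dev_less_subset) (auto simp: lideals_def submod_zero)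
qed

end

section \<open>Extending module homomorphisms\<close>

context qt
begin

text \<open>For \<open>P\<close> free this says that Ext^1 of \<open>P / N\<close> with values in
  \<open>Q\<close> vanishes over the subtorus on \<open>T\<close>. Along a resolution, taking
  \<open>N\<close> to be the j-th syzygy expresses vanishing of higher Ext groups.\<close>

definition extends_to :: "nat set \<Rightarrow> ('x \<times> expo \<Rightarrow> 'k) set \<Rightarrow> ('x \<times> expo \<Rightarrow> 'k) set \<Rightarrow> ('y \<times> expo \<Rightarrow> 'k) set \<Rightarrow> bool"
  where
  "extends_to T P N Q \<longleftrightarrow> (\<forall>f. lin T N f \<and> f ` N \<subseteq> Q \<longrightarrow>
     (\<exists>g. lin T P g \<and> g ` P \<subseteq> Q \<and> (\<forall>z\<in>N. g z = f z)))"

lemma extends_toD: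
  assumes "extends_to T P N Q" "lin T N f" "f ` N \<subseteq> Q"
  shows "\<exists>g. lin T P g \<and> g ` P \<subseteq> Q \<and> (\<forall>z\<in>N. g z = f z)"
  using assms(1)[unfolded extends_to_def, THEN spec, of f] assms(2,3) by (elim impE) simp_all

definition axis :: "nat \<Rightarrow> int \<Rightarrow> expo" where
  "axis t k = (\<lambda>j. if j = t then k else 0)"

lemma axis_add: "axis t k + axis t l = axis t (k + l)"
  and axis_minus: "- axis t k = axis t (- k)"
  and axis_zero [simp]: "axis t 0 = 0"
  and axis_apply: "axis t k j = (if j = t then k else 0)"
  by (auto simp: axis_def fun_eq_iff fun_simps)

lemma axis_lat: "t \<in> T \<Longrightarrow> axis t k \<in> lat T"
  by (auto simp: axis_def lat_def)

lemma bc_axis [simp]: "bc (axis t k) (axis t l) = 1"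
proof -
  have "c i j powi (axis t k i * axis t l j) = 1" for i j
    by (cases "i = t \<and> j = t") (auto simp: axis_def c_diag)
  then show ?thesis by (simp add: bich_def)
qed

lemma mop_axis: "mop (axis t k) (mop (axis t l) f) = mop (axis t (k + l)) f"
  by (simp add: mop_mop axis_add)

lemma lin_eq_on_bas:
  fixes f :: "'x \<times> expo \<Rightarrow> 'k"
  assumes "lin {} (Fr T X) A" "lin {} (Fr T X) B" "\<And>x a. x \<in> X \<Longrightarrow> a \<in> lat T \<Longrightarrow> A (bas (x, a)) = B (bas (x, a))"
    and f: "f \<in> Fr T X"
  shows "A f = B f"
proof -
  have sub: "submod {} (Fr T X :: ('x \<times> expo \<Rightarrow> 'k) set)" by (rule submod_Fr) simp
  have f': "f = (\<Sum>p\<in>supp f. sc (f p) (bas p))" by (rule bas_expansion) (use f Fr_finite in auto)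
  have in_Fr: "bas p \<in> Fr T X" if "p \<in> supp f" for p
    using that f by (cases p) (auto simp: Fr_def)
  have *: "H (\<Sum>p\<in>supp f. sc (f p) (bas p)) = (\<Sum>p\<in>supp f. sc (f p) (H (bas p)))"
    if "lin {} (Fr T X) H" for H :: "('x \<times> expo \<Rightarrow> 'k) \<Rightarrow> 'b \<times> expo \<Rightarrow> 'k"
    by (subst lin_sum[OF that sub]) (simp_all add: in_Fr lin_sc[OF that])
  have "A (bas p) = B (bas p)" if "p \<in> supp f" for p
    using assms(3) f that by (cases p) (auto simp: Fr_def)
  then have "(\<Sum>p\<in>supp f. sc (f p) (A (bas p))) = (\<Sum>p\<in>supp f. sc (f p) (B (bas p)))"
    by (intro sum.cong) simp_all
  then show ?thesis using *[OF assms(1)] *[OF assms(2)] f' by metis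
qed

text \<open>Commuting with one power of the new variable extends to all powers because the variable
  is invertible; every monomial is, up to a scalar, a power of it times a monomial in
  \<open>T\<close>.\<close>

lemma lin_insertI:
  fixes P :: "('x \<times> expo \<Rightarrow> 'k) set"
  assumes T: "insert t T \<subseteq> {..<m}" and P: "submod {..<m} P" and g: "lin T P g"
    and shift: "\<And>p. p \<in> P \<Longrightarrow> g (mop (axis t 1) p) = mop (axis t 1) (g p)"
  shows "lin (insert t T) P g"
proof -
  have axP: "mop (axis t k) p \<in> P" if "p \<in> P" for k p
    using that T by (intro submod_mop[OF P] axis_lat) auto
  have shift': "g (mop (axis t (-1)) p) = mop (axis t (-1)) (g p)" if "p \<in> P" for p
  proof -
    have "g p = mop (axis t 1) (g (mop (axis t (-1)) p))"
      using shift[OF axP[OF that, of "-1"]] by (simp add: mop_axis)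
    then show ?thesis by (simp add: mop_axis)
  qed
  have ax: "g (mop (axis t k) p) = mop (axis t k) (g p)" if p: "p \<in> P" for k p
  proof (induction k rule: int_induct[of _ 0])
    case (step1 i)
    have "g (mop (axis t (i + 1)) p) = mop (axis t 1) (g (mop (axis t i) p))"
      using shift[OF axP[OF p, of i]] by (simp add: mop_axis add.commute)
    then show ?case using step1 by (simp add: mop_axis add.commute)
  next
    case (step2 i)
    have "g (mop (axis t (i - 1)) p) = mop (axis t (-1)) (g (mop (axis t i) p))"
      using shift'[OF axP[OF p, of i]] by (simp add: mop_axis)
    then show ?case using step2 by (simp add: mop_axis)
  qed simp
  have "g (mop a p) = mop a (g p)" if a: "a \<in> lat (insert t T)" and p: "p \<in> P" for a p
  proof -
    define a' where "a' = a - axis t (a t)"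
    have a': "a' \<in> lat T" using a by (auto simp: a'_def lat_def axis_def)
    have split: "mop a q = sc (inverse (bc (axis t (a t)) a')) (mop (axis t (a t)) (mop a' q))" for q :: "'z \<times> expo \<Rightarrow> 'k"
      by (simp add: mop_mop a'_def)
    have a'P: "mop a' p \<in> P" using P p lat_mono[OF _ a'] T by (auto intro: submod_mop)
    have "g (mop a p) = sc (inverse (bc (axis t (a t)) a')) (g (mop (axis t (a t)) (mop a' p)))"
      unfolding split[of p] by (rule lin_sc[OF g axP[OF a'P]])
    also have "\<dots> = mop a (g p)"
      unfolding split[of "g p"] ax[OF a'P] by (simp add: lin_mop[OF g a' p])
    finally show ?thesis .
  qed
  then show ?thesis using g unfolding lin_def by blast
qed

text \<open>On a free module the equation \<open>\<tau> \<psi> \<tau>\<^sup>-\<^sup>1 - \<psi> = \<theta>\<close>, with \<open>\<tau>\<close> a new variable, can be solved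
  degree by degree in \<open>\<tau>\<close>.\<close>

lemma coboundary:
  fixes Q :: "('y \<times> expo \<Rightarrow> 'k) set" and X :: "'x set"
  assumes T: "T \<subseteq> {..<m}" "t < m" "t \<notin> T" and Q: "submod {..<m} Q"
    and \<theta>: "lin T (Fr {..<m} X) \<theta>" "\<theta> ` Fr {..<m} X \<subseteq> Q"
  shows "\<exists>\<psi>. lin T (Fr {..<m} X) \<psi> \<and> \<psi> ` Fr {..<m} X \<subseteq> Q \<and>
    (\<forall>p\<in>Fr {..<m} X. mop (axis t 1) (\<psi> (mop (axis t (-1)) p)) = \<psi> p + \<theta> p)"
proof -
  let ?F = "Fr {..<m} X :: ('x \<times> expo \<Rightarrow> 'k) set"
  have F: "submod {..<m} ?F" by (simp add: submod_Fr)
  have ax_lat: "axis t k \<in> lat {..<m}" for k by (rule axis_lat) (use T in simp)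
  have axF: "mop (axis t k) p \<in> ?F" if "p \<in> ?F" for p k using that ax_lat by simp
  have axQ: "mop (axis t k) q \<in> Q" if "q \<in> Q" for q k by (rule submod_mop[OF Q ax_lat that])
  have \<theta>Q: "\<theta> p \<in> Q" if "p \<in> ?F" for p using that \<theta>(2) by blast
  \<comment> \<open>The conjugate of \<theta> by the i-th power of \<tau>. It is again linear over
    \<open>T\<close>: the scalars from moving the two powers of \<tau> past a monomial
    cancel.\<close>
  define \<Theta> where "\<Theta> i p = mop (axis t i) (\<theta> (mop (axis t (- i)) p))" for i p
  have \<Theta>_add: "\<Theta> i (p + q) = \<Theta> i p + \<Theta> i q" if "p \<in> ?F" "q \<in> ?F" for i p q
    using lin_add[OF \<theta>(1) axF[OF that(1)] axF[OF that(2)]] by (simp add: \<Theta>_def mop_add)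
  have \<Theta>_sc: "\<Theta> i (sc r p) = sc r (\<Theta> i p)" if "p \<in> ?F" for i p r
    using lin_sc[OF \<theta>(1) axF[OF that]] by (simp add: \<Theta>_def mop_sc)
  have \<Theta>_mop: "\<Theta> i (mop a p) = mop a (\<Theta> i p)" if a: "a \<in> lat T" and p: "p \<in> ?F" for i p a
  proof -
    let ?u = "axis t i"
    have "\<theta> (mop (axis t (-i)) (mop a p)) =
        sc (bc (axis t (-i)) a / bc a (axis t (-i))) (mop a (\<theta> (mop (axis t (-i)) p)))"
      unfolding mop_commute[of "axis t (-i)" a]
      using lin_sc[OF \<theta>(1) Fr_mop[OF axF[OF p] lat_mono[OF T(1) a]]] lin_mop[OF \<theta>(1) a axF[OF p]]
      by simp
    then have "\<theta> (mop (axis t (-i)) (mop a p)) = sc (bc (- ?u) a / bc a (- ?u)) (mop a (\<theta> (mop (axis t (-i)) p)))"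
      by (simp only: axis_minus)
    then have "\<Theta> i (mop a p) = sc ((bc (- ?u) a / bc a (- ?u)) * (bc ?u a / bc a ?u)) (mop a (\<Theta> i p))"
      by (simp add: \<Theta>_def mop_sc mop_commute[of "axis t i" a])
    moreover have "(bc (- ?u) a / bc a (- ?u)) * (bc ?u a / bc a ?u) = 1"
      by (simp add: bc_minus)
    ultimately show ?thesis by simp
  qed
  have \<Theta>_shift: "mop (axis t 1) (\<Theta> i (mop (axis t (-1)) p)) = \<Theta> (i + 1) p" for i p
    by (simp add: \<Theta>_def mop_axis add.commute)
  have \<Theta>Q: "\<Theta> i p \<in> Q" if "p \<in> ?F" for i p
    unfolding \<Theta>_def by (intro axQ \<theta>Q axF that)
  \<comment> \<open>The solution on monomials of \<tau>-degree k, normalized to 0 at k = 0 and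
    obtained by telescoping the equation in both directions; for each k one of the two sums is
    empty.\<close>
  define \<Psi> where "\<Psi> k p = (\<Sum>i\<in>{k..<0}. \<Theta> i p) - (\<Sum>i\<in>{0..<k}. \<Theta> i p)" for k p
  have \<Psi>_sc: "\<Psi> k (sc r p) = sc r (\<Psi> k p)" if "p \<in> ?F" for k p r
    using that by (simp add: \<Psi>_def \<Theta>_sc sc_sum fs.scale_right_diff_distrib)
  have \<Psi>_mop: "\<Psi> k (mop a p) = mop a (\<Psi> k p)" if "a \<in> lat T" "p \<in> ?F" for k p a
    using that by (simp add: \<Psi>_def \<Theta>_mop mop_sum mop_diff)
  have \<Psi>Q: "\<Psi> k p \<in> Q" if "p \<in> ?F" for k p
    unfolding \<Psi>_def by (intro submod_diff[OF Q] submod_sum[OF Q] \<Theta>Q that)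
  have \<Psi>_rec: "mop (axis t 1) (\<Psi> (k - 1) (mop (axis t (-1)) p)) = \<Psi> k p + \<theta> p" for k p
  proof -
    have sh: "(\<Sum>i\<in>{l..<u}. \<Theta> (i + 1) p) = (\<Sum>i\<in>{l+1..<u+1}. \<Theta> i p)" for l u :: int
      by (rule sum.reindex_bij_witness[of _ "\<lambda>i. i - 1" "\<lambda>i. i + 1"]) auto
    have \<theta>0: "\<theta> p = \<Theta> 0 p" by (simp add: \<Theta>_def)
    have "mop (axis t 1) (\<Psi> (k - 1) (mop (axis t (-1)) p)) = (\<Sum>i\<in>{k..<1}. \<Theta> i p) - (\<Sum>i\<in>{1..<k}. \<Theta> i p)"
      using sh[of "k - 1" 0] sh[of 0 "k - 1"] by (simp add: \<Psi>_def mop_diff mop_sum \<Theta>_shift)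
    also have "\<dots> = \<Psi> k p + \<theta> p"
    proof (cases "k \<le> 0")
      case True
      then have "{k..<1} = insert 0 {k..<0}" by auto
      then show ?thesis using True by (simp add: \<Psi>_def \<theta>0)
    next
      case False
      then have "{0..<k} = insert 0 {1..<k}" by auto
      then show ?thesis using False by (simp add: \<Psi>_def \<theta>0)
    qed
    finally show ?thesis .
  qed
  define h where "h = (\<lambda>(x, a). \<Psi> (a t) (bas (x :: 'x, a)))"
  define \<psi> where "\<psi> = lext h"
  have lin0: "lin {} ?F \<psi>"
    by (simp add: lin_def \<psi>_def lext_add lext_sc Fr_finite)
  have \<psi>_bas: "\<psi> (bas (x, a)) = \<Psi> (a t) (bas (x, a))" for x a by (simp add: \<psi>_def h_def)
  have \<psi>_mop_bas: "\<psi> (mop b (bas (x, a))) = \<Psi> (a t + b t) (mop b (bas (x, a)))"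
    if "x \<in> X" "a \<in> lat {..<m}" "b \<in> lat {..<m}" for x a b
  proof -
    have "bas (x, b + a) \<in> ?F" using that by simp
    then show ?thesis
      using lin_sc[OF lin0, of "bas (x, b + a)"] by (simp add: mop_bas \<psi>_bas \<Psi>_sc plus_fun_apply add.commute)
  qed
  have \<psi>_mop: "\<psi> (mop a p) = mop a (\<psi> p)" if a: "a \<in> lat T" and p: "p \<in> ?F" for a p
  proof (rule lin_eq_on_bas[OF _ _ _ p])
    have am: "a \<in> lat {..<m}" using a T(1) lat_mono by blast
    show "lin {} ?F (\<lambda>p. \<psi> (mop a p))" "lin {} ?F (\<lambda>p. mop a (\<psi> p))"
      using lin0 am by (simp_all add: lin_def mop_add mop_sc)
    fix x e assume x: "x \<in> X" "e \<in> lat {..<m}"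
    have "a t = 0" using a T(3) by (auto simp: lat_def)
    then show "\<psi> (mop a (bas (x, e))) = mop a (\<psi> (bas (x, e)))"
      using \<psi>_mop_bas[OF x am] x by (simp add: \<psi>_bas \<Psi>_mop[OF a])
  qed
  have lin\<psi>: "lin T ?F \<psi>" using lin0 \<psi>_mop unfolding lin_def by blast
  have "mop (axis t 1) (\<psi> (mop (axis t (-1)) p)) = \<psi> p + \<theta> p" if p: "p \<in> ?F" for p
  proof (rule lin_eq_on_bas[OF _ _ _ p])
    show "lin {} ?F (\<lambda>p. mop (axis t 1) (\<psi> (mop (axis t (-1)) p)))"
      using lin0 axF by (simp add: lin_def mop_add mop_sc)
    show "lin {} ?F (\<lambda>p. \<psi> p + \<theta> p)"
      using lin0 \<theta>(1) by (simp add: lin_def sc_add_right)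
    fix x e assume x: "x \<in> X" "e \<in> lat {..<m}"
    show "mop (axis t 1) (\<psi> (mop (axis t (-1)) (bas (x, e)))) = \<psi> (bas (x, e)) + \<theta> (bas (x, e))"
      unfolding \<psi>_mop_bas[OF x ax_lat] \<psi>_bas using \<Psi>_rec[of "e t" "bas (x, e)"] by (simp add: axis_apply)
  qed
  moreover have "\<psi> p \<in> Q" if p: "p \<in> ?F" for p
    unfolding \<psi>_def lext_def
  proof (intro submod_sum[OF Q] submod_sc[OF Q])
    fix xa assume "xa \<in> supp p"
    then have "fst xa \<in> X" "snd xa \<in> lat {..<m}" using p by (auto simp: Fr_def)
    then show "h xa \<in> Q" by (cases xa) (simp add: h_def \<Psi>Q)
  qed
  ultimately show ?thesis using lin\<psi> by blast
qed

text \<open>Adjoining a variable costs one degree: extension over \<open>T\<close> at a syzygy and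
  at the preceding one gives extension over \<open>insert t T\<close> at the later one. This is the
  long exact sequence of a skew Laurent extension.\<close>

lemma extends_step:
  fixes P :: "('x \<times> expo \<Rightarrow> 'k) set" and X :: "'y set" and Q :: "('z \<times> expo \<Rightarrow> 'k) set"
  assumes T: "T \<subseteq> {..<m}" "t < m" "t \<notin> T" and Q: "submod {..<m} Q"
    and P: "submod {..<m} P" and d: "lin {..<m} P d" "d ` P \<subseteq> Fr {..<m} X"
    and e1: "extends_to T P {z\<in>P. d z = 0} Q" and e2: "extends_to T (Fr {..<m} X) (d ` P) Q"
  shows "extends_to (insert t T) P {z\<in>P. d z = 0} Q"
  unfolding extends_to_def
proof (intro allI impI)
  let ?N = "{z\<in>P. d z = 0}" let ?F = "Fr {..<m} X"
  fix f assume f: "lin (insert t T) ?N f \<and> f ` ?N \<subseteq> Q"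
  have N: "submod {..<m} ?N" by (rule lin_kernel_submod[OF d(1) P])
  have ax_lat: "axis t k \<in> lat {..<m}" for k by (rule axis_lat) (use T in simp)
  have axP: "mop (axis t k) p \<in> P" if "p \<in> P" for p k by (rule submod_mop[OF P ax_lat that])
  have axN: "mop (axis t k) p \<in> ?N" if "p \<in> ?N" for p k by (rule submod_mop[OF N ax_lat that])
  have "lin T ?N f" by (rule lin_mono[OF conjunct1[OF f]]) auto
  from extends_toD[OF e1 this conjunct2[OF f]] obtain g
    where g': "lin T P g \<and> g ` P \<subseteq> Q \<and> (\<forall>z\<in>?N. g z = f z)" by (rule exE)
  then have g: "lin T P g" "g ` P \<subseteq> Q" by simp_all
  have gf: "g z = f z" if "z \<in> ?N" for z using g' that by simp
  have Pt: "submod T P" using submod_mono[OF P T(1)] .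
  \<comment> \<open>The failure of g to commute with the new variable \<tau>. It vanishes on the
    kernel of d, where g is the given map, hence factors through d.\<close>
  define \<theta> where "\<theta> p = mop (axis t 1) (g (mop (axis t (-1)) p)) - g p" for p
  have \<theta>: "lin T P \<theta>"
    unfolding lin_def
  proof (intro conjI ballI allI)
    fix u v assume uv: "u \<in> P" "v \<in> P"
    show "\<theta> (u + v) = \<theta> u + \<theta> v"
      using lin_add[OF g(1) axP axP, of u v] lin_add[OF g(1), of u v] uv by (simp add: \<theta>_def mop_add)
  next
    fix r u assume u: "u \<in> P"
    show "\<theta> (sc r u) = sc r (\<theta> u)"
      using lin_sc[OF g(1) axP[OF u]] lin_sc[OF g(1) u] by (simp add: \<theta>_def mop_sc fs.scale_right_diff_distrib)
  next
    fix a p assume a: "a \<in> lat T" and p: "p \<in> P"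
    let ?u = "axis t 1"
    have "g (mop (axis t (-1)) (mop a p)) =
        sc (bc (axis t (-1)) a / bc a (axis t (-1))) (mop a (g (mop (axis t (-1)) p)))"
      unfolding mop_commute[of "axis t (-1)" a]
      using lin_sc[OF g(1) submod_mop[OF Pt a axP[OF p]]] lin_mop[OF g(1) a axP[OF p]]
      by simp
    then have "g (mop (axis t (-1)) (mop a p)) = sc (bc (- ?u) a / bc a (- ?u)) (mop a (g (mop (axis t (-1)) p)))"
      by (simp only: axis_minus)
    then have "mop ?u (g (mop (axis t (-1)) (mop a p))) =
        sc ((bc (- ?u) a / bc a (- ?u)) * (bc ?u a / bc a ?u)) (mop a (mop ?u (g (mop (axis t (-1)) p))))"
      by (simp add: mop_sc mop_commute[of ?u a])
    moreover have "(bc (- ?u) a / bc a (- ?u)) * (bc ?u a / bc a ?u) = 1"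
      by (simp add: bc_minus)
    ultimately show "\<theta> (mop a p) = mop a (\<theta> p)"
      using lin_mop[OF g(1) a p] by (simp add: \<theta>_def mop_diff)
  qed
  have \<theta>N: "\<theta> z = 0" if z: "z \<in> ?N" for z
  proof -
    have "g (mop (axis t (-1)) z) = mop (axis t (-1)) (f z)"
      using gf[OF axN[OF z]] lin_mop[of "insert t T" ?N f "axis t (-1)" z] f z axis_lat[of t "insert t T"] by simp
    then show ?thesis using gf[OF z] by (simp add: \<theta>_def mop_axis)
  qed
  \<comment> \<open>The factorization through d; after it has been extended to the free module,
    \<open>coboundary\<close> can be solved there.\<close>
  define \<theta>' where "\<theta>' y = \<theta> (SOME p. p \<in> P \<and> d p = y)" for y
  have \<theta>'_d: "\<theta>' (d p) = \<theta> p" if p: "p \<in> P" for p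
  proof -
    define p' where "p' = (SOME q. q \<in> P \<and> d q = d p)"
    have p': "p' \<in> P \<and> d p' = d p" unfolding p'_def by (rule someI[of _ p]) (use p in simp)
    then have "p' - p \<in> ?N" using p lin_diff[OF d(1) P] submod_diff[OF P] by simp
    then have "\<theta> (p' - p) = 0" by (rule \<theta>N)
    then have "\<theta> p' = \<theta> p" using lin_diff[OF \<theta> P conjunct1[OF p'] p] by simp
    then show ?thesis by (simp add: \<theta>'_def p'_def)
  qed
  have "lin T (d ` P) \<theta>'"
    unfolding lin_def
  proof (intro conjI ballI allI)
    fix u v assume "u \<in> d ` P" "v \<in> d ` P"
    then obtain u' v' where uv: "u = d u'" "u' \<in> P" "v = d v'" "v' \<in> P" by blast
    then show "\<theta>' (u + v) = \<theta>' u + \<theta>' v"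
      using \<theta>'_d[of "u' + v'"] lin_add[OF d(1), of u' v'] lin_add[OF \<theta>, of u' v'] submod_add[OF P, of u' v']
      by (simp add: \<theta>'_d)
  next
    fix r u assume "u \<in> d ` P"
    then obtain u' where u: "u = d u'" "u' \<in> P" by blast
    then show "\<theta>' (sc r u) = sc r (\<theta>' u)"
      using \<theta>'_d[of "sc r u'"] lin_sc[OF d(1), of u' r] lin_sc[OF \<theta>, of u' r] submod_sc[OF P, of u' r]
      by (simp add: \<theta>'_d)
  next
    fix a u assume a: "a \<in> lat T" and "u \<in> d ` P"
    then obtain u' where u: "u = d u'" "u' \<in> P" by blast
    have "a \<in> lat {..<m}" using a T(1) lat_mono by blast
    then show "\<theta>' (mop a u) = mop a (\<theta>' u)"
      using \<theta>'_d[of "mop a u'"] lin_mop[OF d(1), of a u'] lin_mop[OF \<theta> a, of u'] submod_mop[OF P, of a u'] u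
      by (simp add: \<theta>'_d)
  qed
  moreover have "\<theta>' ` d ` P \<subseteq> Q"
  proof clarify
    fix p assume p: "p \<in> P"
    have "g p \<in> Q" "g (mop (axis t (-1)) p) \<in> Q" using g(2) p axP[OF p, of "-1"] by blast+
    then show "\<theta>' (d p) \<in> Q"
      unfolding \<theta>'_d[OF p] \<theta>_def by (intro submod_diff[OF Q] submod_mop[OF Q ax_lat])
  qed
  ultimately have "\<exists>g. lin T ?F g \<and> g ` ?F \<subseteq> Q \<and> (\<forall>z\<in>d ` P. g z = \<theta>' z)"
    by (rule extends_toD[OF e2])
  then obtain \<theta>2 where \<theta>2': "lin T ?F \<theta>2 \<and> \<theta>2 ` ?F \<subseteq> Q \<and> (\<forall>z\<in>d ` P. \<theta>2 z = \<theta>' z)"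
    by (rule exE)
  then have \<theta>2: "lin T ?F \<theta>2" "\<theta>2 ` ?F \<subseteq> Q" "\<And>y. y \<in> d ` P \<Longrightarrow> \<theta>2 y = \<theta>' y" by blast+
  obtain \<psi> where \<psi>: "lin T ?F \<psi>" "\<psi> ` ?F \<subseteq> Q"
    "\<And>p. p \<in> ?F \<Longrightarrow> mop (axis t 1) (\<psi> (mop (axis t (-1)) p)) = \<psi> p + \<theta>2 p"
    using coboundary[OF T Q \<theta>2(1,2)] by blast
  \<comment> \<open>The correction term cancels \<theta>, so g' commutes with \<tau>; on the kernel
    of d it is zero.\<close>
  define g' where "g' p = g p - \<psi> (d p)" for p
  have dF: "d p \<in> ?F" if "p \<in> P" for p using d(2) that by blast
  have g'T: "lin T P g'"
    unfolding lin_def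
  proof (intro conjI ballI allI)
    fix u v assume uv: "u \<in> P" "v \<in> P"
    show "g' (u + v) = g' u + g' v"
      using lin_add[OF g(1) uv] lin_add[OF d(1) uv] lin_add[OF \<psi>(1) dF dF, of u v] uv by (simp add: g'_def)
  next
    fix r u assume u: "u \<in> P"
    show "g' (sc r u) = sc r (g' u)"
      using lin_sc[OF g(1) u] lin_sc[OF d(1) u] lin_sc[OF \<psi>(1) dF[OF u]] by (simp add: g'_def fs.scale_right_diff_distrib)
  next
    fix a u assume a: "a \<in> lat T" and u: "u \<in> P"
    have "a \<in> lat {..<m}" using a T(1) lat_mono by blast
    then show "g' (mop a u) = mop a (g' u)"
      using lin_mop[OF g(1) a u] lin_mop[OF d(1) _ u, of a] lin_mop[OF \<psi>(1) a dF[OF u]] by (simp add: g'_def mop_diff)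
  qed
  have "mop (axis t 1) (g' (mop (axis t (-1)) p)) = g' p" if p: "p \<in> P" for p
    using \<psi>(3)[OF dF[OF p]] \<theta>2(3)[of "d p"] \<theta>'_d[OF p] lin_mop[OF d(1) ax_lat p, of "-1"] p
    by (simp add: g'_def mop_diff \<theta>_def)
  then have "g' (mop (axis t 1) p) = mop (axis t 1) (g' p)" if p: "p \<in> P" for p
    using axP[OF p, of 1] by (metis mop_axis axis_zero mop_0 add.left_inverse)
  then have "lin (insert t T) P g'" by (intro lin_insertI[OF _ P g'T]) (use T in auto)
  moreover have "g' p \<in> Q" if "p \<in> P" for p
    unfolding g'_def using g(2) \<psi>(2) dF[OF that] that by (intro submod_diff[OF Q]) auto
  moreover have "g' z = f z" if "z \<in> ?N" for z
    using that gf[OF that] lin_zero[OF \<psi>(1) submod_Fr[OF T(1)]] by (simp add: g'_def)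
  ultimately show "\<exists>g. lin (insert t T) P g \<and> g ` P \<subseteq> Q \<and> (\<forall>z\<in>?N. g z = f z)" by blast
qed

text \<open>Over the field alone, a linear projection onto \<open>N\<close> extends every
  map.\<close>

lemma extends_linear:
  fixes N :: "('a \<times> expo \<Rightarrow> 'k) set"
  assumes "submod T N"
  shows "extends_to {} P N Q"
  unfolding extends_to_def
proof (intro allI impI)
  fix f assume f: "lin {} N f \<and> f ` N \<subseteq> Q"
  have "Vector_Spaces.linear sc sc (\<lambda>x :: 'a \<times> expo \<Rightarrow> 'k. x)" by (rule fs.linear_ident)
  then obtain \<pi> where \<pi>: "range \<pi> \<subseteq> N" "Vector_Spaces.linear sc sc \<pi>" "\<And>v. v \<in> N \<Longrightarrow> \<pi> v = v"
    using fsp.linear_exists_left_inverse_on[of "\<lambda>x. x" N] submod_subspace[OF assms(1)] by (auto simp: inj_on_def)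
  have \<pi>': "\<pi> (u + v) = \<pi> u + \<pi> v" "\<pi> (sc r u) = sc r (\<pi> u)" "\<pi> u \<in> N" for u v r
    using \<pi> by (auto simp: Vector_Spaces.linear_iff)
  show "\<exists>g. lin {} P g \<and> g ` P \<subseteq> Q \<and> (\<forall>z\<in>N. g z = f z)"
    using f \<pi>' \<pi>(3) by (intro exI[of _ "\<lambda>x. f (\<pi> x)"]) (auto simp: lin_def image_subset_iff)
qed

end

section \<open>A module that is injective over a subtorus\<close>

definition rst :: "nat set \<Rightarrow> expo \<Rightarrow> expo" where
  "rst S a = (\<lambda>i. if i \<in> S then 0 else a i)"

lemma rst_add: "rst S (a + b) = rst S a + rst S b"
  by (auto simp: rst_def fun_eq_iff plus_fun_apply)

lemma rst_lat: "a \<in> lat S \<Longrightarrow> rst S a = 0"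
  by (auto simp: rst_def lat_def fun_eq_iff zero_fun_apply)

lemma diff_rst: "a - rst S a \<in> lat S"
  by (auto simp: rst_def lat_def)

context qt
begin

text \<open>Arbitrary functions along \<open>S\<close>, supported on finitely many cosets of
  \<open>lat S\<close>. Each coset carries the full dual of the subtorus, which is injective over
  it, and \<open>tors S\<close> is the direct sum of these duals; unlike their product it is not
  automatically injective, which is where noetherianity enters.\<close>

definition tors :: "nat set \<Rightarrow> (nat \<times> expo \<Rightarrow> 'k) set" where
  "tors S = {q. supp q \<subseteq> {0} \<times> lat {..<m} \<and> finite (rst S ` snd ` supp q)}"

lemma torsI:
  assumes "supp q \<subseteq> {0} \<times> lat {..<m}" "finite R" "\<And>a. (0, a) \<in> supp q \<Longrightarrow> rst S a \<in> R"
  shows "q \<in> tors S"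
proof -
  have "rst S ` snd ` supp q \<subseteq> R" using assms(1,3) by auto
  then show ?thesis using assms finite_subset by (auto simp: tors_def)
qed

lemma tors_submod: "submod {..<m} (tors S)"
  unfolding submod_def
proof (intro conjI ballI allI)
  show "0 \<in> tors S" by (simp add: tors_def)
  fix u assume u: "u \<in> tors S"
  show "u + v \<in> tors S" if v: "v \<in> tors S" for v
  proof (rule torsI)
    show "finite (rst S ` snd ` supp u \<union> rst S ` snd ` supp v)" using u v by (simp add: tors_def)
    show "supp (u + v) \<subseteq> {0} \<times> lat {..<m}" using supp_add[of u v] u v by (auto simp: tors_def)
    show "rst S a \<in> rst S ` snd ` supp u \<union> rst S ` snd ` supp v" if "(0, a) \<in> supp (u + v)" for a
      using that supp_add[of u v] by force
  qed
  show "sc r u \<in> tors S" for r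
  proof (rule torsI)
    show "finite (rst S ` snd ` supp u)" using u by (simp add: tors_def)
    show "supp (sc r u) \<subseteq> {0} \<times> lat {..<m}" using supp_sc[of r u] u by (auto simp: tors_def)
    show "rst S a \<in> rst S ` snd ` supp u" if "(0, a) \<in> supp (sc r u)" for a
      using that supp_sc[of r u] by force
  qed
  show "mop a u \<in> tors S" if a: "a \<in> lat {..<m}" for a
  proof (rule torsI)
    show "finite ((\<lambda>b. rst S a + b) ` rst S ` snd ` supp u)" using u by (simp add: tors_def)
    show "supp (mop a u) \<subseteq> {0} \<times> lat {..<m}" unfolding supp_mop using u a by (auto simp: tors_def)
    fix b assume "(0, b) \<in> supp (mop a u)"
    then obtain b' where "(0, b') \<in> supp u" "b = a + b'" unfolding supp_mop by auto
    then show "rst S b \<in> (\<lambda>b. rst S a + b) ` rst S ` snd ` supp u"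
      by (force simp: rst_add)
  qed
qed

text \<open>Noetherianity of the subtorus makes the support of the values on an ideal uniformly finite
  in the remaining directions.\<close>

lemma baer_step:
  fixes N :: "('x \<times> expo \<Rightarrow> 'k) set"
  assumes S: "S \<subseteq> {..<m}" and N: "submod S N" and f: "lin S N f" "f ` N \<subseteq> tors S"
  shows "\<exists>H. lin S (Fr S {..<1::nat}) H \<and> H ` Fr S {..<1} \<subseteq> tors S \<and>
    (\<forall>u\<in>Fr S {..<1}. fext (\<lambda>_. p) u \<in> N \<longrightarrow> H u = f (fext (\<lambda>_. p) u))"
proof -
  let ?A = "Fr S {..<1} :: (nat \<times> expo \<Rightarrow> 'k) set"
  have A: "submod S ?A" by (simp add: submod_Fr)
  define act where "act = fext (\<lambda>_::nat. p)"
  have act: "lin S ?A act" unfolding act_def by (rule lin_fext)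
  define I where "I = {u\<in>?A. act u \<in> N}"
  have I: "submod S I"
    unfolding submod_def I_def using submodD[OF A] submodD[OF N] linD[OF act] lin_zero[OF act A] by simp
  define h where "h u = f (act u)" for u
  have h: "lin S I h"
    unfolding lin_def h_def I_def using linD[OF act] linD[OF f(1)] by simp
  have h_tors: "h u \<in> tors S" if "u \<in> I" for u using that f(2) by (auto simp: h_def I_def)
  have "I \<subseteq> Fr S {..<1}" by (auto simp: I_def)
  from noetherian[OF S I this] obtain s g
    where g: "\<And>y. y < s \<Longrightarrow> g y \<in> I" "fext g ` Fr S {..<s::nat} = I" by blast
  \<comment> \<open>The cosets met by the values on finitely many generators, which therefore
    contain the support of every value of h.\<close>
  define R where "R = (\<Union>y<s. rst S ` snd ` supp (h (g y)))"
  have R: "finite R" unfolding R_def using h_tors[OF g(1)] by (auto simp: tors_def)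
  define B :: "(nat \<times> expo \<Rightarrow> 'k) set" where "B = {q. \<forall>p\<in>supp q. rst S (snd p) \<in> R}"
  have B: "submod S B"
    unfolding submod_def
  proof (intro conjI ballI allI)
    show "0 \<in> B" by (simp add: B_def)
    fix u assume u: "u \<in> B"
    show "u + v \<in> B" if "v \<in> B" for v using u that supp_add[of u v] unfolding B_def by blast
    show "sc r u \<in> B" for r using u supp_sc[of r u] unfolding B_def by blast
    show "mop a u \<in> B" if "a \<in> lat S" for a
      using u that by (auto simp: B_def supp_mop rst_add rst_lat)
  qed
  have hB: "h u \<in> B" if u: "u \<in> I" for u
  proof -
    obtain w where w: "w \<in> Fr S {..<s}" "u = fext g w" using g(2) u by blast
    have sub: "submod S (Fr S {..<s} :: (nat \<times> expo \<Rightarrow> 'k) set)" by (simp add: submod_Fr)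
    have "lin S (Fr S {..<s}) (\<lambda>w. h (fext g w))"
      by (rule lin_comp[OF lin_fext h]) (use g(2) in simp)
    from lin_eq_fext[OF this w(1)] have "h u = fext (\<lambda>y. h (fext g (bas (y, 0)))) w" using w(2) by simp
    also have "\<dots> \<in> B"
    proof (rule fext_in[OF B w(1)])
      fix y :: nat assume y: "y \<in> {..<s}"
      show "h (fext g (bas (y, 0))) \<in> B" using y by (auto simp: fext_bas B_def R_def)
    qed
    finally show ?thesis .
  qed
  \<comment> \<open>A merely linear extension k suffices: a homomorphism into a dual is determined
    by its values at the coset representatives.\<close>
  have "extends_to {} ?A I UNIV" by (rule extends_linear[OF I])
  moreover have "lin {} I h" using h by (rule lin_mono) auto
  ultimately have "\<exists>k. lin {} ?A k \<and> k ` ?A \<subseteq> UNIV \<and> (\<forall>u\<in>I. k u = h u)"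
    by (rule extends_toD) simp
  then obtain k where k: "lin {} ?A k" "\<And>u. u \<in> I \<Longrightarrow> k u = h u" by blast
  \<comment> \<open>The value at e is obtained by moving e to its representative
    \<open>rst S e\<close> with a monomial of the subtorus and reading k there; the denominator
    undoes the scalar of \<open>mop\<close>. Outside the cosets in \<open>R\<close> the value is set
    to 0, which keeps H in \<open>tors S\<close>.\<close>
  define H where "H u = (\<lambda>(x :: nat, e). if x = 0 \<and> e \<in> lat {..<m} \<and> rst S e \<in> R
      then k (mop (- (e - rst S e)) u) (0, rst S e) / bc (- (e - rst S e)) e else 0)" for u
  have H: "H u (0, e) = k (mop (- (e - rst S e)) u) (0, rst S e) / bc (- (e - rst S e)) e"
    if "e \<in> lat {..<m}" "rst S e \<in> R" for u e
    using that by (simp add: H_def)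
  have H0: "H u (x, e) = 0" if "\<not> (x = 0 \<and> e \<in> lat {..<m} \<and> rst S e \<in> R)" for u x e
    using that by (simp only: H_def case_prod_conv if_False)
  have mopA: "mop (- (e - rst S e)) u \<in> ?A" if "u \<in> ?A" for u e
    by (rule Fr_mop[OF that lat_minus[OF diff_rst]])
  have H_tors: "H u \<in> tors S" for u
  proof -
    have H1: "x = 0 \<and> e \<in> lat {..<m} \<and> rst S e \<in> R" if "(x, e) \<in> supp (H u)" for x e
      using that H0[of x e u] unfolding supp_iff by (rule contrapos_np)
    show ?thesis
    proof (rule torsI[OF _ R])
      show "supp (H u) \<subseteq> {0} \<times> lat {..<m}" using H1 by auto
      show "rst S a \<in> R" if "(0, a) \<in> supp (H u)" for a using H1[OF that] by simp
    qed
  qed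
  have H_lin: "lin S ?A H"
    unfolding lin_def
  proof (intro conjI ballI allI)
    fix u v assume uv: "u \<in> ?A" "v \<in> ?A"
    show "H (u + v) = H u + H v"
    proof (rule ext, clarify)
      fix x e
      show "H (u + v) (x, e) = (H u + H v) (x, e)"
        using lin_add[OF k(1) mopA mopA, of u v e e] uv H[of e] H0[of x e]
        by (cases "x = 0 \<and> e \<in> lat {..<m} \<and> rst S e \<in> R")
          (simp_all add: mop_add plus_fun_apply add_divide_distrib)
    qed
  next
    fix r u assume u: "u \<in> ?A"
    show "H (sc r u) = sc r (H u)"
    proof (rule ext, clarify)
      fix x e
      show "H (sc r u) (x, e) = sc r (H u) (x, e)"
        using lin_sc[OF k(1) mopA, of u r e] u H[of e] H0[of x e]
        by (cases "x = 0 \<and> e \<in> lat {..<m} \<and> rst S e \<in> R") (simp_all add: mop_sc sc_apply)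
    qed
  next
    fix b u assume b: "b \<in> lat S" and u: "u \<in> ?A"
    have bm: "b \<in> lat {..<m}" using b S lat_mono by blast
    show "H (mop b u) = mop b (H u)"
    proof (rule ext, clarify)
      fix x e
      have rst_eq: "rst S (e - b) = rst S e"
        using rst_add[of S "e - b" b] rst_lat[OF b] by simp
      have lat_eq: "e - b \<in> lat {..<m} \<longleftrightarrow> e \<in> lat {..<m}"
        using lat_add[of "e - b" "{..<m}" b] lat_diff[of e "{..<m}" b] bm by auto
      show "H (mop b u) (x, e) = mop b (H u) (x, e)"
      proof (cases "x = 0 \<and> e \<in> lat {..<m} \<and> rst S e \<in> R")
        case True
        define a where "a = e - rst S e"
        have e: "e = rst S e + a" by (simp add: a_def)
        have 1: "e - b - rst S (e - b) = a - b" by (simp add: rst_eq a_def)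
        have "mop (- a) (mop b u) = sc (bc (- a) b) (mop (- (a - b)) u)" by (simp add: mop_mop)
        moreover have "mop (- (a - b)) u \<in> ?A" using mopA[OF u, of "e - b"] unfolding 1 .
        ultimately have 2: "k (mop (- a) (mop b u)) = sc (bc (- a) b) (k (mop (- (a - b)) u))"
          using lin_sc[OF k(1)] by simp
        have "H (mop b u) (0, e) = bc (- a) b * k (mop (- (a - b)) u) (0, rst S e) / bc (- a) e"
          using H[of e "mop b u"] True 2 by (simp add: a_def sc_apply)
        also have "\<dots> = bc b (e - b) * (k (mop (- (a - b)) u) (0, rst S e) / bc (- (a - b)) (e - b))"
          by (simp add: bc_simps field_simps)
        also have "\<dots> = mop b (H u) (0, e)"
        proof -
          have "H u (0, e - b) = k (mop (- (e - b - rst S (e - b))) u) (0, rst S (e - b)) / bc (- (e - b - rst S (e - b))) (e - b)"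
            by (rule H) (use True in \<open>simp_all add: rst_eq lat_eq\<close>)
          from this[unfolded 1, unfolded rst_eq] show ?thesis by (simp only: mop_apply)
        qed
        finally show ?thesis using True by simp
      next
        case False
        then have "\<not> (x = 0 \<and> e - b \<in> lat {..<m} \<and> rst S (e - b) \<in> R)"
          by (simp add: rst_eq lat_eq)
        from H0[OF this, of u] H0[OF False, of "mop b u"] show ?thesis by (simp add: mop_apply)
      qed
    qed
  qed
  have "H u = h u" if u: "u \<in> I" for u
  proof (rule ext, clarify)
    fix x e
    show "H u (x, e) = h u (x, e)"
    proof (cases "x = 0 \<and> e \<in> lat {..<m} \<and> rst S e \<in> R")
      case True
      define a where "a = e - rst S e"
      have a: "- a \<in> lat S" unfolding a_def by (rule lat_minus[OF diff_rst])
      have "k (mop (- a) u) = mop (- a) (h u)"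
        using k(2)[OF submod_mop[OF I a u]] lin_mop[OF h a u] by simp
      then have "k (mop (- a) u) (0, rst S e) = bc (- a) (rst S e - - a) * h u (0, rst S e - - a)"
        by (simp only: mop_apply)
      moreover have "rst S e - - a = e" by (simp add: a_def)
      ultimately have "k (mop (- a) u) (0, rst S e) = bc (- a) e * h u (0, e)" by (simp only:)
      moreover have "H u (0, e) = k (mop (- a) u) (0, rst S e) / bc (- a) e"
        unfolding a_def by (rule H) (use True in simp_all)
      ultimately show ?thesis using True by simp
    next
      case False
      have "(x, e) \<notin> supp (h u)"
      proof
        assume xe: "(x, e) \<in> supp (h u)"
        then have "x = 0 \<and> e \<in> lat {..<m}" using h_tors[OF u] by (auto simp: tors_def)
        moreover have "rst S e \<in> R" using hB[OF u] xe unfolding B_def by fastforce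
        ultimately show False using False by blast
      qed
      then show ?thesis using H0[OF False, of u] by (simp add: supp_iff)
    qed
  qed
  then have "\<forall>u\<in>?A. act u \<in> N \<longrightarrow> H u = f (act u)" by (simp add: I_def h_def)
  then show ?thesis using H_lin H_tors unfolding act_def by blast
qed

text \<open>Baer's criterion: a maximal partial extension exists by Zorn's lemma, and
  \<open>baer_step\<close> enlarges it by any further element p.\<close>

lemma extends_tors:
  fixes P N :: "('x \<times> expo \<Rightarrow> 'k) set"
  assumes S: "S \<subseteq> {..<m}" and P: "submod S P" and N: "submod S N" "N \<subseteq> P"
  shows "extends_to S P N (tors S)"
  unfolding extends_to_def
proof (intro allI impI)
  fix f assume f: "lin S N f \<and> f ` N \<subseteq> tors S"
  let ?A = "Fr S {..<1::nat}"
  have Q: "submod S (tors S)" using submod_mono[OF tors_submod S] .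
  \<comment> \<open>Partial homomorphisms are represented by their graphs, so that unions of chains
    are set unions; the last clause makes the graph single-valued.\<close>
  define good where "good \<Gamma> \<longleftrightarrow> (\<lambda>z. (z, f z)) ` N \<subseteq> \<Gamma> \<and> \<Gamma> \<subseteq> P \<times> tors S \<and>
      (\<forall>u v a b. (u, a) \<in> \<Gamma> \<and> (v, b) \<in> \<Gamma> \<longrightarrow> (u + v, a + b) \<in> \<Gamma>) \<and>
      (\<forall>u a r. (u, a) \<in> \<Gamma> \<longrightarrow> (sc r u, sc r a) \<in> \<Gamma>) \<and>
      (\<forall>u a e. (u, a) \<in> \<Gamma> \<and> e \<in> lat S \<longrightarrow> (mop e u, mop e a) \<in> \<Gamma>) \<and>
      (\<forall>a. (0, a) \<in> \<Gamma> \<longrightarrow> a = 0)" for \<Gamma>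
  have "\<exists>M\<in>{\<Gamma>. good \<Gamma>}. \<forall>X\<in>{\<Gamma>. good \<Gamma>}. M \<subseteq> X \<longrightarrow> X = M"
  proof (rule subset_Zorn_nonempty)
    have "good ((\<lambda>z. (z, f z)) ` N)"
      unfolding good_def
      using f N submodD[OF N(1)] linD[of S N f] lin_zero[of S N f S] by (auto simp: image_iff)
    then show "{\<Gamma>. good \<Gamma>} \<noteq> {}" by blast
    fix C assume C: "C \<noteq> {}" "subset.chain {\<Gamma>. good \<Gamma>} C"
    have Cg: "good \<Gamma>" if "\<Gamma> \<in> C" for \<Gamma> using C(2) that by (auto simp: subset.chain_def)
    have pair: "\<exists>\<Gamma>\<in>C. x \<in> \<Gamma> \<and> y \<in> \<Gamma>" if "x \<in> \<Union>C" "y \<in> \<Union>C" for x y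
      using that subset_chain_def[THEN iffD1, OF C(2)] by blast
    show "\<Union>C \<in> {\<Gamma>. good \<Gamma>}"
      unfolding mem_Collect_eq good_def
    proof (intro conjI allI impI)
      show "(\<lambda>z. (z, f z)) ` N \<subseteq> \<Union>C" using C(1) Cg unfolding good_def by blast
      show "\<Union>C \<subseteq> P \<times> tors S" using Cg unfolding good_def by blast
      show "(u + v, a + b) \<in> \<Union>C" if "(u, a) \<in> \<Union>C \<and> (v, b) \<in> \<Union>C" for u v a b
        using pair[of "(u, a)" "(v, b)"] that Cg unfolding good_def by blast
      show "(sc r u, sc r a) \<in> \<Union>C" if "(u, a) \<in> \<Union>C" for u a r
        using that Cg unfolding good_def by blast
      show "(mop e u, mop e a) \<in> \<Union>C" if "(u, a) \<in> \<Union>C \<and> e \<in> lat S" for u a e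
        using that Cg unfolding good_def by blast
      show "a = 0" if "(0, a) \<in> \<Union>C" for a using that Cg unfolding good_def by blast
    qed
  qed
  then obtain \<Gamma> where \<Gamma>: "good \<Gamma>" and max: "\<And>X. good X \<Longrightarrow> \<Gamma> \<subseteq> X \<Longrightarrow> X = \<Gamma>" by blast
  have G: "\<And>z. z \<in> N \<Longrightarrow> (z, f z) \<in> \<Gamma>" "\<And>u a. (u, a) \<in> \<Gamma> \<Longrightarrow> u \<in> P \<and> a \<in> tors S"
    "\<And>u v a b. (u, a) \<in> \<Gamma> \<Longrightarrow> (v, b) \<in> \<Gamma> \<Longrightarrow> (u + v, a + b) \<in> \<Gamma>"
    "\<And>u a r. (u, a) \<in> \<Gamma> \<Longrightarrow> (sc r u, sc r a) \<in> \<Gamma>"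
    "\<And>u a e. (u, a) \<in> \<Gamma> \<Longrightarrow> e \<in> lat S \<Longrightarrow> (mop e u, mop e a) \<in> \<Gamma>"
    "\<And>a. (0, a) \<in> \<Gamma> \<Longrightarrow> a = 0"
    using \<Gamma> unfolding good_def by blast+
  have G00: "(0, 0) \<in> \<Gamma>"
    using G(1)[OF submod_zero[OF N(1)]] G(6) by metis
  have uniq: "a = b" if "(u, a) \<in> \<Gamma>" "(u, b) \<in> \<Gamma>" for u a b
  proof -
    have "(sc (-1) u, sc (-1) b) \<in> \<Gamma>" using G(4)[OF that(2)] .
    then have "(u + sc (-1) u, a + sc (-1) b) \<in> \<Gamma>" by (rule G(3)[OF that(1)])
    moreover have "u + sc (-1) u = 0" "a + sc (-1) b = a - b" by (simp_all add: fun_eq_iff fun_simps)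
    ultimately show ?thesis using G(6)[of "a - b"] by simp
  qed
  define D where "D = fst ` \<Gamma>"
  define F where "F u = (THE a. (u, a) \<in> \<Gamma>)" for u
  have F_eq: "F u = a" if "(u, a) \<in> \<Gamma>" for u a
    unfolding F_def by (rule the_equality) (use that uniq in blast)+
  have FG: "(u, F u) \<in> \<Gamma>" if "u \<in> D" for u
    using that F_eq by (force simp: D_def)
  have DI: "u \<in> D" if "(u, a) \<in> \<Gamma>" for u a using that by (force simp: D_def)
  have D: "submod S D"
    unfolding submod_def using G00 G(3)[OF FG FG] G(4)[OF FG] G(5)[OF FG] DI by blast
  have F: "lin S D F"
    unfolding lin_def using F_eq[OF G(3)[OF FG FG]] F_eq[OF G(4)[OF FG]] F_eq[OF G(5)[OF FG]] by simp
  have F_tors: "F ` D \<subseteq> tors S" using G(2)[OF FG] by blast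
  have "P \<subseteq> D"
  proof
    fix p assume p: "p \<in> P"
    obtain H where H: "lin S ?A H" "H ` ?A \<subseteq> tors S"
      "\<And>u. u \<in> ?A \<Longrightarrow> fext (\<lambda>_. p) u \<in> D \<Longrightarrow> H u = F (fext (\<lambda>_. p) u)"
      using baer_step[OF S D F F_tors, of p] by blast
    let ?act = "fext (\<lambda>_::nat. p)"
    have A: "submod S ?A" by (simp add: submod_Fr)
    have act: "lin S ?A ?act" by (rule lin_fext)
    have actP: "?act w \<in> P" if "w \<in> ?A" for w by (rule fext_in[OF P that p])
    \<comment> \<open>The graph on the sum of the domain and the cyclic module generated by
      p.\<close>
    define \<Gamma>' where "\<Gamma>' = {(u + ?act w, F u + H w) | u w. u \<in> D \<and> w \<in> ?A}"
    have \<Gamma>'I: "(u + ?act w, F u + H w) \<in> \<Gamma>'" if "u \<in> D" "w \<in> ?A" for u w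
      using that unfolding \<Gamma>'_def by blast
    have H0: "H 0 = 0" by (rule lin_zero[OF H(1) A])
    have F0: "F 0 = 0" by (rule lin_zero[OF F D])
    have sub: "\<Gamma> \<subseteq> \<Gamma>'"
    proof clarify
      fix u a assume ua: "(u, a) \<in> \<Gamma>"
      have "(u + ?act 0, F u + H 0) \<in> \<Gamma>'" by (rule \<Gamma>'I[OF DI[OF ua]]) simp
      then show "(u, a) \<in> \<Gamma>'" by (simp add: H0 F_eq[OF ua])
    qed
    have "good \<Gamma>'"
      unfolding good_def
    proof (intro conjI allI impI)
      show "(\<lambda>z. (z, f z)) ` N \<subseteq> \<Gamma>'" using sub G(1) by blast
      show "\<Gamma>' \<subseteq> P \<times> tors S"
        unfolding \<Gamma>'_def using G(2)[OF FG] actP H(2)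
        by (auto intro!: submod_add[OF P] submod_add[OF Q])
      show "(u + v, a + b) \<in> \<Gamma>'" if uv: "(u, a) \<in> \<Gamma>' \<and> (v, b) \<in> \<Gamma>'" for u v a b
      proof -
        obtain u' w v' x where *: "u = u' + ?act w" "a = F u' + H w" "u' \<in> D" "w \<in> ?A"
          "v = v' + ?act x" "b = F v' + H x" "v' \<in> D" "x \<in> ?A"
          using uv unfolding \<Gamma>'_def by blast
        have "((u' + v') + ?act (w + x), F (u' + v') + H (w + x)) \<in> \<Gamma>'"
          by (rule \<Gamma>'I) (use * submod_add[OF D] in auto)
        then show ?thesis
          using * lin_add[OF F, of u' v'] lin_add[OF H(1), of w x] lin_add[OF act, of w x]
          by (simp add: add.assoc add.left_commute)
      qed
      show "(sc r u, sc r a) \<in> \<Gamma>'" if uv: "(u, a) \<in> \<Gamma>'" for u a r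
      proof -
        obtain u' w where *: "u = u' + ?act w" "a = F u' + H w" "u' \<in> D" "w \<in> ?A"
          using uv unfolding \<Gamma>'_def by blast
        have "(sc r u' + ?act (sc r w), F (sc r u') + H (sc r w)) \<in> \<Gamma>'"
          by (rule \<Gamma>'I) (use * submod_sc[OF D] in auto)
        then show ?thesis
          using * lin_sc[OF F, of u' r] lin_sc[OF H(1), of w r] lin_sc[OF act, of w r]
          by (simp add: sc_add_right)
      qed
      show "(mop e u, mop e a) \<in> \<Gamma>'" if uv: "(u, a) \<in> \<Gamma>' \<and> e \<in> lat S" for u a e
      proof -
        obtain u' w where *: "u = u' + ?act w" "a = F u' + H w" "u' \<in> D" "w \<in> ?A"
          using uv unfolding \<Gamma>'_def by blast
        have "(mop e u' + ?act (mop e w), F (mop e u') + H (mop e w)) \<in> \<Gamma>'"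
          by (rule \<Gamma>'I) (use * uv submod_mop[OF D] in auto)
        then show ?thesis
          using * uv lin_mop[OF F, of e u'] lin_mop[OF H(1), of e w] lin_mop[OF act, of e w]
          by (simp add: mop_add)
      qed
      \<comment> \<open>Here the enlarged graph is seen to be single-valued: on the overlap of the
        two summands H agrees with F.\<close>
      show "a = 0" if uv: "(0, a) \<in> \<Gamma>'" for a
      proof -
        obtain u w where *: "0 = u + ?act w" "a = F u + H w" "u \<in> D" "w \<in> ?A"
          using uv unfolding \<Gamma>'_def by blast
        have aw: "?act w = - u" using *(1) by (metis add.commute eq_neg_iff_add_eq_0)
        then have "?act w \<in> D" using submod_uminus[OF D *(3)] by simp
        then have "H w = F (- u)" using H(3)[OF *(4)] aw by simp
        also have "\<dots> = F (0 - u)" by simp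
        also have "\<dots> = F 0 - F u" by (rule lin_diff[OF F D submod_zero[OF D] *(3)])
        finally show ?thesis using *(2) F0 by simp
      qed
    qed
    then have "\<Gamma>' = \<Gamma>" by (rule max[OF _ sub])
    moreover have "(0 + ?act (bas (0, 0)), F 0 + H (bas (0, 0))) \<in> \<Gamma>'"
      by (rule \<Gamma>'I) (simp_all add: submod_zero[OF D])
    ultimately show "p \<in> D" using DI by (simp add: fext_bas)
  qed
  then have "lin S P F" using lin_mono[OF F] by blast
  moreover have "F ` P \<subseteq> tors S" using F_tors \<open>P \<subseteq> D\<close> by blast
  ultimately show "\<exists>g. lin S P g \<and> g ` P \<subseteq> tors S \<and> (\<forall>z\<in>N. g z = f z)"
    using F_eq[OF G(1)] by blast
qed

end

section \<open>Torsion of extension obstructions\<close>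

lemma power_add_le: "(x + h) ^ k \<le> x ^ k + k * h * (x + h) ^ (k - 1)" for x h :: nat
proof (induction k)
  case (Suc k)
  have "(x + h) ^ Suc k = x * (x + h) ^ k + h * (x + h) ^ k" by (simp add: algebra_simps)
  also have "\<dots> \<le> x * (x ^ k + k * h * (x + h) ^ (k - 1)) + h * (x + h) ^ k"
    using Suc by simp
  also have "x * (k * h * (x + h) ^ (k - 1)) \<le> k * h * (x + h) ^ k"
  proof (cases k)
    case (Suc l)
    have "x * (x + h) ^ l \<le> (x + h) * (x + h) ^ l" by simp
    then have "k * h * (x * (x + h) ^ l) \<le> k * h * ((x + h) * (x + h) ^ l)" by (rule mult_le_mono2)
    then show ?thesis by (simp add: Suc ac_simps)
  qed simp
  then have "x * (x ^ k + k * h * (x + h) ^ (k - 1)) + h * (x + h) ^ k \<le> x ^ Suc k + Suc k * h * (x + h) ^ k"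
    by (simp add: algebra_simps)
  finally show ?case by simp
qed simp

text \<open>The shell of fixed thickness around a box of side 2 L + 1 has order L^(k - 1), so any
  constant multiple of it is eventually smaller than the box.\<close>

lemma shell_small:
  fixes C h k :: nat
  assumes "k \<ge> 1"
  shows "\<exists>L. C * ((2 * L + 1 + h) ^ k - (2 * L + 1) ^ k) < (2 * L + 1) ^ k"
proof -
  define L where "L = C * (k * h * (1 + h) ^ (k - 1))"
  define x where "x = 2 * L + 1"
  have "(x + h) ^ (k - 1) \<le> ((1 + h) * x) ^ (k - 1)" by (rule power_mono) (auto simp: x_def)
  then have "k * h * (x + h) ^ (k - 1) \<le> k * h * ((1 + h) * x) ^ (k - 1)" by (rule mult_le_mono2)
  then have "(x + h) ^ k - x ^ k \<le> k * h * ((1 + h) * x) ^ (k - 1)"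
    using power_add_le[of x h k] by linarith
  then have "C * ((x + h) ^ k - x ^ k) \<le> C * (k * h * ((1 + h) * x) ^ (k - 1))" by (rule mult_le_mono2)
  also have "\<dots> = L * x ^ (k - 1)" by (simp only: L_def power_mult_distrib ac_simps)
  also have "\<dots> < x * x ^ (k - 1)" by (rule mult_strict_right_mono) (auto simp: x_def)
  also have "\<dots> = x ^ k" using assms by (cases k) auto
  finally show ?thesis unfolding x_def by blast
qed

lemma card_cube:
  assumes "S \<subseteq> {..<m}"
  shows "finite {b\<in>lat S. \<forall>i\<in>S. \<bar>b i\<bar> \<le> int l}" "card {b\<in>lat S. \<forall>i\<in>S. \<bar>b i\<bar> \<le> int l} = (2 * l + 1) ^ card S"
proof -
  let ?B = "\<lambda>i. if i \<in> S then {- int l..int l} else {0}"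
  have eq: "{b\<in>lat S. \<forall>i\<in>S. \<bar>b i\<bar> \<le> int l} = {a \<in> lat {..<m}. \<forall>i<m. a i \<in> ?B i}"
  proof (rule Set.set_eqI, rule iffI)
    fix a assume "a \<in> {b\<in>lat S. \<forall>i\<in>S. \<bar>b i\<bar> \<le> int l}"
    then have a: "a \<in> lat S" "\<And>i. i \<in> S \<Longrightarrow> \<bar>a i\<bar> \<le> int l" by auto
    have "a i \<in> ?B i" for i using a(1) a(2)[of i] by (auto simp: lat_def)
    then show "a \<in> {a \<in> lat {..<m}. \<forall>i<m. a i \<in> ?B i}" using lat_mono[OF assms a(1)] by blast
  next
    fix a assume a: "a \<in> {a \<in> lat {..<m}. \<forall>i<m. a i \<in> ?B i}"
    have *: "a i \<in> ?B i" for i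
    proof (cases "i < m")
      case False
      then have "a i = 0" using a by (auto simp: lat_def)
      then show ?thesis by simp
    qed (use a in blast)
    have "a i = 0" if "i \<notin> S" for i using *[of i] that by simp
    moreover have "\<bar>a i\<bar> \<le> int l" if "i \<in> S" for i using *[of i] that by (simp add: abs_le_iff)
    ultimately show "a \<in> {b\<in>lat S. \<forall>i\<in>S. \<bar>b i\<bar> \<le> int l}" by (simp add: lat_def)
  qed
  show "finite {b\<in>lat S. \<forall>i\<in>S. \<bar>b i\<bar> \<le> int l}" unfolding eq by (rule card_bounded_funs(1)) simp
  have "card {a \<in> lat {..<m}. \<forall>i<m. a i \<in> ?B i} = (\<Prod>i<m. card (?B i))"
    by (rule card_bounded_funs(2)) simp
  also have "\<dots> = (\<Prod>i<m. if i \<in> S then 2 * l + 1 else 1)" by (rule prod.cong) (auto simp: nat_add_distrib)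
  also have "\<dots> = (\<Prod>i\<in>{..<m} \<inter> S. 2 * l + 1)" by (rule prod.inter_restrict[symmetric]) simp
  also have "\<dots> = (2 * l + 1) ^ card S" using assms by (simp add: Int_absorb1)
  finally show "card {b\<in>lat S. \<forall>i\<in>S. \<bar>b i\<bar> \<le> int l} = (2 * l + 1) ^ card S" unfolding eq .
qed

text \<open>Linear over the field, but not compatible with monomials; the discrepancy is
  concentrated near the boundary of \<open>W\<close>.\<close>

definition cutoff :: "expo set \<Rightarrow> ('x \<times> expo \<Rightarrow> 'k::field) \<Rightarrow> 'x \<times> expo \<Rightarrow> 'k" where
  "cutoff W f = (\<lambda>p. if snd p \<in> W then f p else 0)"

lemma cutoff_sum: "cutoff W (\<Sum>i\<in>I. f i) = (\<Sum>i\<in>I. cutoff W (f i))"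
  by (rule HOL.ext) (simp add: cutoff_def sum_fun_apply)

lemma cutoff_sc: "cutoff W (sc r f) = sc r (cutoff W f)"
  by (rule HOL.ext) (simp add: cutoff_def sc_apply)

lemma sum_nonzero_obtain:
  assumes "(\<Sum>i\<in>I. f i) \<noteq> (0 :: 'a::comm_monoid_add)"
  obtains i where "i \<in> I" "f i \<noteq> 0"
  using assms sum.neutral[of I f] by blast

context qt
begin

text \<open>The element \<open>e\<close> of the injective module is an indicator of a sparse set of points. Cutting the
  extension off outside a box around one of its points leaves an error supported near the boundary
  of the box; there are fewer boundary points than translates of the box.\<close>

lemma window:
  fixes z v :: "nat \<Rightarrow> nat \<times> expo \<Rightarrow> 'k"
  assumes S: "S \<subseteq> {..<m}" "S \<noteq> {}"
    and z: "\<And>y. y < s \<Longrightarrow> z y \<in> Fr {..<m} {..<r}"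
    and v: "\<And>y. y < s \<Longrightarrow> v y \<in> Fr {..<m} {..<1}"
    and ext: "\<And>e. e \<in> tors S \<Longrightarrow> \<exists>\<Psi>. lin {..<m} (Fr {..<m} {..<r}) \<Psi> \<and>
      \<Psi> ` Fr {..<m} {..<r} \<subseteq> tors S \<and> (\<forall>y<s. \<Psi> (z y) = fext (\<lambda>_. e) (v y))"
  shows "\<exists>t \<psi>. finite (supp t) \<and> supp t \<subseteq> lat S \<and> t \<noteq> 0 \<and> lin {..<m} (Fr {..<m} {..<r}) \<psi> \<and>
    \<psi> ` Fr {..<m} {..<r} \<subseteq> Fr {..<m} {..<1} \<and>
    (\<forall>y<s. \<psi> (z y) = (\<Sum>a\<in>supp t. sc (t a) (rop a (v y))))"
proof -
  let ?M = "{..<m}" let ?P = "Fr ?M {..<r} :: (nat \<times> expo \<Rightarrow> 'k) set"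
  obtain i0 where i0: "i0 \<in> S" using S by blast
  \<comment> \<open>Powers of two along one direction: the distances between these points grow, so a
    window of any size around a late point contains no other.\<close>
  define cc :: "nat \<Rightarrow> expo" where "cc N = axis i0 (2 ^ N)" for N
  have cc_lat: "cc N \<in> lat S" for N unfolding cc_def by (rule axis_lat[OF i0])
  have cc_m: "cc N \<in> lat ?M" for N by (rule lat_mono[OF S(1) cc_lat])
  define e :: "nat \<times> expo \<Rightarrow> 'k" where "e = (\<lambda>p. if fst p = 0 \<and> snd p \<in> range cc then 1 else 0)"
  have "e \<in> tors S"
  proof (rule torsI)
    show "supp e \<subseteq> {0} \<times> lat ?M" using cc_m by (force simp: supp_iff e_def split: if_splits)
    show "finite {0 :: expo}" by simp
    show "rst S a \<in> {0}" if "(0, a) \<in> supp e" for a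
      using that rst_lat[OF cc_lat] by (force simp: supp_iff e_def split: if_splits)
  qed
  then obtain \<Psi> where \<Psi>: "lin ?M ?P \<Psi>" "\<Psi> ` ?P \<subseteq> tors S" "\<And>y. y < s \<Longrightarrow> \<Psi> (z y) = fext (\<lambda>_. e) (v y)"
    using ext by blast
  define \<psi>0 where "\<psi>0 x = \<Psi> (bas (x, 0))" for x
  have \<psi>0: "\<psi>0 x \<in> tors S" if "x < r" for x using that \<Psi>(2) by (auto simp: \<psi>0_def)
  define R where "R = (\<Union>x<r. rst S ` snd ` supp (\<psi>0 x))"
  have R: "finite R" unfolding R_def using \<psi>0 by (auto simp: tors_def)
  define As where "As = (\<Union>y<s. snd ` supp (z y)) \<union> (\<Union>y<s. snd ` supp (v y))"
  have As: "finite As" unfolding As_def using z v Fr_finite by blast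
  \<comment> \<open>The finitely many cosets in which boundary errors can lie: a coset of a value of
    \<Psi>, shifted by an exponent from the relations.\<close>
  define Bf where "Bf = (\<lambda>(a, b). rst S a + b) ` (As \<times> R)"
  have Bf: "finite Bf" unfolding Bf_def using As R by simp
  define \<rho> where "\<rho> = nat (Max (insert 0 ((\<lambda>(a, i). \<bar>a i\<bar>) ` (As \<times> S))))"
  have finS: "finite S" using S(1) finite_subset by blast
  have \<rho>: "\<bar>a i\<bar> \<le> int \<rho>" if "a \<in> As" "i \<in> S" for a i
  proof -
    have "\<bar>a i\<bar> \<le> Max (insert 0 ((\<lambda>(a, i). \<bar>a i\<bar>) ` (As \<times> S)))"
      by (rule Max_ge) (use As finS that in force)+
    moreover from this have "0 \<le> Max (insert 0 ((\<lambda>(a, i). \<bar>a i\<bar>) ` (As \<times> S)))"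
      using abs_ge_zero order_trans by blast
    ultimately show ?thesis by (simp only: \<rho>_def int_nat_eq if_True)
  qed
  define k where "k = card S"
  have k: "k \<ge> 1" unfolding k_def using S(2) finS by (simp add: Suc_le_eq card_gt_0_iff)
  \<comment> \<open>Errors occur at distance between L and L + 2 \<rho> from the centre, where
    \<rho> bounds the exponents of the data along \<open>S\<close>. The shell has outer side 2 (L +
    2 \<rho>) + 1, whence the term 4 \<rho>; the factor counts s values and the cosets in
    \<open>Bf\<close>.\<close>
  obtain L where L: "(s * card Bf) * ((2 * L + 1 + 4 * \<rho>) ^ k - (2 * L + 1) ^ k) < (2 * L + 1) ^ k"
    using shell_small[OF k] by blast
  define Rd where "Rd = int L + int \<rho>"
  define Ds where "Ds = {d\<in>lat S. \<forall>i\<in>S. \<bar>d i\<bar> \<le> int L}"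
  have Ds: "finite Ds" "card Ds = (2 * L + 1) ^ k" unfolding Ds_def k_def by (rule card_cube[OF S(1)])+
  \<comment> \<open>The shell after translation back to the origin; it is the same for all
    translates d.\<close>
  define Sh :: "(nat \<times> expo) set" where
    "Sh = {(0, b) | b. rst S b \<in> Bf \<and> (\<forall>i\<in>S. \<bar>b i\<bar> \<le> int (L + 2 * \<rho>)) \<and> (\<exists>i\<in>S. int L < \<bar>b i\<bar>)}"
  have Sh: "finite Sh \<and> card Sh \<le> card Bf * ((2 * L + 1 + 4 * \<rho>) ^ k - (2 * L + 1) ^ k)"
  proof -
    define B1 where "B1 = {b\<in>lat S. \<forall>i\<in>S. \<bar>b i\<bar> \<le> int (L + 2 * \<rho>)}"
    have B1: "finite B1" "card B1 = (2 * L + 1 + 4 * \<rho>) ^ k"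
      unfolding B1_def k_def using card_cube[OF S(1), of "L + 2 * \<rho>"] by (simp_all add: algebra_simps)
    have "Ds \<subseteq> B1" unfolding Ds_def B1_def by force
    then have cd: "card (B1 - Ds) = (2 * L + 1 + 4 * \<rho>) ^ k - (2 * L + 1) ^ k"
      using card_Diff_subset[OF Ds(1)] B1(2) Ds(2) by simp
    have "Sh \<subseteq> (\<lambda>(b, q). (0, b + q)) ` ((B1 - Ds) \<times> Bf)"
    proof
      fix p assume "p \<in> Sh"
      then obtain b where b: "p = (0, b)" "rst S b \<in> Bf" "\<forall>i\<in>S. \<bar>b i\<bar> \<le> int (L + 2 * \<rho>)" "\<exists>i\<in>S. int L < \<bar>b i\<bar>"
        unfolding Sh_def by blast
      have "(b - rst S b) i = b i" if "i \<in> S" for i using that by (simp add: rst_def)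
      then have "b - rst S b \<in> B1 - Ds" using b(3,4) diff_rst unfolding B1_def Ds_def by fastforce
      then show "p \<in> (\<lambda>(b, q). (0, b + q)) ` ((B1 - Ds) \<times> Bf)"
        using b(1,2) by (intro image_eqI[of _ _ "(b - rst S b, rst S b)"]) auto
    qed
    moreover have fin: "finite ((B1 - Ds) \<times> Bf)" using B1 Bf by simp
    ultimately have "finite Sh" "card Sh \<le> card ((B1 - Ds) \<times> Bf)"
      using finite_surj surj_card_le by blast+
    then show ?thesis using cd by (simp add: card_cartesian_product ac_simps)
  qed
  have main: "\<exists>\<psi>. lin ?M ?P \<psi> \<and> \<psi> ` ?P \<subseteq> Fr ?M {..<1} \<and> (\<forall>y<s. supp (rop d (v y) - \<psi> (z y)) \<subseteq> Sh)"
    if d: "d \<in> Ds" for d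
  proof -
    have dS: "d \<in> lat S" "\<And>i. i \<in> S \<Longrightarrow> \<bar>d i\<bar> \<le> int L" using d by (auto simp: Ds_def)
    \<comment> \<open>Chosen so that the neighbours of 2^(N + 1) among the powers of two are more
      than 2 Rd away.\<close>
    define N where "N = nat (2 * Rd + 2)"
    have N: "2 * Rd + 2 < 2 ^ N"
      using of_nat_less_two_power[of N, where 'a = int] by (simp add: N_def Rd_def)
    define c0 where "c0 = cc (Suc N)"
    have iso: "2 * Rd < \<bar>2 ^ K - 2 ^ Suc N\<bar>" if "K \<noteq> Suc N" for K
    proof (cases "K < Suc N")
      case True
      then have "(2::int) ^ K \<le> 2 ^ N" by (intro power_increasing) auto
      then show ?thesis using N unfolding power_Suc by linarith
    next
      case False
      then have "(2::int) ^ Suc (Suc N) \<le> 2 ^ K" using that by (intro power_increasing) auto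
      then show ?thesis using N unfolding power_Suc by linarith
    qed
    \<comment> \<open>The window of radius L + \<rho> around \<open>c0 - d\<close>; as d has size at
      most L, it contains \<open>c0 + a\<close> for every exponent a of the data.\<close>
    define W where "W = {b. \<forall>i\<in>S. \<bar>b i - (c0 i - d i)\<bar> \<le> Rd}"
    have cut_Fr: "cutoff W q \<in> Fr ?M {..<1}" if q: "q \<in> tors S" for q
    proof -
      have sub: "supp (cutoff W q) \<subseteq> Pair 0 ` ((\<lambda>(b, g). b + (c0 - d) + g) ` ({b\<in>lat S. \<forall>i\<in>S. \<bar>b i\<bar> \<le> int (L + \<rho>)} \<times> rst S ` snd ` supp q))"
      proof
        fix p assume "p \<in> supp (cutoff W q)"
        then have p: "p \<in> supp q" "snd p \<in> W" by (auto simp: supp_iff cutoff_def split: if_splits)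
        then obtain b where b: "p = (0, b)" using q by (auto simp: tors_def)
        define b' where "b' = b - rst S b - (c0 - d)"
        have "b' \<in> lat S" unfolding b'_def c0_def using diff_rst cc_lat dS(1) by simp
        moreover have "\<bar>b' i\<bar> \<le> int (L + \<rho>)" if "i \<in> S" for i
          using p(2) that unfolding b W_def b'_def by (auto simp: rst_def Rd_def)
        ultimately show "p \<in> Pair 0 ` ((\<lambda>(b, g). b + (c0 - d) + g) ` ({b\<in>lat S. \<forall>i\<in>S. \<bar>b i\<bar> \<le> int (L + \<rho>)} \<times> rst S ` snd ` supp q))"
          unfolding b using p(1) b
          by (intro imageI image_eqI[of _ _ "(b', rst S b)"]) (auto simp: b'_def image_iff intro!: bexI[of _ "(0, b)"])
      qed
      have "finite (rst S ` snd ` supp q)" using q by (simp add: tors_def)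
      then have "finite (supp (cutoff W q))"
        using card_cube(1)[OF S(1), of "L + \<rho>"]
        by (intro finite_subset[OF sub] finite_imageI[where h = "Pair 0"]
            finite_imageI[where h = "\<lambda>(b, g). b + (c0 - d) + g"] finite_cartesian_product)
      moreover have "supp (cutoff W q) \<subseteq> supp q" by (auto simp: supp_iff cutoff_def split: if_splits)
      ultimately show ?thesis using q by (auto simp: Fr_def tors_def)
    qed
    define \<Psi>W where "\<Psi>W = fext (\<lambda>x. cutoff W (\<psi>0 x))"
    have \<Psi>W: "lin ?M ?P \<Psi>W" "\<And>f. f \<in> ?P \<Longrightarrow> \<Psi>W f \<in> Fr ?M {..<1}"
      unfolding \<Psi>W_def by (rule lin_fext, rule fext_in[OF submod_Fr[OF order_refl]], assumption, rule cut_Fr, rule \<psi>0, simp)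
    have err: "b \<in> W \<longleftrightarrow> b - a \<notin> W \<Longrightarrow> (\<forall>i\<in>S. \<bar>b i - (c0 i - d i)\<bar> \<le> int (L + 2 * \<rho>)) \<and> (\<exists>i\<in>S. int L < \<bar>b i - (c0 i - d i)\<bar>)"
      if a: "a \<in> As" for a b
    proof -
      assume x: "b \<in> W \<longleftrightarrow> b - a \<notin> W"
      have a': "\<bar>a i\<bar> \<le> int \<rho>" if "i \<in> S" for i using \<rho>[OF a that] .
      show ?thesis
      proof (cases "b \<in> W")
        case True
        then have 1: "\<bar>b i - (c0 i - d i)\<bar> \<le> Rd" if "i \<in> S" for i using that by (simp add: W_def)
        obtain i where i: "i \<in> S" "\<not> \<bar>(b - a) i - (c0 i - d i)\<bar> \<le> Rd" using x True by (auto simp: W_def)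
        have "int L < \<bar>b i - (c0 i - d i)\<bar>" using i(2) a'[OF i(1)] unfolding Rd_def minus_apply by linarith
        moreover have "\<bar>b i - (c0 i - d i)\<bar> \<le> int (L + 2 * \<rho>)" if "i \<in> S" for i using 1[OF that] by (simp add: Rd_def)
        ultimately show ?thesis using i(1) by blast
      next
        case False
        then have "b - a \<in> W" using x by blast
        then have 1: "\<bar>(b - a) i - (c0 i - d i)\<bar> \<le> Rd" if "i \<in> S" for i using that by (simp add: W_def)
        obtain i where i: "i \<in> S" "\<not> \<bar>b i - (c0 i - d i)\<bar> \<le> Rd" using False by (auto simp: W_def)
        have "int L < \<bar>b i - (c0 i - d i)\<bar>" using i(2) by (simp add: Rd_def)
        moreover have "\<bar>b i - (c0 i - d i)\<bar> \<le> int (L + 2 * \<rho>)" if "i \<in> S" for i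
          using 1[OF that] a'[OF that] unfolding Rd_def minus_apply by linarith
        ultimately show ?thesis using i(1) by blast
      qed
    qed
    \<comment> \<open>Only the point c0 of e is visible through the window, so the cut-off product
      with e is right multiplication by its monomial, with no boundary error.\<close>
    have cutv: "cutoff W (fext (\<lambda>_. e) (v y)) = rop c0 (v y)" if y: "y < s" for y
    proof (rule HOL.ext, clarify)
      fix x b
      have vA: "a \<in> As" if "(x, a) \<in> supp (v y)" for x a using that y by (force simp: As_def)
      have v0: "x = 0" if "(x, a) \<in> supp (v y)" for x a using v[OF y] that by (auto simp: Fr_def)
      have fin: "finite (supp (v y))" using v[OF y] by (rule Fr_finite)
      have inW: "c0 + a \<in> W" if "a \<in> As" for a
        unfolding W_def mem_Collect_eq
      proof
        fix i assume "i \<in> S"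
        then show "\<bar>(c0 + a) i - (c0 i - d i)\<bar> \<le> Rd"
          using \<rho>[OF that] dS(2) unfolding Rd_def plus_fun_apply by fastforce
      qed
      have only: "K = Suc N" if a: "a \<in> As" "cc K + a \<in> W" for K a
      proof (rule ccontr)
        assume "K \<noteq> Suc N"
        then have 1: "2 * Rd < \<bar>2 ^ K - 2 ^ Suc N\<bar>" by (rule iso)
        have "\<bar>(cc K + a) i0 - (c0 i0 - d i0)\<bar> \<le> Rd" using a(2) i0 by (simp add: W_def)
        then have "\<bar>2 ^ K + a i0 - (2 ^ Suc N - d i0)\<bar> \<le> Rd" by (simp add: cc_def c0_def axis_apply plus_fun_apply)
        moreover have "\<bar>u\<bar> \<le> r \<Longrightarrow> \<bar>u'\<bar> \<le> l \<Longrightarrow> 2 * (l + r) < \<bar>x - x'\<bar> \<Longrightarrow> \<not> \<bar>x + u - (x' - u')\<bar> \<le> l + r"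
          for u u' x x' l r :: int by (unfold abs_le_iff not_le abs_if, simp split: if_splits; linarith | arith | smt (verit))
        ultimately show False using 1 \<rho>[OF a(1) i0] dS(2)[OF i0] unfolding Rd_def by blast
      qed
      show "cutoff W (fext (\<lambda>_. e) (v y)) (x, b) = rop c0 (v y) (x, b)"
      proof (cases "b \<in> W")
        case True
        have "fext (\<lambda>_. e) (v y) (x, b) = (\<Sum>p\<in>supp (v y). v y p * (bc (snd p) (b - snd p) * e (x, b - snd p)))"
          by (simp add: fext_def lext_def fun_simps case_prod_unfold mop_apply)
        also have "\<dots> = (\<Sum>p\<in>supp (v y). if p = (x, b - c0) then bc (b - c0) c0 * v y (x, b - c0) else 0)"
        proof (rule sum.cong[OF refl])
          fix p assume p: "p \<in> supp (v y)"
          have p0: "fst p = 0" "snd p \<in> As" using v0[of "fst p" "snd p"] vA[of "fst p" "snd p"] p unfolding prod.collapse by blast+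
          show "v y p * (bc (snd p) (b - snd p) * e (x, b - snd p)) =
              (if p = (x, b - c0) then bc (b - c0) c0 * v y (x, b - c0) else 0)"
          proof (cases "x = 0 \<and> b - snd p \<in> range cc")
            case T: True
            then obtain K where K: "b - snd p = cc K" by blast
            have "cc K + snd p \<in> W" using True K by (simp flip: K)
            then have "K = Suc N" by (rule only[OF p0(2)])
            then have b: "b - snd p = c0" using K by (simp add: c0_def)
            have sp: "snd p = b - c0" unfolding b[symmetric] by simp
            have pp: "p = (x, b - c0)" using p0(1) T sp by (simp add: prod_eq_iff)
            show ?thesis using T by (simp add: pp e_def mult.commute)
          next
            case F: False
            have "p \<noteq> (x, b - c0)"
            proof
              assume pp: "p = (x, b - c0)"
              then have "b - snd p = c0" by simp
              then show False using F p0(1) pp by (simp add: c0_def)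
            qed
            moreover have "e (x, b - snd p) = 0" using F by (auto simp: e_def)
            ultimately show ?thesis by simp
          qed
        qed
        also have "\<dots> = bc (b - c0) c0 * v y (x, b - c0)" using fin by (simp add: supp_iff)
        finally show ?thesis using True by (simp add: cutoff_def rop_apply)
      next
        case False
        have "v y (x, b - c0) = 0"
        proof (rule ccontr)
          assume "v y (x, b - c0) \<noteq> 0"
          then have "b - c0 \<in> As" using vA by (simp add: supp_iff)
          then have "c0 + (b - c0) \<in> W" by (rule inW)
          then show False using False by simp
        qed
        then show ?thesis using False by (simp add: cutoff_def rop_apply)
      qed
    qed
    define \<mu> where "\<mu> = bc c0 (d - c0)"
    \<comment> \<open>Right multiplication moves c0 to d, and \<mu> is the resulting scalar; so
      \<psi> has the values \<open>rop d (v y)\<close> up to the boundary error.\<close>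
    define \<psi> where "\<psi> f = sc (inverse \<mu>) (rop (d - c0) (\<Psi>W f))" for f
    have dc: "d - c0 \<in> lat S" unfolding c0_def using dS(1) cc_lat by simp
    have "lin ?M ?P \<psi>"
      unfolding lin_def \<psi>_def using linD[OF \<Psi>W(1)]
      by (simp add: rop_add rop_sc sc_add_right mop_rop mop_sc mult.commute)
    moreover have "\<psi> ` ?P \<subseteq> Fr ?M {..<1}"
      unfolding \<psi>_def using \<Psi>W(2) lat_mono[OF S(1) dc] by auto
    moreover have "supp (rop d (v y) - \<psi> (z y)) \<subseteq> Sh" if y: "y < s" for y
    proof -
      define Dy where "Dy = cutoff W (\<Psi> (z y)) - \<Psi>W (z y)"
      have "\<Psi> (z y) = fext \<psi>0 (z y)" unfolding \<psi>0_def by (rule lin_eq_fext[OF \<Psi>(1) z[OF y]])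
      then have Dy: "Dy = (\<Sum>p\<in>supp (z y). sc (z y p) (cutoff W (mop (snd p) (\<psi>0 (fst p))) - mop (snd p) (cutoff W (\<psi>0 (fst p)))))"
        unfolding Dy_def \<Psi>W_def fext_def lext_def case_prod_unfold
        by (simp add: cutoff_sum cutoff_sc fs.scale_right_diff_distrib sum_subtractf)
      have "rop (d - c0) (rop c0 (v y)) = sc \<mu> (rop d (v y))" unfolding rop_rop \<mu>_def by simp
      moreover have "\<mu> \<noteq> 0" by (simp add: \<mu>_def)
      ultimately have eq: "rop d (v y) - \<psi> (z y) = sc (inverse \<mu>) (rop (d - c0) Dy)"
        unfolding Dy_def \<psi>_def \<Psi>(3)[OF y] cutv[OF y] rop_diff fs.scale_right_diff_distrib by simp
      show ?thesis
      proof
        fix p assume "p \<in> supp (rop d (v y) - \<psi> (z y))"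
        then have "p \<in> supp (rop (d - c0) Dy)" unfolding eq by (rule subsetD[OF supp_sc])
        then obtain x b where b: "p = (x, d - c0 + b)" "(x, b) \<in> supp Dy" unfolding supp_rop by auto
        have "(\<Sum>p\<in>supp (z y). (sc (z y p) (cutoff W (mop (snd p) (\<psi>0 (fst p))) - mop (snd p) (cutoff W (\<psi>0 (fst p))))) (x, b)) \<noteq> 0"
          using b(2) unfolding Dy supp_iff sum_fun_apply .
        then obtain q where q: "q \<in> supp (z y)"
          "(sc (z y q) (cutoff W (mop (snd q) (\<psi>0 (fst q))) - mop (snd q) (cutoff W (\<psi>0 (fst q))))) (x, b) \<noteq> 0"
          by (rule sum_nonzero_obtain)
        have qA: "snd q \<in> As" using q(1) y by (force simp: As_def)
        have qr: "fst q < r" using q(1) z[OF y] by (auto simp: Fr_def)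
        have "(if b \<in> W then mop (snd q) (\<psi>0 (fst q)) (x, b) else 0) -
            bc (snd q) (b - snd q) * (if b - snd q \<in> W then \<psi>0 (fst q) (x, b - snd q) else 0) \<noteq> 0"
          using q(2) by (simp add: sc_apply cutoff_def mop_apply)
        then have ne: "b \<in> W \<longleftrightarrow> b - snd q \<notin> W" and nz: "(x, b - snd q) \<in> supp (\<psi>0 (fst q))"
          by (simp_all add: mop_apply supp_iff split: if_splits)
        have x0: "x = 0" using nz \<psi>0[OF qr] by (auto simp: tors_def)
        have "rst S (b - snd q) \<in> R" unfolding R_def using nz qr by force
        then have "rst S (snd q) + rst S (b - snd q) \<in> Bf" unfolding Bf_def
          using qA by (intro image_eqI[of _ _ "(snd q, rst S (b - snd q))"]) auto
        moreover have "rst S (d - c0 + b) = rst S (snd q) + rst S (b - snd q)"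
          using rst_add[of S "snd q" "b - snd q"] rst_add[of S "d - c0" b] rst_lat[OF dc] by simp
        ultimately have "rst S (d - c0 + b) \<in> Bf" by simp
        moreover have "(d - c0 + b) i = b i - (c0 i - d i)" for i by (simp add: plus_fun_apply)
        ultimately show "p \<in> Sh" using err[OF qA ne] unfolding Sh_def b(1) x0 by simp
      qed
    qed
    ultimately show ?thesis by blast
  qed
  then obtain \<psi>d where \<psi>d: "\<And>d. d \<in> Ds \<Longrightarrow> lin ?M ?P (\<psi>d d)" "\<And>d. d \<in> Ds \<Longrightarrow> \<psi>d d ` ?P \<subseteq> Fr ?M {..<1}"
    "\<And>d y. d \<in> Ds \<Longrightarrow> y < s \<Longrightarrow> supp (rop d (v y) - \<psi>d d (z y)) \<subseteq> Sh" by metis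
  \<comment> \<open>The errors for all y < s joined to one vector. These vectors lie in a space
    whose dimension, s times the size of the shell, is less than the number of translates, so a
    combination of translates has no error at all.\<close>
  define u where "u d = (\<lambda>(y, p). if y < s then (rop d (v y) - \<psi>d d (z y)) p else 0)" for d
  have "\<exists>t. (\<exists>d\<in>Ds. t d \<noteq> 0) \<and> (\<Sum>d\<in>Ds. sc (t d) (u d)) = 0"
  proof (rule exists_dependency[OF Ds(1)])
    show "finite (bas ` ({..<s} \<times> Sh) :: (_ \<Rightarrow> 'k) set)" using Sh by simp
    have "card (bas ` ({..<s} \<times> Sh) :: (_ \<Rightarrow> 'k) set) \<le> s * card Sh"
      using card_image_le[of "{..<s} \<times> Sh" bas] Sh by (simp add: card_cartesian_product)
    also have "\<dots> \<le> s * (card Bf * ((2 * L + 1 + 4 * \<rho>) ^ k - (2 * L + 1) ^ k))"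
      using Sh by (intro mult_le_mono2) blast
    also have "\<dots> < card Ds" using L Ds(2) by (simp add: mult.assoc)
    finally show "card (bas ` ({..<s} \<times> Sh) :: (_ \<Rightarrow> 'k) set) < card Ds" .
    fix d assume d: "d \<in> Ds"
    have fin: "finite ({..<s} \<times> Sh)" using Sh by simp
    have sub: "supp (u d) \<subseteq> {..<s} \<times> Sh"
    proof
      fix q assume q: "q \<in> supp (u d)"
      obtain y p where yp: "q = (y, p)" by (cases q)
      then have "y < s" "p \<in> supp (rop d (v y) - \<psi>d d (z y))" using q by (auto simp: u_def supp_iff split: if_splits)
      then show "q \<in> {..<s} \<times> Sh" using \<psi>d(3)[OF d] yp by blast
    qed
    have "u d = (\<Sum>p\<in>{..<s} \<times> Sh. sc (u d p) (bas p))" by (rule bas_expansion[OF fin sub])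
    moreover have "\<dots> \<in> fs.span (bas ` ({..<s} \<times> Sh))" by (intro fs.span_sum fs.span_scale fs.span_base) auto
    ultimately show "u d \<in> fs.span (bas ` ({..<s} \<times> Sh))" by (simp only:)
  qed
  then obtain t0 d0 where t0: "d0 \<in> Ds" "t0 d0 \<noteq> 0" "(\<Sum>d\<in>Ds. sc (t0 d) (u d)) = 0" by blast
  define t where "t d = (if d \<in> Ds then t0 d else 0)" for d
  define \<psi> where "\<psi> f = (\<Sum>d\<in>Ds. sc (t d) (\<psi>d d f))" for f
  have suppt: "supp t \<subseteq> Ds" by (auto simp: supp_iff t_def split: if_splits)
  have "t d0 \<noteq> 0" using t0 by (simp add: t_def)
  then have "t \<noteq> 0" by (auto simp: zero_fun_apply)
  moreover have "finite (supp t)" by (rule finite_subset[OF suppt Ds(1)])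
  moreover have "supp t \<subseteq> lat S" using suppt by (auto simp: Ds_def)
  moreover have "lin ?M ?P \<psi>"
    unfolding lin_def \<psi>_def
  proof (intro conjI ballI allI)
    fix f g assume fg: "f \<in> ?P" "g \<in> ?P"
    have "(\<Sum>d\<in>Ds. sc (t d) (\<psi>d d (f + g))) = (\<Sum>d\<in>Ds. sc (t d) (\<psi>d d f) + sc (t d) (\<psi>d d g))"
      by (rule sum.cong) (simp_all add: lin_add[OF \<psi>d(1) fg] sc_add_right)
    then show "(\<Sum>d\<in>Ds. sc (t d) (\<psi>d d (f + g))) = (\<Sum>d\<in>Ds. sc (t d) (\<psi>d d f)) + (\<Sum>d\<in>Ds. sc (t d) (\<psi>d d g))"
      by (simp add: sum.distrib)
  next
    fix q f assume f: "f \<in> ?P"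
    have "(\<Sum>d\<in>Ds. sc (t d) (\<psi>d d (sc q f))) = (\<Sum>d\<in>Ds. sc q (sc (t d) (\<psi>d d f)))"
      by (rule sum.cong) (simp_all add: lin_sc[OF \<psi>d(1) f] mult.commute)
    then show "(\<Sum>d\<in>Ds. sc (t d) (\<psi>d d (sc q f))) = sc q (\<Sum>d\<in>Ds. sc (t d) (\<psi>d d f))" by (simp only: sc_sum)
  next
    fix a f assume a: "a \<in> lat ?M" and f: "f \<in> ?P"
    show "(\<Sum>d\<in>Ds. sc (t d) (\<psi>d d (mop a f))) = mop a (\<Sum>d\<in>Ds. sc (t d) (\<psi>d d f))"
      unfolding mop_sum mop_sc by (rule sum.cong) (simp_all add: lin_mop[OF \<psi>d(1) a f])
  qed
  moreover have "\<psi> ` ?P \<subseteq> Fr ?M {..<1}"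
    unfolding \<psi>_def image_subset_iff
    by (intro ballI submod_sum[OF submod_Fr[OF order_refl]] Fr_sc) (use \<psi>d(2) in blast)
  moreover have "\<psi> (z y) = (\<Sum>a\<in>supp t. sc (t a) (rop a (v y)))" if y: "y < s" for y
  proof -
    have "(\<Sum>d\<in>Ds. sc (t d) (rop d (v y))) - \<psi> (z y) = (\<Sum>d\<in>Ds. sc (t d) (rop d (v y) - \<psi>d d (z y)))"
      by (simp add: \<psi>_def fs.scale_right_diff_distrib sum_subtractf)
    also have "\<dots> = 0"
    proof
      fix p
      have "(\<Sum>d\<in>Ds. sc (t d) (rop d (v y) - \<psi>d d (z y))) p = (\<Sum>d\<in>Ds. sc (t0 d) (u d)) (y, p)"
        using y by (simp add: fun_simps u_def t_def)
      then show "(\<Sum>d\<in>Ds. sc (t d) (rop d (v y) - \<psi>d d (z y))) p = 0 p" using t0(3) by (simp add: zero_fun_apply)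
    qed
    finally have "\<psi> (z y) = (\<Sum>d\<in>Ds. sc (t d) (rop d (v y)))" by simp
    also have "\<dots> = (\<Sum>a\<in>supp t. sc (t a) (rop a (v y)))"
      by (rule sum.mono_neutral_right[OF Ds(1) suppt]) (simp add: supp_iff)
    finally show ?thesis .
  qed
  ultimately show ?thesis by blast
qed

end

section \<open>Resolutions of left ideals\<close>

context qt
begin

text \<open>\<open>good d L\<close>: the submodule \<open>L\<close> of a free module has a resolution of length \<open>d\<close> whose last term
  is a direct summand of a free module and whose other terms are free.\<close>

primrec good :: "nat \<Rightarrow> ('x \<times> expo \<Rightarrow> 'k) set \<Rightarrow> bool" where
  "good 0 L \<longleftrightarrow> (\<exists>(X :: 'x set) h s. lin {..<m} (Fr {..<m} X) h \<and> h ` Fr {..<m} X = L \<and>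
     lin {..<m} L s \<and> s ` L \<subseteq> Fr {..<m} X \<and> (\<forall>l\<in>L. h (s l) = l))"
| "good (Suc d) L \<longleftrightarrow> (\<exists>(X :: 'x set) h. lin {..<m} (Fr {..<m} X) h \<and> h ` Fr {..<m} X = L \<and>
     good d {f\<in>Fr {..<m} X. h f = 0})"

text \<open>Noetherianity keeps all ranks finite, so syzygies can be taken indefinitely. The
  numbering starts with the ring itself, of rank \<open>r 0 = 1\<close>, which contains
  \<open>I\<close> as image of \<open>d 0\<close>.\<close>

lemma exists_resolution:
  fixes I :: "(nat \<times> expo \<Rightarrow> 'k) set"
  assumes I: "I \<in> lideals"
  shows "\<exists>r d. r 0 = (1::nat) \<and> (\<forall>j. lin {..<m} (Fr {..<m} {..<r (Suc j)}) (d j)) \<and>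
    d 0 ` Fr {..<m} {..<r (Suc 0)} = I \<and>
    (\<forall>j. d (Suc j) ` Fr {..<m} {..<r (Suc (Suc j))} = {z\<in>Fr {..<m} {..<r (Suc j)}. (d j z :: nat \<times> expo \<Rightarrow> 'k) = 0})"
proof -
  let ?M = "{..<m}"
  have noeth: "\<exists>s g. fext g ` Fr ?M {..<s::nat} = L" if "submod ?M L" "L \<subseteq> Fr ?M {..<r}"
    for L :: "(nat \<times> expo \<Rightarrow> 'k) set" and r
    using noetherian[OF order_refl that] by blast
  have I': "submod ?M I" "I \<subseteq> Fr ?M {..<1}" using I by (auto simp: lideals_def)
  obtain s0 g0 where g0: "fext g0 ` Fr ?M {..<s0::nat} = I" using noeth[OF I'] by blast
  have step: "\<exists>s' g'. fext g' ` Fr ?M {..<s'::nat} = {z\<in>Fr ?M {..<s::nat}. (fext g z :: nat \<times> expo \<Rightarrow> 'k) = 0}"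
    for s and g :: "nat \<Rightarrow> nat \<times> expo \<Rightarrow> 'k"
    by (rule noeth[of _ s], rule lin_kernel_submod[OF lin_fext]) (auto simp: submod_Fr)
  have "\<exists>f. f 0 = (s0, g0) \<and> (\<forall>j. fext (snd (f (Suc j))) ` Fr ?M {..<fst (f (Suc j))} =
      {z\<in>Fr ?M {..<fst (f j)}. (fext (snd (f j)) z :: nat \<times> expo \<Rightarrow> 'k) = 0})"
  proof -
    define nx where "nx p = (SOME q :: nat \<times> (nat \<Rightarrow> nat \<times> expo \<Rightarrow> 'k). fext (snd q) ` Fr ?M {..<fst q} =
      {z\<in>Fr ?M {..<fst p}. (fext (snd p) z :: nat \<times> expo \<Rightarrow> 'k) = 0})" for p :: "nat \<times> (nat \<Rightarrow> nat \<times> expo \<Rightarrow> 'k)"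
    have nx: "fext (snd (nx p)) ` Fr ?M {..<fst (nx p)} = {z\<in>Fr ?M {..<fst p}. fext (snd p) z = 0}" for p
    proof -
      obtain s' g' where "fext g' ` Fr ?M {..<s'::nat} = {z\<in>Fr ?M {..<fst p}. fext (snd p) z = 0}"
        using step[of "fst p" "snd p"] by blast
      then have "\<exists>q :: nat \<times> (nat \<Rightarrow> nat \<times> expo \<Rightarrow> 'k). fext (snd q) ` Fr ?M {..<fst q} = {z\<in>Fr ?M {..<fst p}. (fext (snd p) z :: nat \<times> expo \<Rightarrow> 'k) = 0}"
        by (intro exI[of _ "(s', g')"]) simp
      then show ?thesis unfolding nx_def by (rule someI_ex)
    qed
    show ?thesis
      by (intro exI[of _ "\<lambda>j. (nx ^^ j) (s0, g0)"] conjI allI) (simp_all add: nx)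
  qed
  then obtain f where f: "f 0 = (s0, g0)" "\<And>j. fext (snd (f (Suc j))) ` Fr ?M {..<fst (f (Suc j))} =
      {z\<in>Fr ?M {..<fst (f j)}. (fext (snd (f j)) z :: nat \<times> expo \<Rightarrow> 'k) = 0}" by blast
  show ?thesis
    by (intro exI[of _ "\<lambda>j. case j of 0 \<Rightarrow> 1 | Suc i \<Rightarrow> fst (f i)"] exI[of _ "\<lambda>j. fext (snd (f j))"] conjI allI)
      (simp_all add: lin_fext f g0)
qed

text \<open>If extension over \<open>S\<close> holds in every degree, then over
  \<open>S \<union> T\<close> it holds from degree \<open>card T\<close> on: one application of
  \<open>extends_step\<close> for each element of \<open>T\<close>.\<close>

lemma extends_iterate:
  fixes r :: "nat \<Rightarrow> nat"
  assumes Q: "submod {..<m} Q" and S: "S \<subseteq> {..<m}"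
    and d: "\<And>j. lin {..<m} (Fr {..<m} {..<r (Suc j)}) (d j)"
    and d0: "d 0 ` Fr {..<m} {..<r (Suc 0)} \<subseteq> Fr {..<m} {..<r 0}"
    and ker: "\<And>j. d (Suc j) ` Fr {..<m} {..<r (Suc (Suc j))} = {z\<in>Fr {..<m} {..<r (Suc j)}. d j z = 0}"
    and base: "\<And>j. extends_to S (Fr {..<m} {..<r j}) (d j ` Fr {..<m} {..<r (Suc j)}) Q"
    and T: "finite T" "T \<subseteq> {..<m} - S"
  shows "card T \<le> j \<Longrightarrow> extends_to (S \<union> T) (Fr {..<m} {..<r j}) (d j ` Fr {..<m} {..<r (Suc j)}) Q"
  using T
proof (induction T arbitrary: j rule: finite_induct)
  case (insert t T)
  then obtain i where i: "j = Suc i" "card T \<le> i" by (cases j) auto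
  have sub: "d i ` Fr {..<m} {..<r (Suc i)} \<subseteq> Fr {..<m} {..<r i}"
    using d0 ker by (cases i) auto
  have "extends_to (insert t (S \<union> T)) (Fr {..<m} {..<r (Suc i)}) {z\<in>Fr {..<m} {..<r (Suc i)}. d i z = 0} Q"
  proof (rule extends_step[OF _ _ _ Q submod_Fr[OF order_refl] d sub])
    show "S \<union> T \<subseteq> {..<m}" "t < m" "t \<notin> S \<union> T" using insert S by auto
    show "extends_to (S \<union> T) (Fr {..<m} {..<r (Suc i)}) {z\<in>Fr {..<m} {..<r (Suc i)}. d i z = 0} Q"
      using insert.IH[of "Suc i"] insert.prems i by (simp add: ker)
    show "extends_to (S \<union> T) (Fr {..<m} {..<r i}) (d i ` Fr {..<m} {..<r (Suc i)}) Q"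
      using insert.IH[of i] insert.prems i by simp
  qed
  then show ?case by (simp add: i ker)
qed (use base in simp)

text \<open>Subtracting from a preimage p its retraction onto the kernel removes the dependence on
  the choice of p, so \<open>p - \<rho> p\<close> defines a section of d.\<close>

lemma section_of_retract:
  fixes P :: "('x \<times> expo \<Rightarrow> 'k) set"
  assumes P: "submod {..<m} P" and d: "lin {..<m} P d"
    and \<rho>: "lin {..<m} P \<rho>" "\<rho> ` P \<subseteq> {z\<in>P. d z = 0}" "\<forall>z\<in>{z\<in>P. d z = 0}. \<rho> z = z"
  shows "\<exists>s. lin {..<m} (d ` P) s \<and> s ` d ` P \<subseteq> P \<and> (\<forall>l\<in>d ` P. d (s l) = l)"
proof -
  define s where "s l = (let p = (SOME p. p \<in> P \<and> d p = l) in p - \<rho> p)" for l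
  have s_d: "s (d p) = p - \<rho> p" if p: "p \<in> P" for p
  proof -
    define p' where "p' = (SOME q. q \<in> P \<and> d q = d p)"
    have p': "p' \<in> P \<and> d p' = d p" unfolding p'_def by (rule someI[of _ p]) (use p in simp)
    have "p' - p \<in> P" using submod_diff[OF P] p p' by blast
    moreover have "d (p' - p) = 0" using lin_diff[OF d P, of p' p] p p' by simp
    ultimately have "\<rho> (p' - p) = p' - p" using \<rho>(3) by simp
    then have "p' - \<rho> p' = p - \<rho> p" using lin_diff[OF \<rho>(1) P, of p' p] p p' by (simp add: algebra_simps)
    then show ?thesis by (simp add: s_def p'_def Let_def)
  qed
  have \<rho>P: "\<rho> p \<in> P" "d (\<rho> p) = 0" if "p \<in> P" for p using \<rho>(2) that by blast+
  have "lin {..<m} (d ` P) s"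
    unfolding lin_def
  proof (intro conjI ballI allI)
    fix u v assume "u \<in> d ` P" "v \<in> d ` P"
    then obtain u' v' where uv: "u = d u'" "u' \<in> P" "v = d v'" "v' \<in> P" by blast
    then show "s (u + v) = s u + s v"
      using s_d[of "u' + v'"] lin_add[OF d, of u' v'] lin_add[OF \<rho>(1), of u' v'] submod_add[OF P, of u' v']
      by (simp add: s_d)
  next
    fix q u assume "u \<in> d ` P"
    then obtain u' where u: "u = d u'" "u' \<in> P" by blast
    then show "s (sc q u) = sc q (s u)"
      using s_d[of "sc q u'"] lin_sc[OF d, of u' q] lin_sc[OF \<rho>(1), of u' q] submod_sc[OF P, of u' q]
      by (simp add: s_d fs.scale_right_diff_distrib)
  next
    fix a u assume a: "a \<in> lat {..<m}" and "u \<in> d ` P"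
    then obtain u' where u: "u = d u'" "u' \<in> P" by blast
    then show "s (mop a u) = mop a (s u)"
      using s_d[of "mop a u'"] lin_mop[OF d a, of u'] lin_mop[OF \<rho>(1) a, of u'] submod_mop[OF P a, of u']
      by (simp add: s_d mop_diff)
  qed
  moreover have "s ` d ` P \<subseteq> P" using submod_diff[OF P] \<rho>P by (auto simp: s_d)
  moreover have "d (s l) = l" if "l \<in> d ` P" for l
    using that \<rho>P lin_diff[OF d P] by (auto simp: s_d)
  ultimately show ?thesis by blast
qed

lemma lin_eq_on_gens:
  fixes f :: "'x \<times> expo \<Rightarrow> 'k"
  assumes "lin T (Fr T X) A" "lin T (Fr T X) B" "\<And>x. x \<in> X \<Longrightarrow> A (bas (x, 0)) = B (bas (x, 0))" "f \<in> Fr T X"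
  shows "A f = B f"
proof (rule lin_eq_on_bas[OF _ _ _ assms(4)])
  show "lin {} (Fr T X) A" "lin {} (Fr T X) B" using assms(1,2) by (auto intro: lin_mono)
  fix x a assume x: "x \<in> X" "a \<in> lat T"
  have b: "bas (x, 0) \<in> Fr T X" using x by simp
  show "A (bas (x, a)) = B (bas (x, a))"
    unfolding bas_eq_mop[of x a] lin_mop[OF assms(1) x(2) b] lin_mop[OF assms(2) x(2) b] assms(3)[OF x(1)] ..
qed

end

section \<open>Auslander's lemma\<close>

text \<open>A submodule of a free module whose basis is indexed by pairs \<open>(x, i)\<close> is filtered by the
  well-ordered first index; resolutions of the factors of the filtration are assembled to one of the
  submodule.\<close>

locale filtered = qt m c for m and c :: "nat \<Rightarrow> nat \<Rightarrow> 'k::field" +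
  fixes lt :: "'i \<Rightarrow> 'i \<Rightarrow> bool"
  assumes lt_wf: "wfp lt" and lt_trans: "\<And>x y z. lt x y \<Longrightarrow> lt y z \<Longrightarrow> lt x z"
    and lt_total: "\<And>x y. x \<noteq> y \<Longrightarrow> lt x y \<or> lt y x"
begin

abbreviation "M \<equiv> {..<m}"

definition le :: "'i \<Rightarrow> 'i \<Rightarrow> bool" where "le x y \<longleftrightarrow> x = y \<or> lt x y"

lemma lt_irrefl: "\<not> lt x x"
  using wfp_imp_irreflp[OF lt_wf] by (simp add: irreflp_def)

lemma lt_asym: "lt x y \<Longrightarrow> \<not> le y x"
  using lt_irrefl lt_trans by (auto simp: le_def)

definition cmpx :: "'i \<Rightarrow> (('i \<times> nat) \<times> expo \<Rightarrow> 'k) \<Rightarrow> nat \<times> expo \<Rightarrow> 'k" where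
  "cmpx x f = (\<lambda>(i, a). f ((x, i), a))"

definition injx :: "'i \<Rightarrow> (nat \<times> expo \<Rightarrow> 'k) \<Rightarrow> ('i \<times> nat) \<times> expo \<Rightarrow> 'k" where
  "injx x u = (\<lambda>((y, i), a). if y = x then u (i, a) else 0)"

definition below :: "'i \<Rightarrow> (('i \<times> nat) \<times> expo \<Rightarrow> 'k) set" where
  "below x = {f. \<forall>y i a. f ((y, i), a) \<noteq> 0 \<longrightarrow> le y x}"

text \<open>The factor of the filtration of \<open>L\<close> at x, embedded as the module of
  x-components of elements with no component above x.\<close>

definition topm :: "(('i \<times> nat) \<times> expo \<Rightarrow> 'k) set \<Rightarrow> 'i \<Rightarrow> (nat \<times> expo \<Rightarrow> 'k) set" where
  "topm L x = cmpx x ` (L \<inter> below x)"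

lemma cmpx_lin: "cmpx x (f + g) = cmpx x f + cmpx x g" "cmpx x (sc q f) = sc q (cmpx x f)"
  "cmpx x (mop a f) = mop a (cmpx x f)" "cmpx x (f - g) = cmpx x f - cmpx x g" "cmpx x 0 = 0"
  by (auto simp: cmpx_def fun_eq_iff fun_simps mop_apply)

lemma lin_cmpx: "lin T N (cmpx x)"
  by (simp add: lin_def cmpx_lin)

lemma cmpx_injx: "cmpx x (injx y u) = (if x = y then u else 0)"
  by (auto simp: cmpx_def injx_def fun_eq_iff zero_fun_apply)

lemma cmpx_bas: "cmpx x (bas ((y, i), a)) = (if x = y then bas (i, a) else 0)"
  by (auto simp: cmpx_def bas_def fun_eq_iff zero_fun_apply)

lemma injx_zero [simp]: "injx x 0 = 0"
  by (auto simp: injx_def fun_eq_iff zero_fun_apply)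

lemma below_submod: "submod T (below x)"
proof -
  have "f + g \<in> below x" if "f \<in> below x" "g \<in> below x" for f g
    unfolding below_def
  proof (intro CollectI allI impI)
    fix y i a assume "(f + g) ((y, i), a) \<noteq> 0"
    then have "f ((y, i), a) \<noteq> 0 \<or> g ((y, i), a) \<noteq> 0" by (auto simp: plus_fun_apply)
    then show "le y x" using that unfolding below_def by blast
  qed
  moreover have "0 \<in> below x" by (simp add: below_def zero_fun_apply)
  moreover have "sc q f \<in> below x" if "f \<in> below x" for q f
    unfolding below_def
  proof (intro CollectI allI impI)
    fix y i a assume "sc q f ((y, i), a) \<noteq> 0"
    then have "f ((y, i), a) \<noteq> 0" by (simp add: sc_apply)
    then show "le y x" using that unfolding below_def by blast
  qed
  moreover have "mop b f \<in> below x" if "f \<in> below x" for b f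
    unfolding below_def
  proof (intro CollectI allI impI)
    fix y i a assume "mop b f ((y, i), a) \<noteq> 0"
    then have "f ((y, i), a - b) \<noteq> 0" by (simp add: mop_apply)
    then show "le y x" using that unfolding below_def by blast
  qed
  ultimately show ?thesis unfolding submod_def by blast
qed

lemma below_mono: "le x y \<Longrightarrow> f \<in> below x \<Longrightarrow> f \<in> below y"
  unfolding below_def le_def using lt_trans by blast

lemma cmpx_above: "f \<in> below y \<Longrightarrow> lt y x \<Longrightarrow> cmpx x f = 0"
  using lt_asym unfolding below_def by (fastforce simp: cmpx_def fun_eq_iff zero_fun_apply)

lemma max_index:
  assumes "finite (supp f)" "f \<noteq> 0"
  shows "\<exists>x. f \<in> below x \<and> cmpx x f \<noteq> 0"
proof -
  have "\<exists>x\<in>A. \<forall>y\<in>A. le y x" if "finite A" "A \<noteq> {}" for A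
    using that
  proof (induction A rule: finite_ne_induct)
    case (insert z A)
    then obtain x where x: "x \<in> A" "\<forall>y\<in>A. le y x" by blast
    show ?case
    proof (cases "le z x")
      case True
      then show ?thesis using x by blast
    next
      case False
      then have "lt x z" using lt_total[of x z] by (auto simp: le_def)
      then show ?thesis using x lt_trans by (intro bexI[of _ z]) (auto simp: le_def)
    qed
  qed (simp add: le_def)
  moreover have "finite (fst ` fst ` supp f)" "fst ` fst ` supp f \<noteq> {}"
    using assms by (simp_all add: supp_eq_empty)
  ultimately obtain x where x: "x \<in> fst ` fst ` supp f" "\<forall>y\<in>fst ` fst ` supp f. le y x" by blast
  have "f \<in> below x" using x(2) unfolding below_def by (force simp: supp_iff)
  moreover obtain i a where "f ((x, i), a) \<noteq> 0" using x(1) by (force simp: supp_iff)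
  then have "cmpx x f (i, a) \<noteq> 0" by (simp add: cmpx_def)
  then have "cmpx x f \<noteq> 0" by (auto simp: zero_fun_apply)
  ultimately show ?thesis by blast
qed

lemma max_index_below:
  assumes "finite (supp f)" "f \<in> below x" "cmpx x f = 0" "f \<noteq> 0"
  shows "\<exists>y. lt y x \<and> f \<in> below y"
proof -
  obtain y where y: "f \<in> below y" "cmpx y f \<noteq> 0" using max_index[OF assms(1,4)] by blast
  have "\<not> lt x y" using cmpx_above[OF assms(2)] y(2) by blast
  then have "lt y x" using lt_total[of x y] assms(3) y(2) by auto
  then show ?thesis using y by blast
qed

definition pairs :: "('i \<Rightarrow> nat set) \<Rightarrow> ('i \<times> nat) set" where
  "pairs X = {(x, i). i \<in> X x}"

lemma cmpx_Fr: "f \<in> Fr M (pairs X) \<Longrightarrow> cmpx x f \<in> Fr M (X x)"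
proof -
  assume f: "f \<in> Fr M (pairs X)"
  have sub: "supp (cmpx x f) \<subseteq> (\<lambda>p. (snd (fst p), snd p)) ` supp f"
    by (force simp: supp_iff cmpx_def)
  then have "finite (supp (cmpx x f))" using Fr_finite[OF f] by (meson finite_imageI finite_subset)
  moreover have "supp (cmpx x f) \<subseteq> X x \<times> lat M"
    using f by (auto simp: Fr_def supp_def cmpx_def pairs_def)
  ultimately show ?thesis by (simp add: Fr_def)
qed

lemma injx_Fr: "u \<in> Fr M (X x) \<Longrightarrow> injx x u \<in> Fr M (pairs X) \<inter> below x"
proof
  assume u: "u \<in> Fr M (X x)"
  have sub: "supp (injx x u) \<subseteq> (\<lambda>p. ((x, fst p), snd p)) ` supp u"
    by (force simp: supp_iff injx_def split: if_splits)
  then have "finite (supp (injx x u))" using Fr_finite[OF u] by (meson finite_imageI finite_subset)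
  moreover have "supp (injx x u) \<subseteq> pairs X \<times> lat M"
    using u by (auto simp: Fr_def supp_def injx_def pairs_def split: if_splits)
  ultimately show "injx x u \<in> Fr M (pairs X)" by (simp add: Fr_def)
  show "injx x u \<in> below x" by (auto simp: below_def injx_def le_def split: if_splits)
qed

context
  fixes L :: "(('i \<times> nat) \<times> expo \<Rightarrow> 'k) set" and X :: "'i \<Rightarrow> nat set"
    and hx :: "'i \<Rightarrow> (nat \<times> expo \<Rightarrow> 'k) \<Rightarrow> nat \<times> expo \<Rightarrow> 'k"
  assumes L: "submod M L" "L \<subseteq> Fr M UNIV"
    and hx: "\<And>x. lin M (Fr M (X x)) (hx x)" "\<And>x. hx x ` Fr M (X x) = topm L x"
begin

text \<open>A preimage in \<open>L\<close> of each generator of the factor. The free module on all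
  these lifts covers \<open>L\<close> as in the horseshoe lemma.\<close>

definition lift :: "'i \<times> nat \<Rightarrow> ('i \<times> nat) \<times> expo \<Rightarrow> 'k" where
  "lift p = (SOME l. l \<in> L \<inter> below (fst p) \<and> cmpx (fst p) l = hx (fst p) (bas (snd p, 0)))"

lemma lift:
  assumes "i \<in> X x"
  shows "lift (x, i) \<in> L" "lift (x, i) \<in> below x" "cmpx x (lift (x, i)) = hx x (bas (i, 0))"
proof -
  have "hx x (bas (i, 0)) \<in> topm L x" using hx(2)[of x] assms by (metis Fr_bas imageI lat_zero)
  then have "\<exists>l. l \<in> L \<inter> below x \<and> cmpx x l = hx x (bas (i, 0))" unfolding topm_def by (metis imageE)
  then have "lift (x, i) \<in> L \<inter> below x \<and> cmpx x (lift (x, i)) = hx x (bas (i, 0))"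
    unfolding lift_def fst_conv snd_conv by (rule someI_ex)
  then show "lift (x, i) \<in> L" "lift (x, i) \<in> below x" "cmpx x (lift (x, i)) = hx x (bas (i, 0))" by blast+
qed

definition hh :: "(('i \<times> nat) \<times> expo \<Rightarrow> 'k) \<Rightarrow> ('i \<times> nat) \<times> expo \<Rightarrow> 'k" where
  "hh = fext lift"

lemma lin_hh: "lin M (Fr M (pairs X)) hh"
  unfolding hh_def by (rule lin_fext)

lemma hh_L: "f \<in> Fr M (pairs X) \<Longrightarrow> hh f \<in> L"
  unfolding hh_def using lift(1) by (intro fext_in[OF L(1)]) (auto simp: pairs_def)

text \<open>\<open>hh\<close> is triangular for the filtration, with diagonal entries
  \<open>hx x\<close>.\<close>

lemma hh_below:
  assumes f: "f \<in> Fr M (pairs X)" "f \<in> below x"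
  shows "hh f \<in> below x" "cmpx x (hh f) = hx x (cmpx x f)"
proof -
  define B where "B = {(y, i). i \<in> X y \<and> le y x}"
  have fB: "f \<in> Fr M B"
    using f by (auto simp: Fr_def B_def pairs_def below_def supp_def)
  show "hh f \<in> below x"
    unfolding hh_def using lift(2) below_mono by (intro fext_in[OF below_submod fB]) (auto simp: B_def)
  have BX: "B \<subseteq> pairs X" by (auto simp: B_def pairs_def)
  have sub: "Fr M B \<subseteq> Fr M (pairs X)" using Fr_mono[OF BX] by blast
  show "cmpx x (hh f) = hx x (cmpx x f)"
  proof (rule lin_eq_on_gens[OF _ _ _ fB])
    show "lin M (Fr M B) (\<lambda>f. cmpx x (hh f))"
      by (rule lin_comp[OF lin_mono[OF lin_hh order_refl sub] lin_cmpx[of _ UNIV]]) simp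
    show "lin M (Fr M B) (\<lambda>f. hx x (cmpx x f))"
      by (rule lin_comp[OF lin_cmpx hx(1)]) (use cmpx_Fr sub in blast)
    fix p assume "p \<in> B"
    then obtain y i where p: "p = (y, i)" "i \<in> X y" "le y x" by (auto simp: B_def)
    have "hh (bas (p, 0)) = lift p" by (simp add: hh_def fext_bas)
    moreover have "hx x 0 = 0" by (rule lin_zero[OF hx(1) submod_Fr[OF order_refl]])
    ultimately show "cmpx x (hh (bas (p, 0))) = hx x (cmpx x (bas (p, 0)))"
      using p lift(3)[OF p(2)] cmpx_above[OF lift(2)[OF p(2)], of x] lt_irrefl
      by (cases "y = x") (auto simp: cmpx_bas le_def)
  qed
qed

text \<open>Well-founded induction on the top index: the x-component is matched by an element of the
  x-th block and subtracted, leaving an element of smaller top index. The submodule \<open>C\<close>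
  restricts the admissible preimages; taking it to be the sum of the images of sections yields
  \<open>hh_section\<close>.\<close>

lemma hh_surj:
  assumes C: "submod M C" "C \<subseteq> Fr M (pairs X)"
    and sel: "\<And>x l. l \<in> topm L x \<Longrightarrow> \<exists>u\<in>Fr M (X x). hx x u = l \<and> injx x u \<in> C"
    and l: "l \<in> L" "l \<in> below x"
  shows "\<exists>f\<in>C. f \<in> below x \<and> hh f = l"
  using l
proof (induction x arbitrary: l rule: wfp_induct_rule[OF lt_wf])
  case (1 x)
  have "cmpx x l \<in> topm L x" unfolding topm_def using 1 by blast
  then obtain u where u: "u \<in> Fr M (X x)" "hx x u = cmpx x l" "injx x u \<in> C" using sel by blast
  have f1: "injx x u \<in> Fr M (pairs X)" "injx x u \<in> below x" using injx_Fr[of u X x, OF u(1)] by blast+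
  define l' where "l' = l - hh (injx x u)"
  have l'L: "l' \<in> L" unfolding l'_def using 1 hh_L[OF f1(1)] by (intro submod_diff[OF L(1)])
  have l'b: "l' \<in> below x" unfolding l'_def
    using 1 hh_below(1)[OF f1] by (intro submod_diff[OF below_submod[of M]])
  have "cmpx x l' = 0" unfolding l'_def cmpx_lin hh_below(2)[OF f1] cmpx_injx using u(2) by simp
  have "\<exists>f\<in>C. f \<in> below x \<and> hh f = l'"
  proof (cases "l' = 0")
    case True
    then show ?thesis
      using submod_zero[OF C(1)] submod_zero[OF below_submod[of M]] lin_zero[OF lin_hh submod_Fr[OF order_refl]]
      by (intro bexI[of _ 0]) auto
  next
    case False
    have "finite (supp l')" using l'L L(2) Fr_finite by blast
    then obtain y where y: "lt y x" "l' \<in> below y"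
      using max_index_below[OF _ l'b \<open>cmpx x l' = 0\<close> False] by blast
    then obtain f where "f \<in> C" "f \<in> below y" "hh f = l'" using "1.IH" l'L by blast
    then show ?thesis using below_mono[of y x f] y(1) by (auto simp: le_def)
  qed
  then obtain f where f: "f \<in> C" "f \<in> below x" "hh f = l'" by blast
  have "hh (injx x u + f) = l"
    using lin_add[OF lin_hh f1(1), of f] f C(2) by (auto simp: l'_def)
  moreover have "injx x u + f \<in> C" by (rule submod_add[OF C(1) u(3) f(1)])
  moreover have "injx x u + f \<in> below x" by (rule submod_add[OF below_submod[of M] f1(2) f(2)])
  ultimately show ?case by blast
qed

lemma hh_image:
  assumes C: "submod M C" "C \<subseteq> Fr M (pairs X)"
    and sel: "\<And>x l. l \<in> topm L x \<Longrightarrow> \<exists>u\<in>Fr M (X x). hx x u = l \<and> injx x u \<in> C"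
  shows "hh ` C = L"
proof
  show "hh ` C \<subseteq> L" using hh_L C(2) by blast
  show "L \<subseteq> hh ` C"
  proof
    fix l assume l: "l \<in> L"
    show "l \<in> hh ` C"
    proof (cases "l = 0")
      case True
      then show ?thesis
        using submod_zero[OF C(1)] lin_zero[OF lin_hh submod_Fr[OF order_refl]] by (metis imageI)
    next
      case False
      have "finite (supp l)" using l L(2) Fr_finite by blast
      then obtain x where "l \<in> below x" using max_index[OF _ False] by blast
      then show ?thesis using hh_surj[OF C sel l] by blast
    qed
  qed
qed

lemma full_sel: "l \<in> topm L x \<Longrightarrow> \<exists>u\<in>Fr M (X x). hx x u = l \<and> injx x u \<in> Fr M (pairs X)"
  using hx(2)[of x] injx_Fr[of _ X x] by (metis IntD1 imageE)

text \<open>The filtration of the kernel has the kernels of \<open>hx x\<close> as factors, because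
  an element of such a kernel, placed in block x, can be corrected in lower blocks. This carries the
  induction on the length in \<open>auslander\<close>.\<close>

lemma hh_kernel: "topm {f\<in>Fr M (pairs X). hh f = 0} x = {u\<in>Fr M (X x). hx x u = 0}"
proof (rule subset_antisym; rule subsetI)
  fix u assume "u \<in> topm {f\<in>Fr M (pairs X). hh f = 0} x"
  then obtain f where f: "f \<in> Fr M (pairs X)" "hh f = 0" "f \<in> below x" "u = cmpx x f"
    unfolding topm_def by blast
  have "hx x u = cmpx x 0" using hh_below(2)[OF f(1,3)] f(2,4) by simp
  then show "u \<in> {u\<in>Fr M (X x). hx x u = 0}" using cmpx_Fr[OF f(1)] f(4) by (simp add: cmpx_lin)
next
  fix u assume u: "u \<in> {u\<in>Fr M (X x). hx x u = 0}"
  then have f1: "injx x u \<in> Fr M (pairs X)" "injx x u \<in> below x" using injx_Fr[of u X x] by blast+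
  define l where "l = hh (injx x u)"
  have l: "l \<in> L" "l \<in> below x" unfolding l_def using hh_L[OF f1(1)] hh_below(1)[OF f1] by blast+
  have l0: "cmpx x l = 0" unfolding l_def hh_below(2)[OF f1] cmpx_injx using u by simp
  have sub: "submod M (Fr M (pairs X) :: (('i \<times> nat) \<times> expo \<Rightarrow> 'k) set)" by (simp add: submod_Fr)
  have "\<exists>f\<in>Fr M (pairs X). f \<in> below x \<and> cmpx x f = 0 \<and> hh f = l"
  proof (cases "l = 0")
    case True
    then show ?thesis
      using lin_zero[OF lin_hh sub] submod_zero[OF below_submod[of M]]
      by (intro bexI[of _ 0]) (auto simp: cmpx_lin)
  next
    case False
    have "finite (supp l)" using l(1) L(2) Fr_finite by blast
    then obtain y where y: "lt y x" "l \<in> below y" using max_index_below[OF _ l(2) l0 False] by blast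
    obtain f where "f \<in> Fr M (pairs X)" "f \<in> below y" "hh f = l"
      using hh_surj[OF sub order_refl full_sel l(1) y(2)] by blast
    then show ?thesis using below_mono[of y x f] cmpx_above[of f y x] y(1) by (auto simp: le_def)
  qed
  then obtain f where f: "f \<in> Fr M (pairs X)" "f \<in> below x" "cmpx x f = 0" "hh f = l" by blast
  define g where "g = injx x u - f"
  have "g \<in> Fr M (pairs X)" unfolding g_def by (rule submod_diff[OF sub f1(1) f(1)])
  moreover have "g \<in> below x" unfolding g_def by (rule submod_diff[OF below_submod[of M] f1(2) f(2)])
  moreover have "hh g = 0" unfolding g_def lin_diff[OF lin_hh sub f1(1) f(1)] by (simp add: f(4) l_def)
  moreover have "cmpx x g = u" unfolding g_def by (simp add: cmpx_lin cmpx_injx f(3))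
  ultimately show "u \<in> topm {f\<in>Fr M (pairs X). hh f = 0} x" unfolding topm_def by (intro image_eqI[of _ _ g]) auto
qed

text \<open>On the sum \<open>C\<close> of the images of the sections \<open>sx x\<close> the map
  \<open>hh\<close> is bijective onto \<open>L\<close>; its inverse is the required section.\<close>

lemma hh_section:
  assumes s: "\<And>x. lin M (topm L x) (sx x)" "\<And>x. sx x ` topm L x \<subseteq> Fr M (X x)"
    "\<And>x l. l \<in> topm L x \<Longrightarrow> hx x (sx x l) = l"
  shows "\<exists>s. lin M L s \<and> s ` L \<subseteq> Fr M (pairs X) \<and> (\<forall>l\<in>L. hh (s l) = l)"
proof -
  have top_sub: "submod M (topm L x)" for x
    unfolding topm_def using submod_mono[OF below_submod[of M]]
    by (intro lin_image_submod[OF lin_cmpx]) (use L(1) below_submod[of M x] in \<open>auto simp: submod_def\<close>)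
  define C where "C = {f\<in>Fr M (pairs X). \<forall>x. cmpx x f \<in> sx x ` topm L x}"
  have im_sub: "submod M (sx x ` topm L x)" for x by (rule lin_image_submod[OF s(1) top_sub])
  have C: "submod M C" "C \<subseteq> Fr M (pairs X)"
    unfolding submod_def C_def using submodD[OF im_sub] by (auto simp: cmpx_lin)
  have sel: "\<exists>u\<in>Fr M (X x). hx x u = l \<and> injx x u \<in> C" if l: "l \<in> topm L x" for x l
  proof (intro bexI[of _ "sx x l"] conjI)
    show u: "sx x l \<in> Fr M (X x)" using s(2) l by blast
    show "hx x (sx x l) = l" by (rule s(3)[OF l])
    have "cmpx y (injx x (sx x l)) \<in> sx y ` topm L y" for y
      using l submod_zero[OF im_sub] by (auto simp: cmpx_injx)
    then show "injx x (sx x l) \<in> C" unfolding C_def using injx_Fr[of "sx x l" X x, OF u] by blast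
  qed
  have im: "hh ` C = L" by (rule hh_image[OF C sel])
  have linC: "lin M C hh" by (rule lin_mono[OF lin_hh order_refl C(2)])
  \<comment> \<open>The top component of an element of \<open>C\<close> is in the image of a
    section, so it is recovered from its image under \<open>hx x\<close>, which is zero.\<close>
  have inj0: "f = 0" if f: "f \<in> C" "hh f = 0" for f
  proof (rule ccontr)
    assume "f \<noteq> 0"
    have fF: "f \<in> Fr M (pairs X)" using f(1) C(2) by blast
    then obtain x where x: "f \<in> below x" "cmpx x f \<noteq> 0" using max_index[OF Fr_finite \<open>f \<noteq> 0\<close>] by blast
    obtain t where t: "t \<in> topm L x" "cmpx x f = sx x t" using f(1) unfolding C_def by blast
    have "t = hx x (cmpx x f)" using s(3)[OF t(1)] t(2) by simp
    also have "\<dots> = cmpx x (hh f)" using hh_below(2)[OF fF x(1)] by simp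
    also have "\<dots> = 0" using f(2) by (simp add: cmpx_lin)
    finally show False using t(2) x(2) lin_zero[OF s(1) top_sub] by simp
  qed
  have inj: "f = g" if "f \<in> C" "g \<in> C" "hh f = hh g" for f g
    using inj0[of "f - g"] submod_diff[OF C(1) that(1,2)] lin_diff[OF linC C(1) that(1,2)] that(3) by simp
  define s' where "s' = inv_into C hh"
  have s': "s' l \<in> C" "hh (s' l) = l" if "l \<in> L" for l
    unfolding s'_def using that im inv_into_into f_inv_into_f by metis+
  have "lin M L s'"
    unfolding lin_def
  proof (intro conjI ballI allI)
    fix u v assume uv: "u \<in> L" "v \<in> L"
    show "s' (u + v) = s' u + s' v"
      by (rule inj) (use uv s' submod_add[OF L(1)] submod_add[OF C(1)] lin_add[OF linC] in auto)
  next
    fix q u assume u: "u \<in> L"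
    show "s' (sc q u) = sc q (s' u)"
      by (rule inj) (use u s' submod_sc[OF L(1)] submod_sc[OF C(1)] lin_sc[OF linC] in auto)
  next
    fix a u assume a: "a \<in> lat M" and u: "u \<in> L"
    show "s' (mop a u) = mop a (s' u)"
      by (rule inj) (use a u s' submod_mop[OF L(1)] submod_mop[OF C(1)] lin_mop[OF linC] in auto)
  qed
  then show ?thesis using s' C(2) by blast
qed

end

text \<open>A bound on the resolutions of all factors bounds the resolution of \<open>L\<close>,
  whatever the rank of the free module: the blocks are assembled by \<open>hh\<close>, and the
  kernels are filtered by kernels.\<close>

theorem auslander:
  assumes "submod M L" "L \<subseteq> Fr M UNIV" "\<And>x. good d (topm L x)"
  shows "good d L"
  using assms
proof (induction d arbitrary: L)
  case 0
  define Q where "Q x X h s \<longleftrightarrow> lin M (Fr M X) h \<and> h ` Fr M X = topm L x \<and>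
     lin M (topm L x) s \<and> s ` topm L x \<subseteq> Fr M X \<and> (\<forall>l\<in>topm L x. h (s l) = l)" for x and X :: "nat set" and h s
  have "\<forall>x. \<exists>X h s. Q x X h s"
    unfolding Q_def by (intro allI) (rule "0.prems"(3)[unfolded good.simps])
  from choice[OF this] obtain X where "\<forall>x. \<exists>h s. Q x (X x) h s" by (rule exE)
  from choice[OF this] obtain h where "\<forall>x. \<exists>s. Q x (X x) (h x) s" by (rule exE)
  from choice[OF this] obtain s where "\<forall>x. Q x (X x) (h x) (s x)" by (rule exE)
  then have Q: "\<And>x. Q x (X x) (h x) (s x)" by (rule spec)
  note Q' = Q[unfolded Q_def]
  note * = Q'[THEN conjunct1] Q'[THEN conjunct2, THEN conjunct1] Q'[THEN conjunct2, THEN conjunct2, THEN conjunct1]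
    Q'[THEN conjunct2, THEN conjunct2, THEN conjunct2, THEN conjunct1]
    Q'[THEN conjunct2, THEN conjunct2, THEN conjunct2, THEN conjunct2, THEN bspec]
  note ctx = "0.prems"(1,2) *(1,2)
  have "hh L h ` Fr M (pairs X) = L"
    by (rule hh_image[OF ctx submod_Fr[OF order_refl] order_refl full_sel[OF ctx]])
  then show ?case
    unfolding good.simps using lin_hh[OF ctx] hh_section[OF ctx *(3-5)] by blast
next
  case (Suc d)
  define Q where "Q x X h \<longleftrightarrow> lin M (Fr M X) h \<and> h ` Fr M X = topm L x \<and> good d {f\<in>Fr M X. h f = 0}"
    for x and X :: "nat set" and h
  have "\<forall>x. \<exists>X h. Q x X h"
    unfolding Q_def by (intro allI) (rule Suc.prems(3)[unfolded good.simps])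
  from choice[OF this] obtain X where "\<forall>x. \<exists>h. Q x (X x) h" by (rule exE)
  from choice[OF this] obtain h where "\<forall>x. Q x (X x) (h x)" by (rule exE)
  then have Q: "\<And>x. Q x (X x) (h x)" by (rule spec)
  note Q' = Q[unfolded Q_def]
  note * = Q'[THEN conjunct1] Q'[THEN conjunct2, THEN conjunct1] Q'[THEN conjunct2, THEN conjunct2]
  note ctx = Suc.prems(1,2) *(1,2)
  have im: "hh L h ` Fr M (pairs X) = L"
    by (rule hh_image[OF ctx submod_Fr[OF order_refl] order_refl full_sel[OF ctx]])
  have ker: "good d {f\<in>Fr M (pairs X). hh L h f = 0}"
  proof (rule Suc.IH)
    show "submod M {f\<in>Fr M (pairs X). hh L h f = 0}"
      by (rule lin_kernel_submod[OF lin_hh[OF ctx] submod_Fr[OF order_refl]])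
    show "{f\<in>Fr M (pairs X). hh L h f = 0} \<subseteq> Fr M UNIV"
    proof
      fix f assume "f \<in> {f\<in>Fr M (pairs X). hh L h f = 0}"
      then have "f \<in> Fr M (pairs X)" by simp
      then show "f \<in> Fr M UNIV" by (rule Fr_mono[OF subset_UNIV])
    qed
    show "good d (topm {f\<in>Fr M (pairs X). hh L h f = 0} x)" for x
      by (subst hh_kernel[OF ctx]) (rule *(3))
  qed
  show ?case
    unfolding good.simps(2)
    by (rule exI[of _ "pairs X"], rule exI[of _ "hh L h"], intro conjI, rule lin_hh[OF ctx], rule im, rule ker)
qed

end

section \<open>Splitting the resolution of a left ideal\<close>

context sqt
begin

text \<open>If the kernel of d is a direct summand, its image \<open>N\<close> is projective with a
  section \<sigma>. To make \<open>N\<close> a summand of the next free module it suffices to extend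
  \<sigma>, hence every map from \<open>N\<close> to the ring; the obstruction is torsion along all
  sets of n coordinates and dies by \<open>torsion_in_V0\<close>.\<close>

lemma retract_descend:
  fixes d :: "(nat \<times> expo \<Rightarrow> 'k) \<Rightarrow> nat \<times> expo \<Rightarrow> 'k"
  assumes d: "lin {..<2*n} (Fr {..<2*n} {..<s}) d" "d ` Fr {..<2*n} {..<s} \<subseteq> Fr {..<2*n} {..<r}"
    and \<rho>: "lin {..<2*n} (Fr {..<2*n} {..<s}) \<rho>" "\<rho> ` Fr {..<2*n} {..<s} \<subseteq> {z\<in>Fr {..<2*n} {..<s}. d z = 0}"
      "\<forall>z\<in>{z\<in>Fr {..<2*n} {..<s}. d z = 0}. \<rho> z = z"
    and ext: "\<And>S. S \<subseteq> {..<2*n} \<Longrightarrow> card S = n \<Longrightarrow>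
      extends_to {..<2*n} (Fr {..<2*n} {..<r}) (d ` Fr {..<2*n} {..<s}) (tors S)"
  shows "\<exists>\<rho>'. lin {..<2*n} (Fr {..<2*n} {..<r}) \<rho>' \<and> \<rho>' ` Fr {..<2*n} {..<r} \<subseteq> d ` Fr {..<2*n} {..<s} \<and>
    (\<forall>z\<in>d ` Fr {..<2*n} {..<s}. \<rho>' z = z)"
proof -
  let ?M = "{..<2*n}"
  let ?P = "Fr ?M {..<s} :: (nat \<times> expo \<Rightarrow> 'k) set" and ?P' = "Fr ?M {..<r} :: (nat \<times> expo \<Rightarrow> 'k) set"
  let ?A = "Fr ?M {..<1} :: (nat \<times> expo \<Rightarrow> 'k) set"
  have P: "submod ?M ?P" and P': "submod ?M ?P'" and A: "submod ?M ?A" by (simp_all add: submod_Fr)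
  let ?N = "d ` ?P"
  have N: "submod ?M ?N" by (rule lin_image_submod[OF d(1) P])
  from section_of_retract[where \<rho> = \<rho>, OF P d(1) \<rho>] obtain \<sigma>
    where \<sigma>1: "lin ?M ?N \<sigma>" and \<sigma>2: "\<sigma> ` ?N \<subseteq> ?P" and \<sigma>3: "\<forall>l\<in>?N. d (\<sigma> l) = l"
    by (elim exE conjE) (rule that)
  note \<sigma> = \<sigma>1 \<sigma>2 bspec[OF \<sigma>3]
  have ext_A: "\<exists>\<psi>. lin ?M ?P' \<psi> \<and> \<psi> ` ?P' \<subseteq> ?A \<and> (\<forall>z\<in>?N. \<psi> z = \<phi> z)"
    if \<phi>: "lin ?M ?N \<phi>" "\<phi> ` ?N \<subseteq> ?A" for \<phi>
  proof -
    define z where "z y = d (bas (y, 0))" for y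
    have zN: "z y \<in> ?N" if "y < s" for y unfolding z_def using that by simp
    have \<phi>z: "\<phi> (z y) \<in> ?A" if "y < s" for y using zN[OF that] \<phi>(2) by blast
    \<comment> \<open>The values of \<phi> on the generators of \<open>N\<close>, stored as one
      vector on which the torus acts by right multiplication.\<close>
    define v :: "nat \<times> expo \<Rightarrow> 'k" where "v = (\<lambda>(y, a). if y < s then \<phi> (z y) (0, a) else 0)"
    \<comment> \<open>The value vectors of those maps that do extend; \<phi> extends when its vector
      lies here.\<close>
    define V0 :: "(nat \<times> expo \<Rightarrow> 'k) set" where
      "V0 = {w. \<exists>\<psi>. lin ?M ?P' \<psi> \<and> \<psi> ` ?P' \<subseteq> ?A \<and> (\<forall>y<s. \<forall>a. w (y, a) = \<psi> (z y) (0, a))}"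
    have V0I: "w \<in> V0" if "lin ?M ?P' \<psi>" "\<And>p. p \<in> ?P' \<Longrightarrow> \<psi> p \<in> ?A" "\<And>y a. y < s \<Longrightarrow> w (y, a) = \<psi> (z y) (0, a)" for w \<psi>
      unfolding V0_def using that by blast
    have V0_sub: "fs.subspace V0"
      unfolding fs.subspace_def
    proof (intro conjI ballI allI)
      show "0 \<in> V0" by (rule V0I[of "\<lambda>_. 0"]) (simp_all add: lin_def zero_fun_apply)
      fix w assume "w \<in> V0"
      then obtain \<psi> where \<psi>: "lin ?M ?P' \<psi>" "\<psi> ` ?P' \<subseteq> ?A" "\<forall>y<s. \<forall>a. w (y, a) = \<psi> (z y) (0, a)"
        unfolding V0_def by blast
      show "sc q w \<in> V0" for q
        by (rule V0I[of "\<lambda>p. sc q (\<psi> p)"])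
          (use \<psi> linD[OF \<psi>(1)] in \<open>auto simp: lin_def sc_add_right mop_sc sc_apply mult.commute[of q] image_subset_iff\<close>)
      fix w' assume "w' \<in> V0"
      then obtain \<psi>' where \<psi>': "lin ?M ?P' \<psi>'" "\<psi>' ` ?P' \<subseteq> ?A" "\<forall>y<s. \<forall>a. w' (y, a) = \<psi>' (z y) (0, a)"
        unfolding V0_def by blast
      show "w + w' \<in> V0"
        by (rule V0I[of "\<lambda>p. \<psi> p + \<psi>' p"])
          (use \<psi> \<psi>' linD[OF \<psi>(1)] linD[OF \<psi>'(1)] in \<open>auto simp: lin_def sc_add_right mop_add plus_fun_apply image_subset_iff\<close>)
    qed
    have V0_rop: "rop b w \<in> V0" if b: "b \<in> lat ?M" and "w \<in> V0" for b w
    proof -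
      obtain \<psi> where \<psi>: "lin ?M ?P' \<psi>" "\<psi> ` ?P' \<subseteq> ?A" "\<forall>y<s. \<forall>a. w (y, a) = \<psi> (z y) (0, a)"
        using \<open>w \<in> V0\<close> unfolding V0_def by blast
      show ?thesis
        by (rule V0I[of "\<lambda>p. rop b (\<psi> p)"])
          (use \<psi> b linD[OF \<psi>(1)] in \<open>auto simp: lin_def rop_add rop_sc mop_rop rop_apply image_subset_iff\<close>)
    qed
    interpret R: symplectic_rep n "\<lambda>i j. c j i" rop V0 by (rule symplectic_rop[OF V0_sub V0_rop])
    have "v \<in> V0"
    proof (rule R.torsion_in_V0[OF n_pos])
      fix S assume S: "S \<subseteq> ?M" "card S = n"
      then have S0: "S \<noteq> {}" using n_pos by auto
      \<comment> \<open>Composing \<phi> with the map of the ring into \<open>tors S\<close> that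
        sends 1 to e gives a map that extends by assumption; \<open>window\<close> turns these
        extensions into torsion of v.\<close>
      have E: "\<exists>\<Psi>. lin ?M ?P' \<Psi> \<and> \<Psi> ` ?P' \<subseteq> tors S \<and> (\<forall>y<s. \<Psi> (z y) = fext (\<lambda>_. e) (\<phi> (z y)))"
        if e: "e \<in> tors S" for e
      proof -
        have "lin ?M ?N (\<lambda>l. fext (\<lambda>_. e) (\<phi> l))" by (rule lin_comp[OF \<phi>(1) lin_fext \<phi>(2)])
        moreover have "(\<lambda>l. fext (\<lambda>_. e) (\<phi> l)) ` ?N \<subseteq> tors S"
          using fext_in[OF tors_submod, of _ "{..<1::nat}" "\<lambda>_. e"] \<phi>(2) e by blast
        ultimately have "\<exists>g. lin ?M ?P' g \<and> g ` ?P' \<subseteq> tors S \<and> (\<forall>l\<in>?N. g l = fext (\<lambda>_. e) (\<phi> l))"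
          by (rule extends_toD[OF ext[OF S]])
        then obtain g where g: "lin ?M ?P' g \<and> g ` ?P' \<subseteq> tors S \<and> (\<forall>l\<in>?N. g l = fext (\<lambda>_. e) (\<phi> l))"
          by (rule exE)
        then have "g (z y) = fext (\<lambda>_. e) (\<phi> (z y))" if "y < s" for y using zN[OF that] by (elim conjE) (erule bspec)
        then show ?thesis using g by (intro exI[of _ g]) simp
      qed
      have zP: "z y \<in> ?P'" if "y < s" for y using zN[OF that] d(2) by blast
      have "\<exists>t \<psi>. finite (supp t) \<and> supp t \<subseteq> lat S \<and> t \<noteq> 0 \<and> lin ?M ?P' \<psi> \<and> \<psi> ` ?P' \<subseteq> ?A \<and>
          (\<forall>y<s. \<psi> (z y) = (\<Sum>a\<in>supp t. sc (t a) (rop a (\<phi> (z y)))))"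
        by (rule window[OF S(1) S0 zP \<phi>z E])
      then obtain t \<psi>
        where t: "finite (supp t)" "supp t \<subseteq> lat S" "t \<noteq> 0" and \<psi>1: "lin ?M ?P' \<psi>" and \<psi>2: "\<psi> ` ?P' \<subseteq> ?A"
          and \<psi>3: "\<forall>y<s. \<psi> (z y) = (\<Sum>a\<in>supp t. sc (t a) (rop a (\<phi> (z y))))"
        by (elim exE conjE) (rule that)
      note \<psi> = \<psi>1 \<psi>2 \<psi>3[rule_format]
      have "(\<Sum>a\<in>supp t. sc (t a) (rop a v)) \<in> V0"
      proof (rule V0I[OF \<psi>(1)])
        show "\<psi> p \<in> ?A" if "p \<in> ?P'" for p using \<psi>(2) that by blast
        show "(\<Sum>a\<in>supp t. sc (t a) (rop a v)) (y, a) = \<psi> (z y) (0, a)" if "y < s" for y a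
          using that by (simp add: \<psi>(3) fun_simps rop_apply v_def)
      qed
      then show "\<exists>t. finite (supp t) \<and> supp t \<subseteq> lat S \<and> t \<noteq> 0 \<and> (\<Sum>a\<in>supp t. sc (t a) (rop a v)) \<in> V0"
        using t by blast
    qed
    then obtain \<psi> where \<psi>: "lin ?M ?P' \<psi>" "\<psi> ` ?P' \<subseteq> ?A" "\<forall>y<s. \<forall>a. v (y, a) = \<psi> (z y) (0, a)"
      unfolding V0_def by blast
    have eqz: "\<psi> (z y) = \<phi> (z y)" if y: "y < s" for y
    proof (rule HOL.ext, clarify)
      fix x a
      have zero: "f (x, a) = 0" if "f \<in> ?A" "x \<noteq> 0" for f :: "nat \<times> expo \<Rightarrow> 'k"
        using that by (auto simp: Fr_def supp_def)
      have "\<psi> (z y) \<in> ?A" using zN[OF y] d(2) \<psi>(2) by blast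
      then show "\<psi> (z y) (x, a) = \<phi> (z y) (x, a)"
        using zero[of "\<psi> (z y)"] zero[OF \<phi>z[OF y]] \<psi>(3) y by (cases "x = 0") (auto simp: v_def)
    qed
    have "\<psi> (d p) = \<phi> (d p)" if p: "p \<in> ?P" for p
    proof (rule lin_eq_on_gens[OF _ _ _ p])
      show "lin ?M ?P (\<lambda>p. \<psi> (d p))" by (rule lin_comp[OF d(1) \<psi>(1) d(2)])
      show "lin ?M ?P (\<lambda>p. \<phi> (d p))" by (rule lin_comp[OF d(1) \<phi>(1)]) simp
    qed (use eqz in \<open>auto simp: z_def\<close>)
    then show ?thesis using \<psi> by blast
  qed
  \<comment> \<open>The x-th coordinate regarded as an element of the ring, so that \<sigma> can be
    extended coordinate by coordinate.\<close>
  define cmp where "cmp x f = (\<lambda>(y :: nat, a). if y = 0 then f (x, a) else 0)" for x and f :: "nat \<times> expo \<Rightarrow> 'k"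
  have cmp_lin: "cmp x (f + g) = cmp x f + cmp x g" "cmp x (sc q f) = sc q (cmp x f)" "cmp x (mop a f) = mop a (cmp x f)"
    for x f g q a
    by (auto simp: cmp_def fun_eq_iff fun_simps mop_apply)
  have cmp_A: "cmp x f \<in> ?A" if "f \<in> ?P" for x f
  proof -
    have sub: "supp (cmp x f) \<subseteq> Pair 0 ` snd ` supp f"
    proof
      fix p assume "p \<in> supp (cmp x f)"
      then obtain a where "p = (0, a)" "(x, a) \<in> supp f" by (cases p) (auto simp: cmp_def supp_iff split: if_splits)
      then show "p \<in> Pair 0 ` snd ` supp f" by force
    qed
    have "finite (supp f)" using that by (rule Fr_finite)
    then have fin: "finite (supp (cmp x f))" using sub by (meson finite_imageI finite_subset)
    have "supp (cmp x f) \<subseteq> {..<1} \<times> lat ?M"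
    proof
      fix p assume "p \<in> supp (cmp x f)"
      then obtain q where q: "q \<in> supp f" "p = (0, snd q)" using sub by blast
      have "q \<in> {..<s} \<times> lat ?M" using q(1) that unfolding Fr_def by blast
      then show "p \<in> {..<1} \<times> lat ?M" by (auto simp: q(2))
    qed
    then show ?thesis using fin unfolding Fr_def by blast
  qed
  have "\<exists>\<psi>. lin ?M ?P' \<psi> \<and> \<psi> ` ?P' \<subseteq> ?A \<and> (\<forall>z\<in>?N. \<psi> z = cmp x (\<sigma> z))" for x
  proof (rule ext_A)
    show "lin ?M ?N (\<lambda>z. cmp x (\<sigma> z))"
      using linD[OF \<sigma>(1)] by (simp add: lin_def cmp_lin)
    show "(\<lambda>z. cmp x (\<sigma> z)) ` ?N \<subseteq> ?A" using \<sigma>(2) cmp_A by blast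
  qed
  then obtain \<psi> where \<psi>: "\<And>x. lin ?M ?P' (\<psi> x)" "\<And>x. \<psi> x ` ?P' \<subseteq> ?A" "\<And>x z. z \<in> ?N \<Longrightarrow> \<psi> x z = cmp x (\<sigma> z)"
    by metis
  define asm where "asm p = (\<lambda>(x, a). if x < s then \<psi> x p (0, a) else 0)" for p
  have asm_lin: "lin ?M ?P' asm"
    unfolding lin_def asm_def using linD[OF \<psi>(1)]
    by (auto simp: fun_eq_iff fun_simps mop_apply)
  have asm_P: "asm p \<in> ?P" if p: "p \<in> ?P'" for p
  proof -
    have sub: "supp (asm p) \<subseteq> (\<Union>x<s. (\<lambda>q. (x, snd q)) ` supp (\<psi> x p))"
    proof
      fix q assume "q \<in> supp (asm p)"
      then obtain x a where "q = (x, a)" "x < s" "(0, a) \<in> supp (\<psi> x p)"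
        by (cases q) (auto simp: asm_def supp_iff split: if_splits)
      then show "q \<in> (\<Union>x<s. (\<lambda>q. (x, snd q)) ` supp (\<psi> x p))" by force
    qed
    have \<psi>A: "\<psi> x p \<in> ?A" for x using \<psi>(2) p by blast
    have "finite (\<Union>x<s. (\<lambda>q. (x, snd q)) ` supp (\<psi> x p))" using Fr_finite[OF \<psi>A] by simp
    then have "finite (supp (asm p))" using sub finite_subset by blast
    moreover have "supp (asm p) \<subseteq> {..<s} \<times> lat ?M"
    proof
      fix q assume "q \<in> supp (asm p)"
      then obtain x q' where q: "x < s" "q' \<in> supp (\<psi> x p)" "q = (x, snd q')" using sub by blast
      have "q' \<in> {..<1} \<times> lat ?M" using q(2) \<psi>A[of x] unfolding Fr_def by blast
      then show "q \<in> {..<s} \<times> lat ?M" using q(1) by (auto simp: q(3))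
    qed
    ultimately show ?thesis unfolding Fr_def by blast
  qed
  have asm_\<sigma>: "asm z = \<sigma> z" if z: "z \<in> ?N" for z
  proof (rule HOL.ext, clarify)
    fix x a
    have "\<sigma> z \<in> ?P" using \<sigma>(2) z by blast
    then have "\<sigma> z (x, a) = 0" if "\<not> x < s" using that by (auto simp: Fr_def supp_def)
    then show "asm z (x, a) = \<sigma> z (x, a)" by (simp add: asm_def \<psi>(3)[OF z] cmp_def)
  qed
  show ?thesis
  proof (intro exI[of _ "\<lambda>p. d (asm p)"] conjI ballI)
    show "lin ?M ?P' (\<lambda>p. d (asm p))" by (rule lin_comp[OF asm_lin d(1)]) (use asm_P in blast)
    show "(\<lambda>p. d (asm p)) ` ?P' \<subseteq> ?N" using asm_P by blast
    show "d (asm z) = z" if "z \<in> ?N" for z using asm_\<sigma>[OF that] \<sigma>(3)[OF that] by simp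
  qed
qed

text \<open>With \<open>N 0 = I\<close> and \<open>P 0\<close> the ring, \<open>retract j\<close>
  says that the syzygy \<open>N j\<close> is a direct summand of \<open>P j\<close>. Once this holds
  for j = n, the syzygy \<open>N (n - 1)\<close> is projective, and the resolution of
  \<open>I\<close> stops at length n - 1.\<close>

theorem good_lideals:
  assumes I: "I \<in> lideals"
  shows "good (n - 1) I"
proof -
  let ?M = "{..<2*n}"
  obtain r d where r0: "r 0 = (1::nat)" and d: "\<And>j. lin ?M (Fr ?M {..<r (Suc j)}) (d j)"
    and d0: "d 0 ` Fr ?M {..<r (Suc 0)} = I"
    and ker: "\<And>j. d (Suc j) ` Fr ?M {..<r (Suc (Suc j))} = {z\<in>Fr ?M {..<r (Suc j)}. (d j z :: nat \<times> expo \<Rightarrow> 'k) = 0}"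
    using exists_resolution[OF I] by blast
  define P where "P j = (Fr ?M {..<r j} :: (nat \<times> expo \<Rightarrow> 'k) set)" for j
  define N where "N j = d j ` P (Suc j)" for j
  have sub: "N j \<subseteq> P j" for j
    using d0 ker I r0 by (cases j) (auto simp: N_def P_def lideals_def)
  have PM: "submod ?M (P j)" for j by (simp add: P_def submod_Fr)
  have NM: "submod ?M (N j)" for j unfolding N_def P_def by (rule lin_image_submod[OF d submod_Fr]) simp
  have N_Suc: "N (Suc j) = {z\<in>P (Suc j). d j z = 0}" for j using ker by (simp add: N_def P_def)
  have ext: "extends_to ?M (P j) (N j) Q"
    if "S \<subseteq> ?M" "card (?M - S) \<le> j" "submod ?M Q" "\<And>j. extends_to S (P j) (N j) Q"
    for S j and Q :: "(nat \<times> expo \<Rightarrow> 'k) set"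
  proof -
    have "extends_to (S \<union> (?M - S)) (P j) (N j) Q"
      unfolding P_def N_def
    proof (rule extends_iterate[OF that(3,1)])
      show "d 0 ` Fr ?M {..<r (Suc 0)} \<subseteq> Fr ?M {..<r 0}" using sub[of 0] by (simp add: N_def P_def)
    qed (use d ker that in \<open>auto simp: P_def N_def\<close>)
    moreover have "S \<union> (?M - S) = ?M" using that(1) by blast
    ultimately show ?thesis by simp
  qed
  define retract where "retract j \<longleftrightarrow> (\<exists>\<rho>. lin ?M (P j) \<rho> \<and> \<rho> ` P j \<subseteq> N j \<and> (\<forall>z\<in>N j. \<rho> z = z))" for j
  \<comment> \<open>Over the field everything extends, and adjoining all 2n variables costs 2n
    degrees; extending the identity of \<open>N (2*n)\<close> gives the retraction.\<close>
  have top: "retract (2 * n)"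
  proof -
    have "extends_to ?M (P (2*n)) (N (2*n)) (N (2*n))"
      by (rule ext[of "{}", OF _ _ NM extends_linear[OF submod_mono[OF NM]]]) auto
    moreover have "lin ?M (N (2*n)) (\<lambda>z. z)" by (simp add: lin_def)
    ultimately show ?thesis unfolding retract_def by (rule extends_toD) auto
  qed
  \<comment> \<open>The n variables of \<open>S\<close> cost nothing for values in
    \<open>tors S\<close>, so the remaining n variables leave extension valid for every
    \<open>j \<ge> n\<close>.\<close>
  have down: "retract j" if rj: "retract (Suc j)" "n \<le> j" for j
  proof -
    obtain \<rho> where \<rho>: "lin ?M (P (Suc j)) \<rho>" "\<rho> ` P (Suc j) \<subseteq> N (Suc j)" "\<forall>z\<in>N (Suc j). \<rho> z = z"
      using rj(1) unfolding retract_def by blast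
    have "extends_to ?M (P j) (N j) (tors S)" if S: "S \<subseteq> ?M" "card S = n" for S
    proof (rule ext[OF S(1) _ tors_submod])
      have "card (?M - S) = n" using S by (simp add: card_Diff_subset finite_subset)
      then show "card (?M - S) \<le> j" using \<open>n \<le> j\<close> by simp
      show "extends_to S (P i) (N i) (tors S)" for i
        by (rule extends_tors[OF S(1) submod_mono[OF PM S(1)] submod_mono[OF NM S(1)] sub])
    qed
    then show ?thesis
      using retract_descend[where s = "r (Suc j)" and d = "d j" and r = "r j" and \<rho> = \<rho>] d[of j] sub[of j] \<rho> N_Suc[of j]
      unfolding retract_def P_def N_def by simp
  qed
  have "retract (2 * n - i)" if "i \<le> n" for i
    using that
  proof (induction i)
    case (Suc i)
    then have "Suc (2 * n - Suc i) = 2 * n - i" by simp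
    then show ?case using down[of "2 * n - Suc i"] Suc by simp
  qed (use top in simp)
  from this[of n] have "retract n" by simp
  then obtain \<rho> where \<rho>: "lin ?M (P n) \<rho>" "\<rho> ` P n \<subseteq> N n" "\<forall>z\<in>N n. \<rho> z = z"
    unfolding retract_def by blast
  have NE: "d j ` Fr ?M {..<r (Suc j)} = N j" for j by (simp add: N_def P_def)
  \<comment> \<open>At \<open>j = n - 1\<close> the retraction onto \<open>N n\<close>, the kernel
    of \<open>d j\<close>, gives the section required by \<open>good 0\<close>.\<close>
  have "good k (N j)" if "j + k = n - 1" for j k
    using that
  proof (induction k arbitrary: j)
    case 0
    then have j: "Suc j = n" using n_pos by simp
    have "\<exists>s. lin ?M (d j ` P (Suc j)) s \<and> s ` d j ` P (Suc j) \<subseteq> P (Suc j) \<and> (\<forall>l\<in>d j ` P (Suc j). d j (s l) = l)"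
    proof (rule section_of_retract[OF PM, where d = "d j" and \<rho> = \<rho>])
      show "lin ?M (P (Suc j)) (d j)" using d by (simp add: P_def)
    qed (use \<rho> N_Suc[of j] j in simp_all)
    then obtain s where s: "lin ?M (N j) s \<and> s ` N j \<subseteq> Fr ?M {..<r (Suc j)} \<and> (\<forall>l\<in>N j. d j (s l) = l)"
      unfolding N_def P_def by (rule exE)
    show ?case
      unfolding good.simps(1)
      by (rule exI[of _ "{..<r (Suc j)}"], rule exI[of _ "d j"], rule exI[of _ s], rule conjI, rule d,
        rule conjI, rule NE, rule s)
  next
    case (Suc k)
    then have "good k (N (Suc j))" by simp
    then have K: "good k {z\<in>Fr ?M {..<r (Suc j)}. d j z = 0}" by (simp add: N_Suc P_def)
    show ?case
      unfolding good.simps(2)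
      by (rule exI[of _ "{..<r (Suc j)}"], rule exI[of _ "d j"], rule conjI, rule d, rule conjI, rule NE, rule K)
  qed
  from this[of 0 "n - 1"] show ?thesis using d0 by (simp add: NE[symmetric])
qed

end

section \<open>The quantum torus as a ring of functions\<close>

context qt
begin

text \<open>The action of the ring on every function module; applied to an element of
  \<open>TA\<close> it is the ring multiplication itself.\<close>

definition act :: "(nat \<times> expo \<Rightarrow> 'k) \<Rightarrow> ('x \<times> expo \<Rightarrow> 'k) \<Rightarrow> 'x \<times> expo \<Rightarrow> 'k" where
  "act u f = fext (\<lambda>_. f) u"

definition TA :: "(nat \<times> expo \<Rightarrow> 'k) set" where
  "TA = Fr {..<m} {..<1}"

lemma TA_submod: "submod {..<m} TA"
  by (simp add: TA_def submod_Fr)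

lemma TA_finite: "u \<in> TA \<Longrightarrow> finite (supp u)"
  by (simp add: TA_def Fr_finite)

lemma TA_supp: "u \<in> TA \<Longrightarrow> p \<in> supp u \<Longrightarrow> fst p = 0 \<and> snd p \<in> lat {..<m}"
  by (cases p) (auto simp: TA_def Fr_def)

lemma bas_TA: "a \<in> lat {..<m} \<Longrightarrow> bas (0, a) \<in> TA"
  by (simp add: TA_def)

lemma act_sum: "act u f = (\<Sum>p\<in>supp u. sc (u p) (mop (snd p) f))"
  by (simp add: act_def fext_def lext_def case_prod_unfold)

lemma act_bas: "act (bas (0, a)) f = mop a f"
  by (simp add: act_def fext_bas)

lemma act_add_left: "u \<in> TA \<Longrightarrow> v \<in> TA \<Longrightarrow> act (u + v) f = act u f + act v f"
  by (simp add: act_def fext_add TA_finite)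

lemma act_sc_left: "u \<in> TA \<Longrightarrow> act (sc r u) f = sc r (act u f)"
  by (simp add: act_def fext_sc TA_finite)

lemma act_mop_left: "u \<in> TA \<Longrightarrow> act (mop a u) f = mop a (act u f)"
  by (simp add: act_def fext_mop TA_finite)

lemma act_zero_left [simp]: "act 0 f = 0"
  by (simp add: act_def)

lemma act_add_right: "act u (f + g) = act u f + act u g"
  by (simp add: act_sum mop_add sc_add_right sum.distrib)

lemma act_in:
  assumes "submod {..<m} L" "u \<in> TA" "f \<in> L"
  shows "act u f \<in> L"
  unfolding act_sum
  by (rule submod_sum[OF assms(1)], rule submod_sc[OF assms(1)], rule submod_mop[OF assms(1) _ assms(3)])
    (use TA_supp[OF assms(2)] in blast)

lemma lin_act:
  assumes h: "lin {..<m} L h" and L: "submod {..<m} L" and "u \<in> TA" "f \<in> L"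
  shows "h (act u f) = act u (h f)"
proof -
  have lat: "snd p \<in> lat {..<m}" if "p \<in> supp u" for p using TA_supp[OF assms(3) that] by blast
  have "h (act u f) = (\<Sum>p\<in>supp u. h (sc (u p) (mop (snd p) f)))"
    unfolding act_sum
    by (rule lin_sum[OF h L], rule submod_sc[OF L], rule submod_mop[OF L _ assms(4)]) (rule lat)
  also have "\<dots> = act u (h f)"
    unfolding act_sum
    by (rule sum.cong[OF refl]) (simp add: lin_sc[OF h submod_mop[OF L lat assms(4)]] lin_mop[OF h lat assms(4)])
  finally show ?thesis .
qed

lemma act_one: "u \<in> TA \<Longrightarrow> act u (bas (0, 0)) = u"
proof -
  assume u: "u \<in> TA"
  have "act u (bas (0, 0)) = (\<Sum>p\<in>supp u. sc (u p) (bas p))"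
    unfolding act_sum
  proof (rule sum.cong[OF refl])
    fix p assume "p \<in> supp u"
    then have "p = (0, snd p)" using TA_supp[OF u] by (metis prod.collapse)
    then show "sc (u p) (mop (snd p) (bas (0, 0))) = sc (u p) (bas p)" by (metis bas_eq_mop)
  qed
  also have "\<dots> = u" by (rule bas_expansion[symmetric]) (simp_all add: TA_finite[OF u])
  finally show ?thesis .
qed

lemma act_act: "u \<in> TA \<Longrightarrow> v \<in> TA \<Longrightarrow> act u (act v f) = act (act u v) f"
proof (rule lin_act[OF _ TA_submod, symmetric])
  show "lin {..<m} TA (\<lambda>v. act v f)" unfolding lin_def by (simp add: act_add_left act_sc_left act_mop_left)
qed

lemma act_TA: "u \<in> TA \<Longrightarrow> v \<in> TA \<Longrightarrow> act u v \<in> TA"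
  by (rule act_in[OF TA_submod])

definition torus_ring :: "(nat \<times> expo \<Rightarrow> 'k) ring" where
  "torus_ring = \<lparr>carrier = TA, mult = act, one = bas (0, 0), zero = 0, add = (+)\<rparr>"

lemma torus_ring_simps [simp]:
  "carrier torus_ring = TA" "mult torus_ring = act" "one torus_ring = bas (0, 0)"
  "zero torus_ring = 0" "add torus_ring = (+)"
  by (simp_all add: torus_ring_def)

lemma ring_torus_ring: "ring torus_ring"
proof (rule ringI)
  show "abelian_group torus_ring"
  proof (rule abelian_groupI)
    show "\<exists>y\<in>carrier torus_ring. y \<oplus>\<^bsub>torus_ring\<^esub> u = \<zero>\<^bsub>torus_ring\<^esub>" if "u \<in> carrier torus_ring" for u
      using that submod_uminus[OF TA_submod, of u] by (intro bexI[of _ "- u"]) simp_all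
  qed (simp_all add: submod_zero[OF TA_submod] submod_add[OF TA_submod] add.assoc add.commute)
  show "Group.monoid torus_ring"
    by (rule Group.monoidI) (simp_all add: act_TA bas_TA act_act act_one act_bas)
qed (simp_all add: act_add_left act_add_right)

end

locale torus_realization = qt m c + R: ring R
  for m and c :: "nat \<Rightarrow> nat \<Rightarrow> 'k::field" and R :: "('a, 'r) ring_scheme" (structure) +
  fixes E :: "'a \<Rightarrow> nat \<times> expo \<Rightarrow> 'k"
  assumes E_iso: "E \<in> ring_iso R torus_ring"
begin

lemma E_bij: "bij_betw E (carrier R) TA"
  using E_iso by (simp add: ring_iso_def)

lemma E_TA: "r \<in> carrier R \<Longrightarrow> E r \<in> TA"
  using E_bij bij_betwE by blast

lemma E_inj: "r \<in> carrier R \<Longrightarrow> s \<in> carrier R \<Longrightarrow> E r = E s \<Longrightarrow> r = s"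
  using E_bij unfolding bij_betw_def inj_on_def by blast

lemma E_hom: "E \<in> ring_hom R torus_ring"
  using E_iso by (simp add: ring_iso_def)

lemma E_add: "r \<in> carrier R \<Longrightarrow> s \<in> carrier R \<Longrightarrow> E (r \<oplus> s) = E r + E s"
  using ring_hom_add[OF E_hom] by simp

lemma E_mult: "r \<in> carrier R \<Longrightarrow> s \<in> carrier R \<Longrightarrow> E (r \<otimes> s) = act (E r) (E s)"
  using ring_hom_mult[OF E_hom] by simp

lemma E_one: "E \<one> = bas (0, 0)"
  using ring_hom_one[OF E_hom] by simp

lemma E_zero: "E \<zero> = 0"
  using E_add[of \<zero> \<zero>] by simp

definition ei :: "(nat \<times> expo \<Rightarrow> 'k) \<Rightarrow> 'a" where
  "ei u = inv_into (carrier R) E u"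

lemma ei: "u \<in> TA \<Longrightarrow> ei u \<in> carrier R" "u \<in> TA \<Longrightarrow> E (ei u) = u"
  using E_bij unfolding ei_def bij_betw_def by (auto intro: inv_into_into f_inv_into_f)

lemma ei_E: "r \<in> carrier R \<Longrightarrow> ei (E r) = r"
  by (rule E_inj) (simp_all add: ei E_TA)

lemma ei_add: "u \<in> TA \<Longrightarrow> v \<in> TA \<Longrightarrow> ei (u + v) = ei u \<oplus> ei v"
  by (rule E_inj) (simp_all add: ei E_add submod_add[OF TA_submod])

lemma ei_act: "r \<in> carrier R \<Longrightarrow> v \<in> TA \<Longrightarrow> ei (act (E r) v) = r \<otimes> ei v"
  by (rule E_inj) (simp_all add: ei E_mult act_TA E_TA)

lemma ei_zero: "ei 0 = \<zero>"
  by (rule E_inj) (simp_all add: ei E_zero submod_zero[OF TA_submod])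

lemma E_left_ideal:
  assumes "I \<in> left_ideals R"
  shows "E ` I \<in> lideals"
proof -
  have sub: "additive_subgroup I R" and l: "\<And>r x. r \<in> carrier R \<Longrightarrow> x \<in> I \<Longrightarrow> r \<otimes> x \<in> I"
    using assms by (auto simp: left_ideals_def)
  interpret I: additive_subgroup I R by (rule sub)
  have Ic: "x \<in> carrier R" if "x \<in> I" for x using I.a_subset that by blast
  have act_I: "act u (E x) \<in> E ` I" if "u \<in> TA" "x \<in> I" for u x
    using l[OF ei(1)[OF that(1)] that(2)] E_mult[OF ei(1)[OF that(1)] Ic[OF that(2)]] ei(2)[OF that(1)] by (metis imageI)
  have "submod {..<m} (E ` I)"
    unfolding submod_def
  proof (intro conjI ballI allI)
    show "0 \<in> E ` I" using I.zero_closed E_zero by (metis imageI)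
    fix u assume "u \<in> E ` I"
    then obtain x where x: "x \<in> I" "u = E x" by blast
    show "sc r u \<in> E ` I" for r
    proof -
      have "act (sc r (bas (0, 0))) (E x) = sc r (E x)" by (simp add: act_sc_left act_bas bas_TA)
      then show ?thesis using act_I[of "sc r (bas (0, 0))" x] x by (simp add: bas_TA submod_sc[OF TA_submod])
    qed
    show "mop a u \<in> E ` I" if "a \<in> lat {..<m}" for a
      using act_I[OF bas_TA[OF that] x(1)] x(2) by (simp add: act_bas)
    fix v assume "v \<in> E ` I"
    then obtain y where y: "y \<in> I" "v = E y" by blast
    show "u + v \<in> E ` I"
      using E_add[OF Ic[OF x(1)] Ic[OF y(1)]] I.a_closed[OF x(1) y(1)] x(2) y(2) by (metis imageI)
  qed
  moreover have "E ` I \<subseteq> TA" using E_TA Ic by blast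
  ultimately show ?thesis by (simp add: lideals_def TA_def)
qed

lemma left_ideal_E:
  assumes "L \<in> lideals"
  shows "{r \<in> carrier R. E r \<in> L} \<in> left_ideals R"
proof -
  have L: "submod {..<m} L" "L \<subseteq> TA" using assms by (simp_all add: lideals_def TA_def)
  have minus: "E (\<ominus> r) = - E r" if "r \<in> carrier R" for r
    using E_add[of r "\<ominus> r"] that by (simp add: R.r_neg E_zero add_eq_0_iff)
  have "additive_subgroup {r \<in> carrier R. E r \<in> L} R"
    by (intro additive_subgroup.intro subgroup.intro)
      (auto simp: E_add E_zero submod_add[OF L(1)] submod_zero[OF L(1)]
        minus[unfolded a_inv_def] submod_uminus[OF L(1)] R.a_inv_closed[unfolded a_inv_def])
  then show ?thesis
    by (auto simp: left_ideals_def E_mult act_in[OF L(1)] E_TA)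
qed

lemma dev_less_left_ideals: "dev_less d (left_ideals R) \<longleftrightarrow> dev_less d lideals"
proof
  show "dev_less d lideals" if "dev_less d (left_ideals R)"
  proof (rule dev_less_embed[OF that, where f = "\<lambda>L. {r \<in> carrier R. E r \<in> L}"])
    show "{r \<in> carrier R. E r \<in> x} < {r \<in> carrier R. E r \<in> y}" if xy: "x \<in> lideals" "y \<in> lideals" "x < y" for x y
    proof -
      obtain u where u: "u \<in> y" "u \<notin> x" using xy(3) by blast
      then have "u \<in> TA" using xy(2) by (auto simp: lideals_def TA_def)
      then have "ei u \<in> {r \<in> carrier R. E r \<in> y}" "ei u \<notin> {r \<in> carrier R. E r \<in> x}"
        using u ei[of u] by simp_all
      then show ?thesis using xy(3) by blast
    qed
  qed (use left_ideal_E in blast)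
  show "dev_less d (left_ideals R)" if "dev_less d lideals"
  proof (rule dev_less_embed[OF that, where f = "image E"])
    show "E ` x < E ` y" if xy: "x \<in> left_ideals R" "y \<in> left_ideals R" "x < y" for x y
    proof -
      have sub: "y \<subseteq> carrier R" using xy(2) by (auto simp: left_ideals_def dest: additive_subgroup.a_subset)
      obtain u where u: "u \<in> y" "u \<notin> x" using xy(3) by blast
      have "E u \<notin> E ` x" using u xy(3) sub E_inj by blast
      then show ?thesis using u(1) xy(3) by blast
    qed
  qed (use E_left_ideal in blast)
qed

end

section \<open>The lower bound for the Krull dimension\<close>

primrec lexl :: "nat list \<Rightarrow> nat list \<Rightarrow> bool" where
  "lexl [] ys \<longleftrightarrow> False"
| "lexl (x # xs) ys \<longleftrightarrow> (case ys of [] \<Rightarrow> False | y # ys \<Rightarrow> x < y \<or> x = y \<and> lexl xs ys)"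

lemma lexl_trans: "lexl xs ys \<Longrightarrow> lexl ys zs \<Longrightarrow> lexl xs zs"
  by (induction xs arbitrary: ys zs) (auto split: list.splits)

lemma lexl_nth: "lexl xs ys \<Longrightarrow> \<exists>i<length ys. xs ! i < ys ! i"
proof (induction xs arbitrary: ys)
  case (Cons x xs)
  then obtain y zs where ys: "ys = y # zs" by (auto split: list.splits)
  then consider "x < y" | "lexl xs zs" using Cons.prems by auto
  then show ?case
  proof cases
    case 2
    then obtain i where "i < length zs" "xs ! i < zs ! i" using Cons.IH by blast
    then show ?thesis by (intro exI[of _ "Suc i"]) (simp add: ys)
  qed (auto simp: ys intro!: exI[of _ 0])
qed simp

text \<open>A family indexed by n-tuples and reversing the lexicographic order contains, between
  consecutive values of the first entry, a family for n - 1. The bound z supplies the strict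
  inequality needed when n = 0.\<close>

lemma not_dev_less_lex:
  fixes g :: "nat list \<Rightarrow> 'a::order"
  assumes "\<And>a. length a = n \<Longrightarrow> g a \<in> L" "z \<in> L" "\<And>a. length a = n \<Longrightarrow> z < g a"
    and "\<And>a b. length a = n \<Longrightarrow> length b = n \<Longrightarrow> lexl a b \<Longrightarrow> g b < g a"
  shows "\<not> dev_less n L"
  using assms
proof (induction n arbitrary: g L z)
  case 0
  then have "g [] \<in> L" "z < g []" by auto
  then show ?case using 0(2) by auto
next
  case (Suc n)
  \<comment> \<open>Tuples with first entry i lie between \<open>a (Suc i)\<close> and
    \<open>a i\<close>, and \<open>a (Suc i)\<close> plays the part of z in the induction.\<close>
  define a where "a i = g (i # replicate n 0)" for i
  have mono: "g (i # b) \<le> a i" if "length b = n" for i b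
  proof (cases "b = replicate n 0")
    case False
    have "lexl (replicate n 0) b" using that False
    proof (induction b arbitrary: n)
      case (Cons y b)
      then show ?case by (cases n) auto
    qed simp
    then show ?thesis using Suc.prems(4)[of "i # replicate n 0" "i # b"] that by (simp add: a_def)
  qed (simp add: a_def)
  have low: "a (Suc i) < g (i # b)" if "length b = n" for i b
    using Suc.prems(4)[of "i # b" "Suc i # replicate n 0"] that by (simp add: a_def)
  have dec: "decseq a"
    by (rule decseq_SucI) (use low mono in \<open>auto simp: a_def intro: less_imp_le\<close>)
  have aL: "a i \<in> L" for i using Suc.prems(1) by (simp add: a_def)
  have no: "\<not> dev_less n (L \<inter> {a (Suc i)..a i})" for i
  proof (rule Suc.IH[where g = "\<lambda>b. g (i # b)" and z = "a (Suc i)"])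
    show "g (i # b) \<in> L \<inter> {a (Suc i)..a i}" if "length b = n" for b
      using Suc.prems(1)[of "i # b"] mono[OF that] low[OF that, of i] that by (auto intro: less_imp_le)
    show "a (Suc i) \<in> L \<inter> {a (Suc i)..a i}" using aL dec by (auto simp: decseq_Suc_iff)
  qed (use low Suc.prems(4) in auto)
  show ?case
  proof
    assume "dev_less (Suc n) L"
    then have "\<forall>\<^sub>F i in sequentially. dev_less n (L \<inter> {a (Suc i)..a i})"
      using aL dec unfolding dev_less.simps(2) by blast
    then show False using no by (simp add: eventually_sequentially)
  qed
qed

text \<open>The variables below n multiply from the left without scalars and generate a commutative
  Laurent polynomial ring; the powers of t provide infinitely many evaluation points.\<close>

locale split_torus = sqt n c for n and c :: "nat \<Rightarrow> nat \<Rightarrow> 'k::field" +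
  fixes t :: 'k
  assumes c_left: "\<And>i j. i < n \<Longrightarrow> c i j = 1"
    and t_nonzero: "t \<noteq> 0" and t_generic: "\<And>k. k > 0 \<Longrightarrow> t ^ k \<noteq> 1"
begin

lemma bc_left: "(\<And>i. i \<ge> n \<Longrightarrow> a i = 0) \<Longrightarrow> bc a b = 1"
  unfolding bich_def
proof (intro prod.neutral ballI)
  fix i j assume "\<And>i. i \<ge> n \<Longrightarrow> a i = 0"
  then show "c i j powi (a i * b j) = 1" by (cases "i < n") (simp_all add: c_left)
qed

lemma t_power_inj: "t ^ i = t ^ j \<Longrightarrow> i = j"
proof (induction i j rule: linorder_wlog)
  case (le i j)
  have "t ^ j = t ^ i * t ^ (j - i)" using le(1) by (simp flip: power_add)
  then have "t ^ (j - i) = 1" using le(2) t_nonzero by simp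
  then show ?case using t_generic[of "j - i"] le(1) by force
qed simp

text \<open>An eigenvector of infinite support: each variable \<open>i < n\<close> acts on it by
  \<open>t ^ (b ! i)\<close>. The minus sign in the exponent comes from \<open>mop\<close>
  translating the argument backwards.\<close>

definition ev :: "nat list \<Rightarrow> 'x \<times> expo \<Rightarrow> 'k" where
  "ev b = (\<lambda>(x, a). if \<forall>j\<in>{n..<2*n}. a j = 0 then \<Prod>i<n. t powi (- int (b ! i) * a i) else 0)"

lemma mop_ev:
  assumes i: "i < n"
  shows "mop (unit_vec i) (ev b) = sc (t ^ (b ! i)) (ev b)"
proof (rule HOL.ext, clarify)
  fix x a
  have bc1: "bc (unit_vec i) d = 1" for d by (rule bc_left) (use i in \<open>auto simp: unit_vec_def\<close>)
  have y: "(\<forall>j\<in>{n..<2*n}. (a - unit_vec i) j = 0) \<longleftrightarrow> (\<forall>j\<in>{n..<2*n}. a j = 0)"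
    using i by (auto simp: unit_vec_def)
  have "(\<Prod>j<n. t powi (- int (b ! j) * (a - unit_vec i) j)) =
      (\<Prod>j<n. t powi (- int (b ! j) * a j) * (if j = i then t ^ (b ! i) else 1))"
  proof (rule prod.cong[OF refl])
    fix j
    have "t powi (- int (b ! i) * (a i - 1)) = t powi (- int (b ! i) * a i + int (b ! i))"
      by (simp add: algebra_simps)
    also have "\<dots> = t powi (- int (b ! i) * a i) * t ^ (b ! i)"
      by (subst power_int_add) (use t_nonzero in auto)
    finally show "t powi (- int (b ! j) * (a - unit_vec i) j) =
        t powi (- int (b ! j) * a j) * (if j = i then t ^ (b ! i) else 1)"
      by (simp add: unit_vec_def)
  qed
  also have "\<dots> = (\<Prod>j<n. t powi (- int (b ! j) * a j)) * t ^ (b ! i)"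
    using i by (simp add: prod.distrib prod.delta)
  finally show "mop (unit_vec i) (ev b) (x, a) = sc (t ^ (b ! i)) (ev b) (x, a)"
    by (simp only: mop_apply bc1 sc_apply ev_def split y) simp
qed

lemma ev_nonzero: "ev b \<noteq> 0"
proof
  assume "ev b = (0 :: 'x \<times> expo \<Rightarrow> 'k)"
  then have "ev b (undefined :: 'x, 0) = (0 :: 'k)" by (simp add: zero_fun_apply)
  then show False by (simp add: ev_def zero_fun_apply)
qed

definition fpoly :: "(nat \<times> nat) list \<Rightarrow> nat \<times> expo \<Rightarrow> 'k" where
  "fpoly ps = foldr (\<lambda>(i, k) u. mop (unit_vec i) u - sc (t ^ k) u) ps (bas (0, 0))"

lemma fpoly:
  assumes "\<forall>(i, k)\<in>set ps. i < n"
  shows "fpoly ps \<in> TA \<and>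
    act (fpoly ps) (ev b) = sc (\<Prod>(i, k)\<leftarrow>ps. t ^ (b ! i) - t ^ k) (ev b :: nat \<times> expo \<Rightarrow> 'k)"
  using assms
proof (induction ps)
  case Nil
  then show ?case by (simp add: fpoly_def bas_TA act_bas)
next
  case (Cons p ps)
  obtain i k where p: "p = (i, k)" by fastforce
  have i: "i < n" and IH: "fpoly ps \<in> TA"
    "act (fpoly ps) (ev b) = sc (\<Prod>(i, k)\<leftarrow>ps. t ^ (b ! i) - t ^ k) (ev b :: nat \<times> expo \<Rightarrow> 'k)"
    using Cons by (auto simp: p)
  have f: "fpoly (p # ps) = mop (unit_vec i) (fpoly ps) - sc (t ^ k) (fpoly ps)" by (simp add: fpoly_def p)
  have m: "mop (unit_vec i) (fpoly ps) \<in> TA" "sc (- (t ^ k)) (fpoly ps) \<in> TA"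
    by (rule submod_mop[OF TA_submod _ IH(1)], use i in simp) (rule submod_sc[OF TA_submod IH(1)])
  have f': "fpoly (p # ps) = mop (unit_vec i) (fpoly ps) + sc (- (t ^ k)) (fpoly ps)"
    unfolding f by (simp add: fun_eq_iff fun_simps)
  have "act (fpoly (p # ps)) (ev b) = mop (unit_vec i) (act (fpoly ps) (ev b)) + sc (- (t ^ k)) (act (fpoly ps) (ev b))"
    unfolding f' act_add_left[OF m] act_mop_left[OF IH(1)] act_sc_left[OF IH(1)] ..
  also have "\<dots> = sc (\<Prod>(i, k)\<leftarrow>p # ps. t ^ (b ! i) - t ^ k) (ev b :: nat \<times> expo \<Rightarrow> 'k)"
    unfolding IH(2) mop_sc mop_ev[OF i] by (simp add: p fun_eq_iff fun_simps algebra_simps)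
  finally have "act (fpoly (p # ps)) (ev b) = sc (\<Prod>(i, k)\<leftarrow>p # ps. t ^ (b ! i) - t ^ k) (ev b :: nat \<times> expo \<Rightarrow> 'k)" .
  moreover have "fpoly (p # ps) \<in> TA" unfolding f' by (rule submod_add[OF TA_submod m])
  ultimately show ?case by blast
qed

text \<open>The left ideal annihilating the eigenvectors of all points lexicographically below a; a
  larger a imposes more conditions.\<close>

definition vanish :: "nat list \<Rightarrow> (nat \<times> expo \<Rightarrow> 'k) set" where
  "vanish a = {u \<in> TA. \<forall>b. length b = n \<and> lexl b a \<longrightarrow> act u (ev b) = (0 :: nat \<times> expo \<Rightarrow> 'k)}"

lemma vanish_lideals: "vanish a \<in> lideals"
  unfolding lideals_def submod_def vanish_def TA_def[symmetric]
  by (simp add: submodD[OF TA_submod] act_add_left act_sc_left act_mop_left)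

text \<open>The product of all w_i - t^k with \<open>k < a ! i\<close> kills every point having some
  coordinate below that of a, in particular all lexicographically smaller ones, but not the point
  a.\<close>

lemma vanish_witness:
  assumes a: "length a = n"
  shows "\<exists>u\<in>vanish a. act u (ev a) \<noteq> (0 :: nat \<times> expo \<Rightarrow> 'k)"
proof -
  define ps where "ps = concat (map (\<lambda>i. map (Pair i) [0..<a ! i]) [0..<n])"
  have ps: "set ps = {(i, k). i < n \<and> k < a ! i}" by (auto simp: ps_def)
  have f: "fpoly ps \<in> TA" "act (fpoly ps) (ev b) = sc (\<Prod>(i, k)\<leftarrow>ps. t ^ (b ! i) - t ^ k) (ev b :: nat \<times> expo \<Rightarrow> 'k)" for b
    using fpoly[of ps b] by (auto simp: ps)
  have "fpoly ps \<in> vanish a"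
    unfolding vanish_def
  proof (intro CollectI conjI allI impI f(1))
    fix b assume b: "length b = n \<and> lexl b a"
    then obtain i where "i < n" "b ! i < a ! i" using lexl_nth[of b a] a by auto
    then have "(i, b ! i) \<in> set ps" by (simp add: ps)
    then have "(\<Prod>(i, k)\<leftarrow>ps. t ^ (b ! i) - t ^ k) = 0" by (force simp: prod_list_zero_iff)
    then show "act (fpoly ps) (ev b) = (0 :: nat \<times> expo \<Rightarrow> 'k)" unfolding f(2) by simp
  qed
  moreover have "(\<Prod>(i, k)\<leftarrow>ps. t ^ (a ! i) - t ^ k) \<noteq> 0"
  proof
    assume "(\<Prod>(i, k)\<leftarrow>ps. t ^ (a ! i) - t ^ k) = 0"
    then obtain i k where "(i, k) \<in> set ps" "t ^ (a ! i) = t ^ k" by (auto simp: prod_list_zero_iff)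
    then show False using t_power_inj[of "a ! i" k] by (auto simp: ps)
  qed
  then have "act (fpoly ps) (ev a) \<noteq> (0 :: nat \<times> expo \<Rightarrow> 'k)" unfolding f(2) using ev_nonzero by (simp add: fs.scale_eq_0_iff)
  ultimately show ?thesis by blast
qed

theorem not_dev_less_lideals: "\<not> dev_less n lideals"
proof (rule not_dev_less_lex[where g = vanish and z = "{0}"])
  show "{0} \<in> lideals" by (simp add: lideals_def submod_def)
  show "{0} < vanish a" if a: "length a = n" for a
  proof -
    obtain u where u: "u \<in> vanish a" "act u (ev a) \<noteq> (0 :: nat \<times> expo \<Rightarrow> 'k)" using vanish_witness[OF a] by blast
    then have "u \<noteq> 0" by auto
    moreover have "0 \<in> vanish a" by (simp add: vanish_def submod_zero[OF TA_submod])
    ultimately show ?thesis using u(1) by blast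
  qed
  show "vanish b < vanish a" if ab: "length a = n" "length b = n" "lexl a b" for a b
  proof -
    obtain u where u: "u \<in> vanish a" "act u (ev a) \<noteq> (0 :: nat \<times> expo \<Rightarrow> 'k)" using vanish_witness[OF ab(1)] by blast
    have "u \<notin> vanish b" using u(2) ab unfolding vanish_def by blast
    moreover have "vanish b \<subseteq> vanish a" using lexl_trans[OF _ ab(3)] unfolding vanish_def by blast
    ultimately show ?thesis using u(1) by blast
  qed
qed (rule vanish_lideals)

end

section \<open>Modules over the quantum torus\<close>

lemma left_module_homI:
  assumes "\<And>x. x \<in> carrier M \<Longrightarrow> f x \<in> carrier N"
    "\<And>x y. x \<in> carrier M \<Longrightarrow> y \<in> carrier M \<Longrightarrow> f (x \<oplus>\<^bsub>M\<^esub> y) = f x \<oplus>\<^bsub>N\<^esub> f y"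
    "\<And>r x. r \<in> carrier R \<Longrightarrow> x \<in> carrier M \<Longrightarrow> f (r \<odot>\<^bsub>M\<^esub> x) = r \<odot>\<^bsub>N\<^esub> f x"
  shows "f \<in> left_module_hom R M N"
  using assms by (auto simp: left_module_hom_def hom_def)

lemma left_module_homD:
  assumes "f \<in> left_module_hom R M N"
  shows "x \<in> carrier M \<Longrightarrow> f x \<in> carrier N"
    "x \<in> carrier M \<Longrightarrow> y \<in> carrier M \<Longrightarrow> f (x \<oplus>\<^bsub>M\<^esub> y) = f x \<oplus>\<^bsub>N\<^esub> f y"
    "r \<in> carrier R \<Longrightarrow> x \<in> carrier M \<Longrightarrow> f (r \<odot>\<^bsub>M\<^esub> x) = r \<odot>\<^bsub>N\<^esub> f x"
  using assms by (auto simp: left_module_hom_def hom_def)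

lemma left_module_zero:
  assumes N: "left_module R N"
  shows "r \<in> carrier R \<Longrightarrow> r \<odot>\<^bsub>N\<^esub> \<zero>\<^bsub>N\<^esub> = \<zero>\<^bsub>N\<^esub>"
    "x \<in> carrier N \<Longrightarrow> \<zero>\<^bsub>R\<^esub> \<odot>\<^bsub>N\<^esub> x = \<zero>\<^bsub>N\<^esub>"
proof -
  interpret R: ring R by (rule left_module.axioms(1)[OF N])
  interpret N: abelian_group N by (rule left_module.axioms(2)[OF N])
  note sm = left_module.smult_closed[OF N]
  show "r \<odot>\<^bsub>N\<^esub> \<zero>\<^bsub>N\<^esub> = \<zero>\<^bsub>N\<^esub>" if "r \<in> carrier R"
    using left_module.smult_r_distr[OF N that, of "\<zero>\<^bsub>N\<^esub>" "\<zero>\<^bsub>N\<^esub>"] sm[OF that, of "\<zero>\<^bsub>N\<^esub>"]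
    by (metis N.add.l_cancel_one' N.r_zero N.zero_closed)
  show "\<zero>\<^bsub>R\<^esub> \<odot>\<^bsub>N\<^esub> x = \<zero>\<^bsub>N\<^esub>" if "x \<in> carrier N"
    using left_module.smult_l_distr[OF N, of "\<zero>\<^bsub>R\<^esub>" "\<zero>\<^bsub>R\<^esub>" x] sm[of "\<zero>\<^bsub>R\<^esub>" x] that
    by (metis N.add.l_cancel_one' R.r_zero R.zero_closed)
qed

text \<open>Splicing a resolution of the kernel to a projective cover. The kernel \<open>K\<close>
  shares operations and zero with \<open>P\<close>, so its augmentation is also a map to
  \<open>P\<close> and the kernels in the exactness conditions are unchanged.\<close>

lemma resolution_step:
  fixes P :: "('a, 'm) module" and M :: "('a, 'm) module" and K :: "('a, 'm) module"
  assumes P: "projective R P" and g: "g \<in> left_module_hom R P M" "g ` carrier P = carrier M"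
    and K: "has_projective_resolution R K d" "carrier K = {x \<in> carrier P. g x = \<zero>\<^bsub>M\<^esub>}"
      "add K = add P" "zero K = zero P" "smult K = smult P"
  shows "has_projective_resolution R M (Suc d)"
proof -
  obtain Q :: "nat \<Rightarrow> ('a, 'm) module" and \<delta> :: "nat \<Rightarrow> 'm \<Rightarrow> 'm" where
    Q: "\<forall>i\<le>d. projective R (Q i)" and \<delta>0: "\<delta> 0 \<in> left_module_hom R (Q 0) K" "\<delta> 0 ` carrier (Q 0) = carrier K"
    and \<delta>: "\<forall>i<d. \<delta> (Suc i) \<in> left_module_hom R (Q (Suc i)) (Q i) \<and>
           \<delta> (Suc i) ` carrier (Q (Suc i)) =
             a_kernel (Q i) (case i of 0 \<Rightarrow> K | Suc j \<Rightarrow> Q j) (\<delta> i)"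
    and inj: "inj_on (\<delta> d) (carrier (Q d))"
    using K(1) unfolding has_projective_resolution_def by (elim exE conjE) (rule that)
  have \<delta>0': "\<delta> 0 \<in> left_module_hom R (Q 0) P"
    using left_module_homD[OF \<delta>0(1)] K by (intro left_module_homI) auto
  have ker: "a_kernel A (case i of 0 \<Rightarrow> P | Suc j \<Rightarrow> Q j) f = a_kernel A (case i of 0 \<Rightarrow> K | Suc j \<Rightarrow> Q j) f" for A i f
    by (simp add: a_kernel_def kernel_def K(4) split: nat.split)
  show ?thesis
    unfolding has_projective_resolution_def
  proof (intro exI[of _ "case_nat P Q"] exI[of _ "case_nat g \<delta>"] conjI)
    show "\<forall>i\<le>Suc d. projective R (case_nat P Q i)" using P Q by (simp split: nat.split)
    show "\<forall>i<Suc d. case_nat g \<delta> (Suc i) \<in> left_module_hom R (case_nat P Q (Suc i)) (case_nat P Q i) \<and>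
        case_nat g \<delta> (Suc i) ` carrier (case_nat P Q (Suc i)) =
        a_kernel (case_nat P Q i) (case i of 0 \<Rightarrow> M | Suc j \<Rightarrow> case_nat P Q j) (case_nat g \<delta> i)"
    proof (intro allI impI)
      fix i assume i: "i < Suc d"
      show "case_nat g \<delta> (Suc i) \<in> left_module_hom R (case_nat P Q (Suc i)) (case_nat P Q i) \<and>
        case_nat g \<delta> (Suc i) ` carrier (case_nat P Q (Suc i)) =
        a_kernel (case_nat P Q i) (case i of 0 \<Rightarrow> M | Suc j \<Rightarrow> case_nat P Q j) (case_nat g \<delta> i)"
      proof (cases i)
        case 0
        then show ?thesis using \<delta>0' \<delta>0(2) K(2) by (simp add: a_kernel_def kernel_def)
      next
        case (Suc j)
        then show ?thesis using \<delta> i ker[of "Q j" j] by simp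
      qed
    qed
  qed (use g inj in simp_all)
qed

definition row :: "'x \<Rightarrow> ('x \<times> expo \<Rightarrow> 'k::field) \<Rightarrow> nat \<times> expo \<Rightarrow> 'k" where
  "row x u = (\<lambda>(i, a). if i = 0 then u (x, a) else 0)"

context torus_realization
begin

lemma submod_Int: "submod T L \<Longrightarrow> submod T N \<Longrightarrow> submod T (L \<inter> N)"
  by (simp add: submod_def)

lemma row_lin: "lin T N (row x)"
  by (auto simp: lin_def row_def fun_eq_iff fun_simps mop_apply)

lemma row_TA: "u \<in> Fr {..<m} X \<Longrightarrow> row x u \<in> TA"
proof -
  assume u: "u \<in> Fr {..<m} X"
  have sub: "supp (row x u) \<subseteq> Pair 0 ` snd ` supp u"
    by (force simp: supp_iff row_def split: if_splits)
  have "supp u \<subseteq> X \<times> lat {..<m}" "finite (supp u)" using u unfolding Fr_def by blast+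
  then have "supp (row x u) \<subseteq> {..<1} \<times> lat {..<m}" "finite (supp (row x u))"
    using sub by (force, meson finite_imageI finite_subset)
  then show ?thesis by (simp add: TA_def Fr_def)
qed

lemma row_bas: "row x (bas (y, 0)) = (if x = y then bas (0, 0) else 0)"
  by (auto simp: row_def bas_def fun_eq_iff zero_fun_apply)

lemma row_zero: "x \<notin> fst ` supp u \<Longrightarrow> row x u = 0"
  by (force simp: row_def supp_iff fun_eq_iff zero_fun_apply)

lemma Fr_submod: "submod {..<m} (Fr {..<m} X)"
  by (simp add: submod_Fr)

lemma Fr_act_induct:
  assumes u: "u \<in> Fr {..<m} X" and P0: "Q 0"
    and step: "\<And>w x v. w \<in> TA \<Longrightarrow> x \<in> X \<Longrightarrow> v \<in> Fr {..<m} X \<Longrightarrow> Q v \<Longrightarrow> Q (act w (bas (x, 0)) + v)"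
  shows "Q u"
proof -
  have lat: "fst p \<in> X \<and> snd p \<in> lat {..<m}" if "p \<in> supp u" for p
    using u that by (cases p) (auto simp: Fr_def)
  have "finite A \<Longrightarrow> A \<subseteq> supp u \<Longrightarrow> (\<Sum>p\<in>A. sc (u p) (bas p)) \<in> Fr {..<m} X \<and> Q (\<Sum>p\<in>A. sc (u p) (bas p))" for A
  proof (induction A rule: finite_induct)
    case (insert p A)
    obtain x a where p: "p = (x, a)" by fastforce
    have xa: "x \<in> X" "a \<in> lat {..<m}" using lat[of p] insert.prems p by auto
    have w: "sc (u p) (bas (0, a)) \<in> TA" by (rule submod_sc[OF TA_submod bas_TA[OF xa(2)]])
    have eq: "sc (u p) (bas p) = act (sc (u p) (bas (0, a))) (bas (x, 0))"
      by (simp add: act_sc_left bas_TA xa act_bas p mop_bas)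
    have "(\<Sum>p\<in>insert p A. sc (u p) (bas p)) = act (sc (u p) (bas (0, a))) (bas (x, 0)) + (\<Sum>p\<in>A. sc (u p) (bas p))"
      using insert.hyps eq by simp
    moreover have "act (sc (u p) (bas (0, a))) (bas (x, 0)) \<in> Fr {..<m} X"
      by (rule act_in[OF Fr_submod w]) (simp add: xa)
    ultimately show ?case using insert step[OF w xa(1)] by simp
  qed (simp add: P0)
  from this[of "supp u"] show ?thesis
    using bas_expansion[of "supp u" u] Fr_finite[OF u] by simp
qed

text \<open>Universal property of the function model of a free module for targets that are abstract
  modules over \<open>R\<close>. A finitely supported u is the sum of its rows, each of which is a
  ring element acting on \<open>g x\<close>.\<close>

lemma free_extension:
  fixes N :: "('a, 'm) module"
  assumes N: "left_module R N" and g: "\<And>x. x \<in> X \<Longrightarrow> g x \<in> carrier N"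
  obtains \<Phi> where "\<And>u. u \<in> Fr {..<m} X \<Longrightarrow> \<Phi> u \<in> carrier N"
    "\<And>u v. u \<in> Fr {..<m} X \<Longrightarrow> v \<in> Fr {..<m} X \<Longrightarrow> \<Phi> (u + v) = \<Phi> u \<oplus>\<^bsub>N\<^esub> \<Phi> v"
    "\<And>r u. r \<in> carrier R \<Longrightarrow> u \<in> Fr {..<m} X \<Longrightarrow> \<Phi> (act (E r) u) = r \<odot>\<^bsub>N\<^esub> \<Phi> u"
    "\<And>x. x \<in> X \<Longrightarrow> \<Phi> (bas (x, 0)) = g x"
proof -
  interpret N: abelian_group N by (rule left_module.axioms(2)[OF N])
  note sm = left_module.smult_closed[OF N]
  define G where "G u x = ei (row x u) \<odot>\<^bsub>N\<^esub> g x" for u x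
  define \<Phi> where "\<Phi> u = finsum N (G u) (fst ` supp u)" for u
  have G: "G u x \<in> carrier N" if "u \<in> Fr {..<m} X" "x \<in> X" for u x
    unfolding G_def by (intro sm ei row_TA[OF that(1)] g that)
  have sX: "fst ` supp u \<subseteq> X" "finite (fst ` supp u)" if "u \<in> Fr {..<m} X" for u
    using that by (auto simp: Fr_def)
  have sup: "\<Phi> u = finsum N (G u) B" if u: "u \<in> Fr {..<m} X" and B: "finite B" "fst ` supp u \<subseteq> B" "B \<subseteq> X" for u B
    unfolding \<Phi>_def
  proof (rule N.add.finprod_mono_neutral_cong_left[OF B(1,2)])
    show "G u x = \<zero>\<^bsub>N\<^esub>" if "x \<in> B - fst ` supp u" for x
      unfolding G_def using that B(3) g row_zero[of x u] left_module_zero(2)[OF N] by (auto simp: ei_zero)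
    show "G u \<in> B \<rightarrow> carrier N" using G[OF u] B(3) by blast
  qed simp
  have add: "\<Phi> (u + v) = \<Phi> u \<oplus>\<^bsub>N\<^esub> \<Phi> v" if uv: "u \<in> Fr {..<m} X" "v \<in> Fr {..<m} X" for u v
  proof -
    let ?B = "fst ` supp u \<union> fst ` supp v"
    have B: "finite ?B" "?B \<subseteq> X" using sX[OF uv(1)] sX[OF uv(2)] by blast+
    have w: "u + v \<in> Fr {..<m} X" using uv by simp
    have sw: "fst ` supp (u + v) \<subseteq> ?B" using supp_add[of u v] by blast
    have "\<Phi> (u + v) = finsum N (G (u + v)) ?B" by (rule sup[OF w B(1) sw B(2)])
    also have "\<dots> = finsum N (\<lambda>x. G u x \<oplus>\<^bsub>N\<^esub> G v x) ?B"
    proof (rule N.finsum_cong'[OF refl])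
      show "(\<lambda>x. G u x \<oplus>\<^bsub>N\<^esub> G v x) \<in> ?B \<rightarrow> carrier N" using G[OF uv(1)] G[OF uv(2)] B(2) by blast
      show "G (u + v) x = G u x \<oplus>\<^bsub>N\<^esub> G v x" if "x \<in> ?B" for x
      proof -
        have x: "x \<in> X" using that B(2) by blast
        have "row x (u + v) = row x u + row x v" by (rule lin_add[OF row_lin[of "{}" UNIV x] UNIV_I UNIV_I])
        then show ?thesis
          unfolding G_def using left_module.smult_l_distr[OF N ei(1)[OF row_TA[OF uv(1)]] ei(1)[OF row_TA[OF uv(2)]] g[OF x]]
          by (simp add: ei_add row_TA[OF uv(1)] row_TA[OF uv(2)])
      qed
    qed
    also have "\<dots> = finsum N (G u) ?B \<oplus>\<^bsub>N\<^esub> finsum N (G v) ?B"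
      using G[OF uv(1)] G[OF uv(2)] B by (intro N.finsum_addf) blast+
    also have "\<dots> = \<Phi> u \<oplus>\<^bsub>N\<^esub> \<Phi> v"
      using sup[OF uv(1) B(1) _ B(2)] sup[OF uv(2) B(1) _ B(2)] by simp
    finally show ?thesis .
  qed
  have smsum: "r \<odot>\<^bsub>N\<^esub> finsum N f B = finsum N (\<lambda>x. r \<odot>\<^bsub>N\<^esub> f x) B"
    if r: "r \<in> carrier R" and "finite B" "f \<in> B \<rightarrow> carrier N" for r f B
    using that(2,3)
  proof (induction B rule: finite_induct)
    case (insert x B)
    have f: "f x \<in> carrier N" "f \<in> B \<rightarrow> carrier N" using insert.prems by auto
    have f': "r \<odot>\<^bsub>N\<^esub> f x \<in> carrier N" "(\<lambda>x. r \<odot>\<^bsub>N\<^esub> f x) \<in> B \<rightarrow> carrier N" using f sm[OF r] by auto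
    show ?case
      unfolding N.finsum_insert[OF insert.hyps f(2,1)] N.finsum_insert[OF insert.hyps f'(2,1)]
      using left_module.smult_r_distr[OF N r f(1) N.finsum_closed[OF f(2)]] insert.IH[OF f(2)] by simp
  qed (simp add: left_module_zero(1)[OF N r])
  have smult: "\<Phi> (act (E r) u) = r \<odot>\<^bsub>N\<^esub> \<Phi> u" if r: "r \<in> carrier R" and u: "u \<in> Fr {..<m} X" for r u
  proof -
    let ?w = "act (E r) u" let ?B = "fst ` supp u \<union> fst ` supp ?w"
    have w: "?w \<in> Fr {..<m} X" by (rule act_in[OF Fr_submod E_TA[OF r] u])
    have B: "finite ?B" "?B \<subseteq> X" using sX[OF u] sX[OF w] by blast+
    have "\<Phi> ?w = finsum N (G ?w) ?B" by (rule sup[OF w B(1) _ B(2)]) blast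
    also have "\<dots> = finsum N (\<lambda>x. r \<odot>\<^bsub>N\<^esub> G u x) ?B"
    proof (rule N.finsum_cong'[OF refl])
      show "(\<lambda>x. r \<odot>\<^bsub>N\<^esub> G u x) \<in> ?B \<rightarrow> carrier N" using G[OF u] B(2) sm[OF r] by blast
      show "G ?w x = r \<odot>\<^bsub>N\<^esub> G u x" if "x \<in> ?B" for x
      proof -
        have x: "x \<in> X" using that B(2) by blast
        have "row x ?w = act (E r) (row x u)" by (rule lin_act[OF row_lin Fr_submod E_TA[OF r] u])
        then show ?thesis
          unfolding G_def using left_module.smult_assoc1[OF N r ei(1)[OF row_TA[OF u]] g[OF x]]
          by (simp add: ei_act r row_TA[OF u])
      qed
    qed
    also have "\<dots> = r \<odot>\<^bsub>N\<^esub> finsum N (G u) ?B"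
      using G[OF u] B(2) by (intro smsum[OF r B(1), symmetric]) blast
    also have "\<dots> = r \<odot>\<^bsub>N\<^esub> \<Phi> u" using sup[OF u B(1) _ B(2)] by simp
    finally show ?thesis .
  qed
  have "\<Phi> (bas (x, 0)) = g x" if x: "x \<in> X" for x
  proof -
    have "\<Phi> (bas (x, 0)) = finsum N (G (bas (x, 0))) {x}" by (simp add: \<Phi>_def)
    also have "\<dots> = G (bas (x, 0)) x \<oplus>\<^bsub>N\<^esub> finsum N (G (bas (x, 0))) {}"
      by (rule N.finsum_insert) (use G[of "bas (x, 0)" x] x in auto)
    also have "\<dots> = g x"
      using left_module.smult_one[OF N g[OF x]] g[OF x] ei_E[OF R.one_closed] by (simp add: G_def row_bas E_one)
    finally show ?thesis .
  qed
  moreover have "\<Phi> u \<in> carrier N" if "u \<in> Fr {..<m} X" for u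
    unfolding \<Phi>_def using G[OF that] sX(1)[OF that] by (intro N.finsum_closed) blast
  ultimately show ?thesis using that add smult by blast
qed

lemma hom_zero:
  assumes N: "left_module R N" and L: "submod {..<m} L" and "\<And>u. u \<in> L \<Longrightarrow> \<Phi> u \<in> carrier N"
    "\<And>r u. r \<in> carrier R \<Longrightarrow> u \<in> L \<Longrightarrow> \<Phi> (act (E r) u) = r \<odot>\<^bsub>N\<^esub> \<Phi> u"
  shows "\<Phi> 0 = \<zero>\<^bsub>N\<^esub>"
  using assms(4)[OF R.zero_closed submod_zero[OF L]] left_module_zero(2)[OF N assms(3)[OF submod_zero[OF L]]]
  by (simp add: E_zero)

text \<open>Modules in a resolution must have the carrier type \<open>'m\<close> of the given
  module. Function modules are therefore copied into \<open>'m\<close> along an injection on a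
  sufficiently large submodule \<open>U\<close>, and \<open>cod\<close> transports the
  structure.\<close>

definition coding :: "(('x \<times> expo \<Rightarrow> 'k) \<Rightarrow> 'm) \<Rightarrow> ('x \<times> expo \<Rightarrow> 'k) set \<Rightarrow> bool" where
  "coding \<kappa> U \<longleftrightarrow> inj_on \<kappa> U \<and> submod {..<m} U"

definition cod :: "(('x \<times> expo \<Rightarrow> 'k) \<Rightarrow> 'm) \<Rightarrow> ('x \<times> expo \<Rightarrow> 'k) set \<Rightarrow> ('x \<times> expo \<Rightarrow> 'k) set \<Rightarrow> ('a, 'm) module" where
  "cod \<kappa> U L = \<lparr>carrier = \<kappa> ` L, mult = undefined, one = undefined, zero = \<kappa> 0,
     add = (\<lambda>x y. \<kappa> (inv_into U \<kappa> x + inv_into U \<kappa> y)),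
     smult = (\<lambda>r x. \<kappa> (act (E r) (inv_into U \<kappa> x)))\<rparr>"

lemma cod_simps [simp]: "carrier (cod \<kappa> U L) = \<kappa> ` L" "zero (cod \<kappa> U L) = \<kappa> 0"
  "add (cod \<kappa> U L) = (\<lambda>x y. \<kappa> (inv_into U \<kappa> x + inv_into U \<kappa> y))"
  "smult (cod \<kappa> U L) = (\<lambda>r x. \<kappa> (act (E r) (inv_into U \<kappa> x)))"
  by (simp_all add: cod_def)

lemma decode: "coding \<kappa> U \<Longrightarrow> f \<in> U \<Longrightarrow> inv_into U \<kappa> (\<kappa> f) = f"
  by (simp add: coding_def)

lemma left_module_cod:
  assumes \<kappa>: "coding \<kappa> U" and L: "submod {..<m} L" "L \<subseteq> U"
  shows "left_module R (cod \<kappa> U L)"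
proof (rule left_module.intro)
  have dec [simp]: "inv_into U \<kappa> (\<kappa> f) = f" if "f \<in> L" for f using decode[OF \<kappa>] that L(2) by blast
  have A [simp]: "act (E r) f \<in> L" if "r \<in> carrier R" "f \<in> L" for r f by (rule act_in[OF L(1) E_TA[OF that(1)] that(2)])
  have [simp]: "f + g \<in> L" if "f \<in> L" "g \<in> L" for f g by (rule submod_add[OF L(1) that])
  have [simp]: "0 \<in> L" by (rule submod_zero[OF L(1)])
  show "abelian_group (cod \<kappa> U L)"
  proof (rule abelian_groupI)
    fix x assume "x \<in> carrier (cod \<kappa> U L)"
    then obtain f where f: "f \<in> L" "x = \<kappa> f" by auto
    have mf: "- f \<in> L" by (rule submod_uminus[OF L(1) f(1)])
    show "\<exists>y\<in>carrier (cod \<kappa> U L). y \<oplus>\<^bsub>cod \<kappa> U L\<^esub> x = \<zero>\<^bsub>cod \<kappa> U L\<^esub>"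
      by (rule bexI[of _ "\<kappa> (- f)"]) (simp_all add: f mf)
  qed (auto simp: ac_simps)
  show "left_module_axioms R (cod \<kappa> U L)"
    by (rule left_module_axioms.intro)
      (auto simp: E_add E_mult E_one act_add_left act_add_right E_TA act_act act_bas)
qed (rule R.ring_axioms)

lemma hom_from_cod:
  assumes \<kappa>: "coding \<kappa> U" and L: "submod {..<m} L" "L \<subseteq> U"
    and \<Phi>: "\<And>u. u \<in> L \<Longrightarrow> \<Phi> u \<in> carrier N"
    "\<And>u v. u \<in> L \<Longrightarrow> v \<in> L \<Longrightarrow> \<Phi> (u + v) = \<Phi> u \<oplus>\<^bsub>N\<^esub> \<Phi> v"
    "\<And>r u. r \<in> carrier R \<Longrightarrow> u \<in> L \<Longrightarrow> \<Phi> (act (E r) u) = r \<odot>\<^bsub>N\<^esub> \<Phi> u"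
  shows "(\<lambda>x. \<Phi> (inv_into U \<kappa> x)) \<in> left_module_hom R (cod \<kappa> U L) N"
proof -
  have dec [simp]: "inv_into U \<kappa> (\<kappa> f) = f" if "f \<in> U" for f using decode[OF \<kappa>] that by blast
  have LU: "f \<in> U" if "f \<in> L" for f using that L(2) by blast
  have A: "act (E r) f \<in> L" if "r \<in> carrier R" "f \<in> L" for r f by (rule act_in[OF L(1) E_TA[OF that(1)] that(2)])
  show ?thesis
    by (rule left_module_homI) (auto simp: \<Phi> LU A submod_add[OF L(1)])
qed

lemma hom_cod_cod:
  assumes \<kappa>: "coding \<kappa> U" and L: "submod {..<m} L" "L \<subseteq> U" and L': "L' \<subseteq> U"
    and h: "lin {..<m} L h" "h ` L \<subseteq> L'"
  shows "(\<lambda>x. \<kappa> (h (inv_into U \<kappa> x))) \<in> left_module_hom R (cod \<kappa> U L) (cod \<kappa> U L')"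
proof (rule hom_from_cod[OF \<kappa> L])
  have hU: "h u \<in> L'" "h u \<in> U" if "u \<in> L" for u using that h(2) L' by blast+
  show "\<kappa> (h u) \<in> carrier (cod \<kappa> U L')" if "u \<in> L" for u using hU[OF that] by simp
  show "\<kappa> (h (u + v)) = \<kappa> (h u) \<oplus>\<^bsub>cod \<kappa> U L'\<^esub> \<kappa> (h v)" if "u \<in> L" "v \<in> L" for u v
    by (simp add: lin_add[OF h(1) that] decode[OF \<kappa> hU(2)] that)
  show "\<kappa> (h (act (E r) u)) = r \<odot>\<^bsub>cod \<kappa> U L'\<^esub> \<kappa> (h u)" if "r \<in> carrier R" "u \<in> L" for r u
    by (simp add: lin_act[OF h(1) L(1) E_TA[OF that(1)] that(2)] decode[OF \<kappa> hU(2)] that)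
qed

text \<open>A direct summand of a free module: lifts are chosen on the basis, extended by
  \<open>free_extension\<close> and composed with the section s.\<close>

lemma projective_cod:
  fixes \<kappa> :: "('x \<times> expo \<Rightarrow> 'k) \<Rightarrow> 'm"
  assumes \<kappa>: "coding \<kappa> U" and L: "submod {..<m} L" "L \<subseteq> U"
    and h: "lin {..<m} (Fr {..<m} X) h" "h ` Fr {..<m} (X :: 'x set) = L"
    and s: "lin {..<m} L s" "s ` L \<subseteq> Fr {..<m} X" "\<forall>l\<in>L. h (s l) = l"
  shows "projective R (cod \<kappa> U L)"
  unfolding projective_def
proof (intro conjI allI impI left_module_cod[OF \<kappa> L])
  fix M N :: "('a, 'm) module" and g f
  assume "left_module R M \<and> left_module R N \<and> g \<in> left_module_hom R M N \<and> g ` carrier M = carrier N \<and>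
    f \<in> left_module_hom R (cod \<kappa> U L) N"
  then have M: "left_module R M" and N: "left_module R N" and g: "g \<in> left_module_hom R M N" "g ` carrier M = carrier N"
    and f: "f \<in> left_module_hom R (cod \<kappa> U L) N" by blast+
  have hL: "h u \<in> L" if "u \<in> Fr {..<m} X" for u using h(2) that by blast
  have dec: "inv_into U \<kappa> (\<kappa> l) = l" if "l \<in> L" for l using decode[OF \<kappa>] that L(2) by blast
  have "\<forall>x\<in>X. \<exists>y. y \<in> carrier M \<and> g y = f (\<kappa> (h (bas (x, 0))))"
  proof
    fix x assume "x \<in> X"
    then have "f (\<kappa> (h (bas (x, 0)))) \<in> carrier N" using left_module_homD(1)[OF f] hL[of "bas (x, 0)"] by simp
    then show "\<exists>y. y \<in> carrier M \<and> g y = f (\<kappa> (h (bas (x, 0))))" unfolding g(2)[symmetric] by force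
  qed
  from bchoice[OF this] obtain y where y: "\<forall>x\<in>X. y x \<in> carrier M \<and> g (y x) = f (\<kappa> (h (bas (x, 0))))" by blast
  obtain \<Phi> where \<Phi>: "\<And>u. u \<in> Fr {..<m} X \<Longrightarrow> \<Phi> u \<in> carrier M"
    "\<And>u v. u \<in> Fr {..<m} X \<Longrightarrow> v \<in> Fr {..<m} X \<Longrightarrow> \<Phi> (u + v) = \<Phi> u \<oplus>\<^bsub>M\<^esub> \<Phi> v"
    "\<And>r u. r \<in> carrier R \<Longrightarrow> u \<in> Fr {..<m} X \<Longrightarrow> \<Phi> (act (E r) u) = r \<odot>\<^bsub>M\<^esub> \<Phi> u"
    "\<And>x. x \<in> X \<Longrightarrow> \<Phi> (bas (x, 0)) = y x"
    using free_extension[OF M, of X y] y by blast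
  have fh_add: "f (\<kappa> (h (u + v))) = f (\<kappa> (h u)) \<oplus>\<^bsub>N\<^esub> f (\<kappa> (h v))" if "u \<in> Fr {..<m} X" "v \<in> Fr {..<m} X" for u v
    using left_module_homD(2)[OF f, of "\<kappa> (h u)" "\<kappa> (h v)"] hL that by (simp add: lin_add[OF h(1) that] dec)
  have fh_act: "f (\<kappa> (h (act (E r) u))) = r \<odot>\<^bsub>N\<^esub> f (\<kappa> (h u))" if "r \<in> carrier R" "u \<in> Fr {..<m} X" for r u
    using left_module_homD(3)[OF f that(1), of "\<kappa> (h u)"] hL that
    by (simp add: lin_act[OF h(1) Fr_submod E_TA[OF that(1)] that(2)] dec)
  have eq: "g (\<Phi> u) = f (\<kappa> (h u))" if "u \<in> Fr {..<m} X" for u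
    using that
  proof (rule Fr_act_induct)
    have "g (\<Phi> 0) = \<zero>\<^bsub>N\<^esub>"
      by (rule hom_zero[OF N Fr_submod, of X "\<lambda>u. g (\<Phi> u)"]) (simp_all add: \<Phi> left_module_homD[OF g(1)])
    moreover have "f (\<kappa> (h 0)) = \<zero>\<^bsub>N\<^esub>"
      by (rule hom_zero[OF N Fr_submod, of X "\<lambda>u. f (\<kappa> (h u))"]) (use left_module_homD(1)[OF f] hL fh_act in simp_all)
    ultimately show "g (\<Phi> 0) = f (\<kappa> (h 0))" by simp
    fix w x v assume w: "w \<in> TA" "x \<in> X" "v \<in> Fr {..<m} X" and IH: "g (\<Phi> v) = f (\<kappa> (h v))"
    define r where "r = ei w"
    have r: "r \<in> carrier R" "w = E r" using ei[OF w(1)] by (simp_all add: r_def)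
    have b: "bas (x, 0) \<in> Fr {..<m} X" using w(2) by simp
    have a: "act (E r) (bas (x, 0)) \<in> Fr {..<m} X" by (rule act_in[OF Fr_submod E_TA[OF r(1)] b])
    have "g (\<Phi> (act (E r) (bas (x, 0)) + v)) = g (\<Phi> (act (E r) (bas (x, 0)))) \<oplus>\<^bsub>N\<^esub> g (\<Phi> v)"
      unfolding \<Phi>(2)[OF a w(3)] by (rule left_module_homD(2)[OF g(1) \<Phi>(1)[OF a] \<Phi>(1)[OF w(3)]])
    moreover have "g (\<Phi> (act (E r) (bas (x, 0)))) = r \<odot>\<^bsub>N\<^esub> g (\<Phi> (bas (x, 0)))"
      unfolding \<Phi>(3)[OF r(1) b] by (rule left_module_homD(3)[OF g(1) r(1) \<Phi>(1)[OF b]])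
    moreover have "g (\<Phi> (bas (x, 0))) = f (\<kappa> (h (bas (x, 0))))"
      using y w(2) \<Phi>(4) by simp
    ultimately show "g (\<Phi> (act w (bas (x, 0)) + v)) = f (\<kappa> (h (act w (bas (x, 0)) + v)))"
      unfolding r(2) fh_add[OF a w(3)] fh_act[OF r(1) b] by (simp only: IH)
  qed
  have sF: "s l \<in> Fr {..<m} X" if "l \<in> L" for l using that s(2) by blast
  show "\<exists>k\<in>left_module_hom R (cod \<kappa> U L) M. \<forall>x\<in>carrier (cod \<kappa> U L). g (k x) = f x"
  proof (rule bexI[of _ "\<lambda>x. \<Phi> (s (inv_into U \<kappa> x))"])
    show "(\<lambda>x. \<Phi> (s (inv_into U \<kappa> x))) \<in> left_module_hom R (cod \<kappa> U L) M"
      by (rule hom_from_cod[OF \<kappa> L, of "\<lambda>u. \<Phi> (s u)"])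
        (simp_all add: \<Phi> sF lin_add[OF s(1)] lin_act[OF s(1) L(1)] E_TA)
    show "\<forall>x\<in>carrier (cod \<kappa> U L). g (\<Phi> (s (inv_into U \<kappa> x))) = f x"
      using s(3) sF eq by (auto simp: dec)
  qed
qed

lemma projective_Fr:
  assumes "coding \<kappa> U" "Fr {..<m} X \<subseteq> U"
  shows "projective R (cod \<kappa> U (Fr {..<m} X))"
  by (rule projective_cod[OF assms(1) Fr_submod assms(2), of X "\<lambda>u. u" "\<lambda>u. u"]) (simp_all add: lin_def)

lemma good_resolution:
  fixes L :: "('x \<times> expo \<Rightarrow> 'k) set"
  assumes \<kappa>: "coding \<kappa> (Fr {..<m} UNIV)"
  shows "good d L \<Longrightarrow> submod {..<m} L \<Longrightarrow> L \<subseteq> Fr {..<m} UNIV \<Longrightarrow>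
    has_projective_resolution R (cod \<kappa> (Fr {..<m} UNIV) L) d"
proof (induction d arbitrary: L)
  case 0
  from "0.prems"(1) obtain X :: "'x set" and h s where
    *: "lin {..<m} (Fr {..<m} X) h" "h ` Fr {..<m} X = L" "lin {..<m} L s" "s ` L \<subseteq> Fr {..<m} X" "\<forall>l\<in>L. h (s l) = l"
    unfolding good.simps by (elim exE conjE) (rule that; assumption)
  have P: "projective R (cod \<kappa> (Fr {..<m} UNIV) L)" by (rule projective_cod[OF \<kappa> "0.prems"(2,3) *])
  then interpret L: abelian_group "cod \<kappa> (Fr {..<m} UNIV) L"
    using left_module.axioms(2) unfolding projective_def by blast
  show ?case
    unfolding has_projective_resolution_def
    by (intro exI[of _ "\<lambda>_. cod \<kappa> (Fr {..<m} UNIV) L"] exI[of _ "\<lambda>_ x. x"] conjI)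
      (use P in \<open>auto intro!: left_module_homI simp del: cod_simps\<close>)
next
  case (Suc d)
  let ?U = "Fr {..<m} UNIV"
  from Suc.prems(1) obtain X :: "'x set" and h where
    h: "lin {..<m} (Fr {..<m} X) h" "h ` Fr {..<m} X = L" and K: "good d {f\<in>Fr {..<m} X. h f = 0}"
    unfolding good.simps by (elim exE conjE) (rule that; assumption)
  have XU: "Fr {..<m} X \<subseteq> ?U"
  proof
    show "f \<in> ?U" if "f \<in> Fr {..<m} X" for f using that by (rule Fr_mono[OF subset_UNIV])
  qed
  have dec: "inv_into ?U \<kappa> (\<kappa> l) = l" if "l \<in> Fr {..<m} X" for l using decode[OF \<kappa>] that XU by blast
  have hL: "h u \<in> L" if "u \<in> Fr {..<m} X" for u using h(2) that by blast
  have inj: "inj_on \<kappa> ?U" using \<kappa> by (simp add: coding_def)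
  have KU: "{f\<in>Fr {..<m} X. h f = 0} \<subseteq> ?U" using XU by blast
  have res: "has_projective_resolution R (cod \<kappa> ?U {f\<in>Fr {..<m} X. h f = 0}) d"
    by (rule Suc.IH[OF K lin_kernel_submod[OF h(1) Fr_submod] KU])
  have hom: "(\<lambda>x. \<kappa> (h (inv_into ?U \<kappa> x))) \<in> left_module_hom R (cod \<kappa> ?U (Fr {..<m} X)) (cod \<kappa> ?U L)"
    by (rule hom_cod_cod[OF \<kappa> Fr_submod XU Suc.prems(3) h(1)]) (use h(2) in simp)
  have h0: "\<kappa> (h f) = \<kappa> 0 \<longleftrightarrow> h f = 0" if "f \<in> Fr {..<m} X" for f
    using inj_on_eq_iff[OF inj, of "h f" 0] hL[OF that] Suc.prems(3) by auto
  show ?case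
  proof (rule resolution_step[OF projective_Fr[OF \<kappa> XU] hom _ res])
    show "(\<lambda>x. \<kappa> (h (inv_into ?U \<kappa> x))) ` carrier (cod \<kappa> ?U (Fr {..<m} X)) = carrier (cod \<kappa> ?U L)"
      unfolding cod_simps h(2)[symmetric] image_image by (rule image_cong[OF refl]) (simp add: dec)
    show "carrier (cod \<kappa> ?U {f \<in> Fr {..<m} X. h f = 0}) =
        {x \<in> carrier (cod \<kappa> ?U (Fr {..<m} X)). \<kappa> (h (inv_into ?U \<kappa> x)) = \<zero>\<^bsub>cod \<kappa> ?U L\<^esub>}"
      by (auto simp: dec h0)
  qed simp_all
qed

text \<open>A finitely supported function is a finite list of data from an infinite type, hence can
  be coded in that type by means of a pairing injection. An exponent in the lattice is determined by
  its first m entries, a list of integers and thus a natural number.\<close>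

lemma exists_coding:
  assumes inf: "infinite (UNIV :: 'm set)" and \<phi>: "inj (\<phi> :: 'k \<Rightarrow> 'm)"
  shows "\<exists>\<kappa> :: (('m \<times> nat) \<times> expo \<Rightarrow> 'k) \<Rightarrow> 'm. coding \<kappa> (Fr {..<m} UNIV)"
proof -
  obtain \<nu> :: "nat \<Rightarrow> 'm" where \<nu>: "inj \<nu>" using infinite_countable_subset[OF inf] by blast
  obtain \<pi> :: "'m \<times> 'm \<Rightarrow> 'm" where "bij_betw \<pi> (UNIV \<times> UNIV) UNIV"
    using iffD2[OF card_of_ordIso card_of_Times_same_infinite[OF inf]] by blast
  then have "inj \<pi>" by (simp add: bij_betw_def)
  then have \<pi>: "\<pi> p = \<pi> q \<longleftrightarrow> p = q" for p q by (rule inj_eq)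
  define en where "en xs = foldr (\<lambda>x y. \<pi> (x, y)) xs (\<nu> 0)" for xs
  have en: "length xs = length ys \<Longrightarrow> en xs = en ys \<Longrightarrow> xs = ys" for xs ys
    by (induction xs ys rule: list_induct2) (auto simp: en_def \<pi>)
  define elt where "elt p k = en [fst (fst p), \<nu> (snd (fst p)), \<nu> (to_nat (map (snd p) [0..<m])), \<phi> k]"
    for p :: "('m \<times> nat) \<times> expo" and k
  have elt: "p = q \<and> k = l" if "elt p k = elt q l" "snd p \<in> lat {..<m}" "snd q \<in> lat {..<m}" for p q k l
  proof -
    have 1: "[fst (fst p), \<nu> (snd (fst p)), \<nu> (to_nat (map (snd p) [0..<m])), \<phi> k] =
        [fst (fst q), \<nu> (snd (fst q)), \<nu> (to_nat (map (snd q) [0..<m])), \<phi> l]"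
      by (rule en) (use that(1) in \<open>simp_all add: elt_def\<close>)
    then have map: "map (snd p) [0..<m] = map (snd q) [0..<m]"
      using \<nu> by (simp add: inj_eq)
    have "snd p = snd q"
    proof
      fix i show "snd p i = snd q i"
        using map that(2,3) by (cases "i < m") (auto simp: lat_def)
    qed
    then show ?thesis using 1 \<nu> \<phi> by (auto simp: inj_eq prod_eq_iff)
  qed
  define ls where "ls f = (SOME ps. set ps = supp f)" for f :: "('m \<times> nat) \<times> expo \<Rightarrow> 'k"
  define code where "code f = map (\<lambda>p. elt p (f p)) (ls f)" for f
  \<comment> \<open>\<open>en\<close> is injective only on lists of equal length, so the length is
    coded as well.\<close>
  define \<kappa> where "\<kappa> f = \<pi> (\<nu> (length (code f)), en (code f))" for f
  have ls: "set (ls f) = supp f" if "f \<in> Fr {..<m} UNIV" for f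
    unfolding ls_def using finite_list[OF Fr_finite[OF that]] by (rule someI_ex)
  have le: "g p = f p" if f: "f \<in> Fr {..<m} UNIV" "g \<in> Fr {..<m} UNIV" and eq: "code f = code g" and p: "p \<in> supp f" for f g p
  proof -
    have lat: "snd p \<in> lat {..<m}" if "f \<in> Fr {..<m} UNIV" "p \<in> supp f" for f p
      using that by (cases p) (auto simp: Fr_def)
    have "elt p (f p) \<in> set (code f)" using p by (simp add: code_def ls[OF f(1)])
    then obtain q where q: "q \<in> supp g" "elt p (f p) = elt q (g q)" unfolding eq by (auto simp: code_def ls[OF f(2)])
    have "p = q \<and> f p = g q" by (rule elt[OF q(2) lat[OF f(1) p] lat[OF f(2) q(1)]])
    then show ?thesis by metis
  qed
  have "inj_on \<kappa> (Fr {..<m} UNIV)"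
  proof (rule inj_onI)
    fix f g assume f: "f \<in> Fr {..<m} UNIV" "g \<in> Fr {..<m} UNIV" and "\<kappa> f = \<kappa> g"
    then have "length (code f) = length (code g)" "en (code f) = en (code g)"
      using \<nu> by (simp_all add: \<kappa>_def \<pi> inj_eq)
    then have eq: "code f = code g" by (rule en)
    show "f = g"
    proof
      fix p show "f p = g p"
      proof (cases "p \<in> supp f")
        case True
        show ?thesis by (rule le[OF f eq True, symmetric])
      next
        case F: False
        show ?thesis
        proof (cases "p \<in> supp g")
          case True
          show ?thesis by (rule le[OF f(2,1) eq[symmetric] True])
        next
          case False
          have "f p = 0" "g p = 0" using F False unfolding supp_iff by blast+
          then show ?thesis by metis
        qed
      qed
    qed
  qed
  then show ?thesis unfolding coding_def using Fr_submod by blast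
qed

lemma lin_of_hom:
  assumes L: "submod {..<m} L" and N: "left_module R N" and \<Phi>: "\<And>u. u \<in> L \<Longrightarrow> \<Phi> u \<in> carrier N"
    "\<And>u v. u \<in> L \<Longrightarrow> v \<in> L \<Longrightarrow> \<Phi> (u + v) = \<Phi> u \<oplus>\<^bsub>N\<^esub> \<Phi> v"
    "\<And>r u. r \<in> carrier R \<Longrightarrow> u \<in> L \<Longrightarrow> \<Phi> (act (E r) u) = r \<odot>\<^bsub>N\<^esub> \<Phi> u"
  shows "submod {..<m} {u\<in>L. \<Phi> u = \<zero>\<^bsub>N\<^esub>}"
proof -
  interpret N: abelian_group N by (rule left_module.axioms(2)[OF N])
  have A: "\<Phi> (act w u) = \<zero>\<^bsub>N\<^esub>" if "w \<in> TA" "u \<in> L" "\<Phi> u = \<zero>\<^bsub>N\<^esub>" for w u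
    using \<Phi>(3)[OF ei(1)[OF that(1)] that(2)] that left_module_zero(1)[OF N ei(1)[OF that(1)]] by (simp add: ei)
  have sc: "sc r u = act (sc r (bas (0, 0))) u" for r and u :: "'b \<times> expo \<Rightarrow> 'k"
    by (simp add: act_sc_left bas_TA act_bas)
  have scT: "sc r (bas (0, 0)) \<in> TA" for r by (rule submod_sc[OF TA_submod bas_TA]) simp
  have "\<Phi> 0 = \<zero>\<^bsub>N\<^esub>" by (rule hom_zero[OF N L \<Phi>(1,3)])
  moreover have "\<Phi> (sc r u) = \<zero>\<^bsub>N\<^esub>" if "u \<in> L" "\<Phi> u = \<zero>\<^bsub>N\<^esub>" for r u
    unfolding sc by (rule A[OF scT that])
  moreover have "\<Phi> (mop a u) = \<zero>\<^bsub>N\<^esub>" if "u \<in> L" "\<Phi> u = \<zero>\<^bsub>N\<^esub>" "a \<in> lat {..<m}" for a u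
    using A[OF bas_TA[OF that(3)] that(1,2)] by (simp add: act_bas)
  ultimately show ?thesis
    unfolding submod_def by (auto simp: \<Phi>(2) submodD[OF L])
qed

end

locale sqt_realization = sqt n c + torus_realization "2 * n" c R E
  for n and c :: "nat \<Rightarrow> nat \<Rightarrow> 'k::field" and R :: "('a, 'r) ring_scheme" (structure)
    and E :: "'a \<Rightarrow> nat \<times> expo \<Rightarrow> 'k"
begin

text \<open>The kernel of the free cover on the elements of \<open>N\<close> has left ideals as
  filtration factors; these have resolutions of length n - 1, Auslander's lemma assembles them, and
  the cover adds one.\<close>

theorem resolution_length_n:
  fixes N :: "('a, 'm) module"
  assumes inf: "infinite (UNIV :: 'm set)" and \<phi>: "inj (\<phi> :: 'k \<Rightarrow> 'm)" and N: "left_module R N"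
  shows "has_projective_resolution R N n"
proof -
  let ?M = "{..<2*n}"
  obtain \<kappa> :: "(('m \<times> nat) \<times> expo \<Rightarrow> 'k) \<Rightarrow> 'm" where \<kappa>: "coding \<kappa> (Fr ?M UNIV)"
    using exists_coding[OF inf \<phi>] by blast
  obtain r :: "('m \<times> 'm) set" where r: "well_order_on UNIV r" using well_order_on by blast
  define lt where "lt x y \<longleftrightarrow> (x, y) \<in> r - Id" for x y
  interpret filtered "2*n" c lt
  proof unfold_locales
    have w: "trans r" "antisym r" "total_on UNIV r" "wf (r - Id)"
      using r unfolding well_order_on_def linear_order_on_def partial_order_on_def preorder_on_def by blast+
    have "{(x, y). lt x y} = r - Id" by (auto simp: lt_def)
    then show "wfp lt" unfolding wfp_def by (metis w(4))
    show "lt x z" if "lt x y" "lt y z" for x y z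
      using that w(1,2) unfolding lt_def by (auto dest: transD antisymD)
    show "lt x y \<or> lt y x" if "x \<noteq> y" for x y
      using that w(3) unfolding lt_def total_on_def by blast
  qed
  \<comment> \<open>One basis vector for each element of \<open>N\<close>, so each factor of the
    filtration sits in a free module of rank one, that is, it is a left ideal.\<close>
  define Xs where "Xs x = (if x \<in> carrier N then {..<1 :: nat} else {})" for x
  define X where "X = pairs Xs"
  have XU: "Fr ?M X \<subseteq> Fr ?M UNIV"
  proof
    show "f \<in> Fr ?M UNIV" if "f \<in> Fr ?M X" for f using that by (rule Fr_mono[OF subset_UNIV])
  qed
  have X: "p \<in> X \<longleftrightarrow> fst p \<in> carrier N \<and> snd p = 0" for p
    by (cases p) (simp add: X_def pairs_def Xs_def)
  obtain \<Phi> where \<Phi>: "\<And>u. u \<in> Fr ?M X \<Longrightarrow> \<Phi> u \<in> carrier N"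
    "\<And>u v. u \<in> Fr ?M X \<Longrightarrow> v \<in> Fr ?M X \<Longrightarrow> \<Phi> (u + v) = \<Phi> u \<oplus>\<^bsub>N\<^esub> \<Phi> v"
    "\<And>r u. r \<in> carrier R \<Longrightarrow> u \<in> Fr ?M X \<Longrightarrow> \<Phi> (act (E r) u) = r \<odot>\<^bsub>N\<^esub> \<Phi> u"
    "\<And>x. x \<in> X \<Longrightarrow> \<Phi> (bas (x, 0)) = fst x"
    using free_extension[OF N, of X fst] X by blast
  define L where "L = {u\<in>Fr ?M X. \<Phi> u = \<zero>\<^bsub>N\<^esub>}"
  have L: "submod ?M L" unfolding L_def by (rule lin_of_hom[OF Fr_submod N \<Phi>(1-3)])
  have LX: "L \<subseteq> Fr ?M X" by (auto simp: L_def)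
  then have LU: "L \<subseteq> Fr ?M UNIV" using XU by blast
  have top: "good (n - 1) (topm L x)" for x
  proof (rule good_lideals)
    have b: "submod ?M (below x)" by (rule below_submod)
    have "submod ?M (L \<inter> below x)"
      by (rule submod_Int[OF L b])
    then have "submod ?M (topm L x)" unfolding topm_def by (rule lin_image_submod[OF lin_cmpx])
    moreover have "topm L x \<subseteq> Fr ?M {..<1}"
    proof
      fix u assume "u \<in> topm L x"
      then obtain f where f: "f \<in> Fr ?M (pairs Xs)" "u = cmpx x f" unfolding topm_def using LX X_def by blast
      have "Xs x \<subseteq> {..<1}" by (simp add: Xs_def)
      then show "u \<in> Fr ?M {..<1}" using cmpx_Fr[OF f(1), of x] unfolding f(2) by (rule Fr_mono)
    qed
    ultimately show "topm L x \<in> lideals" unfolding lideals_def by blast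
  qed
  have "good (n - 1) L" by (rule auslander[OF L LU top])
  then have res: "has_projective_resolution R (cod \<kappa> (Fr ?M UNIV) L) (n - 1)"
    by (rule good_resolution[OF \<kappa> _ L LU])
  have dec: "inv_into (Fr ?M UNIV) \<kappa> (\<kappa> l) = l" if "l \<in> Fr ?M X" for l using decode[OF \<kappa>] that XU by blast
  have "has_projective_resolution R N (Suc (n - 1))"
  proof (rule resolution_step[OF projective_Fr[OF \<kappa> XU] hom_from_cod[OF \<kappa> Fr_submod XU \<Phi>(1-3)] _ res])
    have "\<Phi> ` Fr ?M X = carrier N"
    proof
      show "\<Phi> ` Fr ?M X \<subseteq> carrier N" using \<Phi>(1) by blast
      show "carrier N \<subseteq> \<Phi> ` Fr ?M X"
      proof
        fix x assume "x \<in> carrier N"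
        then have x: "(x, 0) \<in> X" by (simp add: X)
        then show "x \<in> \<Phi> ` Fr ?M X" using \<Phi>(4)[OF x] by (intro image_eqI[of _ _ "bas ((x, 0), 0)"]) simp_all
      qed
    qed
    then show "(\<lambda>x. \<Phi> (inv_into (Fr ?M UNIV) \<kappa> x)) ` carrier (cod \<kappa> (Fr ?M UNIV) (Fr ?M X)) = carrier N"
      unfolding cod_simps image_image by (simp add: dec)
    show "carrier (cod \<kappa> (Fr ?M UNIV) L) =
        {x \<in> carrier (cod \<kappa> (Fr ?M UNIV) (Fr ?M X)). \<Phi> (inv_into (Fr ?M UNIV) \<kappa> x) = \<zero>\<^bsub>N\<^esub>}"
      by (auto simp: L_def dec)
  qed simp_all
  then show ?thesis using n_pos by simp
qed

end

section \<open>The lower bound for the global dimension\<close>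

context split_torus
begin

text \<open>Multiplication by w - 1, where w is the variable with coordinate i.\<close>

definition dif :: "nat \<Rightarrow> ('x \<times> expo \<Rightarrow> 'k) \<Rightarrow> 'x \<times> expo \<Rightarrow> 'k" where
  "dif i f = mop (unit_vec i) f - f"

lemma lat_left: "a \<in> lat {..<n} \<Longrightarrow> n \<le> i \<Longrightarrow> a i = 0"
  by (simp add: lat_def)

lemma mop_mop_left: "a \<in> lat {..<n} \<Longrightarrow> mop a (mop b f) = mop (a + b) f"
  using bc_left[of a b] lat_left[of a] by (simp add: mop_mop)

lemma mop_commute_left: "a \<in> lat {..<n} \<Longrightarrow> b \<in> lat {..<n} \<Longrightarrow> mop a (mop b f) = mop b (mop a f)"
  by (simp add: mop_mop_left add.commute)

lemma dif_add: "dif i (f + g) = dif i f + dif i g"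
  by (simp add: dif_def mop_add)

lemma dif_diff: "dif i (f - g) = dif i f - dif i g"
  by (simp add: dif_def mop_diff)

lemma dif_sc: "dif i (sc r f) = sc r (dif i f)"
  by (simp add: dif_def mop_sc fs.scale_right_diff_distrib)

lemma dif_zero [simp]: "dif i 0 = 0"
  by (simp add: dif_def)

lemma dif_mop: "i < n \<Longrightarrow> a \<in> lat {..<n} \<Longrightarrow> dif i (mop a f) = mop a (dif i f)"
  by (simp add: dif_def mop_diff mop_commute_left[of "unit_vec i" a])

lemma dif_dif: "i < n \<Longrightarrow> j < n \<Longrightarrow> dif i (dif j f) = dif j (dif i f)"
  using dif_mop[of i "unit_vec j" f] by (simp add: dif_def[of j] dif_diff)

lemma dif_in: "submod {..<n} N \<Longrightarrow> i < n \<Longrightarrow> f \<in> N \<Longrightarrow> dif i f \<in> N"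
  unfolding dif_def by (rule submod_diff) (auto intro: submod_mop)

lemma lin_dif:
  assumes h: "lin {..<n} N h" and N: "submod {..<n} N" and i: "i < n" and f: "f \<in> N"
  shows "h (dif i f) = dif i (h f)"
proof -
  have u: "unit_vec i \<in> lat {..<n}" using i by simp
  show ?thesis
    unfolding dif_def lin_diff[OF h N submod_mop[OF N u f] f] lin_mop[OF h u f] ..
qed

text \<open>The submodule generated by the first j elements w - 1 acting on \<open>N\<close>; the
  quotient of \<open>N\<close> by it restricts \<open>N\<close> to the locus where the first j
  variables equal 1.\<close>

primrec XS :: "nat \<Rightarrow> ('x \<times> expo \<Rightarrow> 'k) set \<Rightarrow> ('x \<times> expo \<Rightarrow> 'k) set" where
  "XS 0 N = {0}"
| "XS (Suc j) N = {u + dif j v | u v. u \<in> XS j N \<and> v \<in> N}"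

lemma XS_submod: "submod {..<n} N \<Longrightarrow> j \<le> n \<Longrightarrow> submod {..<n} (XS j N) \<and> XS j N \<subseteq> N"
proof (induction j)
  case 0
  then show ?case by (simp add: submod_def)
next
  case (Suc j)
  then have N: "submod {..<n} N" and j: "j < n" and IH: "submod {..<n} (XS j N)" "XS j N \<subseteq> N" by auto
  have I: "u + dif j v \<in> XS (Suc j) N" if "u \<in> XS j N" "v \<in> N" for u v using that by auto
  have "submod {..<n} (XS (Suc j) N)"
    unfolding submod_def
  proof (intro conjI ballI allI)
    show "0 \<in> XS (Suc j) N" using I[OF submod_zero[OF IH(1)] submod_zero[OF N]] by simp
    fix z assume "z \<in> XS (Suc j) N"
    then obtain u v where z: "z = u + dif j v" "u \<in> XS j N" "v \<in> N" by auto
    show "sc r z \<in> XS (Suc j) N" for r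
      using I[OF submod_sc[OF IH(1) z(2)] submod_sc[OF N z(3)], of r r] by (simp add: z(1) dif_sc sc_add_right)
    show "mop a z \<in> XS (Suc j) N" if "a \<in> lat {..<n}" for a
      using I[OF submod_mop[OF IH(1) that z(2)] submod_mop[OF N that z(3)]] by (simp add: z(1) dif_mop[OF j that] mop_add)
    fix z' assume "z' \<in> XS (Suc j) N"
    then obtain u' v' where z': "z' = u' + dif j v'" "u' \<in> XS j N" "v' \<in> N" by auto
    have "z + z' = (u + u') + dif j (v + v')" unfolding z(1) z'(1) dif_add by (simp add: ac_simps)
    then show "z + z' \<in> XS (Suc j) N"
      using I[OF submod_add[OF IH(1) z(2) z'(2)] submod_add[OF N z(3) z'(3)]] by metis
  qed
  moreover have "XS (Suc j) N \<subseteq> N"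
    using IH(2) dif_in[OF N j] submod_add[OF N] by auto
  ultimately show ?case by blast
qed

lemma XS_Suc_mono: "submod {..<n} N \<Longrightarrow> XS j N \<subseteq> XS (Suc j) N"
proof
  fix u assume "submod {..<n} N" "u \<in> XS j N"
  then have "u = u + dif j 0 \<and> u \<in> XS j N \<and> 0 \<in> N" using submod_zero by auto
  then show "u \<in> XS (Suc j) N" unfolding XS.simps by blast
qed

lemma XS_mem: "submod {..<n} N \<Longrightarrow> j \<le> n \<Longrightarrow> i < j \<Longrightarrow> v \<in> N \<Longrightarrow> dif i v \<in> XS j N"
proof (induction j)
  case (Suc j)
  show ?case
  proof (cases "i = j")
    case True
    have "0 \<in> XS j N" using XS_submod[OF Suc.prems(1), of j] Suc.prems(2) submod_zero by auto
    then have "dif i v = 0 + dif j v \<and> 0 \<in> XS j N \<and> v \<in> N" using True Suc.prems by simp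
    then show ?thesis unfolding XS.simps by blast
  next
    case False
    then show ?thesis using Suc XS_Suc_mono[OF Suc.prems(1), of j] by auto
  qed
qed simp

lemma XS_mono: "N \<subseteq> N' \<Longrightarrow> XS j N \<subseteq> XS j N'"
  by (induction j) auto

lemma XS_image:
  assumes h: "lin {..<n} N h" and N: "submod {..<n} N"
  shows "j \<le> n \<Longrightarrow> h ` XS j N = XS j (h ` N)"
proof (induction j)
  case 0
  then show ?case by (simp add: lin_zero[OF h N])
next
  case (Suc j)
  then have j: "j < n" and IH: "h ` XS j N = XS j (h ` N)" by auto
  have sub: "XS j N \<subseteq> N" using XS_submod[OF N, of j] j by auto
  have eq: "h (u + dif j v) = h u + dif j (h v)" if "u \<in> XS j N" "v \<in> N" for u v
    using lin_add[OF h _ dif_in[OF N j that(2)], of u] lin_dif[OF h N j that(2)] that(1) sub by auto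
  show ?case
  proof
    show "h ` XS (Suc j) N \<subseteq> XS (Suc j) (h ` N)" using eq IH by fastforce
    show "XS (Suc j) (h ` N) \<subseteq> h ` XS (Suc j) N"
    proof
      fix z assume "z \<in> XS (Suc j) (h ` N)"
      then obtain u v where z: "z = u + dif j v" "u \<in> XS j (h ` N)" "v \<in> h ` N" by auto
      then obtain u' v' where uv: "u' \<in> XS j N" "u = h u'" "v' \<in> N" "v = h v'" using IH by blast
      then have "u' + dif j v' \<in> XS (Suc j) N" by auto
      then show "z \<in> h ` XS (Suc j) N" using eq[OF uv(1,3)] z(1) uv by (metis imageI)
    qed
  qed
qed

definition regular :: "nat \<Rightarrow> ('x \<times> expo \<Rightarrow> 'k) set \<Rightarrow> bool" where
  "regular k N \<longleftrightarrow> (\<forall>j<k. \<forall>z\<in>N. dif j z \<in> XS j N \<longrightarrow> z \<in> XS j N)"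

lemma regularD: "regular k N \<Longrightarrow> j < k \<Longrightarrow> z \<in> N \<Longrightarrow> dif j z \<in> XS j N \<Longrightarrow> z \<in> XS j N"
  by (simp add: regular_def)

text \<open>A homomorphism commutes with forming \<open>XS\<close>, so membership found in the free
  module can be pulled back to the summand by the retraction.\<close>

lemma regular_retract:
  assumes F: "submod {..<n} F" "regular n F" and \<rho>: "lin {..<n} F \<rho>" "\<rho> ` F = P" "P \<subseteq> F" "\<And>z. z \<in> P \<Longrightarrow> \<rho> z = z"
  shows "regular n P"
  unfolding regular_def
proof (intro allI ballI impI)
  fix j z assume j: "j < n" and z: "z \<in> P" "dif j z \<in> XS j P"
  have "z \<in> XS j F" using regularD[OF F(2) j] z XS_mono[OF \<rho>(3), of j] \<rho>(3) by blast
  then have "\<rho> z \<in> XS j (\<rho> ` F)" using XS_image[OF \<rho>(1) F(1), of j] j by auto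
  then show "z \<in> XS j P" using \<rho>(2,4) z(1) by simp
qed

definition trunc :: "nat \<Rightarrow> expo \<Rightarrow> expo" where
  "trunc j b = (\<lambda>i. if i < j then 0 else b i)"

text \<open>Sets the first j variables equal to 1. Its kernel on a free module is
  \<open>XS j\<close>, by \<open>col_XS\<close> and \<open>col_cong\<close>, so it models the
  quotient inside the same function space.\<close>

definition col :: "nat \<Rightarrow> ('x \<times> expo \<Rightarrow> 'k) \<Rightarrow> 'x \<times> expo \<Rightarrow> 'k" where
  "col j = lext (\<lambda>(x, b). bas (x, trunc j b))"

lemma lin_col: "lin {} (Fr T X) (col j)"
  by (simp add: lin_def col_def lext_add lext_sc Fr_finite)

lemma mop_unit_bas: "i < n \<Longrightarrow> mop (unit_vec i) (bas (x, a)) = bas (x, unit_vec i + a)"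
  using bc_left[of "unit_vec i" a] by (simp add: mop_bas unit_vec_def)

lemma col_mop:
  assumes i: "i < n" and f: "f \<in> Fr {..<2*n} X"
  shows "col j (mop (unit_vec i) f) = (if i < j then col j f else mop (unit_vec i) (col j f))"
proof (rule lin_eq_on_bas[OF _ _ _ f])
  have m: "lin {} (Fr {..<2*n} X) (mop (unit_vec i))" by (simp add: lin_def mop_add mop_sc)
  show "lin {} (Fr {..<2*n} X) (\<lambda>f. col j (mop (unit_vec i) f))"
    by (rule lin_comp[OF m lin_col[of "{..<2*n}" X]]) (use i in auto)
  show "lin {} (Fr {..<2*n} X) (\<lambda>f. if i < j then col j f else mop (unit_vec i) (col j f))"
  proof (cases "i < j")
    case False
    have "lin {} (Fr {..<2*n} X) (\<lambda>f. mop (unit_vec i) (col j f))"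
      using linD(1,2)[OF lin_col[of "{..<2*n}" X j]] by (simp add: lin_def mop_add mop_sc)
    then show ?thesis using False by simp
  qed (simp add: lin_col)
  fix x a
  have "trunc j (unit_vec i + a) = (if i < j then trunc j a else unit_vec i + trunc j a)"
    by (auto simp: trunc_def unit_vec_def fun_eq_iff plus_fun_apply)
  then show "col j (mop (unit_vec i) (bas (x, a))) =
      (if i < j then col j (bas (x, a)) else mop (unit_vec i) (col j (bas (x, a))))"
    by (simp add: mop_unit_bas[OF i] col_def)
qed

lemma Fr_left: "submod {..<n} (Fr {..<2*n} X)"
  by (rule submod_Fr) auto

lemma col_dif:
  assumes i: "i < n" and f: "f \<in> Fr {..<2*n} X"
  shows "col j (dif i f) = (if i < j then 0 else dif i (col j f))"
proof -
  have "mop (unit_vec i) f \<in> Fr {..<2*n} X" using f i by simp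
  then have "col j (dif i f) = col j (mop (unit_vec i) f) - col j f"
    unfolding dif_def by (intro lin_diff[OF lin_col submod_Fr[of "{}"]]) (use f in auto)
  then show ?thesis by (simp add: col_mop[OF i f] dif_def)
qed

lemma col_XS: "j \<le> j' \<Longrightarrow> j \<le> n \<Longrightarrow> z \<in> XS j (Fr {..<2*n} X) \<Longrightarrow> col j' z = 0"
proof (induction j arbitrary: z)
  case 0
  then show ?case by (simp add: col_def)
next
  case (Suc j)
  then obtain u v where z: "z = u + dif j v" "u \<in> XS j (Fr {..<2*n} X)" "v \<in> Fr {..<2*n} X" by auto
  have j: "j < n" using Suc.prems by simp
  have u: "u \<in> Fr {..<2*n} X" using XS_submod[OF Fr_left, of j X] z(2) j by auto
  show ?case
    using lin_add[OF lin_col u dif_in[OF Fr_left j z(3)], of j'] col_dif[OF j z(3), of j'] Suc.IH[OF _ _ z(2)] Suc.prems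
    by (simp add: z(1))
qed

lemma bas_trunc:
  assumes "x \<in> X"
  shows "b \<in> lat {..<2*n} \<Longrightarrow> j \<le> n \<Longrightarrow> bas (x, b) - bas (x, trunc j b) \<in> XS j (Fr {..<2*n} X)"
proof (induction j)
  case 0
  have "trunc 0 b = b" by (simp add: trunc_def)
  then show ?case by simp
next
  case (Suc j)
  let ?F = "Fr {..<2*n} X :: ('a \<times> expo \<Rightarrow> 'k) set"
  define b' where "b' = trunc j b"
  have j: "j < n" using Suc.prems by simp
  have S: "submod {..<n} (XS (Suc j) ?F)" using XS_submod[OF Fr_left, of "Suc j" X] Suc.prems by blast
  have lat: "b'(j := k) \<in> lat {..<2*n}" for k
    using Suc.prems(1) j by (auto simp: b'_def trunc_def lat_def)
  have step: "dif j (bas (x, b'(j := k))) = bas (x, b'(j := k + 1)) - (bas (x, b'(j := k)) :: 'a \<times> expo \<Rightarrow> 'k)" for k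
  proof -
    have "unit_vec j + b'(j := k) = b'(j := k + 1)" by (auto simp: unit_vec_def fun_eq_iff plus_fun_apply)
    then show ?thesis by (simp add: dif_def mop_unit_bas[OF j])
  qed
  have d: "dif j (bas (x, b'(j := k))) \<in> XS (Suc j) ?F" for k
    by (rule XS_mem[OF Fr_left]) (use Suc.prems lat assms in auto)
  have k: "bas (x, b'(j := k)) - bas (x, b'(j := 0)) \<in> XS (Suc j) ?F" for k
  proof (induction k rule: int_induct[where k = 0])
    case base
    then show ?case using submod_zero[OF S] unfolding diff_self .
  next
    case (step1 i)
    have "bas (x, b'(j := i + 1)) - bas (x, b'(j := 0)) =
        (bas (x, b'(j := i)) - bas (x, b'(j := 0))) + (dif j (bas (x, b'(j := i))) :: 'a \<times> expo \<Rightarrow> 'k)"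
      unfolding step by (rule HOL.ext) (simp add: fun_simps)
    then show ?case using submod_add[OF S step1(2) d[of i]] by (simp only:)
  next
    case (step2 i)
    have "bas (x, b'(j := i - 1)) - bas (x, b'(j := 0)) =
        (bas (x, b'(j := i)) - bas (x, b'(j := 0))) - (dif j (bas (x, b'(j := i - 1))) :: 'a \<times> expo \<Rightarrow> 'k)"
      unfolding step by (rule HOL.ext) (simp add: fun_simps)
    then show ?case using submod_diff[OF S step2(2) d[of "i - 1"]] by (simp only:)
  qed
  have b': "b'(j := b j) = trunc j b" "b'(j := 0) = trunc (Suc j) b" by (auto simp: b'_def trunc_def fun_eq_iff)
  note 1 = k[of "b j", unfolded b']
  have "bas (x, b) - bas (x, trunc j b) \<in> XS j ?F" by (rule Suc.IH) (use Suc.prems in auto)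
  then have 2: "bas (x, b) - bas (x, trunc j b) \<in> XS (Suc j) ?F" using XS_Suc_mono[OF Fr_left] by blast
  have "bas (x, b) - bas (x, trunc (Suc j) b) =
      (bas (x, b) - bas (x, trunc j b)) + (bas (x, trunc j b) - bas (x, trunc (Suc j) b) :: 'a \<times> expo \<Rightarrow> 'k)"
    by (rule HOL.ext) (simp add: fun_simps)
  then show ?case using submod_add[OF S 2 1] by (simp only:)
qed

text \<open>Each basis vector is changed one coordinate at a time, and moving a coordinate by one
  changes it by a value of \<open>dif\<close>.\<close>

lemma col_cong:
  assumes f: "f \<in> Fr {..<2*n} X" and j: "j \<le> n"
  shows "f - col j f \<in> XS j (Fr {..<2*n} X)"
proof -
  have S: "submod {..<n} (XS j (Fr {..<2*n} X))" using XS_submod[OF Fr_left j] by blast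
  have "f = (\<Sum>p\<in>supp f. sc (f p) (bas p))" by (rule bas_expansion) (use Fr_finite[OF f] in auto)
  then have "f - col j f = (\<Sum>p\<in>supp f. sc (f p) (bas p)) - (\<Sum>p\<in>supp f. sc (f p) (bas (fst p, trunc j (snd p))))"
    by (simp add: col_def lext_def case_prod_unfold)
  also have "\<dots> = (\<Sum>p\<in>supp f. sc (f p) (bas p - bas (fst p, trunc j (snd p))))"
    by (simp add: sum_subtractf fs.scale_right_diff_distrib)
  also have "\<dots> \<in> XS j (Fr {..<2*n} X)"
  proof (rule submod_sum[OF S], rule submod_sc[OF S])
    fix p assume "p \<in> supp f"
    then have "fst p \<in> X" "snd p \<in> lat {..<2*n}" using f by (auto simp: Fr_def)
    then show "bas p - bas (fst p, trunc j (snd p)) \<in> XS j (Fr {..<2*n} X)"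
      using bas_trunc[of "fst p" X "snd p" j] j by simp
  qed
  finally show ?thesis .
qed

text \<open>A function invariant under translation in one direction has infinite support unless it
  is zero.\<close>

lemma dif_injective:
  assumes j: "j < n" and f: "finite (supp f)" "dif j f = 0"
  shows "f = 0"
proof (rule ccontr)
  assume "f \<noteq> 0"
  then obtain x b where b: "f (x, b) \<noteq> 0" by (auto simp: fun_eq_iff zero_fun_apply)
  have "mop (unit_vec j) f = f" using f(2) by (simp add: dif_def)
  moreover have "bc (unit_vec j) a = 1" for a by (rule bc_left) (use j in \<open>auto simp: unit_vec_def\<close>)
  ultimately have sh: "f (y, a) = f (y, a - unit_vec j)" for y a using mop_apply[of "unit_vec j" f y a] by simp
  define g where "g k = (x, b(j := b j - int k))" for k
  have "f (g k) = f (x, b)" for k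
  proof (induction k)
    case 0
    then show ?case by (simp add: g_def)
  next
    case (Suc k)
    have "b(j := b j - int k) - unit_vec j = b(j := b j - int (Suc k))"
      by (auto simp: unit_vec_def fun_eq_iff)
    then have "f (g (Suc k)) = f (g k)" using sh[of x "b(j := b j - int k)"] by (simp add: g_def)
    then show ?case using Suc by simp
  qed
  then have "range g \<subseteq> supp f" using b by (auto simp: supp_iff)
  moreover have "inj g"
  proof (rule injI)
    fix k l assume "g k = g l"
    then have "(b(j := b j - int k)) j = (b(j := b j - int l)) j" by (simp add: g_def del: fun_upd_apply)
    then show "k = l" by simp
  qed
  ultimately show False using f(1) finite_subset range_inj_infinite by blast
qed

text \<open>Modulo \<open>XS j\<close> the module is again one of finitely supported functions,
  where the next w - 1 acts injectively.\<close>

lemma regular_Fr: "regular n (Fr {..<2*n} X)"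
  unfolding regular_def
proof (intro allI ballI impI)
  fix j z assume j: "j < n" and z: "z \<in> Fr {..<2*n} X" "dif j z \<in> XS j (Fr {..<2*n} X)"
  have d: "z - col j z \<in> XS j (Fr {..<2*n} X)" by (rule col_cong[OF z(1)]) (use j in simp)
  then have "z - col j z \<in> Fr {..<2*n} X" using XS_submod[OF Fr_left, of j X] j by auto
  then have "z - (z - col j z) \<in> Fr {..<2*n} X" by (rule submod_diff[OF Fr_left z(1)])
  then have fin: "finite (supp (col j z))" using Fr_finite by simp
  have "col j (dif j z) = 0" by (rule col_XS[OF order_refl _ z(2)]) (use j in simp)
  then have "dif j (col j z) = 0" using col_dif[OF j z(1), of j] by simp
  then have "col j z = 0" by (rule dif_injective[OF j fin])
  then show "z \<in> XS j (Fr {..<2*n} X)" using d by simp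
qed

text \<open>This is the vanishing of the Koszul homology of a projective module in positive degrees: a class of
  degree \<open>n\<close> in the cokernel is pushed down along the resolution.\<close>

theorem chase:
  fixes P :: "nat \<Rightarrow> ('x \<times> expo \<Rightarrow> 'k) set"
  assumes P: "\<And>k. k \<le> d \<Longrightarrow> submod {..<n} (P k)" "\<And>k. k \<le> d \<Longrightarrow> regular n (P k)"
    and D: "\<And>k. k \<le> d \<Longrightarrow> lin {..<n} (P k) (D k)"
    and ker: "\<And>k. k < d \<Longrightarrow> D (Suc k) ` P (Suc k) = {z \<in> P k. D k z = 0}"
    and inj: "\<And>z. z \<in> P d \<Longrightarrow> D d z = 0 \<Longrightarrow> z = 0"
    and e: "e \<in> D 0 ` P 0" "e \<noteq> 0" "\<And>i. i < n \<Longrightarrow> dif i e = 0"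
  shows "n \<le> d"
proof (rule ccontr)
  assume "\<not> n \<le> d"
  then have dn: "d < n" by simp
  define N where "N k = D k ` P k" for k
  have N: "submod {..<n} (N k)" if "k \<le> d" for k unfolding N_def by (rule lin_image_submod[OF D P(1)]) (use that in simp_all)
  have NK: "N (Suc k) = {z \<in> P k. D k z = 0}" if "k < d" for k using ker[OF that] by (simp add: N_def)
  have XP: "submod {..<n} (XS j (P k))" "XS j (P k) \<subseteq> P k" if "k \<le> d" "j \<le> n" for j k using XS_submod[OF P(1)] that by blast+
  have XN: "submod {..<n} (XS j (N k))" "XS j (N k) \<subseteq> N k" if "k \<le> d" "j \<le> n" for j k using XS_submod[OF N] that by blast+
  have img: "D k ` XS j (P k) = XS j (N k)" if "k \<le> d" "j \<le> n" for j k
    unfolding N_def by (rule XS_image[OF D P(1) that(2)]) (use that in simp_all)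
  \<comment> \<open>The intersection of \<open>XS j (P k)\<close> with the kernel of
    \<open>D k\<close> is \<open>XS j\<close> of the next syzygy, i.e. a Tor group of
    \<open>N k\<close> vanishes. By regularity of \<open>N k\<close> the coefficient v of the last
    generator can be changed by an element of \<open>XS j (P k)\<close> so as to lie in the
    kernel.\<close>
  have claim: "regular j (N k) \<Longrightarrow> z \<in> XS j (P k) \<Longrightarrow> D k z = 0 \<Longrightarrow> z \<in> XS j (N (Suc k))" if k: "k < d" and "j \<le> n" for j k z
    using that(2)
  proof (induction j arbitrary: z)
    case (Suc j)
    have j: "j < n" "j \<le> n" using Suc.prems by simp_all
    have kd: "k \<le> d" using k by simp
    obtain u v where z: "z = u + dif j v" "u \<in> XS j (P k)" "v \<in> P k" using Suc.prems(2) by auto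
    have uP: "u \<in> P k" using z(2) XP(2)[OF kd j(2)] by blast
    have dP: "dif j w \<in> P k" if "w \<in> P k" for w using dif_in[OF P(1)[OF kd] j(1) that] .
    have "D k u + dif j (D k v) = 0"
      using Suc.prems(3) lin_add[OF D[OF kd] uP dP[OF z(3)]] lin_dif[OF D[OF kd] P(1)[OF kd] j(1) z(3)] by (simp add: z(1))
    then have "dif j (D k v) = - D k u" by (simp add: eq_neg_iff_add_eq_0 add.commute)
    moreover have "D k u \<in> XS j (N k)" using img[OF kd j(2)] z(2) by blast
    ultimately have "dif j (D k v) \<in> XS j (N k)" using submod_uminus[OF XN(1)[OF kd j(2)]] by simp
    then have "D k v \<in> XS j (N k)"
      by (rule regularD[OF Suc.prems(1), of j, rotated 2]) (use z(3) in \<open>auto simp: N_def\<close>)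
    then obtain p where p: "p \<in> XS j (P k)" "D k p = D k v" using img[OF kd j(2)] by (metis imageE)
    have pP: "p \<in> P k" using p(1) XP(2)[OF kd j(2)] by blast
    have n0: "v - p \<in> N (Suc k)"
      unfolding NK[OF k] using submod_diff[OF P(1)[OF kd] z(3) pP] lin_diff[OF D[OF kd] P(1)[OF kd] z(3) pP] p(2) by simp
    have w: "u + dif j p \<in> XS j (P k)"
      by (rule submod_add[OF XP(1)[OF kd j(2)] z(2) dif_in[OF XP(1)[OF kd j(2)] j(1) p(1)]])
    have "D k (u + dif j p) = 0"
      using lin_add[OF D[OF kd] uP dP[OF pP]] lin_dif[OF D[OF kd] P(1)[OF kd] j(1) pP] \<open>D k u + dif j (D k v) = 0\<close> by (simp add: p(2))
    moreover have "regular j (N k)" using Suc.prems(1) by (simp add: regular_def)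
    ultimately have "u + dif j p \<in> XS j (N (Suc k))" using Suc.IH[OF _ w] j by blast
    moreover have "z = (u + dif j p) + dif j (v - p)" by (simp add: z(1) dif_diff)
    ultimately show ?case using n0 unfolding XS.simps by blast
  qed simp
  \<comment> \<open>Every passage to a syzygy gains one degree of regularity.\<close>
  have reg: "regular (Suc k) (N (Suc k))" if r: "regular k (N k)" and k: "k < d" for k
    unfolding regular_def
  proof (intro allI ballI impI)
    fix j z assume j: "j < Suc k" and z: "z \<in> N (Suc k)" "dif j z \<in> XS j (N (Suc k))"
    have jn: "j < n" "j \<le> n" and kd: "k \<le> d" using j k dn by simp_all
    have zP: "z \<in> P k" "D k z = 0" using z(1) NK[OF k] by simp_all
    have "N (Suc k) \<subseteq> P k" using NK[OF k] by blast
    then have "dif j z \<in> XS j (P k)" using XS_mono z(2) by blast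
    then have "z \<in> XS j (P k)" by (rule regularD[OF P(2)[OF kd] jn(1) zP(1)])
    moreover have "regular j (N k)" using r j by (simp add: regular_def)
    ultimately show "z \<in> XS j (N (Suc k))" using claim[OF k jn(2)] zP(2) by blast
  qed
  \<comment> \<open>The class that is pushed down: x is nonzero modulo \<open>XS k\<close>, but
    annihilated there by all remaining w - 1. At k = 0 it is e.\<close>
  have main: "regular k (N k) \<and> (\<exists>x\<in>N k. x \<notin> XS k (N k) \<and> (\<forall>i. k \<le> i \<and> i < n \<longrightarrow> dif i x \<in> XS k (N k)))" if "k \<le> d" for k
    using that
  proof (induction k)
    case 0
    then show ?case using e by (auto simp: regular_def N_def)
  next
    case (Suc k)
    then have k: "k < d" "k \<le> d" "k < n" "k \<le> n" "Suc k \<le> d" "Suc k \<le> n" using dn by simp_all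
    obtain x where r: "regular k (N k)" and x: "x \<in> N k" "x \<notin> XS k (N k)" "\<And>i. k \<le> i \<Longrightarrow> i < n \<Longrightarrow> dif i x \<in> XS k (N k)"
      using Suc.IH k by blast
    obtain p where p: "p \<in> P k" "D k p = x" using x(1) unfolding N_def by blast
    have dP: "dif i w \<in> P k" if "w \<in> P k" "i < n" for w i using dif_in[OF P(1)[OF k(2)] that(2,1)] .
    have lift: "\<exists>q\<in>XS k (P k). dif i p - q \<in> N (Suc k)" if i: "k \<le> i" "i < n" for i
    proof -
      have "D k (dif i p) = dif i x" using lin_dif[OF D[OF k(2)] P(1)[OF k(2)] i(2) p(1)] p(2) by simp
      then have "D k (dif i p) \<in> D k ` XS k (P k)" using x(3)[OF i] img[OF k(2,4)] by simp
      then obtain q where q: "q \<in> XS k (P k)" "D k (dif i p) = D k q" by blast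
      have qP: "q \<in> P k" using q(1) XP(2)[OF k(2,4)] by blast
      have "dif i p - q \<in> N (Suc k)"
        unfolding NK[OF k(1)]
        using submod_diff[OF P(1)[OF k(2)] dP[OF p(1) i(2)] qP] lin_diff[OF D[OF k(2)] P(1)[OF k(2)] dP[OF p(1) i(2)] qP] q(2) by simp
      then show ?thesis using q(1) by blast
    qed
    obtain q where q: "q \<in> XS k (P k)" "dif k p - q \<in> N (Suc k)" using lift[of k] k by blast
    \<comment> \<open>The connecting map: x is lifted to p, multiplied by the k-th element w - 1,
      and corrected by q so as to land in the next syzygy.\<close>
    define x' where "x' = dif k p - q"
    have S: "submod {..<n} (XS (Suc k) (N (Suc k)))" by (rule XN(1)[OF k(5,6)])
    have "x' \<notin> XS (Suc k) (N (Suc k))"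
    proof
      assume "x' \<in> XS (Suc k) (N (Suc k))"
      then obtain u v where uv: "x' = u + dif k v" "u \<in> XS k (N (Suc k))" "v \<in> N (Suc k)" by auto
      have NP: "N (Suc k) \<subseteq> P k" using NK[OF k(1)] by blast
      have vP: "v \<in> P k" "D k v = 0" using uv(3) NK[OF k(1)] by simp_all
      have "u \<in> XS k (P k)" using uv(2) XS_mono[OF NP] by blast
      then have "u + q \<in> XS k (P k)" by (rule submod_add[OF XP(1)[OF k(2,4)] _ q(1)])
      moreover have "dif k (p - v) = u + q" using uv(1) by (simp add: x'_def dif_diff algebra_simps)
      ultimately have "dif k (p - v) \<in> XS k (P k)" by simp
      then have "p - v \<in> XS k (P k)"
        by (rule regularD[OF P(2)[OF k(2)] k(3) submod_diff[OF P(1)[OF k(2)] p(1) vP(1)]])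
      then have "D k (p - v) \<in> XS k (N k)" using img[OF k(2,4)] by blast
      then show False using x(2) lin_diff[OF D[OF k(2)] P(1)[OF k(2)] p(1) vP(1)] p(2) vP(2) by simp
    qed
    moreover have "dif i x' \<in> XS (Suc k) (N (Suc k))" if i: "Suc k \<le> i" "i < n" for i
    proof -
      have kk: "k \<le> k" "k \<le> i" using i by simp_all
      obtain q' where q': "q' \<in> XS k (P k)" "dif i p - q' \<in> N (Suc k)" using lift[OF kk(2) i(2)] by blast
      define y where "y = dif i p - q'"
      have eq: "dif i x' - dif k y = dif k q' - dif i q"
        using dif_dif[OF i(2) k(3), of p] by (simp add: x'_def y_def dif_diff)
      have 1: "dif k q' - dif i q \<in> XS k (P k)"
        by (rule submod_diff[OF XP(1)[OF k(2,4)] dif_in[OF XP(1)[OF k(2,4)] k(3) q'(1)] dif_in[OF XP(1)[OF k(2,4)] i(2) q(1)]])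
      have 2: "dif i x' - dif k y \<in> N (Suc k)"
        by (rule submod_diff[OF N[OF k(5)] dif_in[OF N[OF k(5)] i(2)] dif_in[OF N[OF k(5)] k(3)]])
          (use q(2) q'(2) in \<open>simp_all add: x'_def y_def\<close>)
      then have "D k (dif i x' - dif k y) = 0" unfolding NK[OF k(1)] by simp
      then have "dif i x' - dif k y \<in> XS k (N (Suc k))" using claim[OF k(1,4) r, of "dif i x' - dif k y"] 1 eq by simp
      then have 3: "dif i x' - dif k y \<in> XS (Suc k) (N (Suc k))" using XS_Suc_mono[OF N[OF k(5)]] by blast
      have "dif k y \<in> XS (Suc k) (N (Suc k))"
        by (rule XS_mem[OF N[OF k(5)] k(6)]) (use q'(2) in \<open>simp_all add: y_def\<close>)
      from submod_add[OF S 3 this] show ?thesis by simp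
    qed
    ultimately show ?case using reg[OF r k(1)] q(2) unfolding x'_def by blast
  qed
  \<comment> \<open>As d < n there is still an operator \<open>dif d\<close> left;
    \<open>D d\<close> is injective, so the lift p satisfies the same relation in
    \<open>P d\<close>, and regularity there makes the class zero.\<close>
  obtain x where x: "x \<in> N d" "x \<notin> XS d (N d)" "dif d x \<in> XS d (N d)" using main[of d] dn by blast
  have d: "d \<le> d" "d \<le> n" using dn by simp_all
  obtain p where p: "p \<in> P d" "D d p = x" using x(1) unfolding N_def by blast
  obtain q where q: "q \<in> XS d (P d)" "dif d x = D d q" using x(3) img[OF d] by (metis imageE)
  have qP: "q \<in> P d" using q(1) XP(2)[OF d] by blast
  have dp: "dif d p \<in> P d" by (rule dif_in[OF P(1)[OF d(1)] dn p(1)])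
  have "D d (dif d p - q) = 0"
    using lin_diff[OF D[OF d(1)] P(1)[OF d(1)] dp qP] lin_dif[OF D[OF d(1)] P(1)[OF d(1)] dn p(1)] p(2) q(2) by simp
  then have "dif d p - q = 0" by (rule inj[OF submod_diff[OF P(1)[OF d(1)] dp qP]])
  then have "dif d p \<in> XS d (P d)" using q(1) by simp
  then have "p \<in> XS d (P d)" by (rule regularD[OF P(2)[OF d(1)] dn p(1)])
  then show False using img[OF d] p(2) x(2) by blast
qed

end

context torus_realization
begin

lemma lin_of_act:
  assumes "submod {..<m} L" "\<And>u v. u \<in> L \<Longrightarrow> v \<in> L \<Longrightarrow> h (u + v) = h u + h v"
    "\<And>r u. r \<in> carrier R \<Longrightarrow> u \<in> L \<Longrightarrow> h (act (E r) u) = act (E r) (h u)"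
  shows "lin {..<m} L h"
proof -
  have A: "h (act w u) = act w (h u)" if "w \<in> TA" "u \<in> L" for w u
    using assms(3)[OF ei(1)[OF that(1)] that(2)] by (simp add: ei that)
  have scT: "sc r (bas (0, 0)) \<in> TA" for r by (rule submod_sc[OF TA_submod bas_TA]) simp
  have sc: "sc r u = act (sc r (bas (0, 0))) u" for r and u :: "'z \<times> expo \<Rightarrow> 'k"
    by (simp add: act_sc_left bas_TA act_bas)
  have "h (sc r u) = sc r (h u)" if "u \<in> L" for r u
    using A[OF scT that, of r] by (simp only: sc[symmetric])
  moreover have "h (mop a u) = mop a (h u)" if "a \<in> lat {..<m}" "u \<in> L" for a u
    using A[OF bas_TA[OF that(1)] that(2)] by (simp add: act_bas)
  ultimately show ?thesis using assms(2) by (simp add: lin_def)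
qed

text \<open>The identity of \<open>Q\<close> is lifted along the canonical surjection from a coded
  free module; decoding turns abstract projective modules into direct summands of function
  modules.\<close>

lemma projective_retract:
  fixes Q :: "('a, 'm) module" and \<kappa> :: "(('m \<times> nat) \<times> expo \<Rightarrow> 'k) \<Rightarrow> 'm"
  assumes \<kappa>: "coding \<kappa> (Fr {..<m} UNIV)" and Q: "projective R Q"
  shows "\<exists>X \<sigma> \<theta>. (\<forall>x\<in>carrier Q. \<sigma> x \<in> Fr {..<m} (X :: ('m \<times> nat) set) \<and> \<theta> (\<sigma> x) = x) \<and>
    (\<forall>x\<in>carrier Q. \<forall>y\<in>carrier Q. \<sigma> (x \<oplus>\<^bsub>Q\<^esub> y) = \<sigma> x + \<sigma> y) \<and>
    (\<forall>r\<in>carrier R. \<forall>x\<in>carrier Q. \<sigma> (r \<odot>\<^bsub>Q\<^esub> x) = act (E r) (\<sigma> x)) \<and>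
    (\<forall>u\<in>Fr {..<m} X. \<theta> u \<in> carrier Q) \<and>
    (\<forall>u\<in>Fr {..<m} X. \<forall>v\<in>Fr {..<m} X. \<theta> (u + v) = \<theta> u \<oplus>\<^bsub>Q\<^esub> \<theta> v) \<and>
    (\<forall>r\<in>carrier R. \<forall>u\<in>Fr {..<m} X. \<theta> (act (E r) u) = r \<odot>\<^bsub>Q\<^esub> \<theta> u)"
proof -
  let ?U = "Fr {..<m} UNIV :: (('m \<times> nat) \<times> expo \<Rightarrow> 'k) set"
  have LQ: "left_module R Q" using Q by (simp add: projective_def)
  define X where "X = carrier Q \<times> {0 :: nat}"
  have X: "p \<in> X \<longleftrightarrow> fst p \<in> carrier Q \<and> snd p = 0" for p by (cases p) (simp add: X_def)
  have XU: "Fr {..<m} X \<subseteq> ?U"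
  proof
    show "f \<in> ?U" if "f \<in> Fr {..<m} X" for f using that by (rule Fr_mono[OF subset_UNIV])
  qed
  obtain \<Phi> where \<Phi>: "\<And>u. u \<in> Fr {..<m} X \<Longrightarrow> \<Phi> u \<in> carrier Q"
    "\<And>u v. u \<in> Fr {..<m} X \<Longrightarrow> v \<in> Fr {..<m} X \<Longrightarrow> \<Phi> (u + v) = \<Phi> u \<oplus>\<^bsub>Q\<^esub> \<Phi> v"
    "\<And>r u. r \<in> carrier R \<Longrightarrow> u \<in> Fr {..<m} X \<Longrightarrow> \<Phi> (act (E r) u) = r \<odot>\<^bsub>Q\<^esub> \<Phi> u"
    "\<And>x. x \<in> X \<Longrightarrow> \<Phi> (bas (x, 0)) = fst x"
    using free_extension[OF LQ, of X fst] X by blast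
  let ?F = "cod \<kappa> ?U (Fr {..<m} X)" and ?g = "\<lambda>x. \<Phi> (inv_into ?U \<kappa> x)"
  have dec: "inv_into ?U \<kappa> (\<kappa> l) = l" if "l \<in> Fr {..<m} X" for l using decode[OF \<kappa>] that XU by blast
  have g: "?g \<in> left_module_hom R ?F Q" by (rule hom_from_cod[OF \<kappa> Fr_submod XU \<Phi>(1-3)])
  have "\<Phi> ` Fr {..<m} X = carrier Q"
  proof
    show "\<Phi> ` Fr {..<m} X \<subseteq> carrier Q" using \<Phi>(1) by blast
    show "carrier Q \<subseteq> \<Phi> ` Fr {..<m} X"
    proof
      fix x assume "x \<in> carrier Q"
      then have x: "(x, 0) \<in> X" by (simp add: X_def)
      then show "x \<in> \<Phi> ` Fr {..<m} X" using \<Phi>(4)[OF x] by (intro image_eqI[of _ _ "bas ((x, 0), 0)"]) simp_all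
    qed
  qed
  then have im: "?g ` carrier ?F = carrier Q" unfolding cod_simps image_image by (simp add: dec)
  have id: "(\<lambda>x. x) \<in> left_module_hom R Q Q" by (rule left_module_homI) simp_all
  have "\<exists>h\<in>left_module_hom R Q ?F. \<forall>x\<in>carrier Q. ?g (h x) = x"
    using Q[unfolded projective_def, THEN conjunct2, rule_format, of ?F Q ?g "\<lambda>x. x"]
      left_module_cod[OF \<kappa> Fr_submod XU] LQ g im id by blast
  then obtain h where h: "h \<in> left_module_hom R Q ?F" "\<And>x. x \<in> carrier Q \<Longrightarrow> ?g (h x) = x" by blast
  define \<sigma> where "\<sigma> x = inv_into ?U \<kappa> (h x)" for x
  have \<sigma>: "\<sigma> x \<in> Fr {..<m} X" "\<kappa> (\<sigma> x) = h x" if x: "x \<in> carrier Q" for x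
  proof -
    have "h x \<in> \<kappa> ` Fr {..<m} X" using left_module_homD(1)[OF h(1) x] by simp
    then obtain l where "l \<in> Fr {..<m} X" "h x = \<kappa> l" by blast
    then show "\<sigma> x \<in> Fr {..<m} X" "\<kappa> (\<sigma> x) = h x" by (simp_all add: \<sigma>_def dec)
  qed
  have "\<sigma> (x \<oplus>\<^bsub>Q\<^esub> y) = \<sigma> x + \<sigma> y" if "x \<in> carrier Q" "y \<in> carrier Q" for x y
  proof -
    have "h (x \<oplus>\<^bsub>Q\<^esub> y) = \<kappa> (\<sigma> x + \<sigma> y)" using left_module_homD(2)[OF h(1) that] by (simp add: \<sigma>_def)
    then show ?thesis unfolding \<sigma>_def[of "x \<oplus>\<^bsub>Q\<^esub> y"] using dec \<sigma>(1) that by simp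
  qed
  moreover have "\<sigma> (r \<odot>\<^bsub>Q\<^esub> x) = act (E r) (\<sigma> x)" if "r \<in> carrier R" "x \<in> carrier Q" for r x
  proof -
    have "h (r \<odot>\<^bsub>Q\<^esub> x) = \<kappa> (act (E r) (\<sigma> x))" using left_module_homD(3)[OF h(1) that] by (simp add: \<sigma>_def)
    then show ?thesis
      unfolding \<sigma>_def[of "r \<odot>\<^bsub>Q\<^esub> x"] using dec[OF act_in[OF Fr_submod E_TA[OF that(1)] \<sigma>(1)[OF that(2)]]] by simp
  qed
  moreover have "\<Phi> (\<sigma> x) = x" if "x \<in> carrier Q" for x using h(2)[OF that] by (simp add: \<sigma>_def)
  ultimately show ?thesis
    using \<Phi>(1-3) \<sigma>(1) by (intro exI[of _ X] exI[of _ \<sigma>] exI[of _ \<Phi>] conjI ballI)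
qed

end

locale split_realization = split_torus n c t + torus_realization "2 * n" c R E
  for n and c :: "nat \<Rightarrow> nat \<Rightarrow> 'k::field" and t and R :: "('a, 'r) ring_scheme" (structure) and E
begin

text \<open>The test module is cyclic, generated by the eigenvector at the point where all w are 1.
  The terms of any projective resolution are replaced by summands of function modules, where
  \<open>chase\<close> applies.\<close>

theorem resolution_lower:
  assumes inf: "infinite (UNIV :: 'm set)" and \<phi>: "inj (\<phi> :: 'k \<Rightarrow> 'm)" and \<psi>: "inj (\<psi> :: 'a set \<Rightarrow> 'm)"
  shows "\<exists>V :: ('a, 'm) module. left_module R V \<and> (\<forall>d. has_projective_resolution R V d \<longrightarrow> n \<le> d)"
proof -
  let ?M = "{..<2*n}"
  obtain \<kappa> :: "(('m \<times> nat) \<times> expo \<Rightarrow> 'k) \<Rightarrow> 'm" where \<kappa>: "coding \<kappa> (Fr ?M UNIV)"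
    using exists_coding[OF inf \<phi>] by blast
  define e :: "('m \<times> nat) \<times> expo \<Rightarrow> 'k" where "e = ev (replicate n 0)"
  define U where "U = (\<lambda>u. act u e) ` TA"
  have "lin ?M TA (\<lambda>u. act u e)" by (simp add: lin_def act_add_left act_sc_left act_mop_left)
  then have U: "submod ?M U" unfolding U_def by (rule lin_image_submod[OF _ TA_submod])
  have eU: "e \<in> U" unfolding U_def using bas_TA[of 0] act_bas[of 0 e] by (metis imageI lat_zero mop_0)
  have e: "dif i e = 0" if "i < n" for i
    using mop_ev[OF that, of "replicate n 0"] that by (simp add: dif_def e_def)
  have e0: "e \<noteq> 0" unfolding e_def by (rule ev_nonzero)
  \<comment> \<open>An element of the cyclic module is coded by the set of ring elements carrying e
    to it, a coset of the annihilator; the carrier type must contain such sets.\<close>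
  define \<kappa>V where "\<kappa>V f = \<psi> {r \<in> carrier R. act (E r) e = f}" for f
  have injV: "inj_on \<kappa>V U"
  proof (rule inj_onI)
    fix f g assume f: "f \<in> U" and eq: "\<kappa>V f = \<kappa>V g"
    obtain u where u: "u \<in> TA" "f = act u e" using f unfolding U_def by blast
    have "ei u \<in> {r \<in> carrier R. act (E r) e = f}" using u ei[OF u(1)] by simp
    moreover have "{r \<in> carrier R. act (E r) e = f} = {r \<in> carrier R. act (E r) e = g}"
      using eq \<psi> by (simp add: \<kappa>V_def inj_eq)
    ultimately show "f = g" by blast
  qed
  have \<kappa>V: "coding \<kappa>V U" unfolding coding_def using injV U by blast
  define V where "V = cod \<kappa>V U U"
  have V: "left_module R V" unfolding V_def by (rule left_module_cod[OF \<kappa>V U order_refl])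
  have decV: "inv_into U \<kappa>V (\<kappa>V f) = f" if "f \<in> U" for f by (rule decode[OF \<kappa>V that])
  have "n \<le> d" if res: "has_projective_resolution R V d" for d
  proof -
    obtain Q :: "nat \<Rightarrow> ('a, 'm) module" and \<delta> :: "nat \<Rightarrow> 'm \<Rightarrow> 'm" where
      Q: "\<forall>i\<le>d. projective R (Q i)" and \<delta>0: "\<delta> 0 \<in> left_module_hom R (Q 0) V" "\<delta> 0 ` carrier (Q 0) = carrier V"
      and \<delta>: "\<forall>i<d. \<delta> (Suc i) \<in> left_module_hom R (Q (Suc i)) (Q i) \<and>
           \<delta> (Suc i) ` carrier (Q (Suc i)) = a_kernel (Q i) (case i of 0 \<Rightarrow> V | Suc j \<Rightarrow> Q j) (\<delta> i)"
      and inj: "inj_on (\<delta> d) (carrier (Q d))"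
      using res unfolding has_projective_resolution_def by (elim exE conjE) (rule that)
    \<comment> \<open>Targets shifted by one, so that \<open>\<delta> k\<close> maps
      \<open>Q k\<close> to \<open>T k\<close> also for the augmentation k = 0;
      \<open>\<tau>\<close> decodes them to functions.\<close>
    define T where "T k = (case k of 0 \<Rightarrow> V | Suc j \<Rightarrow> Q j)" for k
    have QM: "left_module R (Q i)" if "i \<le> d" for i using Q that by (simp add: projective_def)
    define Rt where "Rt i X \<sigma> \<theta> \<longleftrightarrow> (\<forall>x\<in>carrier (Q i). \<sigma> x \<in> Fr ?M (X :: ('m \<times> nat) set) \<and> \<theta> (\<sigma> x) = x) \<and>
      (\<forall>x\<in>carrier (Q i). \<forall>y\<in>carrier (Q i). \<sigma> (x \<oplus>\<^bsub>Q i\<^esub> y) = \<sigma> x + \<sigma> y) \<and>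
      (\<forall>r\<in>carrier R. \<forall>x\<in>carrier (Q i). \<sigma> (r \<odot>\<^bsub>Q i\<^esub> x) = act (E r) (\<sigma> x)) \<and>
      (\<forall>u\<in>Fr ?M X. \<theta> u \<in> carrier (Q i)) \<and>
      (\<forall>u\<in>Fr ?M X. \<forall>v\<in>Fr ?M X. \<theta> (u + v) = \<theta> u \<oplus>\<^bsub>Q i\<^esub> \<theta> v) \<and>
      (\<forall>r\<in>carrier R. \<forall>u\<in>Fr ?M X. \<theta> (act (E r) u) = r \<odot>\<^bsub>Q i\<^esub> \<theta> u)" for i X \<sigma> \<theta>
    have "\<forall>i. \<exists>X \<sigma> \<theta>. i \<le> d \<longrightarrow> Rt i X \<sigma> \<theta>"
    proof
      fix i show "\<exists>X \<sigma> \<theta>. i \<le> d \<longrightarrow> Rt i X \<sigma> \<theta>"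
      proof (cases "i \<le> d")
        case True
        then have "\<exists>X \<sigma> \<theta>. Rt i X \<sigma> \<theta>" unfolding Rt_def using projective_retract[OF \<kappa>, of "Q i"] Q by simp
        then show ?thesis by blast
      qed blast
    qed
    from choice[OF this] obtain X where "\<forall>i. \<exists>\<sigma> \<theta>. i \<le> d \<longrightarrow> Rt i (X i) \<sigma> \<theta>" by (rule exE)
    from choice[OF this] obtain \<sigma> where "\<forall>i. \<exists>\<theta>. i \<le> d \<longrightarrow> Rt i (X i) (\<sigma> i) \<theta>" by (rule exE)
    from choice[OF this] obtain \<theta> where "\<forall>i. i \<le> d \<longrightarrow> Rt i (X i) (\<sigma> i) (\<theta> i)" by (rule exE)
    then have Rt: "Rt i (X i) (\<sigma> i) (\<theta> i)" if "i \<le> d" for i using that by blast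
    have \<sigma>: "\<sigma> i x \<in> Fr ?M (X i)" "\<theta> i (\<sigma> i x) = x" if "i \<le> d" "x \<in> carrier (Q i)" for i x
      using Rt[OF that(1)] that(2) unfolding Rt_def by blast+
    have \<sigma>_add: "\<sigma> i (x \<oplus>\<^bsub>Q i\<^esub> y) = \<sigma> i x + \<sigma> i y" if "i \<le> d" "x \<in> carrier (Q i)" "y \<in> carrier (Q i)" for i x y
      using Rt[OF that(1)] that(2,3) unfolding Rt_def by blast
    have \<sigma>_act: "\<sigma> i (r \<odot>\<^bsub>Q i\<^esub> x) = act (E r) (\<sigma> i x)" if "i \<le> d" "r \<in> carrier R" "x \<in> carrier (Q i)" for i r x
      using Rt[OF that(1)] that(2,3) unfolding Rt_def by blast
    have \<theta>: "\<theta> i u \<in> carrier (Q i)" if "i \<le> d" "u \<in> Fr ?M (X i)" for i u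
      using Rt[OF that(1)] that(2) unfolding Rt_def by blast
    have \<theta>_add: "\<theta> i (u + v) = \<theta> i u \<oplus>\<^bsub>Q i\<^esub> \<theta> i v" if "i \<le> d" "u \<in> Fr ?M (X i)" "v \<in> Fr ?M (X i)" for i u v
      using Rt[OF that(1)] that(2,3) unfolding Rt_def by blast
    have \<theta>_act: "\<theta> i (act (E r) u) = r \<odot>\<^bsub>Q i\<^esub> \<theta> i u" if "i \<le> d" "r \<in> carrier R" "u \<in> Fr ?M (X i)" for i r u
      using Rt[OF that(1)] that(2,3) unfolding Rt_def by blast
    define P where "P i = \<sigma> i ` carrier (Q i)" for i
    have linp: "lin ?M (Fr ?M (X i)) (\<lambda>u. \<sigma> i (\<theta> i u))" if "i \<le> d" for i
      by (rule lin_of_act[OF Fr_submod]) (simp_all add: \<sigma>_add \<sigma>_act \<theta>_add \<theta>_act \<theta> that)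
    have Pim: "(\<lambda>u. \<sigma> i (\<theta> i u)) ` Fr ?M (X i) = P i" if "i \<le> d" for i
    proof
      show "(\<lambda>u. \<sigma> i (\<theta> i u)) ` Fr ?M (X i) \<subseteq> P i" unfolding P_def using \<theta>[OF that] by blast
      show "P i \<subseteq> (\<lambda>u. \<sigma> i (\<theta> i u)) ` Fr ?M (X i)"
        unfolding P_def using \<sigma>[OF that] by (auto intro!: image_eqI)
    qed
    have PF: "P i \<subseteq> Fr ?M (X i)" if "i \<le> d" for i unfolding P_def using \<sigma>(1)[OF that] by blast
    have PM: "submod ?M (P i)" if "i \<le> d" for i
      using lin_image_submod[OF linp[OF that] Fr_submod] Pim[OF that] by simp
    have nM: "{..<n} \<subseteq> ?M" by auto
    define \<tau> where "\<tau> k = (case k of 0 \<Rightarrow> inv_into U \<kappa>V | Suc j \<Rightarrow> \<sigma> j)" for k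
    have \<tau>_add: "\<tau> k (x \<oplus>\<^bsub>T k\<^esub> y) = \<tau> k x + \<tau> k y" if "k \<le> Suc d" "x \<in> carrier (T k)" "y \<in> carrier (T k)" for k x y
      using that \<sigma>_add submod_add[OF U] by (cases k) (auto simp: \<tau>_def T_def V_def decV)
    have \<tau>_act: "\<tau> k (r \<odot>\<^bsub>T k\<^esub> x) = act (E r) (\<tau> k x)" if "k \<le> Suc d" "r \<in> carrier R" "x \<in> carrier (T k)" for k r x
      using that \<sigma>_act act_in[OF U E_TA] by (cases k) (auto simp: \<tau>_def T_def V_def decV)
    have TM: "left_module R (T k)" if "k \<le> Suc d" for k
      using that QM V by (cases k) (auto simp: T_def)
    have \<tau>_inj: "inj_on (\<tau> k) (carrier (T k))" if k: "k \<le> Suc d" for k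
    proof (cases k)
      case 0
      then show ?thesis by (auto simp: \<tau>_def T_def V_def decV inj_on_def)
    next
      case (Suc j)
      then show ?thesis using \<sigma>(2)[of j] k by (auto simp: \<tau>_def T_def intro!: inj_on_inverseI[of _ "\<theta> j"])
    qed
    have zT: "\<zero>\<^bsub>T k\<^esub> \<in> carrier (T k)" "\<zero>\<^bsub>T k\<^esub> \<oplus>\<^bsub>T k\<^esub> \<zero>\<^bsub>T k\<^esub> = \<zero>\<^bsub>T k\<^esub>" if "k \<le> Suc d" for k
    proof -
      interpret A: abelian_group "T k" by (rule left_module.axioms(2)[OF TM[OF that]])
      show "\<zero>\<^bsub>T k\<^esub> \<in> carrier (T k)" "\<zero>\<^bsub>T k\<^esub> \<oplus>\<^bsub>T k\<^esub> \<zero>\<^bsub>T k\<^esub> = \<zero>\<^bsub>T k\<^esub>" by simp_all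
    qed
    have \<tau>0: "\<tau> k \<zero>\<^bsub>T k\<^esub> = 0" if "k \<le> Suc d" for k
      using \<tau>_add[OF that zT(1)[OF that] zT(1)[OF that]] zT(2)[OF that] by simp
    have \<tau>_eq0: "\<tau> k x = 0 \<longleftrightarrow> x = \<zero>\<^bsub>T k\<^esub>" if "k \<le> Suc d" "x \<in> carrier (T k)" for k x
      using inj_on_eq_iff[OF \<tau>_inj[OF that(1)] that(2) zT(1)[OF that(1)]] \<tau>0[OF that(1)] by simp
    have \<delta>T: "\<delta> k \<in> left_module_hom R (Q k) (T k)" if "k \<le> d" for k
      using that \<delta>0(1) \<delta> by (cases k) (simp_all add: T_def)
    have \<delta>ker: "\<delta> (Suc k) ` carrier (Q (Suc k)) = {x \<in> carrier (Q k). \<delta> k x = \<zero>\<^bsub>T k\<^esub>}" if "k < d" for k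
      using \<delta> that unfolding T_def by (simp add: a_kernel_def kernel_def)
    define D where "D k f = \<tau> k (\<delta> k (\<theta> k f))" for k f
    have D\<sigma>: "D k (\<sigma> k x) = \<tau> k (\<delta> k x)" if "k \<le> d" "x \<in> carrier (Q k)" for k x
      by (simp add: D_def \<sigma>(2)[OF that])
    have DF: "lin ?M (Fr ?M (X k)) (D k)" if k: "k \<le> d" for k
    proof (rule lin_of_act[OF Fr_submod])
      note h = left_module_homD[OF \<delta>T[OF k]] and k' = le_SucI[OF k]
      show "D k (u + v) = D k u + D k v" if "u \<in> Fr ?M (X k)" "v \<in> Fr ?M (X k)" for u v
        unfolding D_def \<theta>_add[OF k that] h(2)[OF \<theta>[OF k that(1)] \<theta>[OF k that(2)]]
        by (rule \<tau>_add[OF k' h(1)[OF \<theta>[OF k that(1)]] h(1)[OF \<theta>[OF k that(2)]]])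
      show "D k (act (E r) u) = act (E r) (D k u)" if "r \<in> carrier R" "u \<in> Fr ?M (X k)" for r u
        unfolding D_def \<theta>_act[OF k that] h(3)[OF that(1) \<theta>[OF k that(2)]]
        by (rule \<tau>_act[OF k' that(1) h(1)[OF \<theta>[OF k that(2)]]])
    qed
    show ?thesis
    proof (rule chase[of d P D e])
      show "submod {..<n} (P k)" if "k \<le> d" for k by (rule submod_mono[OF PM[OF that] nM])
      show "regular n (P k)" if k: "k \<le> d" for k
      proof (rule regular_retract[OF Fr_left regular_Fr lin_mono[OF linp[OF k] nM order_refl] Pim[OF k] PF[OF k]])
        show "\<sigma> k (\<theta> k z) = z" if "z \<in> P k" for z using that \<sigma>(2)[OF k] by (auto simp: P_def)
      qed
      show "lin {..<n} (P k) (D k)" if "k \<le> d" for k by (rule lin_mono[OF DF[OF that] nM PF[OF that]])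
      show "D (Suc k) ` P (Suc k) = {z \<in> P k. D k z = 0}" if k: "k < d" for k
      proof -
        have kd: "k \<le> d" "k \<le> Suc d" "Suc k \<le> d" using k by simp_all
        have "D (Suc k) ` P (Suc k) = (\<lambda>x. \<sigma> k (\<delta> (Suc k) x)) ` carrier (Q (Suc k))"
          unfolding P_def image_image by (rule image_cong[OF refl]) (simp add: D\<sigma>[OF kd(3)], simp add: \<tau>_def)
        also have "\<dots> = \<sigma> k ` {x \<in> carrier (Q k). \<delta> k x = \<zero>\<^bsub>T k\<^esub>}"
          unfolding \<delta>ker[OF k, symmetric] image_image ..
        also have "{x \<in> carrier (Q k). \<delta> k x = \<zero>\<^bsub>T k\<^esub>} = {x \<in> carrier (Q k). D k (\<sigma> k x) = 0}"
          using D\<sigma>[OF kd(1)] \<tau>_eq0[OF kd(2)] left_module_homD(1)[OF \<delta>T[OF kd(1)]] \<tau>0[OF kd(2)] by auto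
        also have "\<sigma> k ` {x \<in> carrier (Q k). D k (\<sigma> k x) = 0} = {z \<in> P k. D k z = 0}"
          unfolding P_def by auto
        finally show ?thesis .
      qed
      show "z = 0" if z: "z \<in> P d" "D d z = 0" for z
      proof -
        have d: "d \<le> d" "d \<le> Suc d" by simp_all
        obtain x where x: "x \<in> carrier (Q d)" "z = \<sigma> d x" using z(1) by (auto simp: P_def)
        interpret A: abelian_group "Q d" by (rule left_module.axioms(2)[OF QM[OF d(1)]])
        have 0: "\<tau> (Suc d) \<zero>\<^bsub>T (Suc d)\<^esub> = 0" by (rule \<tau>0) simp
        then have \<sigma>0: "\<sigma> d \<zero>\<^bsub>Q d\<^esub> = 0" by (simp add: \<tau>_def T_def)
        have "\<tau> d (\<delta> d x) = 0" using z(2) D\<sigma>[OF d(1) x(1)] x(2) by simp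
        moreover have "\<tau> d (\<delta> d \<zero>\<^bsub>Q d\<^esub>) = 0"
          using D\<sigma>[OF d(1) A.zero_closed] \<sigma>0 lin_zero[OF DF[OF d(1)] Fr_submod] by simp
        ultimately have "\<delta> d x = \<delta> d \<zero>\<^bsub>Q d\<^esub>"
          using \<tau>_eq0[OF d(2)] left_module_homD(1)[OF \<delta>T[OF d(1)]] x(1) A.zero_closed by metis
        then have "x = \<zero>\<^bsub>Q d\<^esub>" using inj x(1) A.zero_closed by (simp add: inj_on_eq_iff)
        then show ?thesis using x(2) \<sigma>0 by simp
      qed
      have "D 0 ` P 0 = (\<lambda>x. inv_into U \<kappa>V (\<delta> 0 x)) ` carrier (Q 0)"
        unfolding P_def image_image by (rule image_cong[OF refl]) (simp add: D\<sigma>, simp add: \<tau>_def)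
      also have "\<dots> = inv_into U \<kappa>V ` \<kappa>V ` U"
        using \<delta>0(2) by (simp add: V_def flip: image_image[of "inv_into U \<kappa>V" "\<delta> 0"])
      also have "\<dots> = U" unfolding image_image by (simp add: decV)
      finally show "e \<in> D 0 ` P 0" using eU by simp
    qed (use e e0 in simp_all)
  qed
  then show ?thesis using V by blast
qed

end

section \<open>The presentation of the quantum torus\<close>

lemma free_algebra_simps [simp]:
  "mult (free_algebra X) = (*)" "one (free_algebra X) = 1" "zero (free_algebra X) = 0" "add (free_algebra X) = (+)"
  by (simp_all add: free_algebra_def)

lemma single_carrier: "set w \<subseteq> X \<Longrightarrow> Poly_Mapping.single w k \<in> carrier (free_algebra X)"
  by (simp add: free_algebra_def)

lemma free_algebra_induct [consumes 1, case_names zero add]: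
  assumes f: "f \<in> carrier (free_algebra X)" and "Q 0"
    and step: "\<And>w k g. set w \<subseteq> X \<Longrightarrow> g \<in> carrier (free_algebra X) \<Longrightarrow> Q g \<Longrightarrow> Q (Poly_Mapping.single w k + g)"
  shows "Q f"
proof -
  have "finite A \<Longrightarrow> Poly_Mapping.keys f = A \<Longrightarrow> f \<in> carrier (free_algebra X) \<Longrightarrow> Q f" for A f
  proof (induction A arbitrary: f rule: finite_induct)
    case empty
    then show ?case using assms(2) by simp
  next
    case (insert w A)
    define g where "g = f - Poly_Mapping.single w (Poly_Mapping.lookup f w)"
    have f: "f = Poly_Mapping.single w (Poly_Mapping.lookup f w) + g" by (simp add: g_def)
    have look: "Poly_Mapping.lookup g v = (if v = w then 0 else Poly_Mapping.lookup f v)" for v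
      by (simp add: g_def lookup_minus lookup_single when_def)
    have lk: "Poly_Mapping.lookup f v \<noteq> 0 \<longleftrightarrow> v = w \<or> v \<in> A" for v
      using in_keys_iff[of v f] insert.prems(1) by simp
    have "v \<in> Poly_Mapping.keys g \<longleftrightarrow> v \<in> A" for v
      unfolding in_keys_iff look using lk[of v] insert.hyps(2) by auto
    then have k: "Poly_Mapping.keys g = A" by blast
    have w: "set w \<subseteq> X" and g: "g \<in> carrier (free_algebra X)"
      using insert.prems k by (auto simp: free_algebra_def)
    show ?case by (subst f) (rule step[OF w g insert.IH[OF k g]])
  qed
  from this[OF _ refl f] show ?thesis by simp
qed

primrec ginv :: "generator \<Rightarrow> generator" where
  "ginv (Z i) = Z_inv i" | "ginv (Z_inv i) = Z i" | "ginv (Y i) = Y_inv i" | "ginv (Y_inv i) = Y i"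

locale torus_data =
  fixes n :: nat and p q :: "nat \<Rightarrow> 'k::field" and \<gamma> :: "nat \<Rightarrow> nat \<Rightarrow> 'k"
  assumes n1: "n \<ge> 1" and q_nonzero: "\<And>i. i \<in> {1..n} \<Longrightarrow> q i \<noteq> 0"
    and \<gamma>_diag: "\<And>i. i \<in> {1..n} \<Longrightarrow> \<gamma> i i = 1"
    and \<gamma>_anti: "\<And>i j. i \<in> {1..n} \<Longrightarrow> j \<in> {1..n} \<Longrightarrow> \<gamma> i j * \<gamma> j i = 1"
    and p_one: "\<And>i. i \<in> {1..n} \<Longrightarrow> p i = 1"
    and q_generic: "\<And>i. i \<in> {1..n} \<Longrightarrow> \<not> (\<exists>m>0. q i ^ m = 1)"
begin

text \<open>The coordinates \<open>k < n\<close> of an exponent vector refer to the elements \<open>w = z\<^sub>k\<^sub>+\<^sub>1 / z\<^sub>k\<close> (with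
  \<open>z\<^sub>0 = 1\<close>), which commute with each other and with all \<open>y\<^sub>i\<close> except \<open>y\<^sub>k\<^sub>+\<^sub>1\<close>; the coordinates
  \<open>n + k\<close> refer to \<open>y\<^sub>k\<^sub>+\<^sub>1\<close>.\<close>

definition tc :: "nat \<Rightarrow> nat \<Rightarrow> 'k" where
  "tc i j = (if n \<le> i \<and> i < 2 * n \<and> j < 2 * n then
     if j < n then if i = n + j then inverse (q (Suc j)) else 1
     else if j < i then \<gamma> (Suc (i - n)) (Suc (j - n)) else 1 else 1)"

lemma \<gamma>_nonzero: "i \<in> {1..n} \<Longrightarrow> j \<in> {1..n} \<Longrightarrow> \<gamma> i j \<noteq> 0"
  using \<gamma>_anti[of i j] by auto

text \<open>Any element of infinite order can serve as t; \<open>q 1\<close> is available because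
  \<open>n \<ge> 1\<close>.\<close>

sublocale split_torus n tc "q 1"
proof unfold_locales
  have "Suc (i - n) \<in> {1..n}" if "i < 2 * n" "n \<le> i" for i
    using that by (intro atLeastAtMost_iff[THEN iffD2] conjI) linarith+
  from \<gamma>_nonzero[OF this this] show "tc i j \<noteq> 0" for i j
    using q_nonzero[of "Suc j"] by (simp add: tc_def not_less)
  show "tc i i = 1" for i by (simp add: tc_def)
  show "n \<ge> 1" by (rule n1)
  show "tc i j = tc j i" if "j < n" "i < 2 * n" "i \<noteq> n + j" for i j using that by (simp add: tc_def)
  show "(tc (n + j) j / tc j (n + j)) ^ e \<noteq> 1" if "j < n" "0 < e" for j e
  proof -
    have "Suc j \<in> {1..n}" using that(1) by simp
    from q_generic[OF this] have "q (Suc j) ^ e \<noteq> 1" using that(2) by blast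
    then show ?thesis using that by (simp add: tc_def power_inverse)
  qed
  show "tc i j = 1" if "i < n" for i j using that by (simp add: tc_def)
  show "q 1 \<noteq> 0" using q_nonzero n1 by simp
  have "1 \<in> {1..n}" using n1 by simp
  from q_generic[OF this] show "q 1 ^ k \<noteq> 1" if "k > 0" for k using that by blast
qed

section \<open>The monomial operators satisfy the defining relations\<close>

definition zv :: "nat \<Rightarrow> expo" where "zv i = (\<lambda>k. if k < i then 1 else 0)"

definition uy :: "nat \<Rightarrow> expo" where "uy i = unit_vec (n + i - 1)"

primrec gv :: "generator \<Rightarrow> expo" where
  "gv (Z i) = zv i" | "gv (Z_inv i) = - zv i" | "gv (Y i) = uy i" | "gv (Y_inv i) = - uy i"

abbreviation "X \<equiv> torus_generators n"

abbreviation F :: "(generator list \<Rightarrow>\<^sub>0 'k) ring" where "F \<equiv> free_algebra X"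

lemma bc_zv: "i \<in> {1..n} \<Longrightarrow> bc (zv i) b = 1"
  by (rule bc_left) (simp add: zv_def)

lemma bc_unit:
  assumes "i < 2 * n"
  shows "bc (unit_vec i) b = (\<Prod>j<2*n. tc i j powi b j)"
proof -
  have "bc (unit_vec i) b = (\<Prod>i'<2*n. if i' = i then \<Prod>j<2*n. tc i j powi b j else 1)"
    unfolding bich_def by (rule prod.cong[OF refl]) (simp add: unit_vec_def)
  then show ?thesis using assms by (simp add: prod.delta)
qed

lemma bc_uy_zv:
  assumes "i \<in> {1..n}" "j \<in> {1..n}"
  shows "bc (uy i) (zv j) = (if i \<le> j then inverse (q i) else 1)"
proof -
  have "bc (uy i) (zv j) = (\<Prod>k<2*n. tc (n + i - 1) k powi zv j k)"
    unfolding uy_def by (rule bc_unit) (use assms in auto)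
  also have "\<dots> = (\<Prod>k<2*n. if k = i - 1 then if i \<le> j then inverse (q i) else 1 else 1)"
    by (rule prod.cong[OF refl]) (use assms in \<open>auto simp: tc_def zv_def\<close>)
  also have "\<dots> = (if i \<le> j then inverse (q i) else 1)" using assms by (subst prod.delta) auto
  finally show ?thesis .
qed

lemma bc_uy_uy:
  assumes "i \<in> {1..n}" "j \<in> {1..n}"
  shows "bc (uy i) (uy j) = (if j < i then \<gamma> i j else 1)"
proof -
  have "bc (uy i) (uy j) = (\<Prod>k<2*n. tc (n + i - 1) k powi uy j k)"
    unfolding uy_def by (rule bc_unit) (use assms in auto)
  also have "\<dots> = (\<Prod>k<2*n. if k = n + j - 1 then tc (n + i - 1) (n + j - 1) else 1)"
    by (rule prod.cong[OF refl]) (simp add: uy_def unit_vec_def)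
  also have "\<dots> = tc (n + i - 1) (n + j - 1)" using assms by (subst prod.delta) auto
  also have "\<dots> = (if j < i then \<gamma> i j else 1)" using assms by (auto simp: tc_def)
  finally show ?thesis .
qed

lemma mop_gv_inverse:
  assumes "i \<in> {1..n}"
  shows "mop (zv i) (mop (- zv i) f) = f" "mop (- zv i) (mop (zv i) f) = f"
    "mop (uy i) (mop (- uy i) f) = f" "mop (- uy i) (mop (uy i) f) = f"
  using assms by (simp_all add: mop_inverse bc_minus bc_zv bc_uy_uy)

lemma mop_relations:
  assumes "i \<in> {1..n}" "j \<in> {1..n}"
  shows "mop (zv i) (mop (zv j) f) = mop (zv j) (mop (zv i) f)"
    "j < i \<Longrightarrow> mop (zv j) (mop (uy i) f) = mop (uy i) (mop (zv j) f)"
    "i \<le> j \<Longrightarrow> mop (zv j) (mop (uy i) f) = sc (q i) (mop (uy i) (mop (zv j) f))"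
    "mop (uy i) (mop (uy j) f) = sc (\<gamma> i j) (mop (uy j) (mop (uy i) f))"
  using assms q_nonzero[of i] \<gamma>_anti[of i j] \<gamma>_diag[of i]
  by (auto simp: mop_mop bc_zv bc_uy_zv bc_uy_uy add.commute linorder_neq_iff)

primrec opw :: "generator list \<Rightarrow> (nat \<times> expo \<Rightarrow> 'k) \<Rightarrow> nat \<times> expo \<Rightarrow> 'k" where
  "opw [] f = f" | "opw (x # w) f = mop (gv x) (opw w f)"

definition wt :: "generator list \<Rightarrow> expo" where "wt w = (\<Sum>x\<leftarrow>w. gv x)"

lemma wt_simps [simp]: "wt [] = 0" "wt (x # w) = gv x + wt w" "wt (v @ w) = wt v + wt w"
  by (simp_all add: wt_def)

lemma opw_append: "opw (v @ w) f = opw v (opw w f)"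
  by (induction v) auto

lemma opw_add: "opw w (f + g) = opw w f + opw w g"
  and opw_sc: "opw w (sc r f) = sc r (opw w f)"
  and opw_zero: "opw w 0 = 0"
  by (induction w) (simp_all add: mop_add mop_sc)

lemma opw_bas: "\<exists>k. k \<noteq> 0 \<and> opw w (bas (0, 0)) = sc k (bas (0, wt w))"
proof (induction w)
  case Nil
  then show ?case by (intro exI[of _ 1]) simp
next
  case (Cons x w)
  then obtain k where "k \<noteq> 0" "opw w (bas (0, 0)) = sc k (bas (0, wt w))" by blast
  then show ?case by (intro exI[of _ "k * bc (gv x) (wt w)"]) (simp add: mop_sc mop_bas)
qed

lemma gv_lat: "x \<in> X \<Longrightarrow> gv x \<in> lat {..<2*n}"
  by (auto simp: torus_generators_def zv_def uy_def lat_def unit_vec_def)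

lemma wt_lat: "set w \<subseteq> X \<Longrightarrow> wt w \<in> lat {..<2*n}"
  by (induction w) (simp_all add: gv_lat)

lemma opw_TA: "set w \<subseteq> X \<Longrightarrow> opw w (bas (0, 0)) \<in> TA"
  by (induction w) (auto simp: bas_TA gv_lat intro!: submod_mop[OF TA_submod])

lemma act_opw: "set w \<subseteq> X \<Longrightarrow> act (opw w (bas (0, 0))) u = opw w u"
  by (induction w) (simp_all add: act_bas act_mop_left opw_TA)

text \<open>The action of the free algebra on functions in which each generator acts by its monomial
  operator; evaluating at 1 gives the candidate isomorphism \<open>h\<close>.\<close>

definition evF :: "(generator list \<Rightarrow>\<^sub>0 'k) \<Rightarrow> (nat \<times> expo \<Rightarrow> 'k) \<Rightarrow> nat \<times> expo \<Rightarrow> 'k" where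
  "evF f u = lext (\<lambda>w. opw w u) (Poly_Mapping.lookup f)"

lemma finite_supp_lookup: "finite (supp (Poly_Mapping.lookup f))"
proof -
  have "supp (Poly_Mapping.lookup f) = Poly_Mapping.keys f" by (auto simp: supp_iff in_keys_iff)
  then show ?thesis by simp
qed

lemma evF_add: "evF (f + g) u = evF f u + evF g u"
proof -
  have "Poly_Mapping.lookup (f + g) = Poly_Mapping.lookup f + Poly_Mapping.lookup g"
    by (simp add: fun_eq_iff lookup_add plus_fun_apply)
  then show ?thesis by (simp add: evF_def lext_add finite_supp_lookup)
qed

lemma evF_zero: "evF 0 u = 0"
  using evF_add[of 0 0 u] by simp

lemma evF_diff: "evF (f - g) u = evF f u - evF g u"
  using evF_add[of "f - g" g u] by (simp add: algebra_simps)

lemma evF_single: "evF (Poly_Mapping.single w k) u = sc k (opw w u)"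
proof -
  have "Poly_Mapping.lookup (Poly_Mapping.single w k) = sc k (bas w)"
    by (auto simp: fun_eq_iff lookup_single when_def sc_apply bas_apply)
  then show ?thesis by (simp add: evF_def lext_sc)
qed

lemma evF_mult: "evF (f * g) u = evF f (evF g u)"
proof -
  have UN: "f \<in> carrier (free_algebra UNIV)" for f :: "generator list \<Rightarrow>\<^sub>0 'k" by (simp add: free_algebra_def)
  have 1: "evF (Poly_Mapping.single w k * g) u = sc k (opw w (evF g u))" for w k
    using UN[of g]
  proof (induction g rule: free_algebra_induct)
    case zero
    then show ?case by (simp add: evF_zero opw_zero)
  next
    case (add v l g)
    then show ?case
      by (simp add: distrib_left evF_add mult_single evF_single plus_list_def opw_append opw_add opw_sc sc_add_right)
  qed
  show ?thesis
    using UN[of f]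
  proof (induction f rule: free_algebra_induct)
    case (add w k f)
    then show ?case by (simp add: distrib_right evF_add 1 evF_single)
  qed (simp add: evF_zero)
qed

lemma evF_gen: "evF (gen x) u = mop (gv x) u"
  by (simp add: gen_def evF_single)

lemma evF_scalar: "evF (scalar k) u = sc k u"
  by (simp add: scalar_def evF_single)

lemma evF_one: "evF 1 u = u"
  using evF_scalar[of 1 u] by (simp add: scalar_def flip: zero_list_def)

definition h :: "(generator list \<Rightarrow>\<^sub>0 'k) \<Rightarrow> nat \<times> expo \<Rightarrow> 'k" where
  "h f = evF f (bas (0, 0))"

lemma h_TA:
  assumes "f \<in> carrier F"
  shows "h f \<in> TA \<and> act (h f) u = evF f u"
  using assms
proof (induction rule: free_algebra_induct)
  case zero
  then show ?case by (simp add: h_def evF_zero submod_zero[OF TA_submod])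
next
  case (add w k g)
  have eq: "h (Poly_Mapping.single w k + g) = sc k (opw w (bas (0, 0))) + h g" by (simp add: h_def evF_add evF_single)
  have s: "sc k (opw w (bas (0, 0))) \<in> TA" by (rule submod_sc[OF TA_submod opw_TA[OF add(1)]])
  show ?case
    unfolding eq using add(3) s
    by (simp add: submod_add[OF TA_submod] act_add_left act_sc_left opw_TA[OF add(1)] act_opw[OF add(1)] evF_add evF_single)
qed

lemma h_ring_hom: "ring_hom_ring F torus_ring h"
proof (rule ring_hom_ringI2[OF ring_free_algebra ring_torus_ring], rule ring_hom_memI)
  show "h (f \<otimes>\<^bsub>F\<^esub> g) = h f \<otimes>\<^bsub>torus_ring\<^esub> h g" if "f \<in> carrier F" "g \<in> carrier F" for f g
    using h_TA[OF that(1)] by (simp add: h_def evF_mult)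
qed (use h_TA in \<open>auto simp: h_def evF_add evF_one\<close>)

section \<open>Words modulo the ideal of relations\<close>

abbreviation "I \<equiv> Idl\<^bsub>F\<^esub> (torus_relations n p q \<gamma>)"

lemma kernel_h: "a_kernel F torus_ring h = {f \<in> carrier F. h f = 0}"
  by (simp add: a_kernel_def kernel_def)

lemma evF_relations:
  assumes i: "i \<in> {1..n}"
  shows "evF (gen (Z i) * gen (Z_inv i) - 1) u = 0" "evF (gen (Z_inv i) * gen (Z i) - 1) u = 0"
    "evF (gen (Y i) * gen (Y_inv i) - 1) u = 0" "evF (gen (Y_inv i) * gen (Y i) - 1) u = 0"
    "j \<in> {1..n} \<Longrightarrow> evF (gen (Z i) * gen (Z j) - gen (Z j) * gen (Z i)) u = 0"
    "j \<in> {1..n} \<Longrightarrow> j < i \<Longrightarrow> evF (gen (Z j) * gen (Y i) - scalar (p i) * gen (Y i) * gen (Z j)) u = 0"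
    "j \<in> {1..n} \<Longrightarrow> i \<le> j \<Longrightarrow> evF (gen (Z j) * gen (Y i) - scalar (q i) * gen (Y i) * gen (Z j)) u = 0"
    "j \<in> {1..n} \<Longrightarrow> evF (gen (Y i) * gen (Y j) - scalar (\<gamma> i j) * gen (Y j) * gen (Y i)) u = 0"
  unfolding evF_diff evF_mult evF_gen evF_scalar evF_one gv.simps mop_gv_inverse[OF i] diff_self p_one[OF i] eq_iff_diff_eq_0[symmetric]
  using mop_relations[OF i, of j u] by simp_all

lemma relations_kernel: "torus_relations n p q \<gamma> \<subseteq> a_kernel F torus_ring h"
proof
  fix r assume r: "r \<in> torus_relations n p q \<gamma>"
  have "h r = 0"
    using r unfolding torus_relations_def h_def
    by (elim UnE CollectE exE conjE) (simp_all only: evF_relations)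
  then show "r \<in> a_kernel F torus_ring h" using r torus_relations_closed unfolding kernel_h by blast
qed

lemma I_ideal: "ideal I F"
  by (rule ring.genideal_ideal[OF ring_free_algebra torus_relations_closed])

lemma I_kernel: "I \<subseteq> a_kernel F torus_ring h"
  by (rule ring.genideal_minimal[OF ring_free_algebra ring_hom_ring.kernel_is_ideal[OF h_ring_hom] relations_kernel])

lemma I_closed:
  shows I_add: "f \<in> I \<Longrightarrow> g \<in> I \<Longrightarrow> f + g \<in> I"
    and I_left: "f \<in> I \<Longrightarrow> r \<in> carrier F \<Longrightarrow> r * f \<in> I"
    and I_right: "f \<in> I \<Longrightarrow> r \<in> carrier F \<Longrightarrow> f * r \<in> I"
    and I_zero: "0 \<in> I"
  using ideal.I_l_closed[OF I_ideal, of f r] ideal.I_r_closed[OF I_ideal, of f r]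
    additive_subgroup.a_closed[OF ideal.axioms(1)[OF I_ideal], of f g]
    additive_subgroup.zero_closed[OF ideal.axioms(1)[OF I_ideal]] by simp_all

lemma I_relation: "r \<in> torus_relations n p q \<gamma> \<Longrightarrow> r \<in> I"
  using ring.genideal_self[OF ring_free_algebra torus_relations_closed] by blast

text \<open>Words agree up to an unspecified nonzero scalar modulo the ideal. The scalar is
  recovered afterwards by applying \<open>h\<close>.\<close>

definition W :: "generator list \<Rightarrow> generator list \<Rightarrow> bool" where
  "W u v \<longleftrightarrow> (\<exists>k. k \<noteq> 0 \<and> Poly_Mapping.single u 1 - Poly_Mapping.single v k \<in> I)"

lemma WI: "k \<noteq> 0 \<Longrightarrow> Poly_Mapping.single u 1 - Poly_Mapping.single v k \<in> I \<Longrightarrow> W u v"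
  unfolding W_def by blast

lemma W_refl: "W u u"
  by (rule WI[of 1]) (simp_all add: I_zero)

lemma scalar_single: "Poly_Mapping.single [] k * Poly_Mapping.single w l = Poly_Mapping.single w (k * l)"
  by (simp add: mult_single plus_list_def)

lemma scalar_carrier: "Poly_Mapping.single [] k \<in> carrier F"
  by (rule single_carrier) simp

lemma W_trans [trans]:
  assumes "W u v" "W v w"
  shows "W u w"
proof -
  obtain k l where k: "k \<noteq> 0" "Poly_Mapping.single u 1 - Poly_Mapping.single v k \<in> I"
    and l: "l \<noteq> 0" "Poly_Mapping.single v 1 - Poly_Mapping.single w l \<in> I"
    using assms unfolding W_def by blast
  have "Poly_Mapping.single u 1 - Poly_Mapping.single w (k * l) =
      (Poly_Mapping.single u 1 - Poly_Mapping.single v k) +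
      Poly_Mapping.single [] k * (Poly_Mapping.single v 1 - Poly_Mapping.single w l)"
    by (simp add: right_diff_distrib scalar_single)
  also have "\<dots> \<in> I" by (rule I_add[OF k(2) I_left[OF l(2) scalar_carrier]])
  finally show ?thesis using k(1) l(1) by (intro WI[of "k * l"]) simp_all
qed

lemma W_sym: "W u v \<Longrightarrow> W v u"
proof -
  assume "W u v"
  then obtain k where k: "k \<noteq> 0" "Poly_Mapping.single u 1 - Poly_Mapping.single v k \<in> I" unfolding W_def by blast
  have "Poly_Mapping.single v 1 - Poly_Mapping.single u (1 / k) =
      Poly_Mapping.single [] (- (1 / k)) * (Poly_Mapping.single u 1 - Poly_Mapping.single v k)"
    using k(1) by (simp only: right_diff_distrib scalar_single) (simp add: single_uminus)
  also have "\<dots> \<in> I" by (rule I_left[OF k(2) scalar_carrier])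
  finally show ?thesis using k(1) by (intro WI[of "1 / k"]) simp_all
qed

lemma W_context:
  assumes "W u v" "set a \<subseteq> X" "set b \<subseteq> X"
  shows "W (a @ u @ b) (a @ v @ b)"
proof -
  obtain k where k: "k \<noteq> 0" "Poly_Mapping.single u 1 - Poly_Mapping.single v k \<in> I" using assms(1) unfolding W_def by blast
  have "Poly_Mapping.single (a @ u @ b) 1 - Poly_Mapping.single (a @ v @ b) k =
      Poly_Mapping.single a 1 * (Poly_Mapping.single u 1 - Poly_Mapping.single v k) * Poly_Mapping.single b 1"
    by (simp add: right_diff_distrib left_diff_distrib mult_single plus_list_def)
  also have "\<dots> \<in> I" by (rule I_right[OF I_left[OF k(2) single_carrier[OF assms(2)]] single_carrier[OF assms(3)]])
  finally show ?thesis by (rule WI[OF k(1)])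
qed

lemma gen_gen: "gen x * gen y = Poly_Mapping.single [x, y] 1"
  "scalar k * gen x * gen y = Poly_Mapping.single [x, y] k"
  by (simp_all add: gen_def scalar_def mult_single plus_list_def)

lemma W_inverse: "x \<in> X \<Longrightarrow> W [x, ginv x] []"
proof -
  assume "x \<in> X"
  have r: "i \<in> {1..n} \<Longrightarrow> gen (Z i) * gen (Z_inv i) - 1 \<in> torus_relations n p q \<gamma>"
    "i \<in> {1..n} \<Longrightarrow> gen (Z_inv i) * gen (Z i) - 1 \<in> torus_relations n p q \<gamma>"
    "i \<in> {1..n} \<Longrightarrow> gen (Y i) * gen (Y_inv i) - 1 \<in> torus_relations n p q \<gamma>"
    "i \<in> {1..n} \<Longrightarrow> gen (Y_inv i) * gen (Y i) - 1 \<in> torus_relations n p q \<gamma>" for i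
    unfolding torus_relations_def by blast+
  have "gen x * gen (ginv x) - 1 \<in> torus_relations n p q \<gamma>"
    using \<open>x \<in> X\<close> unfolding torus_generators_def by (elim UnE imageE) (simp_all only: ginv.simps r)
  then have "Poly_Mapping.single [x, ginv x] 1 - Poly_Mapping.single [] 1 \<in> I"
    using I_relation unfolding gen_gen by (simp flip: zero_list_def)
  then show ?thesis by (intro WI[of 1]) simp_all
qed

lemma ginv_X [simp]: "ginv x \<in> X \<longleftrightarrow> x \<in> X" and ginv_ginv [simp]: "ginv (ginv x) = x"
  by (cases x; auto simp: torus_generators_def)+

lemma gv_ginv [simp]: "gv (ginv x) = - gv x"
  by (cases x) simp_all

lemma W_base:
  assumes ij: "i \<in> {1..n}" "j \<in> {1..n}"
  shows "W [Z i, Z j] [Z j, Z i]" "W [Z j, Y i] [Y i, Z j]" "W [Y i, Y j] [Y j, Y i]"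
proof -
  have "gen (Z i) * gen (Z j) - gen (Z j) * gen (Z i) \<in> torus_relations n p q \<gamma>"
    using ij unfolding torus_relations_def by blast
  then show "W [Z i, Z j] [Z j, Z i]" using I_relation unfolding gen_gen by (intro WI[of 1]) simp_all
  have "gen (Y i) * gen (Y j) - scalar (\<gamma> i j) * gen (Y j) * gen (Y i) \<in> torus_relations n p q \<gamma>"
    using ij unfolding torus_relations_def by blast
  then show "W [Y i, Y j] [Y j, Y i]"
    using I_relation \<gamma>_nonzero[OF ij] unfolding gen_gen by (intro WI[of "\<gamma> i j"]) simp_all
  show "W [Z j, Y i] [Y i, Z j]"
  proof (cases "j < i")
    case True
    then have "gen (Z j) * gen (Y i) - scalar (p i) * gen (Y i) * gen (Z j) \<in> torus_relations n p q \<gamma>"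
      using ij unfolding torus_relations_def by blast
    then show ?thesis using I_relation p_one[OF ij(1)] unfolding gen_gen by (intro WI[of "p i"]) simp_all
  next
    case False
    then have "gen (Z j) * gen (Y i) - scalar (q i) * gen (Y i) * gen (Z j) \<in> torus_relations n p q \<gamma>"
      using ij unfolding torus_relations_def not_less by blast
    then show ?thesis using I_relation q_nonzero[OF ij(1)] unfolding gen_gen by (intro WI[of "q i"]) simp_all
  qed
qed

text \<open>Commutation up to a scalar passes to the inverse generator by multiplying with it on
  both sides.\<close>

lemma W_invert:
  assumes "x \<in> X" "y \<in> X" "W [x, y] [y, x]"
  shows "W [ginv x, y] [y, ginv x]"
proof -
  have "W [ginv x, y] [ginv x, y, x, ginv x]"
    using W_context[OF W_sym[OF W_inverse[OF assms(1)]], of "[ginv x, y]" "[]"] assms by simp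
  also have "W [ginv x, y, x, ginv x] [ginv x, x, y, ginv x]"
    using W_context[OF W_sym[OF assms(3)], of "[ginv x]" "[ginv x]"] assms by simp
  also have "W [ginv x, x, y, ginv x] [y, ginv x]"
    using W_context[OF W_inverse[of "ginv x"], of "[]" "[y, ginv x]"] assms by simp
  finally show ?thesis .
qed

lemma W_commute:
  assumes "x \<in> X" "y \<in> X"
  shows "W [x, y] [y, x]"
proof -
  define B where "B = Z ` {1..n} \<union> Y ` {1..n}"
  have BX: "b \<in> X" if "b \<in> B" for b using that by (auto simp: B_def torus_generators_def)
  have B: "W [b, b'] [b', b]" if "b \<in> B" "b' \<in> B" for b b'
    using that unfolding B_def by (elim UnE imageE) (auto intro: W_base W_sym[OF W_base(2)])
  have split: "x \<in> B \<or> (\<exists>b\<in>B. x = ginv b)" if "x \<in> X" for x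
    using that unfolding B_def torus_generators_def by force
  have 1: "W [x, b] [b, x]" if x: "x \<in> X" and b: "b \<in> B" for x b
    using split[OF x]
  proof
    assume "\<exists>b\<in>B. x = ginv b"
    then obtain b' where "b' \<in> B" "x = ginv b'" by blast
    then show ?thesis using W_invert[OF BX BX B] b by blast
  qed (use B b in blast)
  show ?thesis
    using split[OF assms(2)]
  proof
    assume "\<exists>b\<in>B. y = ginv b"
    then obtain b where b: "b \<in> B" "y = ginv b" by blast
    then show ?thesis using W_sym[OF W_invert[OF BX[OF b(1)] assms(1) W_sym[OF 1[OF assms(1) b(1)]]]] by simp
  qed (use 1 assms(1) in blast)
qed

lemma W_move: "x \<in> X \<Longrightarrow> set v \<subseteq> X \<Longrightarrow> W (x # v) (v @ [x])"
proof (induction v)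
  case (Cons y v)
  have "W (x # y # v) (y # x # v)"
    using W_context[OF W_commute[of x y], of "[]" v] Cons.prems by simp
  also have "W (y # x # v) (y # v @ [x])"
    using W_context[OF Cons.IH, of "[y]" "[]"] Cons.prems by simp
  finally show ?case by simp
qed (simp add: W_refl)

text \<open>The multiplicity of a generator in a weight, negative for its inverse. Since z_i is the
  product of the first i elements w, the multiplicity of z_i is the difference of two consecutive
  w-exponents, the one after the last being 0.\<close>

primrec ph :: "generator \<Rightarrow> expo \<Rightarrow> int" where
  "ph (Z i) a = a (i - 1) - (if i < n then a i else 0)"
| "ph (Z_inv i) a = - (a (i - 1) - (if i < n then a i else 0))"
| "ph (Y i) a = a (n + i - 1)"
| "ph (Y_inv i) a = - a (n + i - 1)"

lemma ph_add: "ph x (a + b) = ph x a + ph x b" and ph_zero: "ph x 0 = 0"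
  by (cases x; simp add: plus_fun_apply zero_fun_apply)+

lemma ph_gv:
  assumes "x \<in> X" "y \<in> X"
  shows "ph x (gv y) = (if y = x then 1 else if y = ginv x then - 1 else 0)"
  using assms
  by (cases x; cases y) (auto simp: torus_generators_def zv_def uy_def unit_vec_def)

lemma ph_negative:
  assumes "x \<in> X"
  shows "set v \<subseteq> X \<Longrightarrow> ph x (wt v) < 0 \<Longrightarrow> ginv x \<in> set v"
proof (induction v)
  case (Cons y v)
  then have y: "y \<in> X" "set v \<subseteq> X" by simp_all
  show ?case
  proof (cases "y = ginv x")
    case False
    then have "ph x (gv y) \<ge> 0" using ph_gv[OF assms y(1)] by simp
    then show ?thesis using Cons.IH[OF y(2)] Cons.prems(2) by (simp add: ph_add)
  qed simp
qed (simp add: ph_zero)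

text \<open>In a word of weight 0 the first letter must be compensated by its inverse further on; it
  is moved there and cancelled, which shortens the word by two.\<close>

lemma W_weight_zero: "set w \<subseteq> X \<Longrightarrow> wt w = 0 \<Longrightarrow> W w []"
proof (induction "length w" arbitrary: w rule: less_induct)
  case less
  show ?case
  proof (cases w)
    case Nil
    then show ?thesis by (simp add: W_refl)
  next
    case (Cons x v)
    then have x: "x \<in> X" "set v \<subseteq> X" using less.prems by simp_all
    have "ph x (gv x) + ph x (wt v) = 0" using less.prems(2) Cons by (simp add: ph_zero flip: ph_add)
    then have "ph x (wt v) < 0" using ph_gv[OF x(1,1)] by simp
    then obtain v1 v2 where v: "v = v1 @ ginv x # v2" using ph_negative[OF x] split_list by meson
    have X12: "set v1 \<subseteq> X" "set v2 \<subseteq> X" using x(2) v by simp_all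
    have "W w (v1 @ [x] @ ginv x # v2)"
      using W_context[OF W_move[OF x(1) X12(1)], of "[]" "ginv x # v2"] x X12 by (simp add: Cons v)
    also have "W (v1 @ [x] @ ginv x # v2) (v1 @ v2)"
      using W_context[OF W_inverse[OF x(1)] X12] by simp
    also have "W (v1 @ v2) []"
    proof (rule less.hyps)
      show "length (v1 @ v2) < length w" by (simp add: Cons v)
      show "set (v1 @ v2) \<subseteq> X" using X12 by simp
      show "wt (v1 @ v2) = 0" using less.prems(2) by (simp add: Cons v algebra_simps)
    qed
    finally show ?thesis .
  qed
qed

definition winv :: "generator list \<Rightarrow> generator list" where "winv w = rev (map ginv w)"

lemma winv: "set w \<subseteq> X \<Longrightarrow> set (winv w) \<subseteq> X" "wt (winv w) = - wt w"
  unfolding winv_def by (auto, induction w) auto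

lemma W_weight:
  assumes "set u \<subseteq> X" "set v \<subseteq> X" "wt u = wt v"
  shows "W u v"
proof -
  have "W u (u @ winv v @ v)"
    using W_context[OF W_sym[OF W_weight_zero[of "winv v @ v"]], of u "[]"] winv assms by simp
  also have "W (u @ winv v @ v) v"
    using W_context[OF W_weight_zero[of "u @ winv v"], of "[]" v] winv assms by simp
  finally show ?thesis .
qed

text \<open>The weights of words form a group; it contains all unit vectors, those of the w's as
  differences of consecutive weights of the z's.\<close>

lemma exists_word:
  assumes a: "a \<in> lat {..<2*n}"
  shows "\<exists>w. set w \<subseteq> X \<and> wt w = a"
proof -
  define H where "H = {a. \<exists>w. set w \<subseteq> X \<and> wt w = a}"
  have add: "a + b \<in> H" if ab: "a \<in> H" "b \<in> H" for a b
  proof -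
    obtain u v where "set u \<subseteq> X" "wt u = a" "set v \<subseteq> X" "wt v = b" using ab unfolding H_def by blast
    then show ?thesis unfolding H_def by (intro CollectI exI[of _ "u @ v"]) simp
  qed
  have neg: "- a \<in> H" if "a \<in> H" for a
    using that winv unfolding H_def by blast
  have diff: "a - b \<in> H" if "a \<in> H" "b \<in> H" for a b
    using add[OF that(1) neg[OF that(2)]] by simp
  have H0: "0 \<in> H" unfolding H_def by (intro CollectI exI[of _ "[]"]) simp
  have gen: "gv x \<in> H" if "x \<in> X" for x
    unfolding H_def using that by (intro CollectI exI[of _ "[x]"]) simp
  have zH: "zv j \<in> H" if "j \<le> n" for j
  proof (cases "j = 0")
    case True
    then have "zv j = 0" by (simp add: zv_def fun_eq_iff zero_fun_apply)
    then show ?thesis using H0 by simp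
  next
    case False
    then show ?thesis using gen[of "Z j"] that by (simp add: torus_generators_def)
  qed
  have unit: "unit_vec j \<in> H" if "j < 2 * n" for j
  proof (cases "j < n")
    case True
    have "unit_vec j = zv (Suc j) - zv j" by (auto simp: unit_vec_def zv_def fun_eq_iff)
    then show ?thesis using diff[OF zH zH, of "Suc j" j] True by simp
  next
    case False
    then have "Suc (j - n) \<in> {1..n}" using that by auto
    then have "gv (Y (Suc (j - n))) \<in> H" by (intro gen) (simp add: torus_generators_def)
    then show ?thesis using False by (simp add: uy_def)
  qed
  define pv where "pv N = (\<lambda>k. if k < N then a k else 0)" for N
  have "pv N \<in> H" if "N \<le> 2 * n" for N
    using that
  proof (induction N)
    case 0
    have "pv 0 = 0" by (simp add: pv_def fun_eq_iff zero_fun_apply)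
    then show ?case using H0 by simp
  next
    case (Suc N)
    have step: "(pv N)(N := k + 1) = (pv N)(N := k) + unit_vec N" for k
      by (auto simp: fun_eq_iff unit_vec_def plus_fun_apply)
    have u: "unit_vec N \<in> H" using unit Suc.prems by simp
    have "(pv N)(N := k) \<in> H" for k
    proof (induction k rule: int_induct[where k = 0])
      case base
      have "(pv N)(N := 0) = pv N" by (auto simp: pv_def fun_eq_iff)
      then show ?case using Suc by simp
    next
      case (step1 i)
      show ?case unfolding step by (rule add[OF step1(2) u])
    next
      case (step2 i)
      have "(pv N)(N := i - 1) = (pv N)(N := i) - unit_vec N" using step[of "i - 1"] by (simp add: algebra_simps)
      then show ?case using diff[OF step2(2) u] by (simp only:)
    qed
    from this[of "a N"] show ?case
    proof -
      have "(pv N)(N := a N) = pv (Suc N)" by (auto simp: pv_def fun_eq_iff less_Suc_eq)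
      then show ?thesis using \<open>(pv N)(N := a N) \<in> H\<close> by simp
    qed
  qed
  from this[of "2 * n"] have "pv (2 * n) \<in> H" by simp
  moreover have "pv (2 * n) = a" using a by (auto simp: pv_def lat_def fun_eq_iff)
  ultimately show ?thesis by (simp add: H_def)
qed

section \<open>Normal forms and the isomorphism with the ring of functions\<close>

definition rep :: "expo \<Rightarrow> generator list" where
  "rep a = (SOME w. set w \<subseteq> X \<and> wt w = a)"

lemma rep: "a \<in> lat {..<2*n} \<Longrightarrow> set (rep a) \<subseteq> X" "a \<in> lat {..<2*n} \<Longrightarrow> wt (rep a) = a"
  using someI_ex[OF exists_word, of a] unfolding rep_def by blast+

definition kap :: "generator list \<Rightarrow> 'k" where
  "kap w = opw w (bas (0, 0)) (0, wt w)"

lemma kap: "kap w \<noteq> 0" "opw w (bas (0, 0)) = sc (kap w) (bas (0, wt w))"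
  using opw_bas[of w] by (auto simp: kap_def sc_apply bas_apply)

text \<open>A linear section of \<open>h\<close>: each monomial is represented by a chosen word of
  its weight, divided by the scalar with which that word acts on 1.\<close>

definition nf :: "(nat \<times> expo \<Rightarrow> 'k) \<Rightarrow> generator list \<Rightarrow>\<^sub>0 'k" where
  "nf u = (\<Sum>x\<in>supp u. Poly_Mapping.single (rep (snd x)) (u x / kap (rep (snd x))))"

lemma nf_superset:
  "finite B \<Longrightarrow> supp u \<subseteq> B \<Longrightarrow> nf u = (\<Sum>x\<in>B. Poly_Mapping.single (rep (snd x)) (u x / kap (rep (snd x))))"
  unfolding nf_def by (rule sum.mono_neutral_left) (auto simp: supp_iff)

lemma nf_add: "finite (supp u) \<Longrightarrow> finite (supp v) \<Longrightarrow> nf (u + v) = nf u + nf v"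
  using nf_superset[of "supp u \<union> supp v" "u + v"] nf_superset[of "supp u \<union> supp v" u]
    nf_superset[of "supp u \<union> supp v" v] supp_add[of u v]
  by (simp add: plus_fun_apply add_divide_distrib single_add sum.distrib)

lemma nf_bas: "nf (sc k (bas x)) = Poly_Mapping.single (rep (snd x)) (k / kap (rep (snd x)))"
  using nf_superset[of "{x}" "sc k (bas x)"] supp_sc[of k "bas x"] by (simp add: sc_apply bas_apply)

text \<open>Each word is a scalar multiple of the chosen word of its weight modulo the ideal.
  Consequently an element of the kernel of \<open>h\<close> is congruent to the normal form of
  0.\<close>

lemma nf_cong: "f \<in> carrier F \<Longrightarrow> f - nf (h f) \<in> I"
proof (induction rule: free_algebra_induct)
  case zero
  then show ?case by (simp add: h_def evF_zero nf_def I_zero)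
next
  case (add w k g)
  let ?r = "rep (wt w)"
  note lat = wt_lat[OF add(1)]
  have "W w ?r" by (rule W_weight[OF add(1) rep(1)[OF lat] rep(2)[OF lat, symmetric]])
  then obtain s where s: "s \<noteq> 0" "Poly_Mapping.single w 1 - Poly_Mapping.single ?r s \<in> I" unfolding W_def by blast
  \<comment> \<open>The ideal lies in the kernel of \<open>h\<close>, so comparing values identifies
    the unknown scalar s as the quotient of the two scalars \<open>kap\<close>.\<close>
  have "h (Poly_Mapping.single w 1 - Poly_Mapping.single ?r s) = 0" using s(2) I_kernel unfolding kernel_h by blast
  then have "sc (kap w) (bas (0, wt w)) = (sc (s * kap ?r) (bas (0, wt w)) :: nat \<times> expo \<Rightarrow> 'k)"
    using kap(2)[of w] kap(2)[of ?r] rep(2)[OF lat] by (simp add: h_def evF_diff evF_single)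
  from fun_cong[OF this, of "(0, wt w)"] have ks: "kap w = s * kap ?r" by (simp add: sc_apply bas_apply)
  have hw: "h (Poly_Mapping.single w k) = sc (k * kap w) (bas (0, wt w))"
    by (simp add: h_def evF_single kap(2))
  have fin: "finite (supp (h f))" if "f \<in> carrier F" for f using h_TA[OF that] TA_finite by blast
  have "nf (h (Poly_Mapping.single w k + g)) = nf (h (Poly_Mapping.single w k)) + nf (h g)"
    using nf_add[OF fin[OF single_carrier[OF add(1)]] fin[OF add(2)]] by (simp add: h_def evF_add)
  also have "nf (h (Poly_Mapping.single w k)) = Poly_Mapping.single ?r (k * s)"
    unfolding hw nf_bas using ks kap(1)[of ?r] by simp
  finally have "Poly_Mapping.single w k + g - nf (h (Poly_Mapping.single w k + g)) =
      Poly_Mapping.single [] k * (Poly_Mapping.single w 1 - Poly_Mapping.single ?r s) + (g - nf (h g))"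
    by (simp add: right_diff_distrib scalar_single)
  also have "\<dots> \<in> I" by (rule I_add[OF I_left[OF s(2) scalar_carrier] add(3)])
  finally show ?case .
qed

lemma kernel_I: "a_kernel F torus_ring h = I"
proof
  show "a_kernel F torus_ring h \<subseteq> I"
    using nf_cong unfolding kernel_h by (force simp: nf_def)
qed (rule I_kernel)

lemma h_surj: "h ` carrier F = TA"
proof
  show "h ` carrier F \<subseteq> TA" using h_TA by blast
  show "TA \<subseteq> h ` carrier F"
  proof
    fix u assume u: "u \<in> TA"
    let ?s = "\<lambda>x. Poly_Mapping.single (rep (snd x)) (u x / kap (rep (snd x)))"
    have ux: "fst x = 0" "snd x \<in> lat {..<2*n}" if "x \<in> supp u" for x using TA_supp[OF u that] by blast+
    have sum: "h (\<Sum>x\<in>B. ?s x) = (\<Sum>x\<in>B. sc (u x) (bas x)) \<and> (\<Sum>x\<in>B. ?s x) \<in> carrier F"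
      if "finite B" "B \<subseteq> supp u" for B
      using that
    proof (induction B rule: finite_induct)
      case empty
      have "0 \<in> carrier F" by (simp add: free_algebra_def)
      then show ?case by (simp add: h_def evF_zero)
    next
      case (insert x B)
      have x: "x = (0, snd x)" "snd x \<in> lat {..<2*n}" using ux[of x] insert.prems by (auto simp: prod_eq_iff)
      have hx: "h (?s x) = sc (u x) (bas x)"
        using kap[of "rep (snd x)"] rep(2)[OF x(2)] x(1) by (simp add: h_def evF_single)
      have c: "?s x \<in> carrier F" by (rule single_carrier[OF rep(1)[OF x(2)]])
      have c': "sum ?s B \<in> carrier F" using insert by simp
      have "?s x + sum ?s B \<in> carrier F" using ring.ring_simprules(1)[OF ring_free_algebra c c'] by simp
      then show ?case using insert hx by (simp add: h_def evF_add)
    qed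
    note s = sum[OF TA_finite[OF u] order_refl]
    have "h (\<Sum>x\<in>supp u. ?s x) = u"
      unfolding conjunct1[OF s] by (rule bas_expansion[OF TA_finite[OF u] order_refl, symmetric])
    then show "u \<in> h ` carrier F" using imageI[OF conjunct2[OF s], of h] by (simp only:)
  qed
qed

definition tE :: "(generator list \<Rightarrow>\<^sub>0 'k) set \<Rightarrow> nat \<times> expo \<Rightarrow> 'k" where
  "tE = (\<lambda>C. the_elem (h ` C))"

lemma tE_iso: "tE \<in> ring_iso (quantum_torus n p q \<gamma>) torus_ring"
proof -
  interpret H: ring_hom_ring F torus_ring h by (rule h_ring_hom)
  have R: "quantum_torus n p q \<gamma> = F Quot (a_kernel F torus_ring h)"
    by (simp add: quantum_torus_def Let_def kernel_I)
  have "inj_on tE (carrier (F Quot (a_kernel F torus_ring h)))"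
    unfolding tE_def by (rule inj_onI) (rule H.the_elem_inj)
  moreover have "tE ` carrier (F Quot (a_kernel F torus_ring h)) = carrier torus_ring"
    unfolding tE_def H.the_elem_surj h_surj by simp
  moreover have "tE \<in> ring_hom (F Quot (a_kernel F torus_ring h)) torus_ring"
    unfolding tE_def by (rule H.the_elem_hom)
  ultimately show ?thesis unfolding R ring_iso_def bij_betw_def by blast
qed

section \<open>The dimensions of the presented quantum torus\<close>

sublocale split_realization n tc "q 1" "quantum_torus n p q \<gamma>" tE
proof -
  interpret R: ring "quantum_torus n p q \<gamma>" by (rule ring_quantum_torus)
  show "split_realization n tc (q 1) (quantum_torus n p q \<gamma>) tE"
    by unfold_locales (rule tE_iso)
qed

sublocale sqt_realization n tc "quantum_torus n p q \<gamma>" tE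
  by unfold_locales

lemma krull_dim_quantum_torus: "krull_dim (quantum_torus n p q \<gamma>) = ereal (real n)"
  unfolding krull_dim_def
  by (rule deviation_eq) (simp_all only: dev_less_left_ideals dev_less_lideals not_dev_less_lideals not_False_eq_True)

lemma global_dim_quantum_torus: "global_dim TYPE('u) (quantum_torus n p q \<gamma>) = ereal (real n)"
proof -
  let ?R = "quantum_torus n p q \<gamma>"
  \<comment> \<open>The carrier type contains the sets of ring elements, so a scalar is embedded as
    the singleton of the corresponding ring element.\<close>
  define \<phi> :: "'k \<Rightarrow> 'u + nat + (generator list \<Rightarrow>\<^sub>0 'k) set set" where
    "\<phi> k = Inr (Inr {ei (sc k (bas (0, 0)))})" for k
  have inf: "infinite (UNIV :: ('u + nat + (generator list \<Rightarrow>\<^sub>0 'k) set set) set)"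
  proof -
    have "inj (\<lambda>i :: nat. Inr (Inl i) :: 'u + nat + (generator list \<Rightarrow>\<^sub>0 'k) set set)" by (rule injI) simp
    then show ?thesis using finite_subset[OF subset_UNIV] range_inj_infinite by blast
  qed
  have \<phi>: "inj \<phi>"
  proof (rule injI)
    fix k l assume "\<phi> k = \<phi> l"
    then have e: "ei (sc k (bas (0, 0))) = ei (sc l (bas (0, 0)))" by (simp add: \<phi>_def)
    have T: "sc k (bas (0, 0)) \<in> TA" for k by (rule submod_sc[OF TA_submod bas_TA]) simp
    have "sc k (bas (0, 0)) = (sc l (bas (0, 0)) :: nat \<times> expo \<Rightarrow> 'k)" using ei(2)[OF T[of k]] ei(2)[OF T[of l]] e by metis
    from fun_cong[OF this, of "(0, 0)"] show "k = l" by (simp add: sc_apply bas_apply)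
  qed
  define \<psi> :: "(generator list \<Rightarrow>\<^sub>0 'k) set set \<Rightarrow> 'u + nat + (generator list \<Rightarrow>\<^sub>0 'k) set set" where
    "\<psi> S = Inr (Inr S)" for S
  have \<psi>: "inj \<psi>" by (rule injI) (simp add: \<psi>_def)
  obtain V :: "((generator list \<Rightarrow>\<^sub>0 'k) set, 'u + nat + (generator list \<Rightarrow>\<^sub>0 'k) set set) module"
    where V: "left_module ?R V" "\<And>d. has_projective_resolution ?R V d \<Longrightarrow> n \<le> d"
    using resolution_lower[OF inf \<phi> \<psi>] by blast
  show ?thesis
    unfolding global_dim_def
  proof (rule antisym)
    show "(SUP M\<in>{M :: (_, 'u + nat + (generator list \<Rightarrow>\<^sub>0 'k) set set) module. left_module ?R M}. proj_dim ?R M) \<le> ereal (real n)"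
    proof (rule SUP_least)
      fix M :: "((generator list \<Rightarrow>\<^sub>0 'k) set, 'u + nat + (generator list \<Rightarrow>\<^sub>0 'k) set set) module"
      assume "M \<in> {M. left_module ?R M}"
      then have "has_projective_resolution ?R M n" by (intro resolution_length_n[OF inf \<phi>]) simp
      then show "proj_dim ?R M \<le> ereal (real n)" unfolding proj_dim_def by (intro INF_lower) simp
    qed
    have "ereal (real n) \<le> proj_dim ?R V"
      unfolding proj_dim_def by (rule INF_greatest) (simp add: V(2))
    also have "\<dots> \<le> (SUP M\<in>{M :: (_, 'u + nat + (generator list \<Rightarrow>\<^sub>0 'k) set set) module. left_module ?R M}. proj_dim ?R M)"
      by (rule SUP_upper) (simp add: V(1))
    finally show "ereal (real n) \<le> (SUP M\<in>{M :: (_, 'u + nat + (generator list \<Rightarrow>\<^sub>0 'k) set set) module. left_module ?R M}. proj_dim ?R M)" .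
  qed
qed

end

theorem theorem5p2:
  fixes n :: nat
    and p q :: "nat \<Rightarrow> 'k::field"
    and \<gamma> :: "nat \<Rightarrow> nat \<Rightarrow> 'k"
  assumes "n \<ge> 1"
    and "\<And>i. i \<in> {1..n} \<Longrightarrow> p i \<noteq> 0"
    and "\<And>i. i \<in> {1..n} \<Longrightarrow> q i \<noteq> 0"
    and "\<And>i. i \<in> {1..n} \<Longrightarrow> p i \<noteq> q i"
    and "\<And>i. i \<in> {1..n} \<Longrightarrow> \<gamma> i i = 1"
    and "\<And>i j. i \<in> {1..n} \<Longrightarrow> j \<in> {1..n} \<Longrightarrow> \<gamma> i j * \<gamma> j i = 1"
    and "\<And>i. i \<in> {1..n} \<Longrightarrow> p i = 1"
    and "\<And>i. i \<in> {1..n} \<Longrightarrow> \<not> (\<exists>m>0. q i ^ m = 1)"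
  shows "krull_dim (quantum_torus n p q \<gamma>) = ereal (real n) \<and>
         global_dim TYPE('u) (quantum_torus n p q \<gamma>) = ereal (real n)"
proof -
  interpret torus_data n p q \<gamma>
    by unfold_locales (fact assms)+
  show ?thesis using krull_dim_quantum_torus global_dim_quantum_torus by blast
qed

end
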